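(* Let $\mathbb{K}$ be a commutative ring, $\mathbb{G}\subseteq\mathbb{R}$ a subgroup and $X$ a finite quasimetric space such that $d(x,y)\in\mathbb{G}\cup\{\infty\}$ for all points $x,y$. Then the $\mathbb{Z}\times\mathbb{G}$-graded magnitude cohomology algebra of $X$ is isomorphic to the $\mathbb{Z}\times\mathbb{G}$-graded Yoneda algebra of the $\mathbb{G}$-graded left $\sigma X$-module $S$: $$\mathrm{MH}^{*,*}(X)\cong\mathcal{Y}^{*,*}_{\sigma X}(S).$$
   Context: Quasimetric space: a set $X$ with $d:X\times X\to[0,\infty]$ such that $d(x,y)+d(y,z)\ge d(x,z)$, and $d(x,y)=0$ iff $x=y$. Write $x\preccurlyeq y\preccurlyeq z$ if $d(x,y)+d(y,z)=d(x,z)$. Put $|x_0,\dots,x_n|=\sum_{i=0}^{n-1}d(x_i,x_{i+1})$. Distance algebra: $\sigma X$ is the $\mathbb{G}$-graded $\mathbb{K}$-algebra freely generated as a $\mathbb{K}$-module by pairs $(x,y)$ with $d(x,y)<\infty$, in degree $d(x,y)$, with product $(x,y)\cdot(y',z)=(x,z)$ if $y=y'$ and $x\preccurlyeq y\preccurlyeq z$, and $0$ otherwise; unit $\sum_x(x,x)$. $JX$ is the ideal generated by all pairs of positive degree, and $S=\sigma X/JX$. Magnitude cohomology algebra: $\mathrm{MC}_{\bullet,\ell}(X)$ is the normalised chain complex of the simplicial $\mathbb{K}$-module freely generated in simplicial degree $n$ by tuples $(x_0,\dots,x_n)$ with $|x_0,\dots,x_n|=\ell$, with $i$-th face deleting $x_i$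 (tuples of length $<\ell$ are set to $0$) and $i$-th degeneracy doubling $x_i$; so $\mathrm{MC}_{n,\ell}(X)$ is free on those tuples with $x_i\ne x_{i+1}$ for all $i$. $\mathrm{MC}^{\bullet,\ell}(X)=\mathrm{Hom}_{\mathbb{K}}(\mathrm{MC}_{\bullet,\ell}(X),\mathbb{K})$ and $\mathrm{MH}^{n,\ell}(X)=H^n(\mathrm{MC}^{\bullet,\ell}(X))$. For $\psi\in\mathrm{MC}^{m,s}(X)$ and $\varphi\in\mathrm{MC}^{n,\ell}(X)$ the product $\psi\cdot\varphi\in\mathrm{MC}^{n+m,\ell+s}(X)$ is $$(\psi\cdot\varphi)(x_0,\dots,x_{n+m})=\psi(x_0,\dots,x_m)\,\varphi(x_m,\dots,x_{n+m})$$ if $|x_0,\dots,x_m|=s$ and $|x_m,\dots,x_{n+m}|=\ell$, and $0$ otherwise. This makes $\bigoplus_{\ell\in\mathbb{G}}\mathrm{MC}^{\bullet,\ell}(X)$ a dg-algebra and induces a $\mathbb{Z}\times\mathbb{G}$-graded algebra structure on $\mathrm{MH}^{*,*}(X)$. Yoneda algebra: for a $\mathbb{G}$-graded algebra $\Lambda$ and a $\mathbb{G}$-graded left $\Lambda$-module $M$, with shift $(M[\ell])_g=M_{g-\ell}$, put $\mathcal{Y}^{n,\ell}_\Lambda(M)=\mathrm{Ext}^{n,\ell}_\Lambda(M,M)=\mathrm{Ext}^n(M,M[\ell])$, with $\mathrm{Ext}$ in the category of $\mathbb{G}$-graded left $\Lambda$-modules and degree $0$ morphisms. Let $P_\bullet$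 be a projective resolution of $M$ in this category. Given cocycles $\alpha:P_n\to M[\ell]$ and $\beta:P_m\to M[s]$ (i.e. $\alpha\partial_{n+1}=0$, $\beta\partial_{m+1}=0$), $\alpha$ induces $\alpha':\mathrm{Coker}(\partial_{n+1})\to M[\ell]$, which lifts, uniquely up to homotopy, to morphisms $\alpha_k:P_{n+k}\to P_k[\ell]$, $k\ge0$, with $\partial\alpha_k=\alpha_{k-1}\partial$ for $k\geq 1$ and compatible with $\alpha'$ under the augmentation $P_0[\ell]\to M[\ell]$. The Yoneda product is $[\beta]\circ[\alpha]=[\beta[\ell]\circ\alpha_m]\in\mathcal{Y}^{n+m,\ell+s}_\Lambda(M)$. *)

theory Defs
  imports "HOL-Algebra.Module" "HOL-Algebra.QuotRing" "HOL-Library.Extended_Real"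
begin

section \<open>Modules and linear maps\<close>

text \<open>The locale \<^locale>\<open>module\<close> of HOL-Algebra is restricted to commutative
  base rings; the record type \<open>('r, 'm) module\<close> is reused here for left modules over an arbitrary
  ring and for non-commutative algebras.  Where a record of this type is only a module, its
  fields \<^const>\<open>mult\<close> and \<^const>\<open>one\<close> are irrelevant.\<close>

locale left_module = R?: ring R + M?: abelian_group M
  for R :: "('r, 'y) ring_scheme" (structure) and M :: "('r, 'm, 'z) module_scheme" (structure) +
  assumes smult_closed [simp, intro]:
      "\<lbrakk>a \<in> carrier R; x \<in> carrier M\<rbrakk> \<Longrightarrow> a \<odot>\<^bsub>M\<^esub> x \<in> carrier M"
    and smult_l_distr:
      "\<lbrakk>a \<in> carrier R; b \<in> carrier R; x \<in> carrier M\<rbrakk> \<Longrightarrow>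
        (a \<oplus> b) \<odot>\<^bsub>M\<^esub> x = a \<odot>\<^bsub>M\<^esub> x \<oplus>\<^bsub>M\<^esub> b \<odot>\<^bsub>M\<^esub> x"
    and smult_r_distr:
      "\<lbrakk>a \<in> carrier R; x \<in> carrier M; y \<in> carrier M\<rbrakk> \<Longrightarrow>
        a \<odot>\<^bsub>M\<^esub> (x \<oplus>\<^bsub>M\<^esub> y) = a \<odot>\<^bsub>M\<^esub> x \<oplus>\<^bsub>M\<^esub> a \<odot>\<^bsub>M\<^esub> y"
    and smult_assoc1:
      "\<lbrakk>a \<in> carrier R; b \<in> carrier R; x \<in> carrier M\<rbrakk> \<Longrightarrow>
        (a \<otimes> b) \<odot>\<^bsub>M\<^esub> x = a \<odot>\<^bsub>M\<^esub> (b \<odot>\<^bsub>M\<^esub> x)"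
    and smult_one [simp]: "x \<in> carrier M \<Longrightarrow> \<one> \<odot>\<^bsub>M\<^esub> x = x"

definition linear_maps ::
  "('r, 'x) ring_scheme \<Rightarrow> ('r, 'm, 'y) module_scheme \<Rightarrow> ('r, 'n, 'z) module_scheme \<Rightarrow> ('m \<Rightarrow> 'n) set"
  where "linear_maps R M N =
    {f \<in> carrier M \<rightarrow>\<^sub>E carrier N.
      (\<forall>x\<in>carrier M. \<forall>y\<in>carrier M. f (x \<oplus>\<^bsub>M\<^esub> y) = f x \<oplus>\<^bsub>N\<^esub> f y) \<and>
      (\<forall>r\<in>carrier R. \<forall>x\<in>carrier M. f (r \<odot>\<^bsub>M\<^esub> x) = r \<odot>\<^bsub>N\<^esub> f x)}"

definition regular_module :: "('r, 'x) ring_scheme \<Rightarrow> ('r, 'r) module"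
  where "regular_module R =
    \<lparr>carrier = carrier R, mult = mult R, one = one R, zero = zero R, add = add R, smult = mult R\<rparr>"

definition free_module :: "('r, 'x) ring_scheme \<Rightarrow> 'b set \<Rightarrow> ('r, 'b \<Rightarrow> 'r) module"
  where "free_module R T =
    \<lparr>carrier = {c. (\<forall>t. c t \<in> carrier R) \<and> (\<forall>t. t \<notin> T \<longrightarrow> c t = \<zero>\<^bsub>R\<^esub>) \<and> finite {t. c t \<noteq> \<zero>\<^bsub>R\<^esub>}},
     mult = undefined, one = undefined,
     zero = (\<lambda>t. \<zero>\<^bsub>R\<^esub>),
     add = (\<lambda>c c' t. c t \<oplus>\<^bsub>R\<^esub> c' t),
     smult = (\<lambda>r c t. r \<otimes>\<^bsub>R\<^esub> c t)\<rparr>"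

definition basis_vec :: "('r, 'x) ring_scheme \<Rightarrow> 'b \<Rightarrow> 'b \<Rightarrow> 'r"
  where "basis_vec R t = (\<lambda>t'. if t' = t then \<one>\<^bsub>R\<^esub> else \<zero>\<^bsub>R\<^esub>)"

text \<open>The value at \<open>c\<close> of the linear map on a free module that sends the basis vector of
  \<open>t\<close> to \<open>\<phi> t\<close>.\<close>

definition lin_ext ::
  "('r, 'x) ring_scheme \<Rightarrow> ('r, 'n, 'z) module_scheme \<Rightarrow> ('b \<Rightarrow> 'n) \<Rightarrow> ('b \<Rightarrow> 'r) \<Rightarrow> 'n"
  where "lin_ext R N \<phi> c = (\<Oplus>\<^bsub>N\<^esub>t\<in>{t. c t \<noteq> \<zero>\<^bsub>R\<^esub>}. c t \<odot>\<^bsub>N\<^esub> \<phi> t)"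


section \<open>Cohomology of cochain complexes\<close>

definition quotient_module :: "('r, 'm, 'z) module_scheme \<Rightarrow> 'm set \<Rightarrow> ('r, 'm set) module"
  where "quotient_module M B =
    \<lparr>carrier = a_rcosets\<^bsub>M\<^esub> B, mult = undefined, one = undefined,
     zero = B,
     add = set_add M,
     smult = (\<lambda>r A. \<Union>a\<in>A. B +>\<^bsub>M\<^esub> (r \<odot>\<^bsub>M\<^esub> a))\<rparr>"

definition cocycles :: "(int \<Rightarrow> ('r, 'm) module) \<Rightarrow> (int \<Rightarrow> 'm \<Rightarrow> 'm) \<Rightarrow> int \<Rightarrow> 'm set"
  where "cocycles C \<delta> n = {z \<in> carrier (C n). \<delta> n z = \<zero>\<^bsub>C (n + 1)\<^esub>}"

definition coboundaries :: "(int \<Rightarrow> ('r, 'm) module) \<Rightarrow> (int \<Rightarrow> 'm \<Rightarrow> 'm) \<Rightarrow> int \<Rightarrow> 'm set"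
  where "coboundaries C \<delta> n = \<delta> (n - 1) ` carrier (C (n - 1))"

definition cohomology ::
  "(int \<Rightarrow> ('r, 'm) module) \<Rightarrow> (int \<Rightarrow> 'm \<Rightarrow> 'm) \<Rightarrow> int \<Rightarrow> ('r, 'm set) module"
  where "cohomology C \<delta> n =
    quotient_module ((C n)\<lparr>carrier := cocycles C \<delta> n\<rparr>) (coboundaries C \<delta> n)"

definition cohomology_class ::
  "(int \<Rightarrow> ('r, 'm) module) \<Rightarrow> (int \<Rightarrow> 'm \<Rightarrow> 'm) \<Rightarrow> int \<Rightarrow> 'm \<Rightarrow> 'm set"
  where "cohomology_class C \<delta> n z = coboundaries C \<delta> n +>\<^bsub>C n\<^esub> z"


section \<open>Bigraded algebras\<close>

text \<open>A \<open>\<int> \<times> \<G>\<close>-graded algebra as the family of its homogeneous components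
  (\<open>n\<close> ranging over all integers, the second index over \<open>\<G>\<close>), the products
  \<open>bmult A m s n l : A\<^sup>(\<^sup>m\<^sup>,\<^sup>s\<^sup>) \<times> A\<^sup>(\<^sup>n\<^sup>,\<^sup>l\<^sup>) \<rightarrow> A\<^sup>(\<^sup>m\<^sup>+\<^sup>n\<^sup>,\<^sup>s\<^sup>+\<^sup>l\<^sup>)\<close>,
  and the unit in bidegree \<open>(0, 0)\<close>.\<close>

record ('k, 'h) bigraded_algebra =
  bcomp :: "int \<Rightarrow> real \<Rightarrow> ('k, 'h) module"
  bmult :: "int \<Rightarrow> real \<Rightarrow> int \<Rightarrow> real \<Rightarrow> 'h \<Rightarrow> 'h \<Rightarrow> 'h"
  bone :: "'h"

definition bigraded_algebra_iso ::
  "('k, 'x) ring_scheme \<Rightarrow> real set \<Rightarrow> ('k, 'h) bigraded_algebra \<Rightarrow> ('k, 'j) bigraded_algebra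
    \<Rightarrow> (int \<Rightarrow> real \<Rightarrow> 'h \<Rightarrow> 'j) set"
  where "bigraded_algebra_iso K G A B =
    {\<Phi>. (\<forall>n. \<forall>l\<in>G. \<Phi> n l \<in> linear_maps K (bcomp A n l) (bcomp B n l) \<and>
             bij_betw (\<Phi> n l) (carrier (bcomp A n l)) (carrier (bcomp B n l))) \<and>
         (\<forall>m n. \<forall>s\<in>G. \<forall>l\<in>G. \<forall>a\<in>carrier (bcomp A m s). \<forall>b\<in>carrier (bcomp A n l).
             \<Phi> (m + n) (s + l) (bmult A m s n l a b) =
             bmult B m s n l (\<Phi> m s a) (\<Phi> n l b)) \<and>
         \<Phi> 0 0 (bone A) = bone B}"

definition bigraded_algebra_isomorphic ::
  "('k, 'x) ring_scheme \<Rightarrow> real set \<Rightarrow> ('k, 'h) bigraded_algebra \<Rightarrow> ('k, 'j) bigraded_algebra \<Rightarrow> bool"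
  where "bigraded_algebra_isomorphic K G A B \<longleftrightarrow> bigraded_algebra_iso K G A B \<noteq> {}"


section \<open>Graded modules\<close>

text \<open>Modules with homogeneous parts.  The type serves both for \<open>\<G>\<close>-graded \<open>\<K>\<close>-algebras
  (whose base ring is \<open>\<K>\<close>) and for \<open>\<G>\<close>-graded left modules over such an algebra.  Only
  the values of \<open>gpart\<close> on \<open>\<G>\<close> matter.\<close>

record ('r, 'm) gmodule = "('r, 'm) module" +
  gpart :: "real \<Rightarrow> 'm set"

definition is_decomposition :: "real set \<Rightarrow> ('r, 'm) gmodule \<Rightarrow> 'm \<Rightarrow> (real \<Rightarrow> 'm) \<Rightarrow> bool"
  where "is_decomposition G M x c \<longleftrightarrow>
    (\<forall>g\<in>G. c g \<in> gpart M g) \<and> (\<forall>g. g \<notin> G \<longrightarrow> c g = \<zero>\<^bsub>M\<^esub>) \<and> finite {g. c g \<noteq> \<zero>\<^bsub>M\<^esub>} \<and>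
    x = (\<Oplus>\<^bsub>M\<^esub>g\<in>{g. c g \<noteq> \<zero>\<^bsub>M\<^esub>}. c g)"

definition is_grading :: "real set \<Rightarrow> ('r, 'm) gmodule \<Rightarrow> bool"
  where "is_grading G M \<longleftrightarrow>
    (\<forall>g\<in>G. additive_subgroup (gpart M g) M) \<and>
    (\<forall>x\<in>carrier M. \<exists>!c. is_decomposition G M x c)"

locale graded_left_module = left_module R M
  for G :: "real set" and R :: "('k, 'r) gmodule" (structure) and M :: "('r, 'm) gmodule" (structure) +
  assumes grading: "is_grading G M"
    and smult_gpart:
      "\<lbrakk>g \<in> G; h \<in> G; a \<in> gpart R g; x \<in> gpart M h\<rbrakk> \<Longrightarrow> a \<odot>\<^bsub>M\<^esub> x \<in> gpart M (g + h)"

definition shift :: "real \<Rightarrow> ('r, 'm) gmodule \<Rightarrow> ('r, 'm) gmodule"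
  where "shift l M = M\<lparr>gpart := \<lambda>g. gpart M (g - l)\<rparr>"

definition graded_maps ::
  "real set \<Rightarrow> ('k, 'r) gmodule \<Rightarrow> ('r, 'm) gmodule \<Rightarrow> ('r, 'n) gmodule \<Rightarrow> ('m \<Rightarrow> 'n) set"
  where "graded_maps G \<Lambda> M N =
    {f \<in> linear_maps \<Lambda> M N. \<forall>g\<in>G. f ` gpart M g \<subseteq> gpart N g}"

text \<open>The \<open>\<K>\<close>-module of degree-0 morphisms; \<open>\<K>\<close> acts on \<open>\<Lambda>\<close>-modules through
  \<open>k \<mapsto> k \<cdot> 1\<^sub>\<Lambda>\<close>.\<close>

definition graded_hom_module ::
  "real set \<Rightarrow> ('k, 'r) gmodule \<Rightarrow> ('r, 'm) gmodule \<Rightarrow> ('r, 'n) gmodule \<Rightarrow> ('k, 'm \<Rightarrow> 'n) module"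
  where "graded_hom_module G \<Lambda> M N =
    \<lparr>carrier = graded_maps G \<Lambda> M N, mult = undefined, one = undefined,
     zero = (\<lambda>x\<in>carrier M. \<zero>\<^bsub>N\<^esub>),
     add = (\<lambda>f f'. \<lambda>x\<in>carrier M. f x \<oplus>\<^bsub>N\<^esub> f' x),
     smult = (\<lambda>k f. \<lambda>x\<in>carrier M. (k \<odot>\<^bsub>\<Lambda>\<^esub> \<one>\<^bsub>\<Lambda>\<^esub>) \<odot>\<^bsub>N\<^esub> f x)\<rparr>"

text \<open>Epimorphisms of graded modules are the surjective morphisms.  HOL cannot
  quantify over the epimorphisms \<open>N \<rightarrow> N'\<close> of modules of all types, so the lifting property is
  demanded for \<open>N\<close> with elements in \<open>real \<times> 'p \<Rightarrow> 'r\<close> and \<open>N'\<close> with elements in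
  \<open>'p\<close>.  These types accommodate the canonical epimorphism onto \<open>P\<close> from the free graded
  module on the homogeneous elements of \<open>P\<close>, so that the lifting property follows for
  modules \<open>N\<close>, \<open>N'\<close> of arbitrary types: see \<open>graded_projective_lifting\<close> below.\<close>

definition graded_projective :: "real set \<Rightarrow> ('k, 'r) gmodule \<Rightarrow> ('r, 'p) gmodule \<Rightarrow> bool"
  where "graded_projective G \<Lambda> P \<longleftrightarrow>
    graded_left_module G \<Lambda> P \<and>
    (\<forall>(N :: ('r, real \<times> 'p \<Rightarrow> 'r) gmodule) (N' :: ('r, 'p) gmodule) u f.
       graded_left_module G \<Lambda> N \<longrightarrow> graded_left_module G \<Lambda> N' \<longrightarrow>
       u \<in> graded_maps G \<Lambda> N N' \<longrightarrow> u ` carrier N = carrier N' \<longrightarrow> f \<in> graded_maps G \<Lambda> P N' \<longrightarrow>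
       (\<exists>h \<in> graded_maps G \<Lambda> P N. \<forall>x\<in>carrier P. u (h x) = f x))"


section \<open>Ext and the Yoneda algebra\<close>

text \<open>Complexes are indexed by the integers; resolutions vanish in negative degrees.\<close>

definition projective_resolution ::
  "real set \<Rightarrow> ('k, 'r) gmodule \<Rightarrow> ('r, 'm) gmodule \<Rightarrow>
   (int \<Rightarrow> ('r, 'p) gmodule) \<Rightarrow> (int \<Rightarrow> 'p \<Rightarrow> 'p) \<Rightarrow> ('p \<Rightarrow> 'm) \<Rightarrow> bool"
  where "projective_resolution G \<Lambda> M P D \<epsilon> \<longleftrightarrow>
    (\<forall>n. graded_projective G \<Lambda> (P n)) \<and>
    (\<forall>n<0. carrier (P n) = {\<zero>\<^bsub>P n\<^esub>}) \<and>
    (\<forall>n. D n \<in> graded_maps G \<Lambda> (P n) (P (n - 1))) \<and>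
    (\<forall>n\<ge>1. D (n + 1) ` carrier (P (n + 1)) = {x \<in> carrier (P n). D n x = \<zero>\<^bsub>P (n - 1)\<^esub>}) \<and>
    \<epsilon> \<in> graded_maps G \<Lambda> (P 0) M \<and>
    D 1 ` carrier (P 1) = {x \<in> carrier (P 0). \<epsilon> x = \<zero>\<^bsub>M\<^esub>} \<and>
    \<epsilon> ` carrier (P 0) = carrier M"

definition hom_complex ::
  "real set \<Rightarrow> ('k, 'r) gmodule \<Rightarrow> (int \<Rightarrow> ('r, 'p) gmodule) \<Rightarrow> ('r, 'm) gmodule
    \<Rightarrow> int \<Rightarrow> ('k, 'p \<Rightarrow> 'm) module"
  where "hom_complex G \<Lambda> P N n = graded_hom_module G \<Lambda> (P n) N"

definition hom_diff ::
  "(int \<Rightarrow> ('r, 'p) gmodule) \<Rightarrow> (int \<Rightarrow> 'p \<Rightarrow> 'p) \<Rightarrow> int \<Rightarrow> ('p \<Rightarrow> 'm) \<Rightarrow> ('p \<Rightarrow> 'm)"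
  where "hom_diff P D n \<alpha> = compose (carrier (P (n + 1))) \<alpha> (D (n + 1))"

text \<open>\<open>Ext\<^sup>n(M, M[l])\<close> computed from the resolution \<open>P\<close> of \<open>M\<close>, and the class in it of a
  cocycle.\<close>

definition yoneda_comp ::
  "real set \<Rightarrow> ('k, 'r) gmodule \<Rightarrow> ('r, 'm) gmodule \<Rightarrow> (int \<Rightarrow> ('r, 'p) gmodule)
    \<Rightarrow> (int \<Rightarrow> 'p \<Rightarrow> 'p) \<Rightarrow> int \<Rightarrow> real \<Rightarrow> ('k, ('p \<Rightarrow> 'm) set) module"
  where "yoneda_comp G \<Lambda> M P D n l =
    cohomology (hom_complex G \<Lambda> P (shift l M)) (hom_diff P D) n"

definition yoneda_class ::
  "real set \<Rightarrow> ('k, 'r) gmodule \<Rightarrow> ('r, 'm) gmodule \<Rightarrow> (int \<Rightarrow> ('r, 'p) gmodule)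
    \<Rightarrow> (int \<Rightarrow> 'p \<Rightarrow> 'p) \<Rightarrow> int \<Rightarrow> real \<Rightarrow> ('p \<Rightarrow> 'm) \<Rightarrow> ('p \<Rightarrow> 'm) set"
  where "yoneda_class G \<Lambda> M P D n l =
    cohomology_class (hom_complex G \<Lambda> P (shift l M)) (hom_diff P D) n"

text \<open>The lifts \<open>\<alpha>\<^sub>k : P\<^sub>n\<^sub>+\<^sub>k \<rightarrow> P\<^sub>k[l]\<close> of a cocycle \<open>\<alpha> : P\<^sub>n \<rightarrow> M[l]\<close>.  For \<open>k < 0\<close>
  the map \<open>\<alpha>\<^sub>k\<close> is necessarily zero, since \<open>P\<^sub>k\<close> is.\<close>

definition yoneda_lifts ::
  "real set \<Rightarrow> ('k, 'r) gmodule \<Rightarrow> (int \<Rightarrow> ('r, 'p) gmodule) \<Rightarrow> (int \<Rightarrow> 'p \<Rightarrow> 'p) \<Rightarrow> ('p \<Rightarrow> 'm)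
    \<Rightarrow> int \<Rightarrow> real \<Rightarrow> ('p \<Rightarrow> 'm) \<Rightarrow> (int \<Rightarrow> 'p \<Rightarrow> 'p) set"
  where "yoneda_lifts G \<Lambda> P D \<epsilon> n l \<alpha> =
    {\<alpha>'. (\<forall>k. \<alpha>' k \<in> graded_maps G \<Lambda> (P (n + k)) (shift l (P k))) \<and>
         (\<forall>k\<ge>1. \<forall>x\<in>carrier (P (n + k)). D k (\<alpha>' k x) = \<alpha>' (k - 1) (D (n + k) x)) \<and>
         (\<forall>x\<in>carrier (P n). \<epsilon> (\<alpha>' 0 x) = \<alpha> x)}"

text \<open>The product \<open>[\<beta>] \<circ> [\<alpha>]\<close> is written, like products of cosets in HOL-Algebra, as the union
  over all representatives and all lifts.\<close>

definition yoneda_mult ::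
  "real set \<Rightarrow> ('k, 'r) gmodule \<Rightarrow> ('r, 'm) gmodule \<Rightarrow> (int \<Rightarrow> ('r, 'p) gmodule)
    \<Rightarrow> (int \<Rightarrow> 'p \<Rightarrow> 'p) \<Rightarrow> ('p \<Rightarrow> 'm) \<Rightarrow> int \<Rightarrow> real \<Rightarrow> int \<Rightarrow> real
    \<Rightarrow> ('p \<Rightarrow> 'm) set \<Rightarrow> ('p \<Rightarrow> 'm) set \<Rightarrow> ('p \<Rightarrow> 'm) set"
  where "yoneda_mult G \<Lambda> M P D \<epsilon> m s n l B A =
    (\<Union>\<beta>\<in>B. \<Union>\<alpha>\<in>A. \<Union>\<alpha>'\<in>yoneda_lifts G \<Lambda> P D \<epsilon> n l \<alpha>.
       yoneda_class G \<Lambda> M P D (m + n) (s + l) (compose (carrier (P (m + n))) \<beta> (\<alpha>' m)))"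

definition yoneda_algebra ::
  "real set \<Rightarrow> ('k, 'r) gmodule \<Rightarrow> ('r, 'm) gmodule \<Rightarrow> (int \<Rightarrow> ('r, 'p) gmodule)
    \<Rightarrow> (int \<Rightarrow> 'p \<Rightarrow> 'p) \<Rightarrow> ('p \<Rightarrow> 'm) \<Rightarrow> ('k, ('p \<Rightarrow> 'm) set) bigraded_algebra"
  where "yoneda_algebra G \<Lambda> M P D \<epsilon> =
    \<lparr>bcomp = yoneda_comp G \<Lambda> M P D,
     bmult = yoneda_mult G \<Lambda> M P D \<epsilon>,
     bone = yoneda_class G \<Lambda> M P D 0 0 \<epsilon>\<rparr>"


section \<open>Quasimetric spaces and the distance algebra\<close>

locale quasimetric_space =
  fixes X :: "'x set" and d :: "'x \<Rightarrow> 'x \<Rightarrow> ereal"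
  assumes nonneg: "\<lbrakk>x \<in> X; y \<in> X\<rbrakk> \<Longrightarrow> 0 \<le> d x y"
    and triangle: "\<lbrakk>x \<in> X; y \<in> X; z \<in> X\<rbrakk> \<Longrightarrow> d x y + d y z \<ge> d x z"
    and zero_iff: "\<lbrakk>x \<in> X; y \<in> X\<rbrakk> \<Longrightarrow> d x y = 0 \<longleftrightarrow> x = y"

definition between :: "('x \<Rightarrow> 'x \<Rightarrow> ereal) \<Rightarrow> 'x \<Rightarrow> 'x \<Rightarrow> 'x \<Rightarrow> bool"
  where "between d x y z \<longleftrightarrow> d x y + d y z = d x z"

definition finite_pairs :: "'x set \<Rightarrow> ('x \<Rightarrow> 'x \<Rightarrow> ereal) \<Rightarrow> ('x \<times> 'x) set"
  where "finite_pairs X d = {(x, y). x \<in> X \<and> y \<in> X \<and> d x y < \<infinity>}"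

text \<open>For finite \<open>X\<close>.  The coefficient of \<open>(x, z)\<close> in \<open>a \<cdot> b\<close> collects the products
  \<open>(x, y) \<cdot> (y, z)\<close> that are not set to 0.\<close>

definition distance_algebra ::
  "('k, 'c) ring_scheme \<Rightarrow> 'x set \<Rightarrow> ('x \<Rightarrow> 'x \<Rightarrow> ereal) \<Rightarrow> ('k, 'x \<times> 'x \<Rightarrow> 'k) gmodule"
  where "distance_algebra K X d =
    (let F = free_module K (finite_pairs X d) in
     \<lparr>carrier = carrier F,
      mult = (\<lambda>a b (x, z). \<Oplus>\<^bsub>K\<^esub>y\<in>{y\<in>X. between d x y z}. a (x, y) \<otimes>\<^bsub>K\<^esub> b (y, z)),
      one = (\<lambda>(x, y). if x \<in> X \<and> x = y then \<one>\<^bsub>K\<^esub> else \<zero>\<^bsub>K\<^esub>),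
      zero = zero F, add = add F, smult = smult F,
      gpart = (\<lambda>g. {a \<in> carrier F. \<forall>x y. a (x, y) \<noteq> \<zero>\<^bsub>K\<^esub> \<longrightarrow> d x y = ereal g})\<rparr>)"

definition distance_ideal ::
  "('k, 'c) ring_scheme \<Rightarrow> 'x set \<Rightarrow> ('x \<Rightarrow> 'x \<Rightarrow> ereal) \<Rightarrow> ('x \<times> 'x \<Rightarrow> 'k) set"
  where "distance_ideal K X d =
    Idl\<^bsub>distance_algebra K X d\<^esub> {basis_vec K (x, y) | x y. (x, y) \<in> finite_pairs X d \<and> 0 < d x y}"

text \<open>The quotient algebra by an ideal \<open>J\<close>, as a graded left module over the original
  algebra.\<close>

definition quotient_left_module ::
  "('k, 'r) gmodule \<Rightarrow> 'r set \<Rightarrow> ('r, 'r set) gmodule"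
  where "quotient_left_module \<Lambda> J =
    (let Q = \<Lambda> Quot J in
     \<lparr>carrier = carrier Q, mult = mult Q, one = one Q, zero = zero Q, add = add Q,
      smult = (\<lambda>r A. (J +>\<^bsub>\<Lambda>\<^esub> r) \<otimes>\<^bsub>Q\<^esub> A),
      gpart = (\<lambda>g. (\<lambda>a. J +>\<^bsub>\<Lambda>\<^esub> a) ` gpart \<Lambda> g)\<rparr>)"

definition distance_quotient ::
  "('k, 'c) ring_scheme \<Rightarrow> 'x set \<Rightarrow> ('x \<Rightarrow> 'x \<Rightarrow> ereal) \<Rightarrow> ('x \<times> 'x \<Rightarrow> 'k, ('x \<times> 'x \<Rightarrow> 'k) set) gmodule"
  where "distance_quotient K X d =
    quotient_left_module (distance_algebra K X d) (distance_ideal K X d)"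


section \<open>The magnitude cohomology algebra\<close>

definition path_length :: "('x \<Rightarrow> 'x \<Rightarrow> ereal) \<Rightarrow> 'x list \<Rightarrow> ereal"
  where "path_length d xs = (\<Sum>i<length xs - 1. d (xs ! i) (xs ! Suc i))"

text \<open>The tuples \<open>(x\<^sub>0, \<dots>, x\<^sub>n)\<close> of length \<open>l\<close> with \<open>x\<^sub>i \<noteq> x\<^sub>i\<^sub>+\<^sub>1\<close>; none if \<open>n < 0\<close>.\<close>

definition mag_tuples :: "'x set \<Rightarrow> ('x \<Rightarrow> 'x \<Rightarrow> ereal) \<Rightarrow> int \<Rightarrow> real \<Rightarrow> 'x list set"
  where "mag_tuples X d n l =
    {xs. 0 \<le> n \<and> int (length xs) = n + 1 \<and> set xs \<subseteq> X \<and> path_length d xs = ereal l \<and>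
         (\<forall>i. Suc i < length xs \<longrightarrow> xs ! i \<noteq> xs ! Suc i)}"

definition mag_chains ::
  "('k, 'c) ring_scheme \<Rightarrow> 'x set \<Rightarrow> ('x \<Rightarrow> 'x \<Rightarrow> ereal) \<Rightarrow> real \<Rightarrow> int \<Rightarrow> ('k, 'x list \<Rightarrow> 'k) module"
  where "mag_chains K X d l n = free_module K (mag_tuples X d n l)"

text \<open>The \<open>i\<close>-th face of a basis element of the normalised complex in degree \<open>n\<close>: both the
  tuples that became shorter than \<open>l\<close> and the degenerate ones are 0.\<close>

definition mag_face ::
  "('k, 'c) ring_scheme \<Rightarrow> 'x set \<Rightarrow> ('x \<Rightarrow> 'x \<Rightarrow> ereal) \<Rightarrow> real \<Rightarrow> int \<Rightarrow> nat \<Rightarrow> 'x list \<Rightarrow> 'x list \<Rightarrow> 'k"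
  where "mag_face K X d l n i xs =
    (let ys = take i xs @ drop (Suc i) xs in
     if ys \<in> mag_tuples X d (n - 1) l then basis_vec K ys else \<zero>\<^bsub>mag_chains K X d l (n - 1)\<^esub>)"

definition mag_boundary ::
  "('k, 'c) ring_scheme \<Rightarrow> 'x set \<Rightarrow> ('x \<Rightarrow> 'x \<Rightarrow> ereal) \<Rightarrow> real \<Rightarrow> int \<Rightarrow> ('x list \<Rightarrow> 'k) \<Rightarrow> 'x list \<Rightarrow> 'k"
  where "mag_boundary K X d l n =
    (let C = mag_chains K X d l (n - 1) in
     lin_ext K C (\<lambda>xs. \<Oplus>\<^bsub>C\<^esub>i\<in>{..<length xs}.
       ((\<ominus>\<^bsub>K\<^esub> \<one>\<^bsub>K\<^esub>) [^]\<^bsub>K\<^esub> i) \<odot>\<^bsub>C\<^esub> mag_face K X d l n i xs))"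

definition dual_module :: "('k, 'c) ring_scheme \<Rightarrow> ('k, 'm) module \<Rightarrow> ('k, 'm \<Rightarrow> 'k) module"
  where "dual_module K M =
    \<lparr>carrier = linear_maps K M (regular_module K), mult = undefined, one = undefined,
     zero = (\<lambda>x\<in>carrier M. \<zero>\<^bsub>K\<^esub>),
     add = (\<lambda>f f'. \<lambda>x\<in>carrier M. f x \<oplus>\<^bsub>K\<^esub> f' x),
     smult = (\<lambda>k f. \<lambda>x\<in>carrier M. k \<otimes>\<^bsub>K\<^esub> f x)\<rparr>"

definition mag_cochains ::
  "('k, 'c) ring_scheme \<Rightarrow> 'x set \<Rightarrow> ('x \<Rightarrow> 'x \<Rightarrow> ereal) \<Rightarrow> real \<Rightarrow> int
    \<Rightarrow> ('k, ('x list \<Rightarrow> 'k) \<Rightarrow> 'k) module"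
  where "mag_cochains K X d l n = dual_module K (mag_chains K X d l n)"

definition mag_coboundary ::
  "('k, 'c) ring_scheme \<Rightarrow> 'x set \<Rightarrow> ('x \<Rightarrow> 'x \<Rightarrow> ereal) \<Rightarrow> real \<Rightarrow> int
    \<Rightarrow> (('x list \<Rightarrow> 'k) \<Rightarrow> 'k) \<Rightarrow> ('x list \<Rightarrow> 'k) \<Rightarrow> 'k"
  where "mag_coboundary K X d l n \<psi> =
    compose (carrier (mag_chains K X d l (n + 1))) \<psi> (mag_boundary K X d l (n + 1))"

text \<open>The cochain with prescribed values on tuples.\<close>

definition mag_cochain_of ::
  "('k, 'c) ring_scheme \<Rightarrow> 'x set \<Rightarrow> ('x \<Rightarrow> 'x \<Rightarrow> ereal) \<Rightarrow> real \<Rightarrow> int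
    \<Rightarrow> ('x list \<Rightarrow> 'k) \<Rightarrow> ('x list \<Rightarrow> 'k) \<Rightarrow> 'k"
  where "mag_cochain_of K X d l n v =
    (\<lambda>c\<in>carrier (mag_chains K X d l n). lin_ext K (regular_module K) v c)"

text \<open>On a tuple \<open>(x\<^sub>0, \<dots>, x\<^sub>m\<^sub>+\<^sub>n)\<close>, the two sublists below are \<open>(x\<^sub>0, \<dots>, x\<^sub>m)\<close> and
  \<open>(x\<^sub>m, \<dots>, x\<^sub>m\<^sub>+\<^sub>n)\<close>.\<close>

definition mag_cochain_mult ::
  "('k, 'c) ring_scheme \<Rightarrow> 'x set \<Rightarrow> ('x \<Rightarrow> 'x \<Rightarrow> ereal) \<Rightarrow> int \<Rightarrow> real \<Rightarrow> int \<Rightarrow> real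
    \<Rightarrow> (('x list \<Rightarrow> 'k) \<Rightarrow> 'k) \<Rightarrow> (('x list \<Rightarrow> 'k) \<Rightarrow> 'k) \<Rightarrow> ('x list \<Rightarrow> 'k) \<Rightarrow> 'k"
  where "mag_cochain_mult K X d m s n l \<psi> \<phi> =
    mag_cochain_of K X d (s + l) (m + n) (\<lambda>xs.
      (let ys = take (nat m + 1) xs; zs = drop (nat m) xs in
       if ys \<in> mag_tuples X d m s \<and> zs \<in> mag_tuples X d n l
       then \<psi> (basis_vec K ys) \<otimes>\<^bsub>K\<^esub> \<phi> (basis_vec K zs) else \<zero>\<^bsub>K\<^esub>))"

definition mag_class ::
  "('k, 'c) ring_scheme \<Rightarrow> 'x set \<Rightarrow> ('x \<Rightarrow> 'x \<Rightarrow> ereal) \<Rightarrow> int \<Rightarrow> real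
    \<Rightarrow> (('x list \<Rightarrow> 'k) \<Rightarrow> 'k) \<Rightarrow> (('x list \<Rightarrow> 'k) \<Rightarrow> 'k) set"
  where "mag_class K X d n l = cohomology_class (mag_cochains K X d l) (mag_coboundary K X d l) n"

definition magnitude_cohomology_algebra ::
  "('k, 'c) ring_scheme \<Rightarrow> 'x set \<Rightarrow> ('x \<Rightarrow> 'x \<Rightarrow> ereal)
    \<Rightarrow> ('k, (('x list \<Rightarrow> 'k) \<Rightarrow> 'k) set) bigraded_algebra"
  where "magnitude_cohomology_algebra K X d =
    \<lparr>bcomp = (\<lambda>n l. cohomology (mag_cochains K X d l) (mag_coboundary K X d l) n),
     bmult = (\<lambda>m s n l B A. \<Union>\<psi>\<in>B. \<Union>\<phi>\<in>A.
       mag_class K X d (m + n) (s + l) (mag_cochain_mult K X d m s n l \<psi> \<phi>)),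
     bone = mag_class K X d 0 0 (mag_cochain_of K X d 0 0 (\<lambda>xs. \<one>\<^bsub>K\<^esub>))\<rparr>"


section \<open>The lifting property of projective modules for arbitrary types\<close>

lemma linear_mapsD:
  assumes "f \<in> linear_maps R M N"
  shows "x \<in> carrier M \<Longrightarrow> f x \<in> carrier N"
    and "\<lbrakk>x \<in> carrier M; y \<in> carrier M\<rbrakk> \<Longrightarrow> f (x \<oplus>\<^bsub>M\<^esub> y) = f x \<oplus>\<^bsub>N\<^esub> f y"
    and "\<lbrakk>r \<in> carrier R; x \<in> carrier M\<rbrakk> \<Longrightarrow> f (r \<odot>\<^bsub>M\<^esub> x) = r \<odot>\<^bsub>N\<^esub> f x"
  using assms by (auto simp: linear_maps_def)

lemma linear_maps_zero:
  assumes "abelian_group M" "abelian_group N" "f \<in> linear_maps R M N"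
  shows "f \<zero>\<^bsub>M\<^esub> = \<zero>\<^bsub>N\<^esub>"
proof -
  interpret M: abelian_group M by fact
  interpret N: abelian_group N by fact
  have "f \<zero>\<^bsub>M\<^esub> \<oplus>\<^bsub>N\<^esub> f \<zero>\<^bsub>M\<^esub> = f \<zero>\<^bsub>M\<^esub>"
    using linear_mapsD(2)[OF assms(3), of "\<zero>\<^bsub>M\<^esub>" "\<zero>\<^bsub>M\<^esub>"] by simp
  then show ?thesis
    using linear_mapsD(1)[OF assms(3), of "\<zero>\<^bsub>M\<^esub>"] by simp
qed

lemma linear_maps_finsum:
  assumes "abelian_group M" "abelian_group N" "f \<in> linear_maps R M N"
    and "finite A" "a \<in> A \<rightarrow> carrier M"
  shows "f (finsum M a A) = (\<Oplus>\<^bsub>N\<^esub>i\<in>A. f (a i))"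
proof -
  interpret M: abelian_group M by fact
  interpret N: abelian_group N by fact
  show ?thesis
    using assms(4,5)
  proof (induction A rule: finite_induct)
    case empty
    then show ?case using linear_maps_zero[OF assms(1-3)] by simp
  next
    case (insert i A)
    have "finsum M a (insert i A) = a i \<oplus>\<^bsub>M\<^esub> finsum M a A"
      and "finsum M a A \<in> carrier M"
      and "(\<Oplus>\<^bsub>N\<^esub>j\<in>insert i A. f (a j)) = f (a i) \<oplus>\<^bsub>N\<^esub> (\<Oplus>\<^bsub>N\<^esub>j\<in>A. f (a j))"
      using insert linear_mapsD(1)[OF assms(3)]
      by (auto intro!: M.finsum_insert N.finsum_insert M.finsum_closed simp: Pi_def)
    then show ?case
      using insert linear_mapsD(2)[OF assms(3)] by simp
  qed
qed

lemma free_module_simps [simp]: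
  "\<zero>\<^bsub>free_module R T\<^esub> = (\<lambda>t. \<zero>\<^bsub>R\<^esub>)"
  "c \<oplus>\<^bsub>free_module R T\<^esub> c' = (\<lambda>t. c t \<oplus>\<^bsub>R\<^esub> c' t)"
  "r \<odot>\<^bsub>free_module R T\<^esub> c = (\<lambda>t. r \<otimes>\<^bsub>R\<^esub> c t)"
  by (auto simp: free_module_def)

lemma free_module_carrier:
  "c \<in> carrier (free_module R T) \<longleftrightarrow>
    (\<forall>t. c t \<in> carrier R) \<and> (\<forall>t. t \<notin> T \<longrightarrow> c t = \<zero>\<^bsub>R\<^esub>) \<and> finite {t. c t \<noteq> \<zero>\<^bsub>R\<^esub>}"
  by (simp add: free_module_def)

lemma free_left_module:
  assumes "ring R"
  shows "left_module R (free_module R T)"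
proof -
  interpret R: ring R by fact
  have add: "(\<lambda>t. c t \<oplus>\<^bsub>R\<^esub> c' t) \<in> carrier (free_module R T)"
    if "c \<in> carrier (free_module R T)" "c' \<in> carrier (free_module R T)" for c c'
  proof -
    have "{t. c t \<oplus>\<^bsub>R\<^esub> c' t \<noteq> \<zero>\<^bsub>R\<^esub>} \<subseteq> {t. c t \<noteq> \<zero>\<^bsub>R\<^esub>} \<union> {t. c' t \<noteq> \<zero>\<^bsub>R\<^esub>}"
      by auto
    then show ?thesis
      using that by (auto simp: free_module_carrier intro: finite_subset)
  qed
  have smult: "(\<lambda>t. r \<otimes>\<^bsub>R\<^esub> c t) \<in> carrier (free_module R T)"
    if "r \<in> carrier R" "c \<in> carrier (free_module R T)" for r c
  proof -
    have "{t. r \<otimes>\<^bsub>R\<^esub> c t \<noteq> \<zero>\<^bsub>R\<^esub>} \<subseteq> {t. c t \<noteq> \<zero>\<^bsub>R\<^esub>}"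
      using that by auto
    then show ?thesis
      using that by (auto simp: free_module_carrier intro: finite_subset)
  qed
  have neg: "(\<lambda>t. \<ominus>\<^bsub>R\<^esub> c t) \<in> carrier (free_module R T)"
    if "c \<in> carrier (free_module R T)" for c
  proof -
    have "{t. \<ominus>\<^bsub>R\<^esub> c t \<noteq> \<zero>\<^bsub>R\<^esub>} \<subseteq> {t. c t \<noteq> \<zero>\<^bsub>R\<^esub>}"
      by auto
    then show ?thesis
      using that by (auto simp: free_module_carrier intro: finite_subset)
  qed
  have grp: "abelian_group (free_module R T)"
  proof (rule abelian_groupI)
    fix c assume c: "c \<in> carrier (free_module R T)"
    show "\<exists>y\<in>carrier (free_module R T). y \<oplus>\<^bsub>free_module R T\<^esub> c = \<zero>\<^bsub>free_module R T\<^esub>"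
      using c neg[OF c] by (intro bexI[of _ "\<lambda>t. \<ominus>\<^bsub>R\<^esub> c t"])
        (auto simp: free_module_carrier R.l_neg)
  qed (use add in \<open>auto simp: free_module_carrier R.a_assoc intro!: ext R.a_comm\<close>)
  show ?thesis
    by (intro left_module.intro left_module_axioms.intro)
      (use assms grp smult in \<open>auto simp: free_module_carrier R.l_distr R.r_distr R.m_assoc\<close>)
qed

lemma basis_vec_in_free_module:
  assumes "ring R" "t \<in> T"
  shows "basis_vec R t \<in> carrier (free_module R T)"
proof -
  interpret R: ring R by fact
  have "{t'. basis_vec R t t' \<noteq> \<zero>\<^bsub>R\<^esub>} \<subseteq> {t}" by (auto simp: basis_vec_def)
  then show ?thesis
    using assms(2) by (auto simp: free_module_carrier basis_vec_def intro: finite_subset)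
qed

lemma lin_ext_superset:
  assumes "left_module R N" "c \<in> carrier (free_module R T)" "\<phi> \<in> T \<rightarrow> carrier N"
    and "finite A" "{t. c t \<noteq> \<zero>\<^bsub>R\<^esub>} \<subseteq> A" "A \<subseteq> T"
  shows "lin_ext R N \<phi> c = (\<Oplus>\<^bsub>N\<^esub>t\<in>A. c t \<odot>\<^bsub>N\<^esub> \<phi> t)"
proof -
  interpret left_module R N by fact
  have z: "\<zero>\<^bsub>R\<^esub> \<odot>\<^bsub>N\<^esub> x = \<zero>\<^bsub>N\<^esub>" if "x \<in> carrier N" for x
  proof -
    have "\<zero>\<^bsub>R\<^esub> \<odot>\<^bsub>N\<^esub> x \<oplus>\<^bsub>N\<^esub> \<zero>\<^bsub>R\<^esub> \<odot>\<^bsub>N\<^esub> x = \<zero>\<^bsub>R\<^esub> \<odot>\<^bsub>N\<^esub> x"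
      using smult_l_distr[of "\<zero>\<^bsub>R\<^esub>" "\<zero>\<^bsub>R\<^esub>" x] that by simp
    then show ?thesis using that by simp
  qed
  show ?thesis
    unfolding lin_ext_def
    by (rule M.add.finprod_mono_neutral_cong)
      (use assms z in \<open>auto simp: free_module_carrier Pi_def subset_iff\<close>)
qed

lemma lin_ext_linear:
  assumes "left_module R N" "\<phi> \<in> T \<rightarrow> carrier N"
  shows "(\<lambda>c\<in>carrier (free_module R T). lin_ext R N \<phi> c) \<in> linear_maps R (free_module R T) N"
proof -
  interpret left_module R N by fact
  interpret F: left_module R "free_module R T" by (rule free_left_module) unfold_locales
  have fin: "finite {t. c t \<noteq> \<zero>\<^bsub>R\<^esub>}" and sub: "{t. c t \<noteq> \<zero>\<^bsub>R\<^esub>} \<subseteq> T"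
    and val: "c t \<in> carrier R"
    if "c \<in> carrier (free_module R T)" for c t
    using that by (auto simp: free_module_carrier)
  have \<phi>: "\<phi> t \<in> carrier N" if "t \<in> T" for t using assms(2) that by auto
  have r0: "r \<odot>\<^bsub>N\<^esub> \<zero>\<^bsub>N\<^esub> = \<zero>\<^bsub>N\<^esub>" if "r \<in> carrier R" for r
  proof -
    have "r \<odot>\<^bsub>N\<^esub> \<zero>\<^bsub>N\<^esub> \<oplus>\<^bsub>N\<^esub> r \<odot>\<^bsub>N\<^esub> \<zero>\<^bsub>N\<^esub> = r \<odot>\<^bsub>N\<^esub> \<zero>\<^bsub>N\<^esub>"
      using smult_r_distr[of r "\<zero>\<^bsub>N\<^esub>" "\<zero>\<^bsub>N\<^esub>"] that by simp
    then show ?thesis using that by simp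
  qed
  have clos: "lin_ext R N \<phi> c \<in> carrier N" if "c \<in> carrier (free_module R T)" for c
    unfolding lin_ext_def using fin[OF that] sub[OF that] val[OF that] \<phi>
    by (intro M.finsum_closed) auto
  moreover have "lin_ext R N \<phi> (c \<oplus>\<^bsub>free_module R T\<^esub> c') = lin_ext R N \<phi> c \<oplus>\<^bsub>N\<^esub> lin_ext R N \<phi> c'"
    if c: "c \<in> carrier (free_module R T)" and c': "c' \<in> carrier (free_module R T)" for c c'
  proof -
    let ?A = "{t. c t \<noteq> \<zero>\<^bsub>R\<^esub>} \<union> {t. c' t \<noteq> \<zero>\<^bsub>R\<^esub>}"
    have A: "finite ?A" "?A \<subseteq> T" using fin c c' sub by blast+
    have "lin_ext R N \<phi> (c \<oplus>\<^bsub>free_module R T\<^esub> c') =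
        (\<Oplus>\<^bsub>N\<^esub>t\<in>?A. (c \<oplus>\<^bsub>free_module R T\<^esub> c') t \<odot>\<^bsub>N\<^esub> \<phi> t)"
      by (rule lin_ext_superset[OF assms(1) F.add.m_closed[OF c c'] assms(2) A(1) _ A(2)]) auto
    also have "\<dots> = (\<Oplus>\<^bsub>N\<^esub>t\<in>?A. c t \<odot>\<^bsub>N\<^esub> \<phi> t \<oplus>\<^bsub>N\<^esub> c' t \<odot>\<^bsub>N\<^esub> \<phi> t)"
      using A val[OF c] val[OF c'] \<phi> by (intro M.finsum_cong') (auto simp: smult_l_distr)
    also have "\<dots> = (\<Oplus>\<^bsub>N\<^esub>t\<in>?A. c t \<odot>\<^bsub>N\<^esub> \<phi> t) \<oplus>\<^bsub>N\<^esub> (\<Oplus>\<^bsub>N\<^esub>t\<in>?A. c' t \<odot>\<^bsub>N\<^esub> \<phi> t)"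
      using A val[OF c] val[OF c'] \<phi> by (intro M.finsum_addf) auto
    also have "\<dots> = lin_ext R N \<phi> c \<oplus>\<^bsub>N\<^esub> lin_ext R N \<phi> c'"
      using lin_ext_superset[OF assms(1) c assms(2) A(1) _ A(2)]
        lin_ext_superset[OF assms(1) c' assms(2) A(1) _ A(2)] by simp
    finally show ?thesis .
  qed
  moreover have "lin_ext R N \<phi> (r \<odot>\<^bsub>free_module R T\<^esub> c) = r \<odot>\<^bsub>N\<^esub> lin_ext R N \<phi> c"
    if r: "r \<in> carrier R" and c: "c \<in> carrier (free_module R T)" for r c
  proof -
    let ?A = "{t. c t \<noteq> \<zero>\<^bsub>R\<^esub>}"
    have A: "finite ?A" "?A \<subseteq> T" using fin c sub by blast+
    have lin: "(\<lambda>x\<in>carrier N. r \<odot>\<^bsub>N\<^esub> x) (finsum N a B) = (\<Oplus>\<^bsub>N\<^esub>i\<in>B. r \<odot>\<^bsub>N\<^esub> a i)"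
      if "finite B" "a \<in> B \<rightarrow> carrier N" for a B
      using that
    proof (induction B rule: finite_induct)
      case empty
      then show ?case using r r0 by simp
    next
      case (insert i B)
      moreover from insert have "finsum N a B \<in> carrier N" by (intro M.finsum_closed) auto
      moreover from insert have "(\<Oplus>\<^bsub>N\<^esub>i\<in>insert i B. r \<odot>\<^bsub>N\<^esub> a i) =
          r \<odot>\<^bsub>N\<^esub> a i \<oplus>\<^bsub>N\<^esub> (\<Oplus>\<^bsub>N\<^esub>i\<in>B. r \<odot>\<^bsub>N\<^esub> a i)"
        using r by (intro M.finsum_insert) auto
      ultimately show ?case using r by (auto simp: smult_r_distr)
    qed
    have "lin_ext R N \<phi> (r \<odot>\<^bsub>free_module R T\<^esub> c) =
        (\<Oplus>\<^bsub>N\<^esub>t\<in>?A. (r \<odot>\<^bsub>free_module R T\<^esub> c) t \<odot>\<^bsub>N\<^esub> \<phi> t)"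
      by (rule lin_ext_superset[OF assms(1) F.smult_closed[OF r c] assms(2) A(1) _ A(2)])
        (use r in auto)
    also have "\<dots> = (\<Oplus>\<^bsub>N\<^esub>t\<in>?A. r \<odot>\<^bsub>N\<^esub> (c t \<odot>\<^bsub>N\<^esub> \<phi> t))"
      using A r val[OF c] \<phi> by (intro M.finsum_cong') (auto simp: smult_assoc1)
    also have "\<dots> = r \<odot>\<^bsub>N\<^esub> lin_ext R N \<phi> c"
    proof -
      have "(\<lambda>t. c t \<odot>\<^bsub>N\<^esub> \<phi> t) \<in> ?A \<rightarrow> carrier N"
        using sub[OF c] val[OF c] \<phi> by (auto dest: subsetD)
      from lin[OF A(1) this] show ?thesis
        using clos[OF c] by (simp add: lin_ext_def)
    qed
    finally show ?thesis .
  qed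
  ultimately show ?thesis
    using F.add.m_closed F.smult_closed by (auto simp: linear_maps_def)
qed

lemma lin_ext_basis_vec:
  assumes "left_module R N" "\<phi> t \<in> carrier N"
  shows "lin_ext R N \<phi> (basis_vec R t) = \<phi> t"
proof -
  interpret left_module R N by fact
  have "lin_ext R N \<phi> (basis_vec R t) = (\<Oplus>\<^bsub>N\<^esub>t'\<in>{t}. basis_vec R t t' \<odot>\<^bsub>N\<^esub> \<phi> t')"
    by (rule lin_ext_superset[of _ _ _ "{t}"])
      (use assms basis_vec_in_free_module[of R t "{t}"] in
        \<open>auto simp: basis_vec_def left_module_def\<close>)
  then show ?thesis using assms(2) by (simp add: basis_vec_def)
qed

lemma linear_maps_lin_ext:
  assumes "left_module R N" "left_module R N'" "u \<in> linear_maps R N N'"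
    and "c \<in> carrier (free_module R T)" "\<phi> \<in> T \<rightarrow> carrier N"
  shows "u (lin_ext R N \<phi> c) = lin_ext R N' (\<lambda>t. u (\<phi> t)) c"
proof -
  interpret N: left_module R N by fact
  interpret N': left_module R N' by fact
  have *: "c t \<in> carrier R" "c t \<noteq> \<zero>\<^bsub>R\<^esub> \<Longrightarrow> \<phi> t \<in> carrier N" "finite {t. c t \<noteq> \<zero>\<^bsub>R\<^esub>}" for t
    using assms(4,5) by (auto simp: free_module_carrier)
  have "u (lin_ext R N \<phi> c) = (\<Oplus>\<^bsub>N'\<^esub>t\<in>{t. c t \<noteq> \<zero>\<^bsub>R\<^esub>}. u (c t \<odot>\<^bsub>N\<^esub> \<phi> t))"
    unfolding lin_ext_def
    by (rule linear_maps_finsum[OF _ _ assms(3)]) (use * in \<open>auto intro: N.M.abelian_group_axioms N'.M.abelian_group_axioms\<close>)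
  also have "\<dots> = lin_ext R N' (\<lambda>t. u (\<phi> t)) c"
    unfolding lin_ext_def
    by (rule N'.M.finsum_cong') (use * linear_mapsD[OF assms(3)] in auto)
  finally show ?thesis .
qed

lemma lin_ext_cong:
  assumes "left_module R N" "c \<in> carrier (free_module R T)" "\<phi> \<in> T \<rightarrow> carrier N"
    and "\<And>t. t \<in> T \<Longrightarrow> \<phi>' t = \<phi> t"
  shows "lin_ext R N \<phi>' c = lin_ext R N \<phi> c"
proof -
  interpret left_module R N by fact
  have "t \<in> T" "c t \<in> carrier R" if "c t \<noteq> \<zero>\<^bsub>R\<^esub>" for t
    using assms(2) that by (auto simp: free_module_carrier)
  then show ?thesis
    unfolding lin_ext_def using assms(3,4)
    by (intro M.finsum_cong') auto
qed

lemma graded_mapsD: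
  assumes "f \<in> graded_maps G \<Lambda> M N"
  shows "f \<in> linear_maps \<Lambda> M N"
    and "\<lbrakk>g \<in> G; x \<in> gpart M g\<rbrakk> \<Longrightarrow> f x \<in> gpart N g"
  using assms by (auto simp: graded_maps_def)

lemma graded_maps_comp:
  assumes "f \<in> graded_maps G \<Lambda> L M" "u \<in> graded_maps G \<Lambda> M N"
    and "abelian_group L" "\<And>r x. \<lbrakk>r \<in> carrier \<Lambda>; x \<in> carrier L\<rbrakk> \<Longrightarrow> r \<odot>\<^bsub>L\<^esub> x \<in> carrier L"
    and "\<And>g x. \<lbrakk>g \<in> G; x \<in> gpart L g\<rbrakk> \<Longrightarrow> x \<in> carrier L"
  shows "compose (carrier L) u f \<in> graded_maps G \<Lambda> L N"
proof -
  interpret L: abelian_group L by fact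
  show ?thesis
    using linear_mapsD[OF graded_mapsD(1)[OF assms(1)]] linear_mapsD[OF graded_mapsD(1)[OF assms(2)]]
      graded_mapsD(2)[OF assms(1)] graded_mapsD(2)[OF assms(2)] assms(4,5)
    by (auto simp: graded_maps_def linear_maps_def compose_def)
qed

context graded_left_module
begin

lemma gpart_subgroup: "g \<in> G \<Longrightarrow> additive_subgroup (gpart M g) M"
  using grading by (simp add: is_grading_def)

lemma gpart_carrier: "\<lbrakk>g \<in> G; x \<in> gpart M g\<rbrakk> \<Longrightarrow> x \<in> carrier M"
  using additive_subgroup.a_subset[OF gpart_subgroup] by blast

lemma gpart_zero: "g \<in> G \<Longrightarrow> \<zero>\<^bsub>M\<^esub> \<in> gpart M g"
  using additive_subgroup.zero_closed[OF gpart_subgroup] by blast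

lemma gpart_finsum:
  assumes "g \<in> G" "finite A" "\<And>i. i \<in> A \<Longrightarrow> a i \<in> gpart M g"
  shows "finsum M a A \<in> gpart M g"
  using assms(2,3)
proof (induction A rule: finite_induct)
  case empty
  then show ?case using gpart_zero[OF assms(1)] by simp
next
  case (insert i A)
  then have "finsum M a (insert i A) = a i \<oplus>\<^bsub>M\<^esub> finsum M a A"
    using gpart_carrier[OF assms(1)] by (intro M.finsum_insert) auto
  then show ?case
    using insert additive_subgroup.a_closed[OF gpart_subgroup[OF assms(1)]] by simp
qed

end

lemma graded_surj_gpart:
  assumes N: "graded_left_module G \<Lambda> N" and N': "graded_left_module G \<Lambda> N'"
    and u: "u \<in> graded_maps G \<Lambda> N N'" and surj: "u ` carrier N = carrier N'"
    and g: "g \<in> G" and y: "y \<in> gpart N' g"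
  shows "\<exists>x\<in>gpart N g. u x = y"
proof -
  interpret N: graded_left_module G \<Lambda> N by fact
  interpret N': graded_left_module G \<Lambda> N' by fact
  note ul = graded_mapsD(1)[OF u]
  have u0: "u \<zero>\<^bsub>N\<^esub> = \<zero>\<^bsub>N'\<^esub>"
    by (rule linear_maps_zero[OF _ _ ul]) unfold_locales
  have yc: "y \<in> carrier N'" using N'.gpart_carrier g y by blast
  then obtain x where x: "x \<in> carrier N" "u x = y" using surj by (metis imageE)
  obtain c where c: "is_decomposition G N x c"
    using N.grading x(1) unfolding is_grading_def by blast
  then have cg: "c h \<in> gpart N h" if "h \<in> G" for h
    using that by (simp add: is_decomposition_def)
  have c0: "c h = \<zero>\<^bsub>N\<^esub>" if "h \<notin> G" for h
    using c that by (simp add: is_decomposition_def)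
  have fin: "finite {h. c h \<noteq> \<zero>\<^bsub>N\<^esub>}" and xs: "x = (\<Oplus>\<^bsub>N\<^esub>h\<in>{h. c h \<noteq> \<zero>\<^bsub>N\<^esub>}. c h)"
    using c by (auto simp: is_decomposition_def)
  have cc: "c h \<in> carrier N" for h
    using N.gpart_carrier[OF _ cg] c0 by (cases "h \<in> G") auto
  have "is_decomposition G N' y (\<lambda>h. u (c h))"
  proof -
    have sub: "{h. u (c h) \<noteq> \<zero>\<^bsub>N'\<^esub>} \<subseteq> {h. c h \<noteq> \<zero>\<^bsub>N\<^esub>}" using u0 by auto
    have "y = (\<Oplus>\<^bsub>N'\<^esub>h\<in>{h. c h \<noteq> \<zero>\<^bsub>N\<^esub>}. u (c h))"
      using linear_maps_finsum[OF N.M.abelian_group_axioms N'.M.abelian_group_axioms ul fin, of c]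
        cc x(2) xs by auto
    also have "\<dots> = (\<Oplus>\<^bsub>N'\<^esub>h\<in>{h. u (c h) \<noteq> \<zero>\<^bsub>N'\<^esub>}. u (c h))"
      by (rule N'.M.add.finprod_mono_neutral_cong)
        (use fin sub cc linear_mapsD(1)[OF ul] in \<open>auto intro: finite_subset\<close>)
    finally show ?thesis
      using sub fin cg c0 u0 graded_mapsD(2)[OF u]
      by (auto simp: is_decomposition_def intro: finite_subset)
  qed
  moreover have "is_decomposition G N' y (\<lambda>h. if h = g then y else \<zero>\<^bsub>N'\<^esub>)"
  proof -
    have "y = (\<Oplus>\<^bsub>N'\<^esub>h\<in>{g}. if h = g then y else \<zero>\<^bsub>N'\<^esub>)" using yc by simp
    also have "\<dots> = (\<Oplus>\<^bsub>N'\<^esub>h\<in>{h. (if h = g then y else \<zero>\<^bsub>N'\<^esub>) \<noteq> \<zero>\<^bsub>N'\<^esub>}. if h = g then y else \<zero>\<^bsub>N'\<^esub>)"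
      by (rule N'.M.add.finprod_mono_neutral_cong)
        (use yc in \<open>auto intro: finite_subset[of _ "{g}"]\<close>)
    finally show ?thesis
      using g y N'.gpart_zero by (auto simp: is_decomposition_def intro: finite_subset[of _ "{g}"])
  qed
  ultimately have "(\<lambda>h. u (c h)) = (\<lambda>h. if h = g then y else \<zero>\<^bsub>N'\<^esub>)"
    using N'.grading yc unfolding is_grading_def by blast
  then have "u (c g) = y" by (metis (full_types))
  then show ?thesis using cg[OF g] by blast
qed

definition free_cover ::
  "real set \<Rightarrow> ('k, 'r) gmodule \<Rightarrow> ('r, 'p) gmodule \<Rightarrow> ('r, real \<times> 'p \<Rightarrow> 'r) gmodule"
  where "free_cover G \<Lambda> P =
    (let B = {(g, p). g \<in> G \<and> p \<in> gpart P g}; F = free_module \<Lambda> B in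
     \<lparr>carrier = carrier F, mult = undefined, one = undefined,
      zero = zero F, add = add F, smult = smult F,
      gpart = (\<lambda>h. {c \<in> carrier F. \<forall>q\<in>B. c q \<in> gpart \<Lambda> (h - fst q)})\<rparr>)"

locale graded_ring = R?: ring R for G :: "real set" and R :: "('k, 'r) gmodule" (structure) +
  assumes zero_in: "0 \<in> G"
    and diff_in: "\<lbrakk>g \<in> G; h \<in> G\<rbrakk> \<Longrightarrow> g - h \<in> G"
    and grading: "is_grading G R"
    and mult_gpart: "\<lbrakk>g \<in> G; h \<in> G; a \<in> gpart R g; b \<in> gpart R h\<rbrakk> \<Longrightarrow> a \<otimes> b \<in> gpart R (g + h)"
    and one_gpart: "\<one> \<in> gpart R 0"
begin

lemma plus_in: "\<lbrakk>g \<in> G; h \<in> G\<rbrakk> \<Longrightarrow> g + h \<in> G"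
  using diff_in[of g "0 - h"] diff_in[of 0 h] zero_in by simp

lemma gpart_subgroup: "g \<in> G \<Longrightarrow> additive_subgroup (gpart R g) R"
  using grading by (simp add: is_grading_def)

lemma gpart_zero: "g \<in> G \<Longrightarrow> \<zero> \<in> gpart R g"
  using additive_subgroup.zero_closed[OF gpart_subgroup] by blast

end

lemma (in abelian_group) finsum_fun:
  assumes "finite A" "\<And>i. i \<in> A \<Longrightarrow> a i \<in> carrier F" "abelian_group F"
    and "\<And>c. c \<in> carrier F \<Longrightarrow> c q \<in> carrier G"
    and "\<And>c c'. (c \<oplus>\<^bsub>F\<^esub> c') q = c q \<oplus> c' q" and "\<zero>\<^bsub>F\<^esub> q = \<zero>"
  shows "(finsum F a A) q = (\<Oplus>i\<in>A. a i q)"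
proof -
  interpret F: abelian_group F by fact
  show ?thesis
    using assms(1,2)
  proof (induction A rule: finite_induct)
    case empty
    then show ?case using assms(6) by simp
  next
    case (insert i A)
    then have "finsum F a (insert i A) = a i \<oplus>\<^bsub>F\<^esub> finsum F a A"
      by (intro F.finsum_insert) auto
    moreover from insert have "(\<Oplus>i\<in>insert i A. a i q) = a i q \<oplus> (\<Oplus>i\<in>A. a i q)"
      using assms(4) by (intro finsum_insert) auto
    ultimately show ?case using insert assms(5) by simp
  qed
qed

lemma free_cover_graded:
  assumes "graded_ring G \<Lambda>" "graded_left_module G \<Lambda> P"
  shows "graded_left_module G \<Lambda> (free_cover G \<Lambda> P)"
proof -
  interpret \<Lambda>: graded_ring G \<Lambda> by fact
  interpret P: graded_left_module G \<Lambda> P by fact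
  define B where "B = {(g, p). g \<in> G \<and> p \<in> gpart P g}"
  define F where "F = free_module \<Lambda> B"
  define C where "C = free_cover G \<Lambda> P"
  have sel [simp]: "carrier C = carrier F" "\<zero>\<^bsub>C\<^esub> = (\<lambda>t. \<zero>\<^bsub>\<Lambda>\<^esub>)"
    "c \<oplus>\<^bsub>C\<^esub> c' = (\<lambda>t. c t \<oplus>\<^bsub>\<Lambda>\<^esub> c' t)" "r \<odot>\<^bsub>C\<^esub> c = (\<lambda>t. r \<otimes>\<^bsub>\<Lambda>\<^esub> c t)"
    "gpart C h = {c \<in> carrier F. \<forall>q\<in>B. c q \<in> gpart \<Lambda> (h - fst q)}" for c c' r h
    by (simp_all add: C_def free_cover_def Let_def F_def B_def)
  interpret F: left_module \<Lambda> F
    unfolding F_def by (rule free_left_module) (rule \<Lambda>.ring_axioms)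
  have Fs [simp]: "\<zero>\<^bsub>F\<^esub> = (\<lambda>t. \<zero>\<^bsub>\<Lambda>\<^esub>)" "c \<oplus>\<^bsub>F\<^esub> c' = (\<lambda>t. c t \<oplus>\<^bsub>\<Lambda>\<^esub> c' t)"
    "r \<odot>\<^bsub>F\<^esub> c = (\<lambda>t. r \<otimes>\<^bsub>\<Lambda>\<^esub> c t)" for c c' r
    by (simp_all add: F_def)
  have BG: "fst q \<in> G" if "q \<in> B" for q using that by (auto simp: B_def)
  have Cgrp: "abelian_group C"
  proof (rule abelian_groupI)
    fix c assume "c \<in> carrier C"
    then have "\<ominus>\<^bsub>F\<^esub> c \<in> carrier F" "\<ominus>\<^bsub>F\<^esub> c \<oplus>\<^bsub>F\<^esub> c = \<zero>\<^bsub>F\<^esub>"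
      using F.M.a_inv_closed F.M.l_neg by simp_all
    then show "\<exists>c'\<in>carrier C. c' \<oplus>\<^bsub>C\<^esub> c = \<zero>\<^bsub>C\<^esub>" by auto
  next
    fix x y z assume "x \<in> carrier C" "y \<in> carrier C" "z \<in> carrier C"
    then show "x \<oplus>\<^bsub>C\<^esub> y \<oplus>\<^bsub>C\<^esub> z = x \<oplus>\<^bsub>C\<^esub> (y \<oplus>\<^bsub>C\<^esub> z)"
      using F.M.a_assoc[of x y z] by simp
  next
    fix x y assume "x \<in> carrier C" "y \<in> carrier C"
    then show "x \<oplus>\<^bsub>C\<^esub> y = y \<oplus>\<^bsub>C\<^esub> x" "x \<oplus>\<^bsub>C\<^esub> y \<in> carrier C"
      using F.M.a_comm[of x y] F.M.a_closed[of x y] by simp_all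
  next
    fix x assume "x \<in> carrier C"
    then show "\<zero>\<^bsub>C\<^esub> \<oplus>\<^bsub>C\<^esub> x = x" using F.M.l_zero[of x] by simp
  qed (use F.M.zero_closed in simp)
  interpret C: left_module \<Lambda> C
  proof (intro left_module.intro left_module_axioms.intro)
    show "ring \<Lambda>" by (rule \<Lambda>.ring_axioms)
    show "abelian_group C" by (rule Cgrp)
  qed (use F.smult_closed F.smult_l_distr F.smult_r_distr F.smult_assoc1 F.smult_one in auto)
  have Fc: "c t \<in> carrier \<Lambda>" "t \<notin> B \<Longrightarrow> c t = \<zero>\<^bsub>\<Lambda>\<^esub>" "finite {t. c t \<noteq> \<zero>\<^bsub>\<Lambda>\<^esub>}"
    if "c \<in> carrier F" for c t
    using that unfolding F_def free_module_carrier by blast+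
  have fs: "(finsum C a A) q = (\<Oplus>\<^bsub>\<Lambda>\<^esub>i\<in>A. a i q)"
    if "finite A" "\<And>i. i \<in> A \<Longrightarrow> a i \<in> carrier F" for A :: "real set" and a q
    by (rule \<Lambda>.finsum_fun) (use that Cgrp Fc in auto)
  have sub: "additive_subgroup (gpart C h) C" if "h \<in> G" for h
  proof -
    have "c t \<oplus>\<^bsub>\<Lambda>\<^esub> c' t \<in> gpart \<Lambda> (h - fst t)"
      if "c \<in> gpart C h" "c' \<in> gpart C h" "t \<in> B" for c c' t
      using that additive_subgroup.a_closed[OF \<Lambda>.gpart_subgroup] \<Lambda>.diff_in \<open>h \<in> G\<close> BG by auto
    moreover have "(\<ominus>\<^bsub>C\<^esub> c) \<in> gpart C h" if c: "c \<in> gpart C h" for c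
    proof -
      have cF: "c \<in> carrier C" using c by simp
      then have "\<ominus>\<^bsub>C\<^esub> c \<in> carrier C" by (rule C.M.a_inv_closed)
      moreover have "(\<ominus>\<^bsub>C\<^esub> c) t = \<ominus>\<^bsub>\<Lambda>\<^esub> c t" for t
      proof -
        have "\<ominus>\<^bsub>C\<^esub> c \<oplus>\<^bsub>C\<^esub> c = \<zero>\<^bsub>C\<^esub>" using cF by (rule C.M.l_neg)
        then have "(\<ominus>\<^bsub>C\<^esub> c) t \<oplus>\<^bsub>\<Lambda>\<^esub> c t = \<zero>\<^bsub>\<Lambda>\<^esub>" by (simp only: sel fun_eq_iff)
        then show ?thesis
          using Fc(1) \<open>\<ominus>\<^bsub>C\<^esub> c \<in> carrier C\<close> cF by (simp add: \<Lambda>.minus_equality)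
      qed
      ultimately show ?thesis
        using c BG \<Lambda>.diff_in \<open>h \<in> G\<close> additive_subgroup.a_inv_closed[OF \<Lambda>.gpart_subgroup] by auto
    qed
    moreover have "\<zero>\<^bsub>C\<^esub> \<in> gpart C h"
      using F.M.zero_closed \<Lambda>.gpart_zero \<Lambda>.diff_in \<open>h \<in> G\<close> BG by auto
    ultimately show ?thesis
      using F.M.a_closed
      by (intro additive_subgroup.intro subgroup.intro) (auto simp: a_inv_def)
  qed
  have dec: "\<exists>!D. is_decomposition G C c D" if c: "c \<in> carrier C" for c
  proof -
    have cF: "c \<in> carrier F" using c by simp
    have "\<forall>q. \<exists>!e. is_decomposition G \<Lambda> (c q) e"
      using \<Lambda>.grading Fc(1)[OF cF] by (simp add: is_grading_def)
    then obtain e where e: "\<And>q. is_decomposition G \<Lambda> (c q) (e q)"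
      and eu: "\<And>q e'. is_decomposition G \<Lambda> (c q) e' \<Longrightarrow> e' = e q"
      unfolding Ex1_def by metis

    have e1: "e q g \<in> gpart \<Lambda> g" if "g \<in> G" for q g using e that by (simp add: is_decomposition_def)
    have e2: "e q g = \<zero>\<^bsub>\<Lambda>\<^esub>" if "g \<notin> G" for q g using e that by (simp add: is_decomposition_def)
    have e3: "finite {g. e q g \<noteq> \<zero>\<^bsub>\<Lambda>\<^esub>}" "c q = (\<Oplus>\<^bsub>\<Lambda>\<^esub>g\<in>{g. e q g \<noteq> \<zero>\<^bsub>\<Lambda>\<^esub>}. e q g)" for q
      using e[of q] unfolding is_decomposition_def by blast+
    have ec: "e q g \<in> carrier \<Lambda>" for q g
    proof (cases "g \<in> G")
      case True
      then show ?thesis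
        using e1[OF True, of q] additive_subgroup.a_subset[OF \<Lambda>.gpart_subgroup[OF True]] by blast
    qed (simp add: e2)
    have e0: "e q g = \<zero>\<^bsub>\<Lambda>\<^esub>" if "c q = \<zero>\<^bsub>\<Lambda>\<^esub>" for q g
    proof -
      have dz: "is_decomposition G \<Lambda> (c q) (\<lambda>g. \<zero>\<^bsub>\<Lambda>\<^esub>)"
        using that \<Lambda>.gpart_zero by (simp add: is_decomposition_def)
      show ?thesis using fun_cong[OF eu[OF dz], of g] by simp
    qed
    define D where "D = (\<lambda>h q. e q (h - fst q))"
    define S where "S = (\<Union>q\<in>{q. c q \<noteq> \<zero>\<^bsub>\<Lambda>\<^esub>}. (\<lambda>g. g + fst q) ` {g. e q g \<noteq> \<zero>\<^bsub>\<Lambda>\<^esub>})"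
    have D_nz: "c q \<noteq> \<zero>\<^bsub>\<Lambda>\<^esub>" "h \<in> (\<lambda>g. g + fst q) ` {g. e q g \<noteq> \<zero>\<^bsub>\<Lambda>\<^esub>}" "h \<in> S" if "D h q \<noteq> \<zero>\<^bsub>\<Lambda>\<^esub>" for h q
    proof -
      show 1: "c q \<noteq> \<zero>\<^bsub>\<Lambda>\<^esub>" using that e0[of q "h - fst q"] unfolding D_def by blast
      show 2: "h \<in> (\<lambda>g. g + fst q) ` {g. e q g \<noteq> \<zero>\<^bsub>\<Lambda>\<^esub>}"
        using that by (intro image_eqI[of _ _ "h - fst q"]) (auto simp: D_def)
      show "h \<in> S" using 1 2 unfolding S_def by blast
    qed
    have Sfin: "finite S" unfolding S_def using Fc(3)[OF cF] e3(1) by blast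
    have Dc: "D h \<in> carrier F" for h
    proof -
      have "{q. D h q \<noteq> \<zero>\<^bsub>\<Lambda>\<^esub>} \<subseteq> {q. c q \<noteq> \<zero>\<^bsub>\<Lambda>\<^esub>}" using D_nz(1) by blast
      moreover have "D h q = \<zero>\<^bsub>\<Lambda>\<^esub>" if "q \<notin> B" for q using D_nz(1) Fc(2)[OF cF that] by blast
      ultimately show ?thesis
        using ec Fc(3)[OF cF] by (auto simp: F_def free_module_carrier D_def intro: finite_subset)
    qed
    have shift_sum: "(\<Oplus>\<^bsub>\<Lambda>\<^esub>h\<in>(\<lambda>g. g + b) ` A. f (h - b)) = (\<Oplus>\<^bsub>\<Lambda>\<^esub>g\<in>A. f g)"
      if "f \<in> A \<rightarrow> carrier \<Lambda>" for f A and b :: real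
      by (subst \<Lambda>.add.finprod_reindex) (use that in \<open>auto simp: inj_on_def\<close>)
    have dD: "is_decomposition G C c D"
    proof -
      have DG: "D h = \<zero>\<^bsub>C\<^esub>" if "h \<notin> G" for h
      proof -
        have "D h q = \<zero>\<^bsub>\<Lambda>\<^esub>" for q
        proof (cases "q \<in> B")
          case True
          then have "h - fst q \<notin> G" using \<Lambda>.plus_in[of "h - fst q" "fst q"] BG that by auto
          then show ?thesis using e2 by (simp add: D_def)
        next
          case False
          then show ?thesis using D_nz(1) Fc(2)[OF cF] by blast
        qed
        then show ?thesis by auto
      qed
      have fin: "{h. D h \<noteq> \<zero>\<^bsub>C\<^esub>} \<subseteq> S" using D_nz(3) by (auto simp: fun_eq_iff)
      have "c = finsum C D S"
      proof
        fix q
        have "(finsum C D S) q = (\<Oplus>\<^bsub>\<Lambda>\<^esub>h\<in>S. D h q)" by (rule fs) (use Sfin Dc in auto)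
        also have "\<dots> = (\<Oplus>\<^bsub>\<Lambda>\<^esub>h\<in>(\<lambda>g. g + fst q) ` {g. e q g \<noteq> \<zero>\<^bsub>\<Lambda>\<^esub>}. D h q)"
        proof (cases "c q = \<zero>\<^bsub>\<Lambda>\<^esub>")
          case True
          then have "D h q = \<zero>\<^bsub>\<Lambda>\<^esub>" for h using D_nz(1) by blast
          then show ?thesis by simp
        next
          case False
          then have "(\<lambda>g. g + fst q) ` {g. e q g \<noteq> \<zero>\<^bsub>\<Lambda>\<^esub>} \<subseteq> S" unfolding S_def by blast
          moreover have "D h q \<in> carrier \<Lambda>" for h using ec by (simp add: D_def)
          ultimately show ?thesis
            by (intro \<Lambda>.add.finprod_mono_neutral_cong[symmetric] Sfin finite_imageI e3(1))
              (use D_nz(2) in blast)+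
        qed
        also have "\<dots> = c q" unfolding D_def
          by (subst shift_sum) (use ec e3(2)[of q] in auto)
        finally show "c q = (finsum C D S) q" ..
      qed
      also have "\<dots> = finsum C D {h. D h \<noteq> \<zero>\<^bsub>C\<^esub>}"
        by (rule C.M.add.finprod_mono_neutral_cong)
          (use Sfin fin Dc in \<open>auto intro: finite_subset\<close>)
      finally show ?thesis
        using DG finite_subset[OF fin Sfin] Dc e1 \<Lambda>.diff_in BG
        unfolding is_decomposition_def by (auto simp: D_def)
    qed
    moreover have "D' = D" if D': "is_decomposition G C c D'" for D'
    proof (intro ext)
      fix h q
      have 1: "D' h \<in> gpart C h" if "h \<in> G" for h using D' that unfolding is_decomposition_def by blast
      have 2: "D' h = \<zero>\<^bsub>C\<^esub>" if "h \<notin> G" for h using D' that unfolding is_decomposition_def by blast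
      have 3: "finite {h. D' h \<noteq> \<zero>\<^bsub>C\<^esub>}" "c = finsum C D' {h. D' h \<noteq> \<zero>\<^bsub>C\<^esub>}"
        using D' unfolding is_decomposition_def by blast+
      have 4: "D' h \<in> carrier F" for h using 1[of h] 2[of h] F.M.zero_closed by (cases "h \<in> G") auto
      show "D' h q = D h q"
      proof (cases "q \<in> B")
        case True
        note q = BG[OF True]
        have dD': "is_decomposition G \<Lambda> (c q) (\<lambda>g. D' (g + fst q) q)"
        proof -
          let ?A = "{h. D' h \<noteq> \<zero>\<^bsub>C\<^esub>}"
          let ?E = "{g. D' (g + fst q) q \<noteq> \<zero>\<^bsub>\<Lambda>\<^esub>}"
          have A: "(\<lambda>g. g + fst q) ` ?E \<subseteq> ?A" by auto
          have fE: "finite ?E"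
            by (rule finite_imageD[OF finite_subset[OF A 3(1)]]) (auto simp: inj_on_def)
          have "c q = (finsum C D' ?A) q" using 3(2) by simp
          also have "\<dots> = (\<Oplus>\<^bsub>\<Lambda>\<^esub>h\<in>?A. D' h q)" by (rule fs) (use 3 4 in auto)
          also have "\<dots> = (\<Oplus>\<^bsub>\<Lambda>\<^esub>h\<in>(\<lambda>g. g + fst q) ` ?E. D' h q)"
          proof (rule \<Lambda>.add.finprod_mono_neutral_cong[OF finite_imageI[OF fE] 3(1)])
            fix h assume "h \<in> ?A - (\<lambda>g. g + fst q) ` ?E"
            then have "h - fst q \<notin> ?E" using image_eqI[of h "\<lambda>g. g + fst q" "h - fst q" ?E] by fastforce
            then show "D' h q = \<zero>\<^bsub>\<Lambda>\<^esub>" by simp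
          qed (use A Fc(1)[OF 4] in auto)
          also have "\<dots> = (\<Oplus>\<^bsub>\<Lambda>\<^esub>g\<in>?E. D' (g + fst q) q)"
            using shift_sum[of "\<lambda>g. D' (g + fst q) q" ?E "fst q"] Fc(1)[OF 4] by simp
          finally have "c q = (\<Oplus>\<^bsub>\<Lambda>\<^esub>g\<in>?E. D' (g + fst q) q)" .
          moreover have "D' (g + fst q) q \<in> gpart \<Lambda> g" if "g \<in> G" for g
            using 1[OF \<Lambda>.plus_in[OF that q]] True by auto
          moreover have "D' (g + fst q) q = \<zero>\<^bsub>\<Lambda>\<^esub>" if "g \<notin> G" for g
          proof -
            have "g + fst q \<notin> G" using \<Lambda>.diff_in[of "g + fst q" "fst q"] q that by auto
            from fun_cong[OF 2[OF this], of q] show ?thesis by simp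
          qed
          ultimately show ?thesis using fE by (simp add: is_decomposition_def)
        qed
        have "e q (h - fst q) = D' (h - fst q + fst q) q"
          using fun_cong[OF eu[OF dD'], of "h - fst q"] by simp
        then show ?thesis by (simp add: D_def)
      next
        case False
        then show ?thesis using Fc(2)[OF 4] Fc(2)[OF Dc] by simp
      qed
    qed
    ultimately show ?thesis by blast
  qed
  have "graded_left_module G \<Lambda> C"
  proof (intro graded_left_module.intro graded_left_module_axioms.intro)
    show "left_module \<Lambda> C" by unfold_locales
    show "is_grading G C" using sub dec by (simp add: is_grading_def del: sel)
    show "a \<odot>\<^bsub>C\<^esub> c \<in> gpart C (g + h)"
      if "g \<in> G" "h \<in> G" "a \<in> gpart \<Lambda> g" "c \<in> gpart C h" for g h a c
    proof -
      have "a \<in> carrier \<Lambda>"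
        using additive_subgroup.a_subset[OF \<Lambda>.gpart_subgroup] that by blast
      moreover have "a \<otimes>\<^bsub>\<Lambda>\<^esub> c q \<in> gpart \<Lambda> (g + h - fst q)" if q: "q \<in> B" for q
        using \<Lambda>.mult_gpart[of g "h - fst q" a "c q"] \<open>c \<in> gpart C h\<close> q BG \<Lambda>.diff_in that(1)
          \<open>g \<in> G\<close> \<open>h \<in> G\<close> \<open>a \<in> gpart \<Lambda> g\<close> by (simp add: add_diff_eq)
      ultimately show ?thesis using that(4) F.smult_closed[of a c] by simp
    qed
  qed
  then show ?thesis by (simp add: C_def)
qed

lemma free_cover_lin_ext:
  assumes "graded_ring G \<Lambda>" "graded_left_module G \<Lambda> P" "graded_left_module G \<Lambda> N"
    and "\<And>g p. \<lbrakk>g \<in> G; p \<in> gpart P g\<rbrakk> \<Longrightarrow> \<nu> (g, p) \<in> gpart N g"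
  shows "(\<lambda>c\<in>carrier (free_cover G \<Lambda> P). lin_ext \<Lambda> N \<nu> c) \<in> graded_maps G \<Lambda> (free_cover G \<Lambda> P) N"
proof -
  interpret \<Lambda>: graded_ring G \<Lambda> by fact
  interpret N: graded_left_module G \<Lambda> N by fact
  define B where "B = {(g, p). g \<in> G \<and> p \<in> gpart P g}"
  have B: "fst q \<in> G" "\<nu> q \<in> gpart N (fst q)" if "q \<in> B" for q
    using that assms(4) by (auto simp: B_def)
  have \<nu>: "\<nu> \<in> B \<rightarrow> carrier N" using B N.gpart_carrier by blast
  have lin: "(\<lambda>c\<in>carrier (free_module \<Lambda> B). lin_ext \<Lambda> N \<nu> c) \<in> linear_maps \<Lambda> (free_module \<Lambda> B) N"
    by (rule lin_ext_linear[OF _ \<nu>]) unfold_locales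
  have "lin_ext \<Lambda> N \<nu> c \<in> gpart N h"
    if "h \<in> G" "c \<in> carrier (free_module \<Lambda> B)" "\<And>q. q \<in> B \<Longrightarrow> c q \<in> gpart \<Lambda> (h - fst q)" for c h
    unfolding lin_ext_def
  proof (rule N.gpart_finsum[OF that(1)])
    show "finite {t. c t \<noteq> \<zero>\<^bsub>\<Lambda>\<^esub>}" using that(2) by (simp add: free_module_carrier)
    fix q assume "q \<in> {t. c t \<noteq> \<zero>\<^bsub>\<Lambda>\<^esub>}"
    then have "q \<in> B" using that(2) unfolding free_module_carrier by blast
    then show "c q \<odot>\<^bsub>N\<^esub> \<nu> q \<in> gpart N h"
      using N.smult_gpart[of "h - fst q" "fst q" "c q" "\<nu> q"] B[OF \<open>q \<in> B\<close>] that \<Lambda>.diff_in by simp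
  qed
  then show ?thesis
    using lin by (auto simp: graded_maps_def linear_maps_def free_cover_def Let_def B_def)
qed

theorem graded_projective_lifting:
  assumes "graded_ring G \<Lambda>" and proj: "graded_projective G \<Lambda> P"
    and N: "graded_left_module G \<Lambda> N" and N': "graded_left_module G \<Lambda> N'"
    and u: "u \<in> graded_maps G \<Lambda> N N'" "u ` carrier N = carrier N'"
    and f: "f \<in> graded_maps G \<Lambda> P N'"
  shows "\<exists>h \<in> graded_maps G \<Lambda> P N. \<forall>x\<in>carrier P. u (h x) = f x"
proof -
  interpret \<Lambda>: graded_ring G \<Lambda> by fact
  have Pg: "graded_left_module G \<Lambda> P" using proj by (simp add: graded_projective_def)
  interpret P: graded_left_module G \<Lambda> P by fact
  interpret N: graded_left_module G \<Lambda> N by fact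
  interpret N': graded_left_module G \<Lambda> N' by fact
  define B where "B = {(g, p). g \<in> G \<and> p \<in> gpart P g}"
  define C where "C = free_cover G \<Lambda> P"
  have Cc: "carrier C = carrier (free_module \<Lambda> B)"
    by (simp add: C_def free_cover_def Let_def B_def)
  have Cgr: "graded_left_module G \<Lambda> C"
    unfolding C_def by (rule free_cover_graded) fact+
  interpret C: graded_left_module G \<Lambda> C by (rule Cgr)
  have sndB: "snd \<in> B \<rightarrow> carrier P" using P.gpart_carrier by (auto simp: B_def)
  define p where "p = (\<lambda>c\<in>carrier C. lin_ext \<Lambda> P snd c)"
  have p: "p \<in> graded_maps G \<Lambda> C P"
    unfolding p_def C_def by (rule free_cover_lin_ext) (use assms(1) Pg in auto)
  have surj: "p ` carrier C = carrier P"
  proof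
    show "p ` carrier C \<subseteq> carrier P" using linear_mapsD(1)[OF graded_mapsD(1)[OF p]] by blast
    show "carrier P \<subseteq> p ` carrier C"
    proof
      fix x assume "x \<in> carrier P"
      then obtain c where c: "is_decomposition G P x c"
        using P.grading unfolding is_grading_def by blast
      let ?A = "{g. c g \<noteq> \<zero>\<^bsub>P\<^esub>}"
      have A: "(g, c g) \<in> B" if "g \<in> ?A" for g
        using c that unfolding is_decomposition_def B_def by blast
      have bc: "basis_vec \<Lambda> (g, c g) \<in> carrier C" if "g \<in> ?A" for g
        unfolding Cc by (rule basis_vec_in_free_module[OF \<Lambda>.ring_axioms A[OF that]])
      have cc: "c g \<in> carrier P" if "g \<in> ?A" for g using A[OF that] sndB by (auto dest: funcset_mem)
      have fin: "finite ?A" and x: "x = finsum P c ?A" using c by (auto simp: is_decomposition_def)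
      have "p (\<Oplus>\<^bsub>C\<^esub>g\<in>?A. basis_vec \<Lambda> (g, c g)) = (\<Oplus>\<^bsub>P\<^esub>g\<in>?A. p (basis_vec \<Lambda> (g, c g)))"
        by (rule linear_maps_finsum[OF C.M.abelian_group_axioms P.M.abelian_group_axioms
              graded_mapsD(1)[OF p] fin]) (use bc in auto)
      also have "\<dots> = x" unfolding x
      proof (rule P.M.finsum_cong')
        fix g assume g: "g \<in> ?A"
        have "lin_ext \<Lambda> P snd (basis_vec \<Lambda> (g, c g)) = snd (g, c g)"
          by (rule lin_ext_basis_vec) (use cc[OF g] P.left_module_axioms in auto)
        then show "p (basis_vec \<Lambda> (g, c g)) = c g" using bc[OF g] by (simp add: p_def)
      qed (use cc in auto)
      finally show "x \<in> p ` carrier C"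
        using C.M.finsum_closed[of "\<lambda>g. basis_vec \<Lambda> (g, c g)" ?A] bc by (metis (no_types, lifting) Pi_I image_eqI)
    qed
  qed
  have id: "(\<lambda>x\<in>carrier P. x) \<in> graded_maps G \<Lambda> P P"
    using P.gpart_carrier by (auto simp: graded_maps_def linear_maps_def)
  obtain s where s: "s \<in> graded_maps G \<Lambda> P C" "\<And>x. x \<in> carrier P \<Longrightarrow> p (s x) = x"
  proof -
    have "\<exists>h \<in> graded_maps G \<Lambda> P C. \<forall>x\<in>carrier P. p (h x) = (\<lambda>x\<in>carrier P. x) x"
      using proj[unfolded graded_projective_def, THEN conjunct2, rule_format, OF Cgr Pg p surj id] .
    then show ?thesis using that by auto
  qed
  have "\<forall>q\<in>B. \<exists>n\<in>gpart N (fst q). u n = f (snd q)"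
    using graded_surj_gpart[OF N N' u] graded_mapsD(2)[OF f] by (auto simp: B_def)
  then obtain \<nu> where \<nu>: "\<And>q. q \<in> B \<Longrightarrow> \<nu> q \<in> gpart N (fst q) \<and> u (\<nu> q) = f (snd q)" by metis
  define v where "v = (\<lambda>c\<in>carrier C. lin_ext \<Lambda> N \<nu> c)"
  have v: "v \<in> graded_maps G \<Lambda> C N"
    unfolding v_def C_def by (rule free_cover_lin_ext) (use assms(1) Pg N \<nu> in \<open>auto simp: B_def\<close>)
  have \<nu>B: "\<nu> \<in> B \<rightarrow> carrier N" using \<nu> N.gpart_carrier by (auto simp: B_def)
  have uv: "u (v c) = f (p c)" if c: "c \<in> carrier C" for c
  proof -
    have "u (v c) = lin_ext \<Lambda> N' (\<lambda>q. u (\<nu> q)) c"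
      using linear_maps_lin_ext[OF N.left_module_axioms N'.left_module_axioms graded_mapsD(1)[OF u(1)], of c B \<nu>]
        c \<nu>B by (simp add: v_def Cc)
    also have "\<dots> = lin_ext \<Lambda> N' (\<lambda>q. f (snd q)) c"
      by (rule lin_ext_cong[OF N'.left_module_axioms, of _ B])
        (use c sndB \<nu> linear_mapsD(1)[OF graded_mapsD(1)[OF f]] in \<open>auto simp: Cc\<close>)
    also have "\<dots> = f (p c)"
      using linear_maps_lin_ext[OF P.left_module_axioms N'.left_module_axioms graded_mapsD(1)[OF f], of c B snd]
        c sndB by (simp add: p_def Cc)
    finally show ?thesis .
  qed
  have "compose (carrier P) v s \<in> graded_maps G \<Lambda> P N"
    by (rule graded_maps_comp[OF s(1) v P.M.abelian_group_axioms]) (use P.gpart_carrier in auto)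
  moreover have "u (compose (carrier P) v s x) = f x" if "x \<in> carrier P" for x
    using that uv[of "s x"] s(2) linear_mapsD(1)[OF graded_mapsD(1)[OF s(1)]] by (simp add: compose_eq)
  ultimately show ?thesis by blast
qed

end

theory Submission
  imports Defs
begin

text \<open>
  The module \<open>S\<close> has a normalised bar resolution \<open>B\<close>: in degree \<open>n\<close> it is the direct sum, over the
  tuples \<open>(x\<^sub>0, \<dots>, x\<^sub>n)\<close> of points with \<open>x\<^sub>i \<noteq> x\<^sub>i\<^sub>+\<^sub>1\<close> and finite length, of shifts of the left
  ideals \<open>\<sigma>X \<cdot> (x\<^sub>0, x\<^sub>0)\<close>. These ideals are projective because \<open>(x\<^sub>0, x\<^sub>0)\<close> is idempotent, and the
  finiteness of \<open>X\<close> provides the unit of \<open>\<sigma>X\<close>.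
  Inserting a point on the left is a \<open>\<K>\<close>-linear contraction \<open>s\<close>. Every generator is of the form \<open>s c\<close>,
  so \<open>\<partial>s + s\<partial> = 1\<close> determines \<open>\<partial>\<close> recursively and yields both \<open>\<partial>\<partial> = 0\<close> and exactness.

  A morphism from \<open>B\<^sub>n\<close> to \<open>S[l]\<close> is determined by its values on the generators of degree \<open>l\<close>, that is,
  by a magnitude cochain \<open>\<phi>\<close> of length \<open>l\<close>. If \<open>\<phi>\<close> is a cocycle, then sending the generator
  \<open>(x\<^sub>0, \<dots>, x\<^sub>n\<^sub>+\<^sub>k)\<close> to \<open>\<phi>(x\<^sub>k, \<dots>, x\<^sub>n\<^sub>+\<^sub>k) \<cdot> (x\<^sub>0, \<dots>, x\<^sub>k)\<close> lifts the corresponding morphism to a chain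
  map, and composition with this lift is the product of magnitude cochains. The comparison theorem
  carries the Yoneda algebra from \<open>B\<close> to an arbitrary projective resolution.
\<close>

section \<open>Graded modules\<close>

text \<open>What makes the two complexes equal: \<open>S\<close> is \<open>K^X\<close> in degree 0,
  and every pair of positive degree acts on it by 0. A morphism to \<open>S[l]\<close> therefore
  sees only the generators of length \<open>l\<close>, each through the coordinate at its first
  point. In the boundary of a generator, the face deleting \<open>x_0\<close> carries the
  coefficient \<open>(x_0, x_1)\<close> and dies in \<open>S\<close>, and the face deleting the last
  point does not occur; for magnitude cochains both faces vanish because deleting an end point
  strictly shortens the tuple. The interior faces agree, since \<open>(x, y)(y, z)\<close> is
  \<open>(x, z)\<close> exactly if removing \<open>y\<close> preserves the length.

  As \<open>toHom\<close> is bijective on cochains, the facts that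
  \<open>\<delta>\<delta> = 0\<close>, that products of cocycles are cocycles, and that products of
  classes do not depend on representatives are carried over from the Yoneda side instead of being
  computed from simplicial identities and a Leibniz rule. The order of factors is preserved: the
  lift of \<open>\<phi>\<close> evaluates the end of a tuple and leaves its beginning to
  \<open>\<psi>\<close>.\<close>

context left_module
begin

lemma smult_r_null [simp]:
  assumes "a \<in> carrier R"
  shows "a \<odot>\<^bsub>M\<^esub> \<zero>\<^bsub>M\<^esub> = \<zero>\<^bsub>M\<^esub>"
proof -
  have "a \<odot>\<^bsub>M\<^esub> \<zero>\<^bsub>M\<^esub> \<oplus>\<^bsub>M\<^esub> a \<odot>\<^bsub>M\<^esub> \<zero>\<^bsub>M\<^esub> = a \<odot>\<^bsub>M\<^esub> \<zero>\<^bsub>M\<^esub>"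
    using smult_r_distr[of a "\<zero>\<^bsub>M\<^esub>" "\<zero>\<^bsub>M\<^esub>"] assms by simp
  then show ?thesis using assms by simp
qed

lemma smult_r_inv:
  assumes "a \<in> carrier R" "x \<in> carrier M"
  shows "a \<odot>\<^bsub>M\<^esub> (\<ominus>\<^bsub>M\<^esub> x) = \<ominus>\<^bsub>M\<^esub> (a \<odot>\<^bsub>M\<^esub> x)"
proof -
  have "a \<odot>\<^bsub>M\<^esub> (\<ominus>\<^bsub>M\<^esub> x) \<oplus>\<^bsub>M\<^esub> a \<odot>\<^bsub>M\<^esub> x = \<zero>\<^bsub>M\<^esub>"
    using smult_r_distr[of a "\<ominus>\<^bsub>M\<^esub> x" x] assms by (simp add: M.l_neg)
  then show ?thesis using assms by (simp add: M.minus_equality)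
qed

text \<open>The candidate \<open>N\<close> is described by its fields, so that the same lemma serves
  shifts, images, modules of cocycles and the bar modules.\<close>

lemma submodule:
  assumes "additive_subgroup H M" "\<And>r x. \<lbrakk>r \<in> carrier R; x \<in> H\<rbrakk> \<Longrightarrow> r \<odot>\<^bsub>M\<^esub> x \<in> H"
    and N: "carrier N = H" "zero N = zero M" "add N = add M" "smult N = smult M"
  shows "left_module R N"
proof -
  interpret H: additive_subgroup H M by fact
  have grp: "abelian_group N"
  proof (rule abelian_groupI)
    fix x assume "x \<in> carrier N"
    then show "\<exists>y\<in>carrier N. y \<oplus>\<^bsub>N\<^esub> x = \<zero>\<^bsub>N\<^esub>"
      using H.a_inv_closed[of x] H.a_subset by (auto simp: N M.l_neg subset_iff intro!: bexI[of _ "\<ominus>\<^bsub>M\<^esub> x"])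
  qed (use H.a_subset in \<open>auto simp: N M.a_assoc subset_iff M.a_comm M.a_lcomm\<close>)
  show ?thesis
    by (intro left_module.intro left_module_axioms.intro grp)
      (use assms(2) H.a_subset in \<open>auto simp: N smult_l_distr smult_r_distr smult_assoc1 subset_iff
        intro: R.ring_axioms\<close>)
qed

end

text \<open>Stated for additive maps because it is applied to coefficient functionals with values in
  \<open>\<K>\<close>, which are not linear over \<open>\<Lambda>\<close>.\<close>

lemma additive_zero:
  assumes "abelian_group M" "abelian_group N"
    and "\<And>x. x \<in> carrier M \<Longrightarrow> f x \<in> carrier N"
    and "\<And>x y. \<lbrakk>x \<in> carrier M; y \<in> carrier M\<rbrakk> \<Longrightarrow> f (x \<oplus>\<^bsub>M\<^esub> y) = f x \<oplus>\<^bsub>N\<^esub> f y"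
  shows "f \<zero>\<^bsub>M\<^esub> = \<zero>\<^bsub>N\<^esub>"
proof -
  interpret M: abelian_group M by fact
  interpret N: abelian_group N by fact
  have "f \<zero>\<^bsub>M\<^esub> \<oplus>\<^bsub>N\<^esub> f \<zero>\<^bsub>M\<^esub> = f \<zero>\<^bsub>M\<^esub>"
    using assms(4)[of "\<zero>\<^bsub>M\<^esub>" "\<zero>\<^bsub>M\<^esub>"] by simp
  then show ?thesis using assms(3)[of "\<zero>\<^bsub>M\<^esub>"] by simp
qed

lemma additive_finsum:
  assumes "abelian_group M" "abelian_group N"
    and "\<And>x. x \<in> carrier M \<Longrightarrow> f x \<in> carrier N"
    and "\<And>x y. \<lbrakk>x \<in> carrier M; y \<in> carrier M\<rbrakk> \<Longrightarrow> f (x \<oplus>\<^bsub>M\<^esub> y) = f x \<oplus>\<^bsub>N\<^esub> f y"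
    and "finite A" "a \<in> A \<rightarrow> carrier M"
  shows "f (finsum M a A) = (\<Oplus>\<^bsub>N\<^esub>i\<in>A. f (a i))"
proof -
  interpret M: abelian_group M by fact
  interpret N: abelian_group N by fact
  show ?thesis
    using assms(5,6)
  proof (induction A rule: finite_induct)
    case empty
    then show ?case using additive_zero[OF assms(1-4)] by simp
  next
    case (insert i A)
    then have "finsum M a A \<in> carrier M" by (intro M.finsum_closed) auto
    with insert show ?case
      using assms(3,4) by (simp add: Pi_def)
  qed
qed

lemma linear_maps_inv:
  assumes "abelian_group M" "abelian_group N" "f \<in> linear_maps R M N" "x \<in> carrier M"
  shows "f (\<ominus>\<^bsub>M\<^esub> x) = \<ominus>\<^bsub>N\<^esub> f x"
proof -
  interpret M: abelian_group M by fact
  interpret N: abelian_group N by fact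
  have "f (\<ominus>\<^bsub>M\<^esub> x) \<oplus>\<^bsub>N\<^esub> f x = \<zero>\<^bsub>N\<^esub>"
    using linear_mapsD(2)[OF assms(3), of "\<ominus>\<^bsub>M\<^esub> x" x] assms(4) linear_maps_zero[OF assms(1-3)]
    by (simp add: M.l_neg)
  then show ?thesis
    using linear_mapsD(1)[OF assms(3)] assms(4) by (simp add: N.minus_equality)
qed

lemma linear_maps_minus:
  assumes "abelian_group M" "abelian_group N" "f \<in> linear_maps R M N" "x \<in> carrier M" "y \<in> carrier M"
  shows "f (x \<ominus>\<^bsub>M\<^esub> y) = f x \<ominus>\<^bsub>N\<^esub> f y"
proof -
  interpret M: abelian_group M by fact
  interpret N: abelian_group N by fact
  show ?thesis
    using linear_mapsD[OF assms(3)] linear_maps_inv[OF assms(1-3)] assms(4,5)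
    by (simp add: M.minus_eq N.minus_eq)
qed

text \<open>The gradings of \<open>\<Lambda>\<close>, of \<open>S\<close> and of the bar modules all
  have this shape: an element is known by its coefficients \<open>ev i\<close>, and every index
  \<open>i\<close> has a degree \<open>w i\<close>. The truncations of an element to the finitely
  many degrees in \<open>W\<close> add up to it, which gives existence of a decomposition;
  uniqueness holds because the coefficients of each component are forced.\<close>

lemma is_gradingI_support:
  assumes M: "abelian_group M" and K: "abelian_group K"
    and ev_closed: "\<And>i m. m \<in> carrier M \<Longrightarrow> ev i m \<in> carrier K"
    and ev_add: "\<And>i m m'. \<lbrakk>m \<in> carrier M; m' \<in> carrier M\<rbrakk> \<Longrightarrow> ev i (m \<oplus>\<^bsub>M\<^esub> m') = ev i m \<oplus>\<^bsub>K\<^esub> ev i m'"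
    and inj: "\<And>m m'. \<lbrakk>m \<in> carrier M; m' \<in> carrier M; \<And>i. ev i m = ev i m'\<rbrakk> \<Longrightarrow> m = m'"
    and part: "\<And>g. g \<in> G \<Longrightarrow> gpart M g = {m \<in> carrier M. \<forall>i. ev i m \<noteq> \<zero>\<^bsub>K\<^esub> \<longrightarrow> w i = g}"
    and trunc: "\<And>m g. m \<in> carrier M \<Longrightarrow>
      \<exists>m'\<in>carrier M. \<forall>i. ev i m' = (if w i = g then ev i m else \<zero>\<^bsub>K\<^esub>)"
    and fin: "\<And>m. m \<in> carrier M \<Longrightarrow> \<exists>W. finite W \<and> W \<subseteq> G \<and> (\<forall>i. ev i m \<noteq> \<zero>\<^bsub>K\<^esub> \<longrightarrow> w i \<in> W)"
  shows "is_grading G M"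
proof -
  interpret M: abelian_group M by fact
  interpret K: abelian_group K by fact
  have ev0: "ev i \<zero>\<^bsub>M\<^esub> = \<zero>\<^bsub>K\<^esub>" for i
    by (rule additive_zero[OF M K]) (use ev_closed ev_add in auto)
  have evinv: "ev i (\<ominus>\<^bsub>M\<^esub> m) = \<ominus>\<^bsub>K\<^esub> ev i m" if "m \<in> carrier M" for i m
  proof -
    have "ev i (\<ominus>\<^bsub>M\<^esub> m) \<oplus>\<^bsub>K\<^esub> ev i m = \<zero>\<^bsub>K\<^esub>"
      using ev_add[of "\<ominus>\<^bsub>M\<^esub> m" m i] that ev0 by (simp add: M.l_neg)
    then show ?thesis using that ev_closed by (simp add: K.minus_equality)
  qed
  have K0: "k = \<zero>\<^bsub>K\<^esub> \<Longrightarrow> \<ominus>\<^bsub>K\<^esub> k = \<zero>\<^bsub>K\<^esub>" for k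
    using K.minus_equality[of "\<zero>\<^bsub>K\<^esub>" "\<zero>\<^bsub>K\<^esub>"] by simp
  have evsum: "ev i (finsum M c A) = (\<Oplus>\<^bsub>K\<^esub>j\<in>A. ev i (c j))"
    if "finite A" "c \<in> A \<rightarrow> carrier M" for i A and c :: "real \<Rightarrow> _"
    by (rule additive_finsum[OF M K]) (use ev_closed ev_add that in auto)
  have sub: "additive_subgroup (gpart M g) M" if g: "g \<in> G" for g
  proof (intro additive_subgroup.intro subgroup.intro)
    fix x y assume "x \<in> gpart M g" "y \<in> gpart M g"
    then have x: "x \<in> carrier M" "\<And>i. w i \<noteq> g \<Longrightarrow> ev i x = \<zero>\<^bsub>K\<^esub>"
      and y: "y \<in> carrier M" "\<And>i. w i \<noteq> g \<Longrightarrow> ev i y = \<zero>\<^bsub>K\<^esub>"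
      unfolding part[OF g] by blast+
    then have "ev i (x \<oplus>\<^bsub>M\<^esub> y) = \<zero>\<^bsub>K\<^esub>" if "w i \<noteq> g" for i
      using that by (simp add: ev_add)
    then show "x \<otimes>\<^bsub>add_monoid M\<^esub> y \<in> gpart M g"
      using x(1) y(1) by (auto simp: part[OF g])
  next
    fix x assume "x \<in> gpart M g"
    then have "\<ominus>\<^bsub>M\<^esub> x \<in> gpart M g"
      unfolding part[OF g] mem_Collect_eq using evinv K0 M.a_inv_closed by metis
    then show "inv\<^bsub>add_monoid M\<^esub> x \<in> gpart M g" by (simp add: a_inv_def)

  qed (use g in \<open>auto simp: part ev0\<close>)
  have ex: "\<exists>c. is_decomposition G M m c" if m: "m \<in> carrier M" for m
  proof -
    obtain t where t: "\<And>g. t g \<in> carrier M" "\<And>g i. ev i (t g) = (if w i = g then ev i m else \<zero>\<^bsub>K\<^esub>)"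
      using trunc[OF m] by metis
    obtain W where W: "finite W" "W \<subseteq> G" "\<And>i. ev i m \<noteq> \<zero>\<^bsub>K\<^esub> \<Longrightarrow> w i \<in> W"
      using fin[OF m] by blast
    define c where "c = (\<lambda>g. if g \<in> W then t g else \<zero>\<^bsub>M\<^esub>)"
    have cc: "c g \<in> carrier M" for g using t(1) by (simp add: c_def)
    have "ev i (finsum M c W) = ev i m" for i
    proof -
      have "ev i (finsum M c W) = (\<Oplus>\<^bsub>K\<^esub>g\<in>W. if w i = g then ev i m else \<zero>\<^bsub>K\<^esub>)"
        using evsum[OF W(1), of c i] cc m ev_closed
        by (auto simp: c_def t intro!: K.finsum_cong')
      also have "\<dots> = ev i m"
      proof (cases "w i \<in> W")
        case True
        then show ?thesis
          using K.finsum_singleton[OF True W(1), of "\<lambda>_. ev i m"] ev_closed[OF m] by simp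
      next
        case False
        then have "(\<Oplus>\<^bsub>K\<^esub>g\<in>W. if w i = g then ev i m else \<zero>\<^bsub>K\<^esub>) = (\<Oplus>\<^bsub>K\<^esub>g\<in>W. \<zero>\<^bsub>K\<^esub>)"
          by (intro K.finsum_cong') auto
        moreover have "ev i m = \<zero>\<^bsub>K\<^esub>" using W(3)[of i] False by blast
        ultimately show ?thesis by (simp only: K.finsum_zero)
      qed
      finally show ?thesis .
    qed
    then have "m = finsum M c W" by (intro inj[OF m M.finsum_closed]) (simp_all add: cc)
    also have "\<dots> = finsum M c {g. c g \<noteq> \<zero>\<^bsub>M\<^esub>}"
      by (rule M.add.finprod_mono_neutral_cong)
        (use W cc in \<open>auto simp: c_def intro: finite_subset[of _ W]\<close>)
    finally have "m = finsum M c {g. c g \<noteq> \<zero>\<^bsub>M\<^esub>}" .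
    moreover have "c g \<in> gpart M g" if "g \<in> G" for g
      using that cc[of g] by (auto simp: part c_def t ev0 split: if_splits)
    moreover have "finite {g. c g \<noteq> \<zero>\<^bsub>M\<^esub>}"
      using W(1) by (rule finite_subset[rotated]) (auto simp: c_def)
    moreover have "\<forall>g. g \<notin> G \<longrightarrow> c g = \<zero>\<^bsub>M\<^esub>" using W(2) by (auto simp: c_def)
    ultimately show ?thesis unfolding is_decomposition_def by blast
  qed
  \<comment> \<open>Uniqueness: of all the components of a decomposition, only the one in degree
    \<open>w i\<close> can contribute to the coefficient at \<open>i\<close>. That degree is added
    to the index set of the sum, since the component there may be zero.\<close>
  have val: "ev i (c g) = (if w i = g then ev i m else \<zero>\<^bsub>K\<^esub>)"
    if c: "is_decomposition G M m c" and g: "g \<in> G" for m c g i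
  proof -
    let ?A = "{g. c g \<noteq> \<zero>\<^bsub>M\<^esub>}"
    have cg: "c h \<in> carrier M" "ev i (c h) \<noteq> \<zero>\<^bsub>K\<^esub> \<Longrightarrow> w i = h" for h i
    proof -
      have "c h \<in> carrier M \<and> (ev i (c h) \<noteq> \<zero>\<^bsub>K\<^esub> \<longrightarrow> w i = h)"
        using c part[of h] by (cases "h \<in> G") (auto simp: is_decomposition_def ev0)
      then show "c h \<in> carrier M" "ev i (c h) \<noteq> \<zero>\<^bsub>K\<^esub> \<Longrightarrow> w i = h" by auto
    qed
    have fA: "finite ?A" and m: "m = finsum M c ?A" using c by (auto simp: is_decomposition_def)
    have "ev i m = (\<Oplus>\<^bsub>K\<^esub>h\<in>?A. ev i (c h))" unfolding m using fA cg by (intro evsum) auto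
    also have "\<dots> = (\<Oplus>\<^bsub>K\<^esub>h\<in>insert (w i) ?A. ev i (c h))"
      by (rule K.add.finprod_mono_neutral_cong) (use fA cg(1) ev_closed ev0 in auto)
    also have "\<dots> = (\<Oplus>\<^bsub>K\<^esub>h\<in>insert (w i) ?A. if w i = h then ev i (c h) else \<zero>\<^bsub>K\<^esub>)"
      by (rule K.finsum_cong') (use cg ev_closed in auto)
    also have "\<dots> = ev i (c (w i))"
      by (rule K.finsum_singleton) (use fA cg ev_closed in auto)
    finally show ?thesis using cg(2)[of i g] by auto
  qed
  have un: "c = c'" if "is_decomposition G M m c" "is_decomposition G M m c'" for m c c'
  proof
    fix g
    show "c g = c' g"
    proof (cases "g \<in> G")
      case True
      have "c g \<in> carrier M" "c' g \<in> carrier M"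
        using that True part by (auto simp: is_decomposition_def)
      then show ?thesis by (rule inj) (simp add: val[OF that(1) True] val[OF that(2) True])
    next
      case False
      then show ?thesis using that by (simp add: is_decomposition_def)
    qed
  qed
  show ?thesis
    unfolding is_grading_def using sub ex un by blast
qed

section \<open>Shifts and images of graded modules\<close>

lemma shift_simps [simp]:
  "carrier (shift l M) = carrier M" "zero (shift l M) = zero M" "add (shift l M) = add M"
  "smult (shift l M) = smult M" "gpart (shift l M) g = gpart M (g - l)"
  by (simp_all add: shift_def)

lemma shift_0 [simp]: "shift 0 M = M"
  by (simp add: shift_def)

lemma shift_shift [simp]: "shift l (shift s M) = shift (l + s) M"
  by (simp add: shift_def algebra_simps)

text \<open>Both \<open>finsum\<close> and, in \<open>a_inv_cong\<close>, \<open>a_inv\<close> are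
  defined with reference to the carrier, so passing to a submodule with the same operations changes
  these terms and their values have to be compared.\<close>

lemma finsum_cong_subset:
  assumes "abelian_group M" "abelian_group N" "zero N = zero M" "add N = add M"
    and "carrier N \<subseteq> carrier M" "finite A" "a \<in> A \<rightarrow> carrier N"
  shows "finsum N a A = finsum M a A"
proof -
  interpret M: abelian_group M by fact
  interpret N: abelian_group N by fact
  show ?thesis using assms(6,7)
  proof (induction A rule: finite_induct)
    case (insert i A)
    then show ?case using assms(3-5) by (simp add: Pi_def subset_iff)
  qed (simp add: assms)
qed

lemma a_inv_cong:
  assumes "abelian_group M" "abelian_group N" "zero N = zero M" "add N = add M"
    and "carrier N \<subseteq> carrier M" "x \<in> carrier N"
  shows "\<ominus>\<^bsub>N\<^esub> x = \<ominus>\<^bsub>M\<^esub> x"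
proof -
  interpret M: abelian_group M by fact
  interpret N: abelian_group N by fact
  have "\<ominus>\<^bsub>N\<^esub> x \<oplus>\<^bsub>M\<^esub> x = \<zero>\<^bsub>M\<^esub>" using N.l_neg[OF assms(6)] assms(3,4) by simp
  moreover have "\<ominus>\<^bsub>N\<^esub> x \<in> carrier M" "x \<in> carrier M" using assms(5,6) N.a_inv_closed by blast+
  ultimately show ?thesis using M.minus_equality by metis
qed

context graded_ring
begin

lemma gpart_carrier: "\<lbrakk>g \<in> G; a \<in> gpart R g\<rbrakk> \<Longrightarrow> a \<in> carrier R"
  using additive_subgroup.a_subset[OF gpart_subgroup] by blast

text \<open>Translation by \<open>l\<close> is a bijection of the group \<open>G\<close>. Hence
  decompositions in the shifted module are decompositions in \<open>M\<close> with translated index,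
  which is the equivalence \<open>dec\<close>.\<close>

lemma shift_graded:
  assumes "graded_left_module G R M" "l \<in> G"
  shows "graded_left_module G R (shift l M)"
proof -
  interpret M: graded_left_module G R M by fact
  have H: "additive_subgroup (carrier M) M"
    by (intro additive_subgroup.intro subgroup.intro) (auto simp: a_inv_def[symmetric])
  have lm: "left_module R (shift l M)"
    by (rule M.submodule[OF H]) auto
  then interpret S: left_module R "shift l M" .
  have dec: "is_decomposition G (shift l M) x c \<longleftrightarrow> is_decomposition G M x (\<lambda>g. c (g + l))" for x c
  proof -
    have img: "{h. c h \<noteq> \<zero>\<^bsub>M\<^esub>} = (\<lambda>g. g + l) ` {g. c (g + l) \<noteq> \<zero>\<^bsub>M\<^esub>}"
    proof (rule subset_antisym; rule subsetI)
      fix h assume "h \<in> {h. c h \<noteq> \<zero>\<^bsub>M\<^esub>}"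
      then show "h \<in> (\<lambda>g. g + l) ` {g. c (g + l) \<noteq> \<zero>\<^bsub>M\<^esub>}"
        by (intro image_eqI[of _ _ "h - l"]) auto
    qed auto
    have fin: "finite {h. c h \<noteq> \<zero>\<^bsub>M\<^esub>} \<longleftrightarrow> finite {g. c (g + l) \<noteq> \<zero>\<^bsub>M\<^esub>}"
      unfolding img by (rule finite_image_iff) (auto simp: inj_on_def)
    have G1: "(\<forall>g\<in>G. c g \<in> gpart M (g - l)) \<longleftrightarrow> (\<forall>g\<in>G. c (g + l) \<in> gpart M g)"
      using diff_in[OF _ assms(2)] plus_in[OF _ assms(2)]
      by (metis add_diff_cancel_right' diff_add_cancel)
    have G2: "(\<forall>g. g \<notin> G \<longrightarrow> c g = \<zero>\<^bsub>M\<^esub>) \<longleftrightarrow> (\<forall>g. g \<notin> G \<longrightarrow> c (g + l) = \<zero>\<^bsub>M\<^esub>)"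
      using diff_in[OF _ assms(2)] plus_in[OF _ assms(2)]
      by (metis add_diff_cancel_right' diff_add_cancel)
    have sum: "finsum (shift l M) c {h. c h \<noteq> \<zero>\<^bsub>M\<^esub>} = (\<Oplus>\<^bsub>M\<^esub>g\<in>{g. c (g + l) \<noteq> \<zero>\<^bsub>M\<^esub>}. c (g + l))"
      if "\<forall>g\<in>G. c (g + l) \<in> gpart M g" "\<forall>g. g \<notin> G \<longrightarrow> c (g + l) = \<zero>\<^bsub>M\<^esub>" "finite {h. c h \<noteq> \<zero>\<^bsub>M\<^esub>}"
    proof -
      have cc: "c (g + l) \<in> carrier M" for g
        using that(1,2) M.gpart_carrier by (cases "g \<in> G") auto
      have cc': "c h \<in> carrier M" for h using cc[of "h - l"] by simp
      have "finsum (shift l M) c {h. c h \<noteq> \<zero>\<^bsub>M\<^esub>} = finsum M c {h. c h \<noteq> \<zero>\<^bsub>M\<^esub>}"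
        by (rule finsum_cong_subset) (use cc' that(3) in \<open>auto intro: M.M.abelian_group_axioms S.M.abelian_group_axioms\<close>)
      also have "\<dots> = (\<Oplus>\<^bsub>M\<^esub>g\<in>{g. c (g + l) \<noteq> \<zero>\<^bsub>M\<^esub>}. c (g + l))"
        unfolding img by (rule M.M.finsum_reindex) (use cc in \<open>auto simp: inj_on_def\<close>)
      finally show ?thesis .
    qed
    show ?thesis
      unfolding is_decomposition_def shift_simps G1 G2 fin using sum fin by auto
  qed
  have "\<exists>!c. is_decomposition G (shift l M) x c" if x: "x \<in> carrier M" for x
  proof -
    obtain c where c: "is_decomposition G M x c" "\<And>c'. is_decomposition G M x c' \<Longrightarrow> c' = c"
      using M.grading x unfolding is_grading_def by blast
    have "is_decomposition G (shift l M) x (\<lambda>g. c (g - l))" using c(1) by (simp add: dec)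
    moreover have "c' = (\<lambda>g. c (g - l))" if "is_decomposition G (shift l M) x c'" for c'
    proof
      fix g show "c' g = c (g - l)"
        using fun_cong[OF c(2)[OF that[unfolded dec]], of "g - l"] by simp
    qed
    ultimately show ?thesis by blast
  qed
  moreover have "additive_subgroup (gpart M (g - l)) (shift l M)" if "g \<in> G" for g
  proof -
    interpret A: additive_subgroup "gpart M (g - l)" M
      by (rule M.gpart_subgroup) (use that assms(2) diff_in in auto)
    have inv: "\<ominus>\<^bsub>shift l M\<^esub> x = \<ominus>\<^bsub>M\<^esub> x" if "x \<in> carrier M" for x
      by (rule a_inv_cong) (use that in \<open>auto intro: M.M.abelian_group_axioms S.M.abelian_group_axioms\<close>)
    show ?thesis
      by (intro additive_subgroup.intro subgroup.intro)
        (use A.a_subset in \<open>auto simp: a_inv_def[symmetric] inv subset_iff\<close>)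
  qed
  ultimately have "is_grading G (shift l M)" by (simp add: is_grading_def)
  moreover have "a \<odot>\<^bsub>M\<^esub> x \<in> gpart M (g + h - l)"
    if "g \<in> G" "h \<in> G" "a \<in> gpart R g" "x \<in> gpart M (h - l)" for g h a x
    using M.smult_gpart[of g "h - l" a x] that diff_in assms(2) by (simp add: algebra_simps)
  ultimately show ?thesis
    by (intro graded_left_module.intro graded_left_module_axioms.intro lm) auto
qed

text \<open>The lifting property of projectives concerns surjections. Giving the image of
  \<open>u\<close> a grading turns any morphism into a surjection onto a graded module. The grading
  exists because the components of \<open>u x\<close> are the images of the components of
  \<open>x\<close>, so they stay in the image.\<close>

lemma image_graded:
  assumes N: "graded_left_module G R N" and N': "graded_left_module G R N'"
    and u: "u \<in> graded_maps G R N N'"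
  shows "graded_left_module G R
    (N'\<lparr>carrier := u ` carrier N, gpart := \<lambda>g. gpart N' g \<inter> u ` carrier N\<rparr>)"
    (is "graded_left_module G R ?I")
proof -
  interpret N: graded_left_module G R N by fact
  interpret N': graded_left_module G R N' by fact
  note ul = graded_mapsD(1)[OF u]
  note ab = N.M.abelian_group_axioms N'.M.abelian_group_axioms
  have uc: "u x \<in> carrier N'" if "x \<in> carrier N" for x using linear_mapsD(1)[OF ul that] .
  have H: "additive_subgroup (u ` carrier N) N'"
  proof (intro additive_subgroup.intro subgroup.intro)
    fix x assume "x \<in> u ` carrier N"
    then show "inv\<^bsub>add_monoid N'\<^esub> x \<in> u ` carrier N"
      using linear_maps_inv[OF ab ul] by (auto simp: a_inv_def[symmetric] image_iff) (metis N.M.a_inv_closed)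
  next
    fix x y assume "x \<in> u ` carrier N" "y \<in> u ` carrier N"
    then show "x \<otimes>\<^bsub>add_monoid N'\<^esub> y \<in> u ` carrier N"
      using linear_mapsD(2)[OF ul] by (auto simp: image_iff) (metis N.M.a_closed)
  next
    show "\<one>\<^bsub>add_monoid N'\<^esub> \<in> u ` carrier N"
      using linear_maps_zero[OF ab ul] by (auto simp: image_iff intro!: bexI[of _ "\<zero>\<^bsub>N\<^esub>"])
  qed (use uc in auto)
  have lm: "left_module R ?I"
  proof (rule N'.submodule[OF H])
    fix r x assume "r \<in> carrier R" "x \<in> u ` carrier N"
    then show "r \<odot>\<^bsub>N'\<^esub> x \<in> u ` carrier N"
      using linear_mapsD(3)[OF ul] by (auto simp: image_iff) (metis N.smult_closed)
  qed auto
  then interpret I: left_module R ?I .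
  have sub: "carrier ?I \<subseteq> carrier N'" using uc by auto
  have inv: "\<ominus>\<^bsub>?I\<^esub> x = \<ominus>\<^bsub>N'\<^esub> x" if "x \<in> carrier ?I" for x
    by (rule a_inv_cong[OF ab(2) I.M.abelian_group_axioms _ _ sub that]) auto
  have "additive_subgroup (gpart ?I g) ?I" if g: "g \<in> G" for g
  proof -
    interpret A: additive_subgroup "gpart N' g" N' by (rule N'.gpart_subgroup[OF g])
    interpret H: additive_subgroup "u ` carrier N" N' by (rule H)
    have "\<ominus>\<^bsub>?I\<^esub> x \<in> gpart ?I g" if "x \<in> gpart ?I g" for x
      using that inv[of x] A.a_inv_closed H.a_inv_closed by simp
    then show ?thesis
      unfolding a_inv_def
      by (intro additive_subgroup.intro subgroup.intro)
        (auto intro: H.zero_closed H.a_closed)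
  qed
  moreover have "\<exists>!c. is_decomposition G ?I y c" if y: "y \<in> carrier ?I" for y
  proof -
    have IN: "is_decomposition G N' y c" if "is_decomposition G ?I y c" for c
    proof -
      have "c g \<in> carrier ?I" for g
        using that I.M.zero_closed by (cases "g \<in> G") (auto simp: is_decomposition_def)
      then have "finsum ?I c {g. c g \<noteq> \<zero>\<^bsub>N'\<^esub>} = finsum N' c {g. c g \<noteq> \<zero>\<^bsub>N'\<^esub>}"
        using that by (intro finsum_cong_subset[OF ab(2) I.M.abelian_group_axioms _ _ sub])
          (auto simp: is_decomposition_def)
      then show ?thesis using that by (auto simp: is_decomposition_def)
    qed
    obtain x where x: "x \<in> carrier N" "y = u x" using y by auto
    obtain c where c: "is_decomposition G N x c" using N.grading x(1) unfolding is_grading_def by blast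
    have cc: "c g \<in> carrier N" for g
      using c N.gpart_carrier by (cases "g \<in> G") (auto simp: is_decomposition_def)
    define c' where "c' = (\<lambda>g. u (c g))"
    have c'c: "c' g \<in> carrier ?I" for g using cc by (simp add: c'_def)
    have fc: "finite {g. c g \<noteq> \<zero>\<^bsub>N\<^esub>}" using c by (simp add: is_decomposition_def)
    have s: "{g. c' g \<noteq> \<zero>\<^bsub>N'\<^esub>} \<subseteq> {g. c g \<noteq> \<zero>\<^bsub>N\<^esub>}"
      using linear_maps_zero[OF ab ul] by (auto simp: c'_def)
    have "y = finsum N' c' {g. c g \<noteq> \<zero>\<^bsub>N\<^esub>}"
      using linear_maps_finsum[OF ab ul fc, of c] cc c x(2) by (auto simp: is_decomposition_def c'_def)
    also have "\<dots> = finsum ?I c' {g. c g \<noteq> \<zero>\<^bsub>N\<^esub>}"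
      by (rule finsum_cong_subset[OF ab(2) I.M.abelian_group_axioms _ _ sub, symmetric])
        (use fc c'c in auto)
    also have "\<dots> = finsum ?I c' {g. c' g \<noteq> \<zero>\<^bsub>?I\<^esub>}"
      by (rule I.M.add.finprod_mono_neutral_cong)
        (use c'c s fc in \<open>auto intro: finite_subset\<close>)
    finally have d: "is_decomposition G ?I y c'"
      using c c'c s fc graded_mapsD(2)[OF u] linear_maps_zero[OF ab ul]
      by (auto simp: is_decomposition_def c'_def intro: finite_subset)
    moreover have "c'' = c'" if "is_decomposition G ?I y c''" for c''
      using IN[OF that] IN[OF d] N'.grading sub y unfolding is_grading_def by blast
    ultimately show ?thesis by blast
  qed
  ultimately have "is_grading G ?I" by (simp add: is_grading_def)
  then show ?thesis
    by (intro graded_left_module.intro graded_left_module_axioms.intro lm)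
      (use N'.smult_gpart I.smult_closed gpart_carrier in auto)
qed

text \<open>Both \<open>u\<close> and \<open>f\<close> are corestricted to the image of
  \<open>u\<close>. This is the form in which exactness of a resolution is combined with
  projectivity.\<close>

lemma graded_lift:
  assumes proj: "graded_projective G R P"
    and N: "graded_left_module G R N" and N': "graded_left_module G R N'"
    and u: "u \<in> graded_maps G R N N'" and f: "f \<in> graded_maps G R P N'"
    and im: "\<And>x. x \<in> carrier P \<Longrightarrow> f x \<in> u ` carrier N"
  shows "\<exists>h \<in> graded_maps G R P N. \<forall>x\<in>carrier P. u (h x) = f x"
proof (rule graded_projective_lifting[OF graded_ring_axioms proj N image_graded[OF N N' u]])
  interpret N: graded_left_module G R N by fact
  interpret P: graded_left_module G R P using proj by (simp add: graded_projective_def)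
  show "u \<in> graded_maps G R N (N'\<lparr>carrier := u ` carrier N, gpart := \<lambda>g. gpart N' g \<inter> u ` carrier N\<rparr>)"
    using u N.gpart_carrier by (auto simp: graded_maps_def linear_maps_def)
  show "f \<in> graded_maps G R P (N'\<lparr>carrier := u ` carrier N, gpart := \<lambda>g. gpart N' g \<inter> u ` carrier N\<rparr>)"
    using f im P.gpart_carrier by (auto simp: graded_maps_def linear_maps_def)
qed auto

lemma graded_maps_shift:
  assumes "u \<in> graded_maps G R N N'" "l \<in> G"
  shows "u \<in> graded_maps G R (shift l N) (shift l N')"
  using assms diff_in by (auto simp: graded_maps_def linear_maps_def)

end

section \<open>Modules of morphisms\<close>

lemma linear_mapsI:
  assumes "f \<in> carrier M \<rightarrow>\<^sub>E carrier N"
    and "\<And>x y. \<lbrakk>x \<in> carrier M; y \<in> carrier M\<rbrakk> \<Longrightarrow> f (x \<oplus>\<^bsub>M\<^esub> y) = f x \<oplus>\<^bsub>N\<^esub> f y"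
    and "\<And>r x. \<lbrakk>r \<in> carrier R; x \<in> carrier M\<rbrakk> \<Longrightarrow> f (r \<odot>\<^bsub>M\<^esub> x) = r \<odot>\<^bsub>N\<^esub> f x"
  shows "f \<in> linear_maps R M N"
  using assms by (simp add: linear_maps_def)

lemma linear_maps_extensional: "f \<in> linear_maps R M N \<Longrightarrow> f \<in> extensional (carrier M)"
  by (simp add: linear_maps_def PiE_def)

lemma graded_mapsI:
  assumes "f \<in> carrier M \<rightarrow>\<^sub>E carrier N"
    and "\<And>x y. \<lbrakk>x \<in> carrier M; y \<in> carrier M\<rbrakk> \<Longrightarrow> f (x \<oplus>\<^bsub>M\<^esub> y) = f x \<oplus>\<^bsub>N\<^esub> f y"
    and "\<And>r x. \<lbrakk>r \<in> carrier R; x \<in> carrier M\<rbrakk> \<Longrightarrow> f (r \<odot>\<^bsub>M\<^esub> x) = r \<odot>\<^bsub>N\<^esub> f x"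
    and "\<And>g x. \<lbrakk>g \<in> G; x \<in> gpart M g\<rbrakk> \<Longrightarrow> f x \<in> gpart N g"
  shows "f \<in> graded_maps G R M N"
  using assms by (auto simp: graded_maps_def intro!: linear_mapsI)

text \<open>The three conditions make \<open>k \<mapsto> k 1\<close> act on morphisms of degree 0:
  being a ring homomorphism gives the module axioms, centrality keeps the result
  \<open>\<Lambda>\<close>-linear, and degree 0 keeps it graded.\<close>

locale graded_algebra = K: cring K + graded_ring G \<Lambda>
  for K :: "('k, 'c) ring_scheme" and G :: "real set" and \<Lambda> :: "('k, 'r) gmodule" +
  assumes scalar_hom: "(\<lambda>k. k \<odot>\<^bsub>\<Lambda>\<^esub> \<one>\<^bsub>\<Lambda>\<^esub>) \<in> ring_hom K \<Lambda>"
    and scalar_central: "\<lbrakk>k \<in> carrier K; a \<in> carrier \<Lambda>\<rbrakk> \<Longrightarrow>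
      (k \<odot>\<^bsub>\<Lambda>\<^esub> \<one>\<^bsub>\<Lambda>\<^esub>) \<otimes>\<^bsub>\<Lambda>\<^esub> a = a \<otimes>\<^bsub>\<Lambda>\<^esub> (k \<odot>\<^bsub>\<Lambda>\<^esub> \<one>\<^bsub>\<Lambda>\<^esub>)"
    and scalar_gpart: "k \<in> carrier K \<Longrightarrow> k \<odot>\<^bsub>\<Lambda>\<^esub> \<one>\<^bsub>\<Lambda>\<^esub> \<in> gpart \<Lambda> 0"
begin

definition scalar :: "'k \<Rightarrow> 'r" where "scalar k = k \<odot>\<^bsub>\<Lambda>\<^esub> \<one>\<^bsub>\<Lambda>\<^esub>"

lemma scalar_closed [simp]: "k \<in> carrier K \<Longrightarrow> scalar k \<in> carrier \<Lambda>"
  using ring_hom_closed[OF scalar_hom] by (simp add: scalar_def)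

lemma scalar_simps:
  "\<lbrakk>k \<in> carrier K; k' \<in> carrier K\<rbrakk> \<Longrightarrow> scalar (k \<oplus>\<^bsub>K\<^esub> k') = scalar k \<oplus>\<^bsub>\<Lambda>\<^esub> scalar k'"
  "\<lbrakk>k \<in> carrier K; k' \<in> carrier K\<rbrakk> \<Longrightarrow> scalar (k \<otimes>\<^bsub>K\<^esub> k') = scalar k \<otimes>\<^bsub>\<Lambda>\<^esub> scalar k'"
  "scalar \<one>\<^bsub>K\<^esub> = \<one>\<^bsub>\<Lambda>\<^esub>"
  using ring_hom_add[OF scalar_hom] ring_hom_mult[OF scalar_hom] ring_hom_one[OF scalar_hom]
  by (simp_all add: scalar_def)

lemma scalar_smult:
  assumes "graded_left_module G \<Lambda> N" "k \<in> carrier K" "a \<in> carrier \<Lambda>" "x \<in> carrier N"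
  shows "scalar k \<odot>\<^bsub>N\<^esub> (a \<odot>\<^bsub>N\<^esub> x) = a \<odot>\<^bsub>N\<^esub> (scalar k \<odot>\<^bsub>N\<^esub> x)"
proof -
  interpret N: graded_left_module G \<Lambda> N by fact
  show ?thesis
    using N.smult_assoc1[of "scalar k" a x] N.smult_assoc1[of a "scalar k" x] scalar_central[of k a] assms
    by (simp add: scalar_def[symmetric])
qed

lemma hom_simps [simp]:
  "carrier (graded_hom_module G \<Lambda> M N) = graded_maps G \<Lambda> M N"
  "zero (graded_hom_module G \<Lambda> M N) = (\<lambda>x\<in>carrier M. \<zero>\<^bsub>N\<^esub>)"
  "f \<oplus>\<^bsub>graded_hom_module G \<Lambda> M N\<^esub> f' = (\<lambda>x\<in>carrier M. f x \<oplus>\<^bsub>N\<^esub> f' x)"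
  "k \<odot>\<^bsub>graded_hom_module G \<Lambda> M N\<^esub> f = (\<lambda>x\<in>carrier M. scalar k \<odot>\<^bsub>N\<^esub> f x)"
  by (simp_all add: graded_hom_module_def scalar_def)

context
  fixes M :: "('r, 'm) gmodule" and N :: "('r, 'n) gmodule"
  assumes M: "graded_left_module G \<Lambda> M" and N: "graded_left_module G \<Lambda> N"
begin

interpretation M: graded_left_module G \<Lambda> M by (rule M)
interpretation N: graded_left_module G \<Lambda> N by (rule N)

lemma graded_maps_zero: "(\<lambda>x\<in>carrier M. \<zero>\<^bsub>N\<^esub>) \<in> graded_maps G \<Lambda> M N"
  by (rule graded_mapsI) (use M.gpart_carrier N.gpart_zero in auto)

lemma graded_maps_add:
  assumes f: "f \<in> graded_maps G \<Lambda> M N" and f': "f' \<in> graded_maps G \<Lambda> M N"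
  shows "(\<lambda>x\<in>carrier M. f x \<oplus>\<^bsub>N\<^esub> f' x) \<in> graded_maps G \<Lambda> M N"
proof -
  note l = linear_mapsD[OF graded_mapsD(1)[OF f]] linear_mapsD[OF graded_mapsD(1)[OF f']]
  show ?thesis
  proof (rule graded_mapsI)
    fix g x assume "g \<in> G" "x \<in> gpart M g"
    then show "(\<lambda>x\<in>carrier M. f x \<oplus>\<^bsub>N\<^esub> f' x) x \<in> gpart N g"
      using additive_subgroup.a_closed[OF N.gpart_subgroup] graded_mapsD(2)[OF f] graded_mapsD(2)[OF f']
        M.gpart_carrier by simp
  qed (use l in \<open>auto simp: N.smult_r_distr N.M.a_ac\<close>)
qed

lemma graded_maps_inv:
  assumes f: "f \<in> graded_maps G \<Lambda> M N"
  shows "(\<lambda>x\<in>carrier M. \<ominus>\<^bsub>N\<^esub> f x) \<in> graded_maps G \<Lambda> M N"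
proof -
  note l = linear_mapsD[OF graded_mapsD(1)[OF f]]
  show ?thesis
  proof (rule graded_mapsI)
    fix g x assume "g \<in> G" "x \<in> gpart M g"
    then show "(\<lambda>x\<in>carrier M. \<ominus>\<^bsub>N\<^esub> f x) x \<in> gpart N g"
      using additive_subgroup.a_inv_closed[OF N.gpart_subgroup] graded_mapsD(2)[OF f]
        M.gpart_carrier by simp
  qed (use l in \<open>auto simp: N.smult_r_inv N.M.minus_add\<close>)
qed

lemma graded_maps_minus:
  assumes f: "f \<in> graded_maps G \<Lambda> M N" and f': "f' \<in> graded_maps G \<Lambda> M N"
  shows "(\<lambda>x\<in>carrier M. f x \<ominus>\<^bsub>N\<^esub> f' x) \<in> graded_maps G \<Lambda> M N"
proof -
  have "(\<lambda>x\<in>carrier M. f x \<ominus>\<^bsub>N\<^esub> f' x)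
      = (\<lambda>x\<in>carrier M. f x \<oplus>\<^bsub>N\<^esub> (\<lambda>x\<in>carrier M. \<ominus>\<^bsub>N\<^esub> f' x) x)"
    by (rule restrict_ext) (simp add: N.M.minus_eq)
  then show ?thesis using graded_maps_add[OF f graded_maps_inv[OF f']] by simp
qed

lemma graded_hom_left_module: "left_module K (graded_hom_module G \<Lambda> M N)" (is "left_module K ?H")
proof -
  have c: "f x \<in> carrier N" if "f \<in> graded_maps G \<Lambda> M N" "x \<in> carrier M" for f x
    using linear_mapsD(1)[OF graded_mapsD(1)[OF that(1)] that(2)] .
  have e: "(\<lambda>x\<in>carrier M. f x) = f" if "f \<in> graded_maps G \<Lambda> M N" for f
    using linear_maps_extensional[OF graded_mapsD(1)[OF that]] by (simp add: extensional_restrict)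
  have grp: "abelian_group ?H"
  proof (rule abelian_groupI)
    fix f assume "f \<in> carrier ?H"
    then have f: "f \<in> graded_maps G \<Lambda> M N" by simp
    show "\<exists>f'\<in>carrier ?H. f' \<oplus>\<^bsub>?H\<^esub> f = \<zero>\<^bsub>?H\<^esub>"
      using graded_maps_inv[OF f] c[OF f]
      by (auto simp: N.M.l_neg intro!: bexI[of _ "\<lambda>x\<in>carrier M. \<ominus>\<^bsub>N\<^esub> f x"] restrict_ext)
  next
    fix f assume "f \<in> carrier ?H"
    then have f: "f \<in> graded_maps G \<Lambda> M N" by simp
    show "\<zero>\<^bsub>?H\<^esub> \<oplus>\<^bsub>?H\<^esub> f = f"
      using c[OF f] by (subst (2) e[OF f, symmetric]) (auto intro!: restrict_ext)
  qed (use graded_maps_zero graded_maps_add c in \<open>auto simp: N.M.a_ac intro!: restrict_ext\<close>)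
  have sm: "(\<lambda>x\<in>carrier M. scalar k \<odot>\<^bsub>N\<^esub> f x) \<in> graded_maps G \<Lambda> M N"
    if "k \<in> carrier K" and f: "f \<in> graded_maps G \<Lambda> M N" for k f
  proof (rule graded_mapsI)
    fix g x assume g: "g \<in> G" "x \<in> gpart M g"
    then show "(\<lambda>x\<in>carrier M. scalar k \<odot>\<^bsub>N\<^esub> f x) x \<in> gpart N g"
      using N.smult_gpart[OF zero_in g(1) scalar_gpart[OF that(1)] graded_mapsD(2)[OF f g]] M.gpart_carrier
      by (simp add: scalar_def)
  next
    fix r x assume "r \<in> carrier \<Lambda>" "x \<in> carrier M"
    then show "(\<lambda>x\<in>carrier M. scalar k \<odot>\<^bsub>N\<^esub> f x) (r \<odot>\<^bsub>M\<^esub> x) =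
        r \<odot>\<^bsub>N\<^esub> (\<lambda>x\<in>carrier M. scalar k \<odot>\<^bsub>N\<^esub> f x) x"
      using scalar_smult[OF N that(1)] c[OF f] linear_mapsD(3)[OF graded_mapsD(1)[OF f]] by simp
  qed (use that(1) c[OF f] linear_mapsD(2)[OF graded_mapsD(1)[OF f]] in \<open>auto simp: N.smult_r_distr\<close>)
  show ?thesis
  proof (intro left_module.intro left_module_axioms.intro grp)
    fix f assume "f \<in> carrier ?H"
    then have f: "f \<in> graded_maps G \<Lambda> M N" by simp
    show "\<one>\<^bsub>K\<^esub> \<odot>\<^bsub>?H\<^esub> f = f"
      using c[OF f] by (subst (2) e[OF f, symmetric]) (auto simp: scalar_simps intro!: restrict_ext)
  qed (use sm c in \<open>auto simp: scalar_simps N.smult_l_distr N.smult_r_distr N.smult_assoc1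
      intro!: restrict_ext intro: K.ring_axioms\<close>)
qed

end

end

section \<open>Maps induced on cohomology\<close>

text \<open>Elements of \<open>linear_maps\<close> are extensional functions, while the
  differentials of the two complexes in question are defined for arguments outside the carrier as
  well; hence the restriction in \<open>diff\<close>.\<close>

locale cochain_complex =
  K: ring K for K :: "('k, 'c) ring_scheme" and C :: "int \<Rightarrow> ('k, 'm) module" and \<delta> :: "int \<Rightarrow> 'm \<Rightarrow> 'm" +
  assumes comp: "left_module K (C n)"
    and diff: "restrict (\<delta> n) (carrier (C n)) \<in> linear_maps K (C n) (C (n + 1))"
    and diff_diff: "x \<in> carrier (C (n - 1)) \<Longrightarrow> \<delta> n (\<delta> (n - 1) x) = \<zero>\<^bsub>C (n + 1)\<^esub>"
begin

abbreviation "Z n \<equiv> (C n)\<lparr>carrier := cocycles C \<delta> n\<rparr>"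
abbreviation "cls n \<equiv> cohomology_class C \<delta> n"

lemma ab: "abelian_group (C n)"
  using comp[of n] by (simp add: left_module_def)

lemma diff_props:
  shows "x \<in> carrier (C n) \<Longrightarrow> \<delta> n x \<in> carrier (C (n + 1))"
    and "\<lbrakk>x \<in> carrier (C n); y \<in> carrier (C n)\<rbrakk> \<Longrightarrow> \<delta> n (x \<oplus>\<^bsub>C n\<^esub> y) = \<delta> n x \<oplus>\<^bsub>C (n + 1)\<^esub> \<delta> n y"
    and "\<lbrakk>k \<in> carrier K; x \<in> carrier (C n)\<rbrakk> \<Longrightarrow> \<delta> n (k \<odot>\<^bsub>C n\<^esub> x) = k \<odot>\<^bsub>C (n + 1)\<^esub> \<delta> n x"
    and "\<delta> n \<zero>\<^bsub>C n\<^esub> = \<zero>\<^bsub>C (n + 1)\<^esub>"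
    and "x \<in> carrier (C n) \<Longrightarrow> \<delta> n (\<ominus>\<^bsub>C n\<^esub> x) = \<ominus>\<^bsub>C (n + 1)\<^esub> \<delta> n x"
proof -
  interpret left_module K "C n" by (rule comp)
  note d = linear_mapsD[OF diff[of n]]
  show "x \<in> carrier (C n) \<Longrightarrow> \<delta> n x \<in> carrier (C (n + 1))" using d(1)[of x] by simp
  show "\<lbrakk>x \<in> carrier (C n); y \<in> carrier (C n)\<rbrakk> \<Longrightarrow> \<delta> n (x \<oplus>\<^bsub>C n\<^esub> y) = \<delta> n x \<oplus>\<^bsub>C (n + 1)\<^esub> \<delta> n y"
    using d(2)[of x y] by simp
  show "\<lbrakk>k \<in> carrier K; x \<in> carrier (C n)\<rbrakk> \<Longrightarrow> \<delta> n (k \<odot>\<^bsub>C n\<^esub> x) = k \<odot>\<^bsub>C (n + 1)\<^esub> \<delta> n x"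
    using d(3)[of k x] by simp
  show "\<delta> n \<zero>\<^bsub>C n\<^esub> = \<zero>\<^bsub>C (n + 1)\<^esub>" using linear_maps_zero[OF ab ab diff[of n]] by simp
  show "x \<in> carrier (C n) \<Longrightarrow> \<delta> n (\<ominus>\<^bsub>C n\<^esub> x) = \<ominus>\<^bsub>C (n + 1)\<^esub> \<delta> n x"
    using linear_maps_inv[OF ab ab diff[of n], of x] by simp
qed

lemmas diff_prev_props = diff_props[where n = "n - 1" for n, simplified]

lemma coboundaries_subset: "coboundaries C \<delta> n \<subseteq> cocycles C \<delta> n"
  using diff_prev_props(1) diff_diff by (auto simp: coboundaries_def cocycles_def)

lemma cocycles_carrier: "z \<in> cocycles C \<delta> n \<Longrightarrow> z \<in> carrier (C n)"
  by (simp add: cocycles_def)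

lemma zero_coboundary: "\<zero>\<^bsub>C n\<^esub> \<in> coboundaries C \<delta> n"
proof -
  interpret C': left_module K "C (n - 1)" by (rule comp)
  show ?thesis
    using diff_prev_props(4)[of n] C'.M.zero_closed
    unfolding coboundaries_def by (metis image_eqI)
qed

lemma cocycles_module: "left_module K (Z n)"
proof -
  interpret left_module K "C n" by (rule comp)
  interpret C': left_module K "C (n + 1)" by (rule comp)
  note d = diff_props[where n = n]
  have "additive_subgroup (cocycles C \<delta> n) (C n)"
    by (intro additive_subgroup.intro subgroup.intro)
      (use d
        C'.M.minus_equality[of "\<zero>\<^bsub>C (n + 1)\<^esub>" "\<zero>\<^bsub>C (n + 1)\<^esub>"]
        in \<open>auto simp: cocycles_def a_inv_def[symmetric]\<close>)
  then show ?thesis by (rule submodule) (use d in \<open>auto simp: cocycles_def\<close>)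
qed

lemma coboundaries_subgroup: "abelian_subgroup (coboundaries C \<delta> n) (Z n)"
proof -
  interpret Z: left_module K "Z n" by (rule cocycles_module)
  interpret C': left_module K "C (n - 1)" by (rule comp)
  note d = diff_prev_props[where n = n]
  have inv: "\<ominus>\<^bsub>Z n\<^esub> x = \<ominus>\<^bsub>C n\<^esub> x" if "x \<in> cocycles C \<delta> n" for x
    by (rule a_inv_cong[OF ab Z.M.abelian_group_axioms]) (use that in \<open>auto simp: cocycles_def\<close>)
  show ?thesis
  proof (intro abelian_subgroupI3 additive_subgroup.intro subgroup.intro)
    fix x assume x: "x \<in> coboundaries C \<delta> n"
    then obtain y where y: "y \<in> carrier (C (n - 1))" "x = \<delta> (n - 1) y" by (auto simp: coboundaries_def)
    have "\<ominus>\<^bsub>C n\<^esub> x = \<delta> (n - 1) (\<ominus>\<^bsub>C (n - 1)\<^esub> y)"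
      using diff_prev_props(5)[OF y(1)] y(2) by simp
    then have "\<ominus>\<^bsub>Z n\<^esub> x = \<delta> (n - 1) (\<ominus>\<^bsub>C (n - 1)\<^esub> y)"
      using inv[of x] x coboundaries_subset[of n] by (simp only: subsetD)
    then have "\<ominus>\<^bsub>Z n\<^esub> x \<in> coboundaries C \<delta> n"
      using y(1) C'.M.a_inv_closed unfolding coboundaries_def by blast
    then show "inv\<^bsub>add_monoid (Z n)\<^esub> x \<in> coboundaries C \<delta> n" by (simp only: a_inv_def)
  next
    fix x y assume "x \<in> coboundaries C \<delta> n" "y \<in> coboundaries C \<delta> n"
    then show "x \<otimes>\<^bsub>add_monoid (Z n)\<^esub> y \<in> coboundaries C \<delta> n"
      using d(2)[symmetric] C'.M.a_closed by (auto simp: coboundaries_def)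
  qed (use coboundaries_subset zero_coboundary Z.M.abelian_group_axioms in auto)
qed

lemma class_rcoset: "cls n z = coboundaries C \<delta> n +>\<^bsub>Z n\<^esub> z"
  by (simp add: cohomology_class_def a_r_coset_def')

lemma class_mem: "z' \<in> cls n z \<longleftrightarrow> (\<exists>b\<in>coboundaries C \<delta> n. z' = b \<oplus>\<^bsub>C n\<^esub> z)"
  by (auto simp: cohomology_class_def a_r_coset_def')

lemma class_self: "z \<in> cocycles C \<delta> n \<Longrightarrow> z \<in> cls n z"
  using abelian_subgroup.a_rcos_self[OF coboundaries_subgroup, of z n] by (simp add: class_rcoset)

lemma class_subset: "z \<in> cocycles C \<delta> n \<Longrightarrow> cls n z \<subseteq> cocycles C \<delta> n"
  using abelian_subgroup.a_elemrcos_carrier[OF coboundaries_subgroup, of z n] by (auto simp: class_rcoset)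

lemma class_eq_of_mem: "\<lbrakk>z \<in> cocycles C \<delta> n; z' \<in> cls n z\<rbrakk> \<Longrightarrow> cls n z' = cls n z"
proof -
  assume z: "z \<in> cocycles C \<delta> n" "z' \<in> cls n z"
  interpret B: abelian_subgroup "coboundaries C \<delta> n" "Z n" by (rule coboundaries_subgroup)
  show ?thesis using B.a_repr_independence'[of z' z] z by (simp add: class_rcoset)
qed

lemma class_eq_iff:
  assumes "z \<in> cocycles C \<delta> n" "z' \<in> cocycles C \<delta> n"
  shows "cls n z' = cls n z \<longleftrightarrow> (\<exists>b\<in>coboundaries C \<delta> n. z' = b \<oplus>\<^bsub>C n\<^esub> z)"
  using class_eq_of_mem[OF assms(1)] class_self[OF assms(2)] by (auto simp flip: class_mem)

lemma cohomology_carrier: "carrier (cohomology C \<delta> n) = cls n ` cocycles C \<delta> n"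
  by (auto simp: cohomology_def quotient_module_def A_RCOSETS_def' class_rcoset)

lemma cohomology_add:
  assumes "z \<in> cocycles C \<delta> n" "z' \<in> cocycles C \<delta> n"
  shows "cls n z \<oplus>\<^bsub>cohomology C \<delta> n\<^esub> cls n z' = cls n (z \<oplus>\<^bsub>C n\<^esub> z')"
  using abelian_subgroup.a_rcos_sum[OF coboundaries_subgroup, of z n z'] assms
  by (simp add: cohomology_def quotient_module_def class_rcoset)

text \<open>Scalar multiplication on the quotient is a union of cosets over all representatives. The
  union collapses because multiples of coboundaries are coboundaries.\<close>

lemma cohomology_smult:
  assumes k: "k \<in> carrier K" and z: "z \<in> cocycles C \<delta> n"
  shows "k \<odot>\<^bsub>cohomology C \<delta> n\<^esub> cls n z = cls n (k \<odot>\<^bsub>C n\<^esub> z)"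
proof -
  interpret Z: left_module K "Z n" by (rule cocycles_module)
  interpret Cn: left_module K "C n" by (rule comp)
  interpret C': left_module K "C (n - 1)" by (rule comp)
  have "cls n (k \<odot>\<^bsub>C n\<^esub> z') = cls n (k \<odot>\<^bsub>C n\<^esub> z)" if z': "z' \<in> cls n z" for z'
  proof -
    obtain y where y: "y \<in> carrier (C (n - 1))" "z' = \<delta> (n - 1) y \<oplus>\<^bsub>C n\<^esub> z"
      using z' unfolding class_mem coboundaries_def by blast
    have "k \<odot>\<^bsub>C n\<^esub> z' = \<delta> (n - 1) (k \<odot>\<^bsub>C (n - 1)\<^esub> y) \<oplus>\<^bsub>C n\<^esub> (k \<odot>\<^bsub>C n\<^esub> z)"
      using y k z diff_prev_props[where n = n] by (simp add: Cn.smult_r_distr cocycles_def)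
    then have "k \<odot>\<^bsub>C n\<^esub> z' \<in> cls n (k \<odot>\<^bsub>C n\<^esub> z)"
      unfolding class_mem coboundaries_def
      by (rule bexI[OF _ imageI[OF C'.smult_closed[OF k y(1)]]])
    then show ?thesis by (rule class_eq_of_mem[rotated]) (use Z.smult_closed[of k z] k z in simp)
  qed
  then have "(\<Union>z'\<in>cls n z. cls n (k \<odot>\<^bsub>C n\<^esub> z')) = cls n (k \<odot>\<^bsub>C n\<^esub> z)"
    using class_self[OF z] by blast
  then show ?thesis
    by (simp add: cohomology_def quotient_module_def class_rcoset[symmetric])
qed

end

text \<open>Injectivity and surjectivity are demanded only up to coboundaries, so that the lemma
  covers both the isomorphism of complexes \<open>toHom\<close> and the homotopy equivalence between
  two resolutions. The value of \<open>\<Phi>\<close> on classes is part of the conclusion because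
  multiplicativity is checked on representatives later.\<close>

lemma cohomology_iso:
  assumes C: "cochain_complex K C \<delta>" and C': "cochain_complex K C' \<delta>'"
    and F: "\<And>n. F n \<in> linear_maps K (C n) (C' n)"
    and comm: "\<And>n x. x \<in> carrier (C n) \<Longrightarrow> F (n + 1) (\<delta> n x) = \<delta>' n (F n x)"
    and inj: "\<And>n z. \<lbrakk>z \<in> cocycles C \<delta> n; F n z \<in> coboundaries C' \<delta>' n\<rbrakk> \<Longrightarrow> z \<in> coboundaries C \<delta> n"
    and surj: "\<And>n z'. z' \<in> cocycles C' \<delta>' n \<Longrightarrow>
      \<exists>z\<in>cocycles C \<delta> n. \<exists>b\<in>coboundaries C' \<delta>' n. F n z = b \<oplus>\<^bsub>C' n\<^esub> z'"
  shows "\<exists>\<Phi>. \<forall>n. \<Phi> n \<in> linear_maps K (cohomology C \<delta> n) (cohomology C' \<delta>' n) \<and>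
      bij_betw (\<Phi> n) (carrier (cohomology C \<delta> n)) (carrier (cohomology C' \<delta>' n)) \<and>
      (\<forall>z\<in>cocycles C \<delta> n. \<Phi> n (cohomology_class C \<delta> n z) = cohomology_class C' \<delta>' n (F n z))"
proof -
  interpret C: cochain_complex K C \<delta> by fact
  interpret C': cochain_complex K C' \<delta>' by fact
  \<comment> \<open>A class is evaluated at a chosen representative; \<open>cls\<close> shows that
    the choice does not matter.\<close>
  define \<Phi> where "\<Phi> n = (\<lambda>A\<in>carrier (cohomology C \<delta> n). C'.cls n (F n (SOME z. z \<in> A)))" for n
  have Fz: "F n z \<in> cocycles C' \<delta>' n" if "z \<in> cocycles C \<delta> n" for n z
    using that linear_mapsD(1)[OF F] comm[of z n] linear_maps_zero[OF C.ab C'.ab F[of "n + 1"]]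
    by (auto simp: cocycles_def)
  have Fb: "F n b \<in> coboundaries C' \<delta>' n" if b: "b \<in> coboundaries C \<delta> n" for n b
  proof -
    obtain y where y: "y \<in> carrier (C (n - 1))" "b = \<delta> (n - 1) y" using b by (auto simp: coboundaries_def)
    then have "F n b = \<delta>' (n - 1) (F (n - 1) y)" using comm[of y "n - 1"] by simp
    then show ?thesis using linear_mapsD(1)[OF F y(1)] by (auto simp: coboundaries_def)
  qed
  have cls: "\<Phi> n (C.cls n z) = C'.cls n (F n z)" if z: "z \<in> cocycles C \<delta> n" for n z
  proof -
    have m: "(SOME z'. z' \<in> C.cls n z) \<in> C.cls n z" (is "?z \<in> _")
      using C.class_self[OF z] by (rule someI)
    then obtain b where b: "b \<in> coboundaries C \<delta> n" "?z = b \<oplus>\<^bsub>C n\<^esub> z" by (auto simp: C.class_mem)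
    have "F n ?z = F n b \<oplus>\<^bsub>C' n\<^esub> F n z"
      unfolding b(2) using b(1) C.coboundaries_subset z
      by (intro linear_mapsD(2)[OF F]) (auto simp: cocycles_def)
    then have "F n ?z \<in> C'.cls n (F n z)" using Fb[OF b(1)] by (auto simp: C'.class_mem)
    then have "C'.cls n (F n ?z) = C'.cls n (F n z)" by (rule C'.class_eq_of_mem[OF Fz[OF z]])
    then show ?thesis using z by (simp add: \<Phi>_def C.cohomology_carrier)
  qed
  have lin: "\<Phi> n \<in> linear_maps K (cohomology C \<delta> n) (cohomology C' \<delta>' n)" for n
  proof -
    interpret Z: left_module K "C.Z n" by (rule C.cocycles_module)
    have cl: "z \<oplus>\<^bsub>C n\<^esub> z' \<in> cocycles C \<delta> n" "k \<odot>\<^bsub>C n\<^esub> z \<in> cocycles C \<delta> n"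
      if "k \<in> carrier K" "z \<in> cocycles C \<delta> n" "z' \<in> cocycles C \<delta> n" for k z z'
      using Z.M.a_closed[of z z'] Z.smult_closed[of k z] that by auto
    show ?thesis
    proof (rule linear_mapsI)
      show "\<Phi> n \<in> carrier (cohomology C \<delta> n) \<rightarrow>\<^sub>E carrier (cohomology C' \<delta>' n)"
        unfolding PiE_def
        using cls Fz by (auto simp: C.cohomology_carrier C'.cohomology_carrier) (simp add: \<Phi>_def C.cohomology_carrier)
    next
      fix x y assume "x \<in> carrier (cohomology C \<delta> n)" "y \<in> carrier (cohomology C \<delta> n)"
      then show "\<Phi> n (x \<oplus>\<^bsub>cohomology C \<delta> n\<^esub> y) = \<Phi> n x \<oplus>\<^bsub>cohomology C' \<delta>' n\<^esub> \<Phi> n y"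
        using Fz cl[OF C.K.one_closed] linear_mapsD(2)[OF F[of n]] C.cocycles_carrier
        by (auto simp: C.cohomology_carrier C.cohomology_add C'.cohomology_add cls)
    next
      fix k x assume "k \<in> carrier K" "x \<in> carrier (cohomology C \<delta> n)"
      then show "\<Phi> n (k \<odot>\<^bsub>cohomology C \<delta> n\<^esub> x) = k \<odot>\<^bsub>cohomology C' \<delta>' n\<^esub> \<Phi> n x"
        using Fz cl linear_mapsD(3)[OF F[of n]] C.cocycles_carrier
        by (auto simp: C.cohomology_carrier C.cohomology_smult C'.cohomology_smult cls)
    qed
  qed
  have "inj_on (\<Phi> n) (carrier (cohomology C \<delta> n))" for n
  proof (rule inj_onI)
    fix x y assume "x \<in> carrier (cohomology C \<delta> n)" "y \<in> carrier (cohomology C \<delta> n)" and eq: "\<Phi> n x = \<Phi> n y"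
    then obtain z z' where z: "z \<in> cocycles C \<delta> n" "z' \<in> cocycles C \<delta> n" "x = C.cls n z" "y = C.cls n z'"
      by (auto simp: C.cohomology_carrier)
    interpret Z: left_module K "C.Z n" by (rule C.cocycles_module)
    interpret Cn: left_module K "C n" by (rule C.comp)
    interpret Cn': left_module K "C' n" by (rule C'.comp)
    have inv: "\<ominus>\<^bsub>C.Z n\<^esub> z' = \<ominus>\<^bsub>C n\<^esub> z'"
      by (rule a_inv_cong[OF C.ab Z.M.abelian_group_axioms]) (use z in \<open>auto simp: cocycles_def\<close>)
    have m: "z \<ominus>\<^bsub>C n\<^esub> z' \<in> cocycles C \<delta> n"
      using Z.M.a_closed[of z "\<ominus>\<^bsub>C.Z n\<^esub> z'"] Z.M.a_inv_closed[of z'] z inv by (simp add: Cn.M.minus_eq)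
    obtain b where b: "b \<in> coboundaries C' \<delta>' n" "F n z = b \<oplus>\<^bsub>C' n\<^esub> F n z'"
      using eq z C'.class_eq_iff[OF Fz[OF z(2)] Fz[OF z(1)]] cls by auto
    have bc: "b \<in> carrier (C' n)" "F n z' \<in> carrier (C' n)"
      using b(1) C'.coboundaries_subset C'.cocycles_carrier Fz[OF z(2)] by auto
    have "F n (z \<ominus>\<^bsub>C n\<^esub> z') = F n z \<ominus>\<^bsub>C' n\<^esub> F n z'"
      using z by (intro linear_maps_minus[OF C.ab C'.ab F]) (auto simp: cocycles_def)
    also have "\<dots> = b" using b bc by (simp add: Cn'.M.minus_eq Cn'.M.a_assoc Cn'.M.r_neg)
    finally have "z \<ominus>\<^bsub>C n\<^esub> z' \<in> coboundaries C \<delta> n" using inj[OF m] b(1) by simp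
    moreover have "z = (z \<ominus>\<^bsub>C n\<^esub> z') \<oplus>\<^bsub>C n\<^esub> z'"
      using z(1,2) by (simp add: cocycles_def Cn.M.minus_eq Cn.M.a_assoc Cn.M.l_neg)
    ultimately show "x = y" using z C.class_eq_iff[OF z(2,1)] by blast
  qed
  moreover have "\<Phi> n ` carrier (cohomology C \<delta> n) = carrier (cohomology C' \<delta>' n)" for n
  proof
    show "\<Phi> n ` carrier (cohomology C \<delta> n) \<subseteq> carrier (cohomology C' \<delta>' n)"
      using linear_mapsD(1)[OF lin] by blast
    show "carrier (cohomology C' \<delta>' n) \<subseteq> \<Phi> n ` carrier (cohomology C \<delta> n)"
    proof
      fix y assume "y \<in> carrier (cohomology C' \<delta>' n)"
      then obtain z' where z': "z' \<in> cocycles C' \<delta>' n" "y = C'.cls n z'" by (auto simp: C'.cohomology_carrier)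
      obtain z where z: "z \<in> cocycles C \<delta> n" "\<exists>b\<in>coboundaries C' \<delta>' n. F n z = b \<oplus>\<^bsub>C' n\<^esub> z'"
        using surj[OF z'(1)] by blast
      then have "y = \<Phi> n (C.cls n z)"
        using C'.class_eq_iff[OF z'(1) Fz[OF z(1)]] cls[OF z(1)] z'(2) by simp
      then show "y \<in> \<Phi> n ` carrier (cohomology C \<delta> n)"
        using z(1) by (auto simp: C.cohomology_carrier)
    qed
  qed
  ultimately have "bij_betw (\<Phi> n) (carrier (cohomology C \<delta> n)) (carrier (cohomology C' \<delta>' n))" for n
    unfolding bij_betw_def by simp
  then show ?thesis using lin cls by (intro exI[of _ \<Phi>]) simp
qed

section \<open>Projective resolutions\<close>

lemma shift_a_inv [simp]: "a_inv (shift l M) = a_inv M" "a_minus (shift l M) = a_minus M"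
  by (auto simp: a_inv_def a_minus_def m_inv_def fun_eq_iff)

text \<open>The lifts in the Yoneda product, with a source complex \<open>Q\<close> that may differ
  from the resolution \<open>P\<close>. For \<open>n = 0\<close> and \<open>l = 0\<close> these are
  the comparison maps between resolutions.\<close>

definition chain_lifts ::
  "real set \<Rightarrow> ('k, 'r) gmodule \<Rightarrow> (int \<Rightarrow> ('r, 'q) gmodule) \<Rightarrow> (int \<Rightarrow> 'q \<Rightarrow> 'q)
    \<Rightarrow> (int \<Rightarrow> ('r, 'p) gmodule) \<Rightarrow> (int \<Rightarrow> 'p \<Rightarrow> 'p) \<Rightarrow> ('p \<Rightarrow> 'm)
    \<Rightarrow> int \<Rightarrow> real \<Rightarrow> ('q \<Rightarrow> 'm) \<Rightarrow> (int \<Rightarrow> 'q \<Rightarrow> 'p) set"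
  where "chain_lifts G \<Lambda> Q DQ P D \<epsilon> n l \<alpha> =
    {\<alpha>'. (\<forall>k. \<alpha>' k \<in> graded_maps G \<Lambda> (Q (n + k)) (shift l (P k))) \<and>
         (\<forall>k\<ge>1. \<forall>x\<in>carrier (Q (n + k)). D k (\<alpha>' k x) = \<alpha>' (k - 1) (DQ (n + k) x)) \<and>
         (\<forall>x\<in>carrier (Q n). \<epsilon> (\<alpha>' 0 x) = \<alpha> x)}"

lemma yoneda_lifts_eq: "yoneda_lifts G \<Lambda> P D \<epsilon> n l \<alpha> = chain_lifts G \<Lambda> P D P D \<epsilon> n l \<alpha>"
  by (simp add: yoneda_lifts_def chain_lifts_def)

text \<open>This is what the comparison theorem asks of its source: projective terms and
  \<open>\<partial>\<partial> = 0\<close>, with exactness left to the target.\<close>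

definition projective_complex ::
  "real set \<Rightarrow> ('k, 'r) gmodule \<Rightarrow> (int \<Rightarrow> ('r, 'q) gmodule) \<Rightarrow> (int \<Rightarrow> 'q \<Rightarrow> 'q) \<Rightarrow> bool"
  where "projective_complex G \<Lambda> Q DQ \<longleftrightarrow>
    (\<forall>n. graded_projective G \<Lambda> (Q n)) \<and> (\<forall>n. DQ n \<in> graded_maps G \<Lambda> (Q n) (Q (n - 1))) \<and>
    (\<forall>n. \<forall>x\<in>carrier (Q n). DQ (n - 1) (DQ n x) = \<zero>\<^bsub>Q (n - 2)\<^esub>)"

lemma compose_graded_maps:
  assumes "f \<in> graded_maps G \<Lambda> L M" "u \<in> graded_maps G \<Lambda> M N" "graded_left_module G \<Lambda> L"
  shows "compose (carrier L) u f \<in> graded_maps G \<Lambda> L N"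
proof -
  interpret L: graded_left_module G \<Lambda> L by fact
  show ?thesis
    by (rule graded_maps_comp[OF assms(1,2) L.M.abelian_group_axioms]) (auto intro: L.gpart_carrier)
qed

lemma graded_maps_closed: "\<lbrakk>f \<in> graded_maps G \<Lambda> M N; x \<in> carrier M\<rbrakk> \<Longrightarrow> f x \<in> carrier N"
  using linear_mapsD(1)[OF graded_mapsD(1)] by metis

lemma graded_maps_ab:
  assumes "f \<in> graded_maps G \<Lambda> M N" "graded_left_module G \<Lambda> M" "graded_left_module G \<Lambda> N"
  shows "f \<zero>\<^bsub>M\<^esub> = \<zero>\<^bsub>N\<^esub>"
    and "\<lbrakk>x \<in> carrier M; y \<in> carrier M\<rbrakk> \<Longrightarrow> f (x \<oplus>\<^bsub>M\<^esub> y) = f x \<oplus>\<^bsub>N\<^esub> f y"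
    and "\<lbrakk>x \<in> carrier M; y \<in> carrier M\<rbrakk> \<Longrightarrow> f (x \<ominus>\<^bsub>M\<^esub> y) = f x \<ominus>\<^bsub>N\<^esub> f y"
proof -
  interpret M: graded_left_module G \<Lambda> M by fact
  interpret N: graded_left_module G \<Lambda> N by fact
  note l = graded_mapsD(1)[OF assms(1)]
  note ab = M.M.abelian_group_axioms N.M.abelian_group_axioms
  show "f \<zero>\<^bsub>M\<^esub> = \<zero>\<^bsub>N\<^esub>" by (rule linear_maps_zero[OF ab l])
  show "\<lbrakk>x \<in> carrier M; y \<in> carrier M\<rbrakk> \<Longrightarrow> f (x \<oplus>\<^bsub>M\<^esub> y) = f x \<oplus>\<^bsub>N\<^esub> f y"
    by (rule linear_mapsD(2)[OF l])
  show "\<lbrakk>x \<in> carrier M; y \<in> carrier M\<rbrakk> \<Longrightarrow> f (x \<ominus>\<^bsub>M\<^esub> y) = f x \<ominus>\<^bsub>N\<^esub> f y"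
    by (rule linear_maps_minus[OF ab l])
qed

lemma graded_left_module_ab: "graded_left_module G \<Lambda> M \<Longrightarrow> abelian_group M"
  by (simp add: graded_left_module_def left_module_def)

lemma (in abelian_group) minus_add_cancel_both [simp]:
  assumes "x \<in> carrier G" "y \<in> carrier G"
  shows "(x \<ominus> y) \<oplus> y = x" "(x \<oplus> y) \<ominus> y = x" "x \<ominus> x = \<zero>"
  using assms by (simp_all add: minus_eq a_assoc l_neg r_neg)

locale resolution = graded_algebra K G \<Lambda>
  for K :: "('k, 'c) ring_scheme" and G :: "real set" and \<Lambda> :: "('k, 'r) gmodule" +
  fixes M :: "('r, 'm) gmodule" and P :: "int \<Rightarrow> ('r, 'p) gmodule" and D :: "int \<Rightarrow> 'p \<Rightarrow> 'p"
    and \<epsilon> :: "'p \<Rightarrow> 'm"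
  assumes M: "graded_left_module G \<Lambda> M" and res: "projective_resolution G \<Lambda> M P D \<epsilon>"
begin

lemma proj: "graded_projective G \<Lambda> (P n)"
  and P_neg: "n < 0 \<Longrightarrow> carrier (P n) = {\<zero>\<^bsub>P n\<^esub>}"
  and D_maps: "D n \<in> graded_maps G \<Lambda> (P n) (P (n - 1))"
  and eps_maps: "\<epsilon> \<in> graded_maps G \<Lambda> (P 0) M"
  using res by (auto simp: projective_resolution_def)

lemma D_maps': "D (n + 1) \<in> graded_maps G \<Lambda> (P (n + 1)) (P n)"
  using D_maps[of "n + 1"] by simp

lemma P_graded: "graded_left_module G \<Lambda> (P n)"
  using proj[of n] by (simp add: graded_projective_def)

text \<open>For \<open>n \<ge> 2\<close> this is contained in exactness at \<open>n - 1\<close>. For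
  smaller \<open>n\<close> the composite ends in a zero module.\<close>

lemma D_D:
  assumes "x \<in> carrier (P n)"
  shows "D (n - 1) (D n x) = \<zero>\<^bsub>P (n - 2)\<^esub>"
proof (cases "n \<ge> 2")
  case True
  then have "n - 1 \<ge> 1" by simp
  then have "D (n - 1 + 1) ` carrier (P (n - 1 + 1)) = {x \<in> carrier (P (n - 1)). D (n - 1) x = \<zero>\<^bsub>P (n - 1 - 1)\<^esub>}"
    using res unfolding projective_resolution_def by blast
  then show ?thesis using assms by (simp add: set_eq_iff image_iff) blast
next
  case False
  then have "carrier (P (n - 2)) = {\<zero>\<^bsub>P (n - 2)\<^esub>}" by (intro P_neg) simp
  then show ?thesis
    using graded_maps_closed[OF D_maps graded_maps_closed[OF D_maps assms]] by simp
qed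

lemma complex: "projective_complex G \<Lambda> P D"
  using proj D_maps D_D by (auto simp: projective_complex_def)

text \<open>The condition for an element of \<open>P\<^sub>k\<close> to be a boundary: the map out of \<open>P\<^sub>0\<close>
  is the augmentation.\<close>

definition aug_zero :: "nat \<Rightarrow> 'p \<Rightarrow> bool" where
  "aug_zero k x \<longleftrightarrow> (if k = 0 then \<epsilon> x = \<zero>\<^bsub>M\<^esub> else D (int k) x = \<zero>\<^bsub>P (int k - 1)\<^esub>)"

text \<open>Exactness in all degrees at once. With it a single induction step covers lifting along
  \<open>D 1\<close>, where cycles are the kernel of \<open>\<epsilon>\<close>, and along the higher
  differentials.\<close>

lemma aug_zero_iff:
  "x \<in> carrier (P (int k)) \<Longrightarrow> aug_zero k x \<longleftrightarrow> x \<in> D (int (Suc k)) ` carrier (P (int (Suc k)))"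
proof -
  have "D (int (Suc k)) ` carrier (P (int (Suc k))) = {x \<in> carrier (P (int k)). aug_zero k x}"
  proof (cases "k = 0")
    case True
    then show ?thesis using res by (simp add: aug_zero_def projective_resolution_def)
  next
    case False
    then have "int k \<ge> 1" by simp
    then have "D (int k + 1) ` carrier (P (int k + 1)) =
        {x \<in> carrier (P (int k)). D (int k) x = \<zero>\<^bsub>P (int k - 1)\<^esub>}"
      using res unfolding projective_resolution_def by blast
    then show ?thesis using False by (simp add: aug_zero_def add.commute)
  qed
  then show "x \<in> carrier (P (int k)) \<Longrightarrow> ?thesis" by blast
qed

lemma eps_D: "x \<in> carrier (P 1) \<Longrightarrow> \<epsilon> (D 1 x) = \<zero>\<^bsub>M\<^esub>"
  using res unfolding projective_resolution_def by blast

lemma lift_step: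
  assumes "graded_projective G \<Lambda> Q" "l \<in> G" "f \<in> graded_maps G \<Lambda> Q (shift l (P (int k)))"
    and "\<And>x. x \<in> carrier Q \<Longrightarrow> aug_zero k (f x)"
  shows "\<exists>h\<in>graded_maps G \<Lambda> Q (shift l (P (int (Suc k)))). \<forall>x\<in>carrier Q. D (int (Suc k)) (h x) = f x"
proof (rule graded_lift[OF assms(1) shift_graded[OF P_graded assms(2)] shift_graded[OF P_graded assms(2)] _ assms(3)])
  show "D (int (Suc k)) \<in> graded_maps G \<Lambda> (shift l (P (int (Suc k)))) (shift l (P (int k)))"
    using graded_maps_shift[OF D_maps[of "int (Suc k)"] assms(2)] by simp
  show "f x \<in> D (int (Suc k)) ` carrier (shift l (P (int (Suc k))))" if "x \<in> carrier Q" for x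
    using graded_maps_closed[OF assms(3) that] assms(4)[OF that] aug_zero_iff[of "f x" k] by simp
qed

lemma lift_eps:
  assumes "graded_projective G \<Lambda> Q" "l \<in> G" "f \<in> graded_maps G \<Lambda> Q (shift l M)"
  shows "\<exists>h\<in>graded_maps G \<Lambda> Q (shift l (P 0)). \<forall>x\<in>carrier Q. \<epsilon> (h x) = f x"
proof (rule graded_lift[OF assms(1) shift_graded[OF P_graded assms(2)] shift_graded[OF M assms(2)] _ assms(3)])
  show "\<epsilon> \<in> graded_maps G \<Lambda> (shift l (P 0)) (shift l M)"
    by (rule graded_maps_shift[OF eps_maps assms(2)])
  show "f x \<in> \<epsilon> ` carrier (shift l (P 0))" if "x \<in> carrier Q" for x
    using graded_maps_closed[OF assms(3) that] res by (simp add: projective_resolution_def)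
qed

text \<open>The existence half of the comparison theorem. Each map of the lift is chosen by
  projectivity from the preceding one, so the whole family comes from dependent choice over the
  natural numbers.\<close>

lemma chain_lifts_exist:
  assumes Q: "projective_complex G \<Lambda> Q DQ" and l: "l \<in> G"
    and \<alpha>: "\<alpha> \<in> graded_maps G \<Lambda> (Q n) (shift l M)"
    and cocycle: "\<And>x. x \<in> carrier (Q (n + 1)) \<Longrightarrow> \<alpha> (DQ (n + 1) x) = \<zero>\<^bsub>M\<^esub>"
  shows "chain_lifts G \<Lambda> Q DQ P D \<epsilon> n l \<alpha> \<noteq> {}"
proof -
  have Qp: "graded_projective G \<Lambda> (Q j)" and Qg: "graded_left_module G \<Lambda> (Q j)"
    and DQ: "DQ j \<in> graded_maps G \<Lambda> (Q j) (Q (j - 1))"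
    and DDQ: "x \<in> carrier (Q j) \<Longrightarrow> DQ (j - 1) (DQ j x) = \<zero>\<^bsub>Q (j - 2)\<^esub>" for j x
    using Q by (auto simp: projective_complex_def graded_projective_def)
  have DQS: "DQ (n + int (Suc k)) \<in> graded_maps G \<Lambda> (Q (n + int (Suc k))) (Q (n + int k))" for k
    using DQ[of "n + int (Suc k)"] by simp
  have DDQS: "DQ (n + int (Suc k)) (DQ (n + int (Suc (Suc k))) x) = \<zero>\<^bsub>Q (n + int k)\<^esub>"
    if "x \<in> carrier (Q (n + int (Suc (Suc k))))" for k x
    using DDQ[OF that] by (simp add: algebra_simps)
  note sP = shift_graded[OF P_graded l]
  \<comment> \<open>The invariant \<open>R\<close> says that the map followed backwards along the
    next differential of \<open>Q\<close> takes values in cycles; by exactness these are boundaries,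
    which is what allows the next lift. For \<open>k = 0\<close> this is the cocycle condition on
    \<open>\<alpha>\<close>.\<close>
  define R where "R k a \<longleftrightarrow> a \<in> graded_maps G \<Lambda> (Q (n + int k)) (shift l (P (int k))) \<and>
    (\<forall>x\<in>carrier (Q (n + int (Suc k))). aug_zero k (a (DQ (n + int (Suc k)) x))) \<and>
    (k = 0 \<longrightarrow> (\<forall>x\<in>carrier (Q n). \<epsilon> (a x) = \<alpha> x))" for k a
  define S where "S k a b \<longleftrightarrow> (\<forall>x\<in>carrier (Q (n + int (Suc k))).
    D (int (Suc k)) (b x) = a (DQ (n + int (Suc k)) x))" for k a b
  have "\<exists>a. \<forall>k. R k (a k) \<and> S k (a k) (a (Suc k))"
  proof (rule dependent_nat_choice)
    obtain a where a: "a \<in> graded_maps G \<Lambda> (Q n) (shift l (P 0))" "\<And>x. x \<in> carrier (Q n) \<Longrightarrow> \<epsilon> (a x) = \<alpha> x"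
      using lift_eps[OF Qp l \<alpha>] by blast
    then have "R 0 a"
      using graded_maps_closed[OF DQS[of 0]] cocycle by (simp add: R_def aug_zero_def)
    then show "\<exists>a. R 0 a" by blast
  next
    fix a k assume a: "R k a"
    let ?f = "compose (carrier (Q (n + int (Suc k)))) a (DQ (n + int (Suc k)))"
    have ag: "a \<in> graded_maps G \<Lambda> (Q (n + int k)) (shift l (P (int k)))" using a by (simp add: R_def)
    have f: "?f \<in> graded_maps G \<Lambda> (Q (n + int (Suc k))) (shift l (P (int k)))"
      by (rule compose_graded_maps[OF DQS ag Qg])
    obtain b where b: "b \<in> graded_maps G \<Lambda> (Q (n + int (Suc k))) (shift l (P (int (Suc k))))"
      "\<And>x. x \<in> carrier (Q (n + int (Suc k))) \<Longrightarrow> D (int (Suc k)) (b x) = a (DQ (n + int (Suc k)) x)"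
      using lift_step[OF Qp l f] a by (auto simp: R_def compose_eq)
    have "D (int (Suc k)) (b (DQ (n + int (Suc (Suc k))) x)) = \<zero>\<^bsub>P (int k)\<^esub>"
      if x: "x \<in> carrier (Q (n + int (Suc (Suc k))))" for x
      using b(2)[OF graded_maps_closed[OF DQS x]] DDQS[OF x] graded_maps_ab(1)[OF ag Qg sP] by simp
    then have "R (Suc k) b" using b(1) by (simp add: R_def aug_zero_def)
    then show "\<exists>b. R (Suc k) b \<and> S k a b" using b(2) by (auto simp: S_def)
  qed
  then obtain a where a: "\<And>k. R k (a k)" "\<And>k. S k (a k) (a (Suc k))" by blast
  \<comment> \<open>In negative degrees the target is a zero module, and the zero map is the only
    candidate.\<close>
  define \<alpha>' where "\<alpha>' k = (if k \<ge> 0 then a (nat k) else (\<lambda>x\<in>carrier (Q (n + k)). \<zero>\<^bsub>P k\<^esub>))" for k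
  have "\<alpha>' k \<in> graded_maps G \<Lambda> (Q (n + k)) (shift l (P k))" for k
    using a(1)[of "nat k"] graded_maps_zero[OF Qg sP, of k "n + k"] by (auto simp: \<alpha>'_def R_def)
  moreover have "D k (\<alpha>' k x) = \<alpha>' (k - 1) (DQ (n + k) x)" if "k \<ge> 1" "x \<in> carrier (Q (n + k))" for k x
  proof -
    have "int (Suc (nat (k - 1))) = k" "Suc (nat (k - 1)) = nat k" using that(1) by auto
    then show ?thesis using a(2)[of "nat (k - 1)"] that by (simp add: \<alpha>'_def S_def)
  qed
  moreover have "\<epsilon> (\<alpha>' 0 x) = \<alpha> x" if "x \<in> carrier (Q n)" for x
    using a(1)[of 0] that by (simp add: \<alpha>'_def R_def)
  ultimately have "\<alpha>' \<in> chain_lifts G \<Lambda> Q DQ P D \<epsilon> n l \<alpha>" by (simp add: chain_lifts_def)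
  then show ?thesis by blast
qed

text \<open>A chain map over a coboundary is null-homotopic up to that coboundary, and a cocycle kills
  the summand of the homotopy formula that ends in \<open>D\<close>.\<close>

lemma pairing_coboundary:
  assumes Q: "projective_complex G \<Lambda> Q DQ" and l: "l \<in> G" and s: "s \<in> G"
    and \<alpha>: "\<And>k. \<alpha> k \<in> graded_maps G \<Lambda> (Q (n + k)) (shift l (P k))"
    and chain: "\<And>k x. \<lbrakk>k \<ge> 1; x \<in> carrier (Q (n + k))\<rbrakk> \<Longrightarrow> D k (\<alpha> k x) = \<alpha> (k - 1) (DQ (n + k) x)"
    and \<gamma>: "\<gamma> \<in> graded_maps G \<Lambda> (Q (n - 1)) (shift l M)"
    and bdry: "\<And>x. x \<in> carrier (Q n) \<Longrightarrow> \<epsilon> (\<alpha> 0 x) = \<gamma> (DQ n x)"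
    and \<beta>: "\<beta> \<in> graded_maps G \<Lambda> (P m) (shift s M)"
    and cocycle: "\<And>y. y \<in> carrier (P (m + 1)) \<Longrightarrow> \<beta> (D (m + 1) y) = \<zero>\<^bsub>M\<^esub>"
  shows "\<exists>\<eta>\<in>graded_maps G \<Lambda> (Q (m + n - 1)) (shift (s + l) M).
    \<forall>x\<in>carrier (Q (m + n)). \<beta> (\<alpha> m x) = \<eta> (DQ (m + n) x)"
proof -
  have Qp: "graded_projective G \<Lambda> (Q j)" and Qg: "graded_left_module G \<Lambda> (Q j)"
    and DQ: "DQ j \<in> graded_maps G \<Lambda> (Q j) (Q (j - 1))"
    and DDQ: "x \<in> carrier (Q j) \<Longrightarrow> DQ (j - 1) (DQ j x) = \<zero>\<^bsub>Q (j - 2)\<^esub>" for j x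
    using Q by (auto simp: projective_complex_def graded_projective_def)
  note sP = shift_graded[OF P_graded l]
  note sM = shift_graded[OF M plus_in[OF s l]] shift_graded[OF M s] shift_graded[OF M l]
  show ?thesis
  proof (cases "m < 0")
    case True
    have "\<alpha> m x = \<zero>\<^bsub>P m\<^esub>" if "x \<in> carrier (Q (m + n))" for x
      using graded_maps_closed[OF \<alpha>[of m]] that P_neg[OF True] by (simp add: add.commute)
    then have "\<beta> (\<alpha> m x) = \<zero>\<^bsub>M\<^esub>" if "x \<in> carrier (Q (m + n))" for x
      using graded_maps_ab(1)[OF \<beta> P_graded sM(2)] that by simp
    then show ?thesis
      using graded_maps_zero[OF Qg sM(1), of "m + n - 1"] graded_maps_closed[OF DQ]
      by (intro bexI[of _ "\<lambda>x\<in>carrier (Q (m + n - 1)). \<zero>\<^bsub>M\<^esub>"]) auto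
  next
    case False
    \<comment> \<open>\<open>f k h\<close> is the part of \<open>\<alpha> k\<close> that the
      homotopy constructed so far does not account for. Lifting it along \<open>D\<close> yields the
      next map of the homotopy, so that \<open>\<alpha> k = h k DQ + D h (k + 1)\<close>.\<close>
    define f where "f k h = (\<lambda>x\<in>carrier (Q (n + int k)). \<alpha> (int k) x \<ominus>\<^bsub>P (int k)\<^esub> h (DQ (n + int k) x))" for k h
    define R where "R k h \<longleftrightarrow> h \<in> graded_maps G \<Lambda> (Q (n + int k - 1)) (shift l (P (int k))) \<and>
      (\<forall>x\<in>carrier (Q (n + int k)). aug_zero k (f k h x))" for k h
    define S where "S k h h' \<longleftrightarrow> (\<forall>x\<in>carrier (Q (n + int k)). D (int (Suc k)) (h' x) = f k h x)" for k h h'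
    have f: "f k h \<in> graded_maps G \<Lambda> (Q (n + int k)) (shift l (P (int k)))"
      if "h \<in> graded_maps G \<Lambda> (Q (n + int k - 1)) (shift l (P (int k)))" for k h
    proof -
      have "f k h = (\<lambda>x\<in>carrier (Q (n + int k)). \<alpha> (int k) x \<ominus>\<^bsub>shift l (P (int k))\<^esub>
          compose (carrier (Q (n + int k))) h (DQ (n + int k)) x)"
        unfolding f_def by (rule restrict_ext) (simp add: compose_eq)
      then show ?thesis
        using graded_maps_minus[OF Qg sP \<alpha> compose_graded_maps[OF DQ that Qg]] by simp
    qed
    have "\<exists>h. \<forall>k. R k (h k) \<and> S k (h k) (h (Suc k))"
    proof (rule dependent_nat_choice)
      \<comment> \<open>The homotopy begins with a lift of \<open>\<gamma>\<close> along the
        augmentation instead of the zero map; this absorbs the coboundary \<open>\<gamma> DQ\<close>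
        over which the chain map lies.\<close>
      obtain h where h: "h \<in> graded_maps G \<Lambda> (Q (n - 1)) (shift l (P 0))"
          "\<And>x. x \<in> carrier (Q (n - 1)) \<Longrightarrow> \<epsilon> (h x) = \<gamma> x"
        using lift_eps[OF Qp l \<gamma>] by blast
      have "\<epsilon> (f 0 h x) = \<zero>\<^bsub>M\<^esub>" if x: "x \<in> carrier (Q n)" for x
      proof -
        have c: "DQ n x \<in> carrier (Q (n - 1))" by (rule graded_maps_closed[OF DQ x])
        have "\<epsilon> (f 0 h x) = \<epsilon> (\<alpha> 0 x) \<ominus>\<^bsub>M\<^esub> \<epsilon> (h (DQ n x))"
          using graded_maps_ab(3)[OF eps_maps P_graded M] graded_maps_closed[OF \<alpha>[of 0]]
            graded_maps_closed[OF h(1) c] x by (simp add: f_def)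
        then show ?thesis
          using bdry[OF x] h(2)[OF c] graded_maps_closed[OF \<gamma> c]
            abelian_group.minus_add_cancel_both(3)[OF graded_left_module_ab[OF M]] by simp
      qed
      then have "R 0 h" using h(1) by (simp add: R_def aug_zero_def)
      then show "\<exists>h. R 0 h" by blast
    next
      fix h k assume h: "R k h"
      then have hg: "h \<in> graded_maps G \<Lambda> (Q (n + int k - 1)) (shift l (P (int k)))" by (simp add: R_def)
      obtain h' where h': "h' \<in> graded_maps G \<Lambda> (Q (n + int k)) (shift l (P (int (Suc k))))"
          "\<And>x. x \<in> carrier (Q (n + int k)) \<Longrightarrow> D (int (Suc k)) (h' x) = f k h x"
        using lift_step[OF Qp l f[OF hg]] h by (auto simp: R_def)
      \<comment> \<open>The new defect is a cycle: \<open>D\<close> sends both of its terms to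
        \<open>\<alpha> k (DQ x)\<close>, the second one because the older part of the homotopy is
        evaluated at \<open>DQ (DQ x) = 0\<close>.\<close>
      have "D (int (Suc k)) (f (Suc k) h' x) = \<zero>\<^bsub>P (int k)\<^esub>"
        if x: "x \<in> carrier (Q (n + int (Suc k)))" for x
      proof -
        have c: "DQ (n + int (Suc k)) x \<in> carrier (Q (n + int k))"
          using graded_maps_closed[OF DQ x] by simp
        have DS: "D (int (Suc k)) \<in> graded_maps G \<Lambda> (P (int (Suc k))) (P (int k))"
          using D_maps[of "int (Suc k)"] by simp
        have a: "\<alpha> (int (Suc k)) x \<in> carrier (P (int (Suc k)))"
          using graded_maps_closed[OF \<alpha> x] by simp
        have b: "\<alpha> (int k) (DQ (n + int (Suc k)) x) \<in> carrier (P (int k))"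
          using graded_maps_closed[OF \<alpha> c] by simp
        have "D (int (Suc k)) (f (Suc k) h' x) =
            D (int (Suc k)) (\<alpha> (int (Suc k)) x) \<ominus>\<^bsub>P (int k)\<^esub> D (int (Suc k)) (h' (DQ (n + int (Suc k)) x))"
          using graded_maps_ab(3)[OF DS P_graded P_graded a] graded_maps_closed[OF h'(1) c] x
          by (simp add: f_def)
        also have "D (int (Suc k)) (\<alpha> (int (Suc k)) x) = \<alpha> (int k) (DQ (n + int (Suc k)) x)"
          using chain[of "int (Suc k)" x] x by simp
        also have "D (int (Suc k)) (h' (DQ (n + int (Suc k)) x)) = f k h (DQ (n + int (Suc k)) x)"
          by (rule h'(2)[OF c])
        also have "\<dots> = \<alpha> (int k) (DQ (n + int (Suc k)) x)"
        proof -
          have "h (DQ (n + int k) (DQ (n + int (Suc k)) x)) = \<zero>\<^bsub>P (int k)\<^esub>"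
            using DDQ[OF x] graded_maps_ab(1)[OF hg Qg sP] by simp
          then show ?thesis
            using c b abelian_group.minus_eq[OF graded_left_module_ab[OF P_graded]]
              abelian_group.minus_add_cancel_both(2)[OF graded_left_module_ab[OF P_graded], of _ "int k" "\<zero>\<^bsub>P (int k)\<^esub>"]
              abelian_group.axioms(1)[OF graded_left_module_ab[OF P_graded]]
            by (simp add: f_def abelian_monoid.zero_closed abelian_monoid.r_zero)
        qed
        finally show ?thesis
          using abelian_group.minus_add_cancel_both(3)[OF graded_left_module_ab[OF P_graded] b b] by simp
      qed
      then have "R (Suc k) h'" using h'(1) by (simp add: R_def aug_zero_def)
      then show "\<exists>h'. R (Suc k) h' \<and> S k h h'" using h'(2) by (auto simp: S_def)
    qed
    then obtain h where h: "\<And>k. R k (h k)" "\<And>k. S k (h k) (h (Suc k))" by blast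
    define k where "k = nat m"
    have m: "m = int k" using False by (simp add: k_def)
    have hg: "h k \<in> graded_maps G \<Lambda> (Q (n + int k - 1)) (shift l (P m))" using h(1)[of k] by (simp add: R_def m)
    have hg': "h (Suc k) \<in> graded_maps G \<Lambda> (Q (n + int k)) (shift l (P (m + 1)))"
      using h(1)[of "Suc k"] by (simp add: R_def m add.commute)
    let ?\<eta> = "compose (carrier (Q (n + int k - 1))) \<beta> (h k)"
    have \<beta>': "\<beta> \<in> graded_maps G \<Lambda> (shift l (P m)) (shift (s + l) M)"
      using graded_maps_shift[OF \<beta> l] by (simp add: add.commute)
    have "?\<eta> \<in> graded_maps G \<Lambda> (Q (n + int k - 1)) (shift (s + l) M)"
      by (rule compose_graded_maps[OF hg \<beta>' Qg])
    moreover have "\<beta> (\<alpha> m x) = ?\<eta> (DQ (m + n) x)" if "x \<in> carrier (Q (m + n))" for x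
    proof -
      have x: "x \<in> carrier (Q (n + int k))" using that by (simp add: m add.commute)
      have c: "DQ (n + int k) x \<in> carrier (Q (n + int k - 1))" by (rule graded_maps_closed[OF DQ x])
      have hc: "h k (DQ (n + int k) x) \<in> carrier (P m)" using graded_maps_closed[OF hg c] by simp
      have hc': "h (Suc k) x \<in> carrier (P (m + 1))" using graded_maps_closed[OF hg' x] by simp
      have ac: "\<alpha> m x \<in> carrier (P m)" using graded_maps_closed[OF \<alpha>[of m]] x m by simp
      have "D (m + 1) (h (Suc k) x) = \<alpha> m x \<ominus>\<^bsub>P m\<^esub> h k (DQ (n + int k) x)"
        using h(2)[of k] x by (simp add: S_def f_def m add.commute)
      then have "\<zero>\<^bsub>M\<^esub> = \<beta> (\<alpha> m x) \<ominus>\<^bsub>M\<^esub> \<beta> (h k (DQ (n + int k) x))"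
        using cocycle[OF hc'] graded_maps_ab(3)[OF \<beta> P_graded sM(2) ac hc] by simp
      moreover have "\<beta> (\<alpha> m x) \<in> carrier M" "\<beta> (h k (DQ (n + int k) x)) \<in> carrier M"
        using graded_maps_closed[OF \<beta>] ac hc by simp_all
      ultimately have "\<beta> (\<alpha> m x) = \<beta> (h k (DQ (n + int k) x))"
        using abelian_group.minus_add_cancel_both(1)[OF graded_left_module_ab[OF M]]
          abelian_monoid.l_zero[OF abelian_group.axioms(1)[OF graded_left_module_ab[OF M]]] by metis
      then show ?thesis using c by (simp add: compose_eq m add.commute)
    qed
    ultimately show ?thesis
      by (intro bexI[of _ ?\<eta>]) (simp_all add: m add.commute)
  qed
qed

end

section \<open>The Yoneda algebra does not depend on the resolution\<close>

lemma chain_liftsD: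
  assumes "a \<in> chain_lifts G \<Lambda> Q DQ P D \<epsilon> n l \<alpha>"
  shows "a k \<in> graded_maps G \<Lambda> (Q (n + k)) (shift l (P k))"
    and "\<lbrakk>k \<ge> 1; x \<in> carrier (Q (n + k))\<rbrakk> \<Longrightarrow> D k (a k x) = a (k - 1) (DQ (n + k) x)"
    and "x \<in> carrier (Q n) \<Longrightarrow> \<epsilon> (a 0 x) = \<alpha> x"
    and "x \<in> carrier (Q (n + k)) \<Longrightarrow> a k x \<in> carrier (P k)"
  using assms graded_maps_closed[of "a k" G \<Lambda> "Q (n + k)" "shift l (P k)" x] by (auto simp: chain_lifts_def)

context resolution
begin

abbreviation "HC l \<equiv> hom_complex G \<Lambda> P (shift l M)"
abbreviation "dH \<equiv> hom_diff P D"
abbreviation "ycls \<equiv> yoneda_class G \<Lambda> M P D"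

lemma hom_complex_simps:
  "carrier (hom_complex G \<Lambda> P N n) = graded_maps G \<Lambda> (P n) N"
  "zero (hom_complex G \<Lambda> P N n) = (\<lambda>x\<in>carrier (P n). \<zero>\<^bsub>N\<^esub>)"
  "f \<oplus>\<^bsub>hom_complex G \<Lambda> P N n\<^esub> f' = (\<lambda>x\<in>carrier (P n). f x \<oplus>\<^bsub>N\<^esub> f' x)"
  "k \<odot>\<^bsub>hom_complex G \<Lambda> P N n\<^esub> f = (\<lambda>x\<in>carrier (P n). scalar k \<odot>\<^bsub>N\<^esub> f x)"
  by (simp_all add: hom_complex_def)

lemma hom_diff_apply: "x \<in> carrier (P (n + 1)) \<Longrightarrow> dH n f x = f (D (n + 1) x)"
  by (simp add: hom_diff_def compose_eq)

lemma D_closed: "x \<in> carrier (P (n + 1)) \<Longrightarrow> D (n + 1) x \<in> carrier (P n)"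
  by (rule graded_maps_closed[OF D_maps'])

lemma hom_diff_closed:
  "f \<in> graded_maps G \<Lambda> (P n) N \<Longrightarrow> dH n f \<in> graded_maps G \<Lambda> (P (n + 1)) N"
  unfolding hom_diff_def by (rule compose_graded_maps[OF D_maps' _ P_graded])

lemma cochain:
  assumes "l \<in> G"
  shows "cochain_complex K (HC l) dH"
proof (intro cochain_complex.intro cochain_complex_axioms.intro K.ring_axioms)
  note sM = shift_graded[OF M assms]
  show "left_module K (HC l n)" for n
    unfolding hom_complex_def by (rule graded_hom_left_module[OF P_graded sM])
  show "restrict (dH n) (carrier (HC l n)) \<in> linear_maps K (HC l n) (HC l (n + 1))" for n
  proof (rule linear_mapsI)
    interpret H: left_module K "HC l n"
      unfolding hom_complex_def by (rule graded_hom_left_module[OF P_graded sM])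
    show "restrict (dH n) (carrier (HC l n)) \<in> carrier (HC l n) \<rightarrow>\<^sub>E carrier (HC l (n + 1))"
      using hom_diff_closed by (auto simp: hom_complex_simps)
    show "restrict (dH n) (carrier (HC l n)) (f \<oplus>\<^bsub>HC l n\<^esub> f') =
        restrict (dH n) (carrier (HC l n)) f \<oplus>\<^bsub>HC l (n + 1)\<^esub> restrict (dH n) (carrier (HC l n)) f'"
      if "f \<in> carrier (HC l n)" "f' \<in> carrier (HC l n)" for f f'
      using that H.M.a_closed[OF that] D_closed[of _ n]
      by (simp add: hom_complex_simps hom_diff_def compose_def cong: restrict_cong)
    show "restrict (dH n) (carrier (HC l n)) (k \<odot>\<^bsub>HC l n\<^esub> f) =
        k \<odot>\<^bsub>HC l (n + 1)\<^esub> restrict (dH n) (carrier (HC l n)) f"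
      if "k \<in> carrier K" "f \<in> carrier (HC l n)" for k f
      using that H.smult_closed[OF that] D_closed[of _ n]
      by (simp add: hom_complex_simps hom_diff_def compose_def cong: restrict_cong)
  qed
  show "dH n (dH (n - 1) f) = \<zero>\<^bsub>HC l (n + 1)\<^esub>" if "f \<in> carrier (HC l (n - 1))" for n f
  proof -
    have f: "f \<in> graded_maps G \<Lambda> (P (n - 1)) (shift l M)" using that by (simp add: hom_complex_simps)
    have "f (D n (D (n + 1) x)) = \<zero>\<^bsub>M\<^esub>" if "x \<in> carrier (P (n + 1))" for x
      using D_D[OF that] graded_maps_ab(1)[OF f P_graded sM] by simp
    then show ?thesis
      using D_closed[of _ n] by (simp add: hom_complex_simps hom_diff_def compose_def cong: restrict_cong)
  qed
qed

lemma cocycles_iff: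
  "\<alpha> \<in> cocycles (HC l) dH n \<longleftrightarrow>
    \<alpha> \<in> graded_maps G \<Lambda> (P n) (shift l M) \<and> (\<forall>x\<in>carrier (P (n + 1)). \<alpha> (D (n + 1) x) = \<zero>\<^bsub>M\<^esub>)"
  by (auto simp: cocycles_def hom_complex_simps hom_diff_def compose_def fun_eq_iff restrict_def)

lemma coboundaryI:
  assumes "\<alpha> \<in> graded_maps G \<Lambda> (P n) (shift l M)" "\<gamma> \<in> graded_maps G \<Lambda> (P (n - 1)) (shift l M)"
    and "\<And>x. x \<in> carrier (P n) \<Longrightarrow> \<alpha> x = \<gamma> (D n x)"
  shows "\<alpha> \<in> coboundaries (HC l) dH n"
proof -
  have "\<alpha> = dH (n - 1) \<gamma>"
    by (rule extensionalityI[of _ "carrier (P n)"])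
      (use assms linear_maps_extensional[OF graded_mapsD(1)[OF assms(1)]] in
        \<open>auto simp: hom_diff_def compose_eq\<close>)
  then show ?thesis using assms(2) by (auto simp: coboundaries_def hom_complex_simps)
qed

lemma coboundaryE:
  assumes "\<alpha> \<in> coboundaries (HC l) dH n"
  obtains \<gamma> where "\<gamma> \<in> graded_maps G \<Lambda> (P (n - 1)) (shift l M)"
    and "\<And>x. x \<in> carrier (P n) \<Longrightarrow> \<alpha> x = \<gamma> (D n x)"
  using assms by (auto simp: coboundaries_def hom_complex_simps hom_diff_def compose_eq)

lemma class_eqI:
  assumes l: "l \<in> G" and a: "\<alpha> \<in> cocycles (HC l) dH n" "\<alpha>' \<in> cocycles (HC l) dH n"
    and g: "\<gamma> \<in> graded_maps G \<Lambda> (P (n - 1)) (shift l M)"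
    and eq: "\<And>x. x \<in> carrier (P n) \<Longrightarrow> \<alpha>' x = \<gamma> (D n x) \<oplus>\<^bsub>M\<^esub> \<alpha> x"
  shows "ycls n l \<alpha>' = ycls n l \<alpha>"
proof -
  interpret H: cochain_complex K "HC l" dH by (rule cochain[OF l])
  let ?b = "dH (n - 1) \<gamma>"
  have b: "?b \<in> coboundaries (HC l) dH n" using g by (auto simp: coboundaries_def hom_complex_simps)
  have "\<alpha>' = ?b \<oplus>\<^bsub>HC l n\<^esub> \<alpha>"
    by (rule extensionalityI[of _ "carrier (P n)"])
      (use a eq linear_maps_extensional[OF graded_mapsD(1)] in
        \<open>auto simp: hom_complex_simps hom_diff_def compose_eq cocycles_iff\<close>)
  then show ?thesis
    unfolding yoneda_class_def using H.class_eq_iff[OF a] b by blast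
qed

lemma class_memE:
  assumes l: "l \<in> G" and a: "\<alpha> \<in> cocycles (HC l) dH n" and a': "\<alpha>' \<in> ycls n l \<alpha>"
  obtains \<gamma> where "\<gamma> \<in> graded_maps G \<Lambda> (P (n - 1)) (shift l M)"
    and "\<And>x. x \<in> carrier (P n) \<Longrightarrow> \<alpha>' x = \<gamma> (D n x) \<oplus>\<^bsub>M\<^esub> \<alpha> x" and "\<alpha>' \<in> cocycles (HC l) dH n"
proof -
  interpret H: cochain_complex K "HC l" dH by (rule cochain[OF l])
  obtain b where b: "b \<in> coboundaries (HC l) dH n" "\<alpha>' = b \<oplus>\<^bsub>HC l n\<^esub> \<alpha>"
    using a' unfolding yoneda_class_def H.class_mem by blast
  obtain \<gamma> where \<gamma>: "\<gamma> \<in> graded_maps G \<Lambda> (P (n - 1)) (shift l M)" "\<And>x. x \<in> carrier (P n) \<Longrightarrow> b x = \<gamma> (D n x)"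
    by (rule coboundaryE[OF b(1)]) blast
  have "\<alpha>' \<in> cocycles (HC l) dH n"
    using H.class_subset[OF a] a' by (auto simp: yoneda_class_def)
  then show thesis using that[OF \<gamma>(1)] \<gamma>(2) b(2) by (simp add: hom_complex_simps)
qed

lemma eps_cocycle: "\<epsilon> \<in> cocycles (HC 0) dH 0"
  unfolding cocycles_iff using eps_maps eps_D by simp

text \<open>Lifts are required to commute with the differentials only for \<open>k \<ge> 1\<close>.
  For \<open>k \<le> 0\<close> both sides lie in the zero module \<open>P (k - 1)\<close>. The
  remaining degrees matter because the product is formed for every integer \<open>m\<close>.\<close>

lemma chain_all:
  assumes Q: "projective_complex G \<Lambda> Q DQ" and a: "a \<in> chain_lifts G \<Lambda> Q DQ P D \<epsilon> n l \<alpha>"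
    and x: "x \<in> carrier (Q (n + k))"
  shows "D k (a k x) = a (k - 1) (DQ (n + k) x)"
proof (cases "k \<ge> 1")
  case False
  have DQ: "DQ (n + k) x \<in> carrier (Q (n + (k - 1)))"
    using Q graded_maps_closed[OF _ x, of "DQ (n + k)" G \<Lambda> "Q (n + k - 1)"]
    by (simp add: projective_complex_def algebra_simps)
  have "carrier (P (k - 1)) = {\<zero>\<^bsub>P (k - 1)\<^esub>}" using False by (intro P_neg) simp
  then show ?thesis
    using graded_maps_closed[OF D_maps chain_liftsD(4)[OF a x]] chain_liftsD(4)[OF a DQ] by simp
qed (use chain_liftsD(2)[OF a _ x] in simp)

text \<open>The difference \<open>t\<close> of the two lifts is a chain map lying over the
  coboundary \<open>\<gamma> DQ\<close>, so \<open>pairing_coboundary\<close> applies to it. This is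
  independence of the product from both the representative of the lifted class and the lift.\<close>

lemma pairing_unique:
  assumes Q: "projective_complex G \<Lambda> Q DQ" and l: "l \<in> G" and s: "s \<in> G"
    and a: "a \<in> chain_lifts G \<Lambda> Q DQ P D \<epsilon> n l \<phi>" and a': "a' \<in> chain_lifts G \<Lambda> Q DQ P D \<epsilon> n l \<phi>'"
    and \<gamma>: "\<gamma> \<in> graded_maps G \<Lambda> (Q (n - 1)) (shift l M)"
    and eq: "\<And>x. x \<in> carrier (Q n) \<Longrightarrow> \<phi> x = \<gamma> (DQ n x) \<oplus>\<^bsub>M\<^esub> \<phi>' x"
    and \<beta>: "\<beta> \<in> cocycles (HC s) dH m"
  shows "\<exists>\<eta>\<in>graded_maps G \<Lambda> (Q (m + n - 1)) (shift (s + l) M).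
    \<forall>x\<in>carrier (Q (m + n)). \<beta> (a m x) = \<eta> (DQ (m + n) x) \<oplus>\<^bsub>M\<^esub> \<beta> (a' m x)"
proof -
  interpret M: graded_left_module G \<Lambda> M by (rule M)
  have Qg: "graded_left_module G \<Lambda> (Q j)" and DQ: "DQ j \<in> graded_maps G \<Lambda> (Q j) (Q (j - 1))" for j
    using Q by (auto simp: projective_complex_def graded_projective_def)
  note sP = shift_graded[OF P_graded l]
  have \<beta>m: "\<beta> \<in> graded_maps G \<Lambda> (P m) (shift s M)"
    and \<beta>c: "y \<in> carrier (P (m + 1)) \<Longrightarrow> \<beta> (D (m + 1) y) = \<zero>\<^bsub>M\<^esub>" for y
    using \<beta> by (auto simp: cocycles_iff)
  define t where "t k = (\<lambda>x\<in>carrier (Q (n + k)). a k x \<ominus>\<^bsub>P k\<^esub> a' k x)" for k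
  have ts: "t k \<in> graded_maps G \<Lambda> (Q (n + k)) (shift l (P k))" for k
    using graded_maps_minus[OF Qg sP chain_liftsD(1)[OF a] chain_liftsD(1)[OF a']] by (simp add: t_def)
  have "\<exists>\<eta>\<in>graded_maps G \<Lambda> (Q (m + n - 1)) (shift (s + l) M).
    \<forall>x\<in>carrier (Q (m + n)). \<beta> (t m x) = \<eta> (DQ (m + n) x)"
  proof (rule pairing_coboundary[where \<alpha> = t, OF Q l s ts _ \<gamma> _ \<beta>m \<beta>c])
    fix k x assume k: "1 \<le> k" and x: "x \<in> carrier (Q (n + k))"
    have DQx: "DQ (n + k) x \<in> carrier (Q (n + (k - 1)))"
      using graded_maps_closed[OF DQ x] by (simp add: algebra_simps)
    then show "D k (t k x) = t (k - 1) (DQ (n + k) x)"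
      using graded_maps_ab(3)[OF D_maps P_graded P_graded chain_liftsD(4)[OF a x] chain_liftsD(4)[OF a' x]]
        chain_liftsD(2)[OF a k x] chain_liftsD(2)[OF a' k x] x by (simp add: t_def)
  next
    fix x assume x: "x \<in> carrier (Q n)"
    then have x': "x \<in> carrier (Q (n + 0))" by simp
    have c: "\<phi>' x \<in> carrier M" "\<gamma> (DQ n x) \<in> carrier M"
      using graded_maps_closed[OF eps_maps chain_liftsD(4)[OF a' x']] chain_liftsD(3)[OF a' x]
        graded_maps_closed[OF \<gamma> graded_maps_closed[OF DQ x]] by simp_all
    have "\<epsilon> (t 0 x) = \<phi> x \<ominus>\<^bsub>M\<^esub> \<phi>' x"
      using graded_maps_ab(3)[OF eps_maps P_graded M chain_liftsD(4)[OF a x'] chain_liftsD(4)[OF a' x']]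
        chain_liftsD(3)[OF a x] chain_liftsD(3)[OF a' x] x by (simp add: t_def)
    then show "\<epsilon> (t 0 x) = \<gamma> (DQ n x)" using eq[OF x] c by simp
  qed
  then obtain \<eta> where \<eta>: "\<eta> \<in> graded_maps G \<Lambda> (Q (m + n - 1)) (shift (s + l) M)"
    "\<And>x. x \<in> carrier (Q (m + n)) \<Longrightarrow> \<beta> (t m x) = \<eta> (DQ (m + n) x)" by blast
  have "\<beta> (a m x) = \<eta> (DQ (m + n) x) \<oplus>\<^bsub>M\<^esub> \<beta> (a' m x)" if x: "x \<in> carrier (Q (m + n))" for x
  proof -
    have x': "x \<in> carrier (Q (n + m))" using x by (simp add: add.commute)
    have "\<beta> (t m x) = \<beta> (a m x) \<ominus>\<^bsub>M\<^esub> \<beta> (a' m x)"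
      using graded_maps_ab(3)[OF \<beta>m P_graded shift_graded[OF M s] chain_liftsD(4)[OF a x'] chain_liftsD(4)[OF a' x']]
        x' by (simp add: t_def)
    then show ?thesis
      using \<eta>(2)[OF x] graded_maps_closed[OF \<beta>m chain_liftsD(4)[OF a x']]
        graded_maps_closed[OF \<beta>m chain_liftsD(4)[OF a' x']] M.M.minus_add_cancel_both(1) by simp
  qed
  then show ?thesis using \<eta>(1) by blast
qed

lemma pairing_unique':
  assumes Q: "projective_complex G \<Lambda> Q DQ" and l: "l \<in> G" and s: "s \<in> G"
    and a: "a \<in> chain_lifts G \<Lambda> Q DQ P D \<epsilon> n l \<phi>" and a': "a' \<in> chain_lifts G \<Lambda> Q DQ P D \<epsilon> n l \<phi>"
    and \<beta>: "\<beta> \<in> cocycles (HC s) dH m"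
  shows "\<exists>\<eta>\<in>graded_maps G \<Lambda> (Q (m + n - 1)) (shift (s + l) M).
    \<forall>x\<in>carrier (Q (m + n)). \<beta> (a m x) = \<eta> (DQ (m + n) x) \<oplus>\<^bsub>M\<^esub> \<beta> (a' m x)"
proof -
  interpret M: graded_left_module G \<Lambda> M by (rule M)
  have Qg: "graded_left_module G \<Lambda> (Q j)" and DQ: "DQ j \<in> graded_maps G \<Lambda> (Q j) (Q (j - 1))" for j
    using Q by (auto simp: projective_complex_def graded_projective_def)
  have "\<phi> x \<in> carrier M" if "x \<in> carrier (Q n)" for x
    using graded_maps_closed[OF eps_maps chain_liftsD(4)[OF a, of x 0]] chain_liftsD(3)[OF a, of x] that by simp
  then show ?thesis
    using graded_maps_closed[OF DQ]
    by (intro pairing_unique[OF Q l s a a' graded_maps_zero[OF Qg shift_graded[OF M l]] _ \<beta>]) simp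
qed

lemma product_cocycle:
  assumes l: "l \<in> G" and s: "s \<in> G" and Q: "projective_complex G \<Lambda> Q DQ"
    and a: "a \<in> chain_lifts G \<Lambda> Q DQ P D \<epsilon> n l \<phi>" and \<beta>: "\<beta> \<in> cocycles (HC s) dH m"
  shows "compose (carrier (Q (m + n))) \<beta> (a m) \<in> graded_maps G \<Lambda> (Q (m + n)) (shift (s + l) M)"
    and "x \<in> carrier (Q (m + n + 1)) \<Longrightarrow>
      compose (carrier (Q (m + n))) \<beta> (a m) (DQ (m + n + 1) x) = \<zero>\<^bsub>M\<^esub>"
proof -
  have Qg: "graded_left_module G \<Lambda> (Q j)" and DQ: "DQ j \<in> graded_maps G \<Lambda> (Q j) (Q (j - 1))" for j
    using Q by (auto simp: projective_complex_def graded_projective_def)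
  have "\<beta> \<in> graded_maps G \<Lambda> (shift l (P m)) (shift (s + l) M)"
    using graded_maps_shift[OF _ l, of \<beta> "P m" "shift s M"] \<beta> by (simp add: cocycles_iff add.commute)
  moreover have "a m \<in> graded_maps G \<Lambda> (Q (m + n)) (shift l (P m))"
    using chain_liftsD(1)[OF a, of m] by (simp add: add.commute)
  ultimately show "compose (carrier (Q (m + n))) \<beta> (a m) \<in> graded_maps G \<Lambda> (Q (m + n)) (shift (s + l) M)"
    by (rule compose_graded_maps[OF _ _ Qg, rotated])
  assume "x \<in> carrier (Q (m + n + 1))"
  then have x: "x \<in> carrier (Q (n + (m + 1)))" by (simp add: algebra_simps)
  have "DQ (n + (m + 1)) x \<in> carrier (Q (m + n))" using graded_maps_closed[OF DQ x] by (simp add: algebra_simps)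
  moreover have "D (m + 1) (a (m + 1) x) = a m (DQ (n + (m + 1)) x)" using chain_all[OF Q a x] by simp
  then have "\<beta> (a m (DQ (n + (m + 1)) x)) = \<zero>\<^bsub>M\<^esub>"
    using chain_liftsD(4)[OF a x] \<beta> unfolding cocycles_iff by metis
  ultimately show "compose (carrier (Q (m + n))) \<beta> (a m) (DQ (m + n + 1) x) = \<zero>\<^bsub>M\<^esub>"
    by (simp add: compose_eq algebra_simps)
qed

text \<open>The product is a union over representatives and lifts, and the content is that all
  members of this union coincide. A change of \<open>\<alpha>\<close> or of its lift is handled by
  \<open>pairing_unique\<close>, a change of \<open>\<beta>\<close> by the commutation of lifts with
  differentials.\<close>

lemma yoneda_mult_class:
  assumes l: "l \<in> G" and s: "s \<in> G"
    and \<beta>: "\<beta> \<in> cocycles (HC s) dH m" and \<alpha>: "\<alpha> \<in> cocycles (HC l) dH n"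
    and a: "a \<in> yoneda_lifts G \<Lambda> P D \<epsilon> n l \<alpha>"
  shows "compose (carrier (P (m + n))) \<beta> (a m) \<in> cocycles (HC (s + l)) dH (m + n)"
    and "yoneda_mult G \<Lambda> M P D \<epsilon> m s n l (ycls m s \<beta>) (ycls n l \<alpha>) =
      ycls (m + n) (s + l) (compose (carrier (P (m + n))) \<beta> (a m))"
proof -
  interpret M: graded_left_module G \<Lambda> M by (rule M)
  note a' = a[unfolded yoneda_lifts_eq]
  have sl: "s + l \<in> G" using plus_in[OF s l] .
  note sM = shift_graded[OF M sl]
  have coc: "compose (carrier (P (m + n))) b (c m) \<in> cocycles (HC (s + l)) dH (m + n)"
    if "b \<in> cocycles (HC s) dH m" "c \<in> chain_lifts G \<Lambda> P D P D \<epsilon> n l \<phi>" for b c \<phi>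
    using product_cocycle[OF l s complex that(2,1)] by (simp add: cocycles_iff)
  show "compose (carrier (P (m + n))) \<beta> (a m) \<in> cocycles (HC (s + l)) dH (m + n)"
    by (rule coc[OF \<beta> a'])
  have key: "ycls (m + n) (s + l) (compose (carrier (P (m + n))) b (c m)) =
      ycls (m + n) (s + l) (compose (carrier (P (m + n))) \<beta> (a m))"
    if b: "b \<in> ycls m s \<beta>" and p: "\<phi> \<in> ycls n l \<alpha>" and c: "c \<in> chain_lifts G \<Lambda> P D P D \<epsilon> n l \<phi>" for b \<phi> c
  proof -
    obtain \<eta> where \<eta>: "\<eta> \<in> graded_maps G \<Lambda> (P (m - 1)) (shift s M)"
      "\<And>x. x \<in> carrier (P m) \<Longrightarrow> b x = \<eta> (D m x) \<oplus>\<^bsub>M\<^esub> \<beta> x" and bc: "b \<in> cocycles (HC s) dH m"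
      using class_memE[OF s \<beta> b] by blast
    obtain \<gamma> where \<gamma>: "\<gamma> \<in> graded_maps G \<Lambda> (P (n - 1)) (shift l M)"
      "\<And>x. x \<in> carrier (P n) \<Longrightarrow> \<phi> x = \<gamma> (D n x) \<oplus>\<^bsub>M\<^esub> \<alpha> x"
      using class_memE[OF l \<alpha> p] by blast
    obtain \<theta> where \<theta>: "\<theta> \<in> graded_maps G \<Lambda> (P (m + n - 1)) (shift (s + l) M)"
      "\<And>x. x \<in> carrier (P (m + n)) \<Longrightarrow> \<beta> (c m x) = \<theta> (D (m + n) x) \<oplus>\<^bsub>M\<^esub> \<beta> (a m x)"
      using pairing_unique[OF complex l s c a' \<gamma>(1) \<gamma>(2) \<beta>] by blast
    \<comment> \<open>A coboundary \<open>\<eta> D\<close> added to \<open>\<beta>\<close> is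
      carried past the lift: \<open>\<eta> D (c m) = \<eta> (c (m - 1)) D\<close>, again a
      coboundary. The witness \<open>?\<zeta>\<close> adds this to the contribution
      \<open>\<theta>\<close> of the other changes.\<close>
    let ?c' = "c (m - 1)"
    have c': "?c' \<in> graded_maps G \<Lambda> (P (m + n - 1)) (shift l (P (m - 1)))"
      using chain_liftsD(1)[OF c, of "m - 1"] by (simp add: algebra_simps)
    have \<eta>': "\<eta> \<in> graded_maps G \<Lambda> (shift l (P (m - 1))) (shift (s + l) M)"
      using graded_maps_shift[OF \<eta>(1) l] by (simp add: add.commute)
    let ?\<eta>c = "compose (carrier (P (m + n - 1))) \<eta> ?c'"
    have \<eta>c: "?\<eta>c \<in> graded_maps G \<Lambda> (P (m + n - 1)) (shift (s + l) M)"
      by (rule compose_graded_maps[OF c' \<eta>' P_graded])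
    let ?\<zeta> = "\<lambda>x\<in>carrier (P (m + n - 1)). ?\<eta>c x \<oplus>\<^bsub>M\<^esub> \<theta> x"
    have \<zeta>: "?\<zeta> \<in> graded_maps G \<Lambda> (P (m + n - 1)) (shift (s + l) M)"
      using graded_maps_add[OF P_graded sM \<eta>c \<theta>(1)] by simp
    show ?thesis
    proof (rule class_eqI[OF sl coc[OF \<beta> a'] coc[OF bc c] \<zeta>])
      fix x assume x: "x \<in> carrier (P (m + n))"
      then have x': "x \<in> carrier (P (n + m))" by (simp add: add.commute)
      have Dx: "D (m + n) x \<in> carrier (P (m + n - 1))" by (rule graded_maps_closed[OF D_maps x])
      have "b (c m x) = \<eta> (D m (c m x)) \<oplus>\<^bsub>M\<^esub> \<beta> (c m x)"
        by (rule \<eta>(2)[OF chain_liftsD(4)[OF c x']])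
      also have "D m (c m x) = ?c' (D (m + n) x)"
        using chain_all[OF complex c x'] by (simp add: add.commute)
      also have "\<eta> \<dots> = ?\<eta>c (D (m + n) x)" using Dx by (simp add: compose_eq)
      also have "\<dots> \<oplus>\<^bsub>M\<^esub> \<beta> (c m x) = ?\<zeta> (D (m + n) x) \<oplus>\<^bsub>M\<^esub> \<beta> (a m x)"
        using \<theta>(2)[OF x] Dx graded_maps_closed[OF \<eta>c Dx] graded_maps_closed[OF \<theta>(1) Dx]
          chain_liftsD(4)[OF a' x'] \<beta> graded_maps_closed[of \<beta> G \<Lambda> "P m" "shift s M"]
        by (simp add: M.M.a_assoc cocycles_iff)
      finally show "compose (carrier (P (m + n))) b (c m) x =
          ?\<zeta> (D (m + n) x) \<oplus>\<^bsub>M\<^esub> compose (carrier (P (m + n))) \<beta> (a m) x"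
        using x by (simp add: compose_eq)
    qed
  qed
  interpret Hs: cochain_complex K "HC s" dH by (rule cochain[OF s])
  interpret Hl: cochain_complex K "HC l" dH by (rule cochain[OF l])
  have "\<beta> \<in> ycls m s \<beta>" "\<alpha> \<in> ycls n l \<alpha>"
    using Hs.class_self[OF \<beta>] Hl.class_self[OF \<alpha>] by (simp_all add: yoneda_class_def)
  then show "yoneda_mult G \<Lambda> M P D \<epsilon> m s n l (ycls m s \<beta>) (ycls n l \<alpha>) =
      ycls (m + n) (s + l) (compose (carrier (P (m + n))) \<beta> (a m))"
    unfolding yoneda_mult_def yoneda_lifts_eq using key a' by blast
qed

lemma yoneda_lifts_exist:
  assumes "l \<in> G" "\<alpha> \<in> cocycles (HC l) dH n"
  shows "yoneda_lifts G \<Lambda> P D \<epsilon> n l \<alpha> \<noteq> {}"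
  unfolding yoneda_lifts_eq
  by (rule chain_lifts_exist[OF complex assms(1)]) (use assms(2) in \<open>auto simp: cocycles_iff\<close>)

lemma identity_lift: "(\<lambda>k. \<lambda>x\<in>carrier (P k). x) \<in> chain_lifts G \<Lambda> P D P D \<epsilon> 0 0 \<epsilon>"
proof -
  have "(\<lambda>x\<in>carrier (P k). x) \<in> graded_maps G \<Lambda> (P k) (P k)" for k
  proof -
    interpret graded_left_module G \<Lambda> "P k" by (rule P_graded)
    show ?thesis using gpart_carrier by (auto simp: graded_maps_def linear_maps_def)
  qed
  then show ?thesis using graded_maps_closed[OF D_maps] by (simp add: chain_lifts_def)
qed

end

section \<open>Comparison maps between two resolutions\<close>

lemma chain_lifts_post:
  assumes R: "projective_complex G \<Lambda> R DR" and shift: "\<And>k. f k \<in> graded_maps G \<Lambda> (shift l (Q k)) (shift l (P k))"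
    and a: "a \<in> chain_lifts G \<Lambda> R DR Q DQ \<epsilon>Q n l \<phi>"
    and f: "f \<in> chain_lifts G \<Lambda> Q DQ P D \<epsilon> 0 0 \<epsilon>Q"
  shows "(\<lambda>k. compose (carrier (R (n + k))) (f k) (a k)) \<in> chain_lifts G \<Lambda> R DR P D \<epsilon> n l \<phi>"
proof -
  have Rg: "graded_left_module G \<Lambda> (R j)" and DR: "DR j \<in> graded_maps G \<Lambda> (R j) (R (j - 1))" for j
    using R by (auto simp: projective_complex_def graded_projective_def)
  have "compose (carrier (R (n + k))) (f k) (a k) \<in> graded_maps G \<Lambda> (R (n + k)) (shift l (P k))" for k
    by (rule compose_graded_maps[OF chain_liftsD(1)[OF a] shift Rg])
  moreover have "D k (compose (carrier (R (n + k))) (f k) (a k) x) =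
      compose (carrier (R (n + (k - 1)))) (f (k - 1)) (a (k - 1)) (DR (n + k) x)"
    if k: "k \<ge> 1" and x: "x \<in> carrier (R (n + k))" for k x
  proof -
    have "DR (n + k) x \<in> carrier (R (n + (k - 1)))"
      using graded_maps_closed[OF DR x] by (simp add: algebra_simps)
    then show ?thesis
      using chain_liftsD(2)[OF f k, of "a k x"] chain_liftsD(4)[OF a x] chain_liftsD(2)[OF a k x] x
      by (simp add: compose_eq)
  qed
  moreover have "\<epsilon> (compose (carrier (R (n + 0))) (f 0) (a 0) x) = \<phi> x" if x: "x \<in> carrier (R n)" for x
    using chain_liftsD(3)[OF f, of "a 0 x"] chain_liftsD(4)[OF a, of x 0] chain_liftsD(3)[OF a x] x
    by (simp add: compose_eq)
  ultimately show ?thesis by (simp add: chain_lifts_def)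
qed

context resolution
begin

context
  fixes Q :: "int \<Rightarrow> ('r, 'q) gmodule" and DQ :: "int \<Rightarrow> 'q \<Rightarrow> 'q" and \<epsilon>Q :: "'q \<Rightarrow> 'm" and f :: "int \<Rightarrow> 'q \<Rightarrow> 'p"
  assumes resQ: "resolution K G \<Lambda> M Q DQ \<epsilon>Q" and f: "f \<in> chain_lifts G \<Lambda> Q DQ P D \<epsilon> 0 0 \<epsilon>Q"
begin

interpretation Q: resolution K G \<Lambda> M Q DQ \<epsilon>Q by (rule resQ)

lemma lift_maps: "f n \<in> graded_maps G \<Lambda> (Q n) (P n)"
  using chain_liftsD(1)[OF f, of n] by simp

lemma lift_closed: "x \<in> carrier (Q n) \<Longrightarrow> f n x \<in> carrier (P n)"
  by (rule graded_maps_closed[OF lift_maps])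

lemma lift_chain: "x \<in> carrier (Q n) \<Longrightarrow> D n (f n x) = f (n - 1) (DQ n x)"
  using chain_all[OF Q.complex f, of x n] by simp

lemma chain_lifts_pre:
  assumes l: "l \<in> G" and a: "a \<in> chain_lifts G \<Lambda> P D P D \<epsilon> n l \<phi>"
  shows "(\<lambda>k. compose (carrier (Q (n + k))) (a k) (f (n + k)))
    \<in> chain_lifts G \<Lambda> Q DQ P D \<epsilon> n l (compose (carrier (Q n)) \<phi> (f n))"
proof -
  have "compose (carrier (Q (n + k))) (a k) (f (n + k)) \<in> graded_maps G \<Lambda> (Q (n + k)) (shift l (P k))" for k
    by (rule compose_graded_maps[OF lift_maps chain_liftsD(1)[OF a] Q.P_graded])
  moreover have "D k (compose (carrier (Q (n + k))) (a k) (f (n + k)) x) =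
      compose (carrier (Q (n + (k - 1)))) (a (k - 1)) (f (n + (k - 1))) (DQ (n + k) x)"
    if k: "k \<ge> 1" and x: "x \<in> carrier (Q (n + k))" for k x
  proof -
    have "DQ (n + k) x \<in> carrier (Q (n + (k - 1)))"
      using graded_maps_closed[OF Q.D_maps x] by (simp add: algebra_simps)
    then show ?thesis
      using chain_liftsD(2)[OF a k lift_closed[OF x]] lift_chain[OF x] x
      by (simp add: compose_eq add_diff_eq)
  qed
  moreover have "\<epsilon> (compose (carrier (Q (n + 0))) (a 0) (f (n + 0)) x) = compose (carrier (Q n)) \<phi> (f n) x"
    if x: "x \<in> carrier (Q n)" for x
    using chain_liftsD(3)[OF a lift_closed[OF x]] x by (simp add: compose_eq)
  ultimately show ?thesis by (simp add: chain_lifts_def)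
qed

text \<open>The composite \<open>f g\<close> and the identity are two lifts of
  \<open>\<epsilon>\<close> from \<open>P\<close> to itself, so that uniqueness of lifts makes their
  effects on cocycles cohomologous.\<close>

lemma round_trip:
  assumes s: "s \<in> G" and g: "g \<in> chain_lifts G \<Lambda> P D Q DQ \<epsilon>Q 0 0 \<epsilon>" and \<beta>: "\<beta> \<in> cocycles (HC s) dH m"
  shows "\<exists>\<eta>\<in>graded_maps G \<Lambda> (P (m - 1)) (shift s M). \<forall>x\<in>carrier (P m).
    \<beta> (f m (g m x)) = \<eta> (D m x) \<oplus>\<^bsub>M\<^esub> \<beta> x"
proof -
  have "(\<lambda>k. compose (carrier (P (0 + k))) (f k) (g k)) \<in> chain_lifts G \<Lambda> P D P D \<epsilon> 0 0 \<epsilon>"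
    by (rule chain_lifts_post[OF complex _ g f]) (simp add: lift_maps)
  from pairing_unique'[OF complex zero_in s this identity_lift \<beta>] show ?thesis
    by (simp add: compose_eq)
qed

definition pullback :: "int \<Rightarrow> ('p \<Rightarrow> 'm) \<Rightarrow> 'q \<Rightarrow> 'm" where
  "pullback n \<alpha> = compose (carrier (Q n)) \<alpha> (f n)"

lemma pullback_apply: "x \<in> carrier (Q n) \<Longrightarrow> pullback n \<alpha> x = \<alpha> (f n x)"
  by (simp add: pullback_def compose_eq)

lemma pullback_maps:
  "\<alpha> \<in> graded_maps G \<Lambda> (P n) N \<Longrightarrow> pullback n \<alpha> \<in> graded_maps G \<Lambda> (Q n) N"
  unfolding pullback_def by (rule compose_graded_maps[OF lift_maps _ Q.P_graded])

lemma pullback_cocycle: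
  assumes "\<alpha> \<in> cocycles (HC l) dH n"
  shows "pullback n \<alpha> \<in> cocycles (Q.HC l) Q.dH n"
proof -
  have "\<alpha> (f n (DQ (n + 1) x)) = \<zero>\<^bsub>M\<^esub>" if "x \<in> carrier (Q (n + 1))" for x
    using assms lift_closed[OF that] lift_chain[OF that] unfolding cocycles_iff by simp metis
  then show ?thesis
    using assms pullback_maps[of \<alpha> n] Q.D_closed[of _ n]
    by (auto simp: cocycles_iff Q.cocycles_iff pullback_apply)
qed

lemma pullback_linear:
  assumes l: "l \<in> G"
  shows "restrict (pullback n) (carrier (HC l n)) \<in> linear_maps K (HC l n) (Q.HC l n)"
proof (rule linear_mapsI)
  interpret H: cochain_complex K "HC l" dH by (rule cochain[OF l])
  interpret H: left_module K "HC l n" by (rule H.comp)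
  show "restrict (pullback n) (carrier (HC l n)) \<in> carrier (HC l n) \<rightarrow>\<^sub>E carrier (Q.HC l n)"
    using pullback_maps by (auto simp: hom_complex_simps Q.hom_complex_simps)
  show "restrict (pullback n) (carrier (HC l n)) (\<phi> \<oplus>\<^bsub>HC l n\<^esub> \<phi>') =
      restrict (pullback n) (carrier (HC l n)) \<phi> \<oplus>\<^bsub>Q.HC l n\<^esub> restrict (pullback n) (carrier (HC l n)) \<phi>'"
    if "\<phi> \<in> carrier (HC l n)" "\<phi>' \<in> carrier (HC l n)" for \<phi> \<phi>'
    using that H.M.a_closed[OF that] lift_closed[of _ n]
    by (simp add: hom_complex_simps Q.hom_complex_simps pullback_def compose_def cong: restrict_cong)
  show "restrict (pullback n) (carrier (HC l n)) (k \<odot>\<^bsub>HC l n\<^esub> \<phi>) =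
      k \<odot>\<^bsub>Q.HC l n\<^esub> restrict (pullback n) (carrier (HC l n)) \<phi>"
    if "k \<in> carrier K" "\<phi> \<in> carrier (HC l n)" for k \<phi>
    using that H.smult_closed[OF that] lift_closed[of _ n]
    by (simp add: hom_complex_simps Q.hom_complex_simps pullback_def compose_def cong: restrict_cong)
qed

text \<open>Pullback along \<open>g\<close> inverts pullback along \<open>f\<close> up to
  coboundaries. One of the two composites is controlled by \<open>round_trip\<close>; the hypothesis
  \<open>gf\<close> is that same lemma with the resolutions exchanged.\<close>

lemma pullback_cohomology_iso:
  assumes l: "l \<in> G" and g: "g \<in> chain_lifts G \<Lambda> P D Q DQ \<epsilon>Q 0 0 \<epsilon>"
    and gf: "\<And>m \<beta>. \<beta> \<in> cocycles (Q.HC l) Q.dH m \<Longrightarrow>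
      \<exists>\<eta>\<in>graded_maps G \<Lambda> (Q (m - 1)) (shift l M). \<forall>x\<in>carrier (Q m).
        \<beta> (g m (f m x)) = \<eta> (DQ m x) \<oplus>\<^bsub>M\<^esub> \<beta> x"
  shows "\<exists>\<Phi>. \<forall>n. \<Phi> n \<in> linear_maps K (yoneda_comp G \<Lambda> M P D n l) (yoneda_comp G \<Lambda> M Q DQ n l) \<and>
      bij_betw (\<Phi> n) (carrier (yoneda_comp G \<Lambda> M P D n l)) (carrier (yoneda_comp G \<Lambda> M Q DQ n l)) \<and>
      (\<forall>z\<in>cocycles (HC l) dH n. \<Phi> n (ycls n l z) = Q.ycls n l (pullback n z))"
proof -
  interpret M: graded_left_module G \<Lambda> M by (rule M)
  note sM = shift_graded[OF M l]
  have gm: "g n \<in> graded_maps G \<Lambda> (P n) (Q n)" for n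
    using chain_liftsD(1)[OF g, of n] by simp
  have gc: "g n x \<in> carrier (Q n)" if "x \<in> carrier (P n)" for n x by (rule graded_maps_closed[OF gm that])
  have gD: "DQ n (g n x) = g (n - 1) (D n x)" if "x \<in> carrier (P n)" for n x
    using Q.chain_all[OF complex g, of x n] that by simp
  let ?F = "\<lambda>n. restrict (pullback n) (carrier (HC l n))"
  have "\<exists>\<Phi>. \<forall>n. \<Phi> n \<in> linear_maps K (cohomology (HC l) dH n) (cohomology (Q.HC l) Q.dH n) \<and>
      bij_betw (\<Phi> n) (carrier (cohomology (HC l) dH n)) (carrier (cohomology (Q.HC l) Q.dH n)) \<and>
      (\<forall>z\<in>cocycles (HC l) dH n. \<Phi> n (cohomology_class (HC l) dH n z) =
        cohomology_class (Q.HC l) Q.dH n (?F n z))"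
  proof (rule cohomology_iso[OF cochain[OF l] Q.cochain[OF l]])
    show "?F n \<in> linear_maps K (HC l n) (Q.HC l n)" for n by (rule pullback_linear[OF l])
  next
    fix n \<alpha> assume "\<alpha> \<in> carrier (HC l n)"
    then have a: "\<alpha> \<in> graded_maps G \<Lambda> (P n) (shift l M)" by (simp add: hom_complex_simps)
    have "pullback (n + 1) (dH n \<alpha>) = Q.dH n (pullback n \<alpha>)"
      by (rule extensionalityI[of _ "carrier (Q (n + 1))"])
        (use lift_closed[of _ "n + 1"] lift_chain[of _ "n + 1"] Q.D_closed[of _ n] in
          \<open>auto simp: pullback_apply hom_diff_apply Q.hom_diff_apply pullback_def hom_diff_def compose_eq\<close>)
    then show "?F (n + 1) (dH n \<alpha>) = Q.dH n (?F n \<alpha>)"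
      using a hom_diff_closed[OF a] by (simp add: hom_complex_simps)
  next
    fix n z assume z: "z \<in> cocycles (HC l) dH n" and Fz: "?F n z \<in> coboundaries (Q.HC l) Q.dH n"
    have zm: "z \<in> graded_maps G \<Lambda> (P n) (shift l M)" using z by (simp add: cocycles_iff)
    have "pullback n z \<in> coboundaries (Q.HC l) Q.dH n" using Fz zm by (simp add: hom_complex_simps)
    then obtain \<gamma> where \<gamma>: "\<gamma> \<in> graded_maps G \<Lambda> (Q (n - 1)) (shift l M)"
      "\<And>x. x \<in> carrier (Q n) \<Longrightarrow> pullback n z x = \<gamma> (DQ n x)"
      by (rule Q.coboundaryE) blast
    obtain \<eta> where \<eta>: "\<eta> \<in> graded_maps G \<Lambda> (P (n - 1)) (shift l M)"
      "\<And>x. x \<in> carrier (P n) \<Longrightarrow> z (f n (g n x)) = \<eta> (D n x) \<oplus>\<^bsub>M\<^esub> z x"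
      using round_trip[OF l g z] by blast
    let ?\<gamma>g = "compose (carrier (P (n - 1))) \<gamma> (g (n - 1))"
    have \<gamma>g: "?\<gamma>g \<in> graded_maps G \<Lambda> (P (n - 1)) (shift l M)"
      by (rule compose_graded_maps[OF gm \<gamma>(1) P_graded])
    have \<zeta>: "(\<lambda>x\<in>carrier (P (n - 1)). ?\<gamma>g x \<ominus>\<^bsub>M\<^esub> \<eta> x) \<in> graded_maps G \<Lambda> (P (n - 1)) (shift l M)"
      using graded_maps_minus[OF P_graded sM \<gamma>g \<eta>(1)] by simp
    show "z \<in> coboundaries (HC l) dH n"
    proof (rule coboundaryI[OF zm \<zeta>])
      fix x assume x: "x \<in> carrier (P n)"
      have Dx: "D n x \<in> carrier (P (n - 1))" by (rule graded_maps_closed[OF D_maps x])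
      have c: "z x \<in> carrier M" "\<eta> (D n x) \<in> carrier M"
        using graded_maps_closed[OF zm x] graded_maps_closed[OF \<eta>(1) Dx] by simp_all
      have "?\<gamma>g (D n x) = \<gamma> (DQ n (g n x))" using Dx gD[OF x] by (simp add: compose_eq)
      also have "\<dots> = z (f n (g n x))" using \<gamma>(2)[OF gc[OF x]] gc[OF x] by (simp add: pullback_apply)
      also have "\<dots> = z x \<oplus>\<^bsub>M\<^esub> \<eta> (D n x)" using \<eta>(2)[OF x] c by (simp add: M.M.a_comm)
      finally show "z x = (\<lambda>x\<in>carrier (P (n - 1)). ?\<gamma>g x \<ominus>\<^bsub>M\<^esub> \<eta> x) (D n x)" using Dx c by simp
    qed
  next
    fix n z' assume z': "z' \<in> cocycles (Q.HC l) Q.dH n"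
    let ?z = "compose (carrier (P n)) z' (g n)"
    have z'm: "z' \<in> graded_maps G \<Lambda> (Q n) (shift l M)"
      and z'c: "x \<in> carrier (Q (n + 1)) \<Longrightarrow> z' (DQ (n + 1) x) = \<zero>\<^bsub>M\<^esub>" for x
      using z' by (auto simp: Q.cocycles_iff)
    have zm: "?z \<in> graded_maps G \<Lambda> (P n) (shift l M)"
      by (rule compose_graded_maps[OF gm z'm P_graded])
    have z: "?z \<in> cocycles (HC l) dH n"
      using zm z'c[OF gc[of _ "n + 1"]] gD[of _ "n + 1"] D_closed[of _ n]
      by (simp add: cocycles_iff compose_eq)
    obtain \<eta> where \<eta>: "\<eta> \<in> graded_maps G \<Lambda> (Q (n - 1)) (shift l M)"
      "\<And>x. x \<in> carrier (Q n) \<Longrightarrow> z' (g n (f n x)) = \<eta> (DQ n x) \<oplus>\<^bsub>M\<^esub> z' x"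
      using gf[OF z'] by blast
    have "?F n ?z = Q.dH (n - 1) \<eta> \<oplus>\<^bsub>Q.HC l n\<^esub> z'"
      by (rule extensionalityI[of _ "carrier (Q n)"])
        (use zm \<eta>(2) lift_closed[of _ n] in
          \<open>auto simp: hom_complex_simps Q.hom_complex_simps pullback_def hom_diff_def compose_eq\<close>)
    then show "\<exists>z\<in>cocycles (HC l) dH n. \<exists>b\<in>coboundaries (Q.HC l) Q.dH n. ?F n z = b \<oplus>\<^bsub>Q.HC l n\<^esub> z'"
      using z \<eta>(1) by (intro bexI[of _ ?z] bexI[of _ "Q.dH (n - 1) \<eta>"])
        (auto simp: coboundaries_def Q.hom_complex_simps)
  qed
  then show ?thesis by (simp add: yoneda_comp_def yoneda_class_def cocycles_iff hom_complex_simps)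
qed

text \<open>The pullback of \<open>\<alpha>\<close> to \<open>Q\<close> has two lifts into
  \<open>P\<close>: the lift \<open>a\<close> preceded by \<open>f\<close>, and a lift
  \<open>b\<close> within \<open>Q\<close> followed by \<open>f\<close>. Composed with
  \<open>\<beta>\<close>, the first is the pullback of the product and the second the product of the
  pullbacks; uniqueness of lifts makes them cohomologous.\<close>

lemma pullback_mult:
  assumes l: "l \<in> G" and s: "s \<in> G" and \<beta>: "\<beta> \<in> cocycles (HC s) dH m" and \<alpha>: "\<alpha> \<in> cocycles (HC l) dH n"
    and a: "a \<in> yoneda_lifts G \<Lambda> P D \<epsilon> n l \<alpha>"
  shows "Q.ycls (m + n) (s + l) (pullback (m + n) (compose (carrier (P (m + n))) \<beta> (a m))) =
    yoneda_mult G \<Lambda> M Q DQ \<epsilon>Q m s n l (Q.ycls m s (pullback m \<beta>)) (Q.ycls n l (pullback n \<alpha>))"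
proof -
  note sl = plus_in[OF s l]
  obtain b where b: "b \<in> yoneda_lifts G \<Lambda> Q DQ \<epsilon>Q n l (pullback n \<alpha>)"
    using Q.yoneda_lifts_exist[OF l pullback_cocycle[OF \<alpha>]] by blast
  note a' = a[unfolded yoneda_lifts_eq] and b' = b[unfolded yoneda_lifts_eq]
  have 1: "(\<lambda>k. compose (carrier (Q (n + k))) (a k) (f (n + k)))
      \<in> chain_lifts G \<Lambda> Q DQ P D \<epsilon> n l (pullback n \<alpha>)"
    unfolding pullback_def by (rule chain_lifts_pre[OF l a'])
  have 2: "(\<lambda>k. compose (carrier (Q (n + k))) (f k) (b k)) \<in> chain_lifts G \<Lambda> Q DQ P D \<epsilon> n l (pullback n \<alpha>)"
    by (rule chain_lifts_post[OF Q.complex graded_maps_shift[OF lift_maps l] b' f])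
  obtain \<eta> where \<eta>: "\<eta> \<in> graded_maps G \<Lambda> (Q (m + n - 1)) (shift (s + l) M)"
    "\<And>x. x \<in> carrier (Q (m + n)) \<Longrightarrow> \<beta> (a m (f (m + n) x)) = \<eta> (DQ (m + n) x) \<oplus>\<^bsub>M\<^esub> \<beta> (f m (b m x))"
    using pairing_unique'[OF Q.complex l s 1 2 \<beta>] by (auto simp: compose_eq add.commute)
  have "Q.ycls (m + n) (s + l) (pullback (m + n) (compose (carrier (P (m + n))) \<beta> (a m))) =
      Q.ycls (m + n) (s + l) (compose (carrier (Q (m + n))) (pullback m \<beta>) (b m))"
  proof (rule Q.class_eqI[OF sl Q.yoneda_mult_class(1)[OF l s pullback_cocycle[OF \<beta>] pullback_cocycle[OF \<alpha>] b]
        pullback_cocycle[OF yoneda_mult_class(1)[OF l s \<beta> \<alpha> a]] \<eta>(1)])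
    fix x assume x: "x \<in> carrier (Q (m + n))"
    have "b m x \<in> carrier (Q m)" using chain_liftsD(4)[OF b', of x m] x by (simp add: add.commute)
    then show "pullback (m + n) (compose (carrier (P (m + n))) \<beta> (a m)) x =
        \<eta> (DQ (m + n) x) \<oplus>\<^bsub>M\<^esub> compose (carrier (Q (m + n))) (pullback m \<beta>) (b m) x"
      using \<eta>(2)[OF x] x lift_closed[OF x] by (simp add: pullback_apply compose_eq)
  qed
  then show ?thesis
    using Q.yoneda_mult_class(2)[OF l s pullback_cocycle[OF \<beta>] pullback_cocycle[OF \<alpha>] b] by simp
qed

end

end

text \<open>The isomorphism is pullback along a comparison map \<open>f\<close>. It is
  contravariant, so \<open>f\<close> goes from \<open>Q\<close> to \<open>P\<close> in order to send
  classes over \<open>P\<close> to classes over \<open>Q\<close>.\<close>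

theorem yoneda_algebra_invariance:
  assumes "resolution K G \<Lambda> M P D \<epsilon>" "resolution K G \<Lambda> M Q DQ \<epsilon>Q"
  shows "bigraded_algebra_isomorphic K G (yoneda_algebra G \<Lambda> M P D \<epsilon>) (yoneda_algebra G \<Lambda> M Q DQ \<epsilon>Q)"
proof -
  interpret P: resolution K G \<Lambda> M P D \<epsilon> by fact
  interpret Q: resolution K G \<Lambda> M Q DQ \<epsilon>Q by fact
  obtain f where f: "f \<in> chain_lifts G \<Lambda> Q DQ P D \<epsilon> 0 0 \<epsilon>Q"
    using P.chain_lifts_exist[OF Q.complex P.zero_in, of \<epsilon>Q 0] Q.eps_maps Q.eps_D by auto
  obtain g where g: "g \<in> chain_lifts G \<Lambda> P D Q DQ \<epsilon>Q 0 0 \<epsilon>"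
    using Q.chain_lifts_exist[OF P.complex P.zero_in, of \<epsilon> 0] P.eps_maps P.eps_D by auto
  let ?pb = "P.pullback Q f"
  have "\<exists>\<Phi>. \<forall>n. \<Phi> n \<in> linear_maps K (yoneda_comp G \<Lambda> M P D n l) (yoneda_comp G \<Lambda> M Q DQ n l) \<and>
      bij_betw (\<Phi> n) (carrier (yoneda_comp G \<Lambda> M P D n l)) (carrier (yoneda_comp G \<Lambda> M Q DQ n l)) \<and>
      (\<forall>z\<in>cocycles (P.HC l) P.dH n. \<Phi> n (P.ycls n l z) = Q.ycls n l (?pb n z))" if "l \<in> G" for l
    by (rule P.pullback_cohomology_iso[OF assms(2) f that g Q.round_trip[OF assms(1) g that f]])
  then obtain \<Psi> where \<Psi>: "\<And>l n. l \<in> G \<Longrightarrow>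
      \<Psi> l n \<in> linear_maps K (yoneda_comp G \<Lambda> M P D n l) (yoneda_comp G \<Lambda> M Q DQ n l)"
      "\<And>l n. l \<in> G \<Longrightarrow>
      bij_betw (\<Psi> l n) (carrier (yoneda_comp G \<Lambda> M P D n l)) (carrier (yoneda_comp G \<Lambda> M Q DQ n l))"
      "\<And>l n z. l \<in> G \<Longrightarrow> z \<in> cocycles (P.HC l) P.dH n \<Longrightarrow> \<Psi> l n (P.ycls n l z) = Q.ycls n l (?pb n z)"
    by metis
  have carr: "\<exists>z\<in>cocycles (P.HC l) P.dH n. A = P.ycls n l z"
    if "l \<in> G" "A \<in> carrier (yoneda_comp G \<Lambda> M P D n l)" for l n A
    using cochain_complex.cohomology_carrier[OF P.cochain[OF that(1)], of n] that(2)
    by (auto simp: yoneda_comp_def yoneda_class_def)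
  have "\<Psi> (s + l) (m + n) (yoneda_mult G \<Lambda> M P D \<epsilon> m s n l B A) =
      yoneda_mult G \<Lambda> M Q DQ \<epsilon>Q m s n l (\<Psi> s m B) (\<Psi> l n A)"
    if sl: "s \<in> G" "l \<in> G" and B: "B \<in> carrier (yoneda_comp G \<Lambda> M P D m s)"
      and A: "A \<in> carrier (yoneda_comp G \<Lambda> M P D n l)" for m n s l A B
  proof -
    obtain \<beta> \<alpha> where \<beta>: "\<beta> \<in> cocycles (P.HC s) P.dH m" "B = P.ycls m s \<beta>"
      and \<alpha>: "\<alpha> \<in> cocycles (P.HC l) P.dH n" "A = P.ycls n l \<alpha>"
      using carr[OF sl(1) B] carr[OF sl(2) A] by blast
    obtain a where a: "a \<in> yoneda_lifts G \<Lambda> P D \<epsilon> n l \<alpha>" using P.yoneda_lifts_exist[OF sl(2) \<alpha>(1)] by blast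
    show ?thesis
      using P.yoneda_mult_class[OF sl(2,1) \<beta>(1) \<alpha>(1) a] P.pullback_mult[OF assms(2) f sl(2,1) \<beta>(1) \<alpha>(1) a]
        \<Psi>(3)[OF P.plus_in[OF sl]] \<Psi>(3)[OF sl(1) \<beta>(1)] \<Psi>(3)[OF sl(2) \<alpha>(1)] \<beta>(2) \<alpha>(2) by simp
  qed
  moreover have "\<Psi> 0 0 (P.ycls 0 0 \<epsilon>) = Q.ycls 0 0 \<epsilon>Q"
  proof -
    \<comment> \<open>Compatibility of \<open>f\<close> with the augmentations is literally the
      statement that the unit pulls back to the unit, already on cocycles.\<close>
    have "?pb 0 \<epsilon> = \<epsilon>Q"
      by (rule extensionalityI[of _ "carrier (Q 0)"])
        (use chain_liftsD(3)[OF f] linear_maps_extensional[OF graded_mapsD(1)[OF Q.eps_maps]] in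
          \<open>auto simp: P.pullback_def[OF assms(2) f] compose_eq\<close>)
    then show ?thesis using \<Psi>(3)[OF P.zero_in P.eps_cocycle] by simp
  qed
  ultimately have "(\<lambda>n l. \<Psi> l n) \<in> bigraded_algebra_iso K G
      (yoneda_algebra G \<Lambda> M P D \<epsilon>) (yoneda_algebra G \<Lambda> M Q DQ \<epsilon>Q)"
    using \<Psi>(1,2) by (simp add: bigraded_algebra_iso_def yoneda_algebra_def)
  then show ?thesis unfolding bigraded_algebra_isomorphic_def by blast
qed

section \<open>The distance algebra\<close>

text \<open>Induction on the size of the support, splitting off one element of \<open>B\<close> at a
  time. In the applications \<open>B\<close> contains all scalar multiples of the basis elements, so
  that additivity of \<open>f\<close> and \<open>g\<close> suffices; this matters for the
  contraction, which is not \<open>\<Lambda>\<close>-linear.\<close>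

lemma additive_eqI:
  assumes f: "\<And>x y. \<lbrakk>x \<in> carrier M; y \<in> carrier M\<rbrakk> \<Longrightarrow> f (x \<oplus>\<^bsub>M\<^esub> y) = f x \<oplus>\<^bsub>N\<^esub> f y"
    and g: "\<And>x y. \<lbrakk>x \<in> carrier M; y \<in> carrier M\<rbrakk> \<Longrightarrow> g (x \<oplus>\<^bsub>M\<^esub> y) = g x \<oplus>\<^bsub>N\<^esub> g y"
    and zero: "f \<zero>\<^bsub>M\<^esub> = g \<zero>\<^bsub>M\<^esub>"
    and gens: "\<And>u. u \<in> B \<Longrightarrow> u \<in> carrier M" "\<And>u. u \<in> B \<Longrightarrow> f u = g u"
    and fin: "\<And>x. x \<in> carrier M \<Longrightarrow> finite (supp x)"
    and empty: "\<And>x. \<lbrakk>x \<in> carrier M; supp x = {}\<rbrakk> \<Longrightarrow> x = \<zero>\<^bsub>M\<^esub>"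
    and split: "\<And>x i. \<lbrakk>x \<in> carrier M; i \<in> supp x\<rbrakk> \<Longrightarrow>
      \<exists>u\<in>B. \<exists>v\<in>carrier M. x = u \<oplus>\<^bsub>M\<^esub> v \<and> supp v \<subset> supp x"
    and x: "x \<in> carrier M"
  shows "f x = g x"
  using x
proof (induction "card (supp x)" arbitrary: x rule: less_induct)
  case less
  show ?case
  proof (cases "supp x = {}")
    case True
    then show ?thesis using empty[OF less.prems] zero by simp
  next
    case False
    then obtain u v where uv: "u \<in> B" "v \<in> carrier M" "x = u \<oplus>\<^bsub>M\<^esub> v" "supp v \<subset> supp x"
      using split[OF less.prems] by blast
    have "f v = g v"
      using less.hyps[OF psubset_card_mono[OF fin[OF less.prems] uv(4)] uv(2)] .
    then show ?thesis using f g gens uv by simp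
  qed
qed

locale finite_quasimetric = K: cring K + quasimetric_space X d
  for K :: "('k, 'c) ring_scheme" and G :: "real set" and X :: "'x set" and d :: "'x \<Rightarrow> 'x \<Rightarrow> ereal" +
  assumes finite_X: "finite X"
    and zero_in_G: "0 \<in> G" and diff_in_G: "\<And>a b. a \<in> G \<Longrightarrow> b \<in> G \<Longrightarrow> a - b \<in> G"
    and dist_in_G: "\<And>x y. x \<in> X \<Longrightarrow> y \<in> X \<Longrightarrow> d x y \<in> insert \<infinity> (ereal ` G)"
begin

abbreviation "\<Lambda> \<equiv> distance_algebra K X d"
abbreviation "FP \<equiv> finite_pairs X d"

text \<open>At infinite distance the value is the default 0, so \<open>rdist\<close> is used for
  pairs in \<open>FP\<close> only. It moves the conditions on distances to linear arithmetic over
  the reals.\<close>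

definition rdist :: "'x \<Rightarrow> 'x \<Rightarrow> real" where "rdist x y = real_of_ereal (d x y)"

lemma add_in_G: "\<lbrakk>a \<in> G; b \<in> G\<rbrakk> \<Longrightarrow> a + b \<in> G"
  using diff_in_G[of a "0 - b"] diff_in_G[of 0 b] zero_in_G by simp

lemma FP_D:
  assumes "(x, y) \<in> FP"
  shows "x \<in> X" "y \<in> X" "d x y = ereal (rdist x y)" "rdist x y \<in> G" "0 \<le> rdist x y"
    "rdist x y = 0 \<longleftrightarrow> x = y"
proof -
  show xy: "x \<in> X" "y \<in> X" using assms by (auto simp: finite_pairs_def)
  obtain g where "g \<in> G" "d x y = ereal g"
    using dist_in_G[OF xy] assms by (auto simp: finite_pairs_def)
  then show "d x y = ereal (rdist x y)" "rdist x y \<in> G" "0 \<le> rdist x y" "rdist x y = 0 \<longleftrightarrow> x = y"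
    using nonneg[OF xy] zero_iff[OF xy] by (auto simp: rdist_def zero_ereal_def)
qed

lemma FP_refl: "x \<in> X \<Longrightarrow> (x, x) \<in> FP"
  using zero_iff[of x x] by (simp add: finite_pairs_def)

lemma FP_trans:
  assumes "(x, y) \<in> FP" "(y, z) \<in> FP"
  shows "(x, z) \<in> FP" "rdist x z \<le> rdist x y + rdist y z"
proof -
  note xy = FP_D[OF assms(1)] and yz = FP_D[OF assms(2)]
  have le: "d x z \<le> ereal (rdist x y + rdist y z)"
    using triangle[OF xy(1,2) yz(2)] xy(3) yz(3) by simp
  then show xz: "(x, z) \<in> FP" using xy(1) yz(2) by (auto simp: finite_pairs_def)
  show "rdist x z \<le> rdist x y + rdist y z" using le FP_D(3)[OF xz] by simp
qed

lemma between_iff: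
  assumes "(x, y) \<in> FP" "(y, z) \<in> FP"
  shows "between d x y z \<longleftrightarrow> rdist x y + rdist y z = rdist x z"
  using FP_D(3)[OF assms(1)] FP_D(3)[OF assms(2)] FP_D(3)[OF FP_trans(1)[OF assms]]
  by (simp add: between_def)

lemma between_refl: "\<lbrakk>x \<in> X; y \<in> X\<rbrakk> \<Longrightarrow> between d x x y" "\<lbrakk>x \<in> X; y \<in> X\<rbrakk> \<Longrightarrow> between d x y y"
  using zero_iff[of x x] zero_iff[of y y] by (auto simp: between_def)

text \<open>A path from \<open>x\<close> to \<open>y\<close> and back has the length
  \<open>d x x = 0\<close> only if it is constant. This is why a product of two pairs of positive
  degree never has a diagonal term.\<close>

lemma between_same: "\<lbrakk>(x, y) \<in> FP; (y, x) \<in> FP; between d x y x\<rbrakk> \<Longrightarrow> x = y"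
  using between_iff[of x y x] FP_D[of x y] FP_D[of y x] FP_D[OF FP_refl[of x]] by auto

text \<open>Both sides say that the path \<open>x, y, z, w\<close> has total length
  \<open>d x w\<close>; the triangle inequalities leave no room for either half to be longer than
  the distance.\<close>

lemma between_assoc:
  assumes "(x, y) \<in> FP" "(y, z) \<in> FP" "(z, w) \<in> FP"
  shows "between d x y z \<and> between d x z w \<longleftrightarrow> between d x y w \<and> between d y z w"
  unfolding between_iff[OF assms(1,2)] between_iff[OF FP_trans(1)[OF assms(1,2)] assms(3)]
    between_iff[OF assms(1) FP_trans(1)[OF assms(2,3)]] between_iff[OF assms(2,3)]
  using FP_trans(2)[OF assms(1,2)] FP_trans(2)[OF assms(2,3)]
    FP_trans(2)[OF assms(1) FP_trans(1)[OF assms(2,3)]] FP_trans(2)[OF FP_trans(1)[OF assms(1,2)] assms(3)]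
  by linarith

lemma finite_FP: "finite FP"
  by (rule finite_subset[of _ "X \<times> X"]) (auto simp: finite_pairs_def finite_X)

lemma carrier_iff:
  "a \<in> carrier \<Lambda> \<longleftrightarrow> (\<forall>p. a p \<in> carrier K) \<and> (\<forall>p. p \<notin> FP \<longrightarrow> a p = \<zero>\<^bsub>K\<^esub>)"
proof -
  have "finite {p. a p \<noteq> \<zero>\<^bsub>K\<^esub>}" if "\<forall>p. p \<notin> FP \<longrightarrow> a p = \<zero>\<^bsub>K\<^esub>"
    by (rule finite_subset[OF _ finite_FP]) (use that in auto)
  then show ?thesis by (auto simp: distance_algebra_def Let_def free_module_carrier)
qed

lemma distance_algebra_simps [simp]:
  "\<zero>\<^bsub>\<Lambda>\<^esub> = (\<lambda>p. \<zero>\<^bsub>K\<^esub>)" "a \<oplus>\<^bsub>\<Lambda>\<^esub> b = (\<lambda>p. a p \<oplus>\<^bsub>K\<^esub> b p)" "k \<odot>\<^bsub>\<Lambda>\<^esub> a = (\<lambda>p. k \<otimes>\<^bsub>K\<^esub> a p)"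
  "\<one>\<^bsub>\<Lambda>\<^esub> = (\<lambda>(x, y). if x \<in> X \<and> x = y then \<one>\<^bsub>K\<^esub> else \<zero>\<^bsub>K\<^esub>)"
  by (simp_all add: distance_algebra_def Let_def)

lemma gpart_iff:
  "a \<in> gpart \<Lambda> g \<longleftrightarrow> a \<in> carrier \<Lambda> \<and> (\<forall>x y. a (x, y) \<noteq> \<zero>\<^bsub>K\<^esub> \<longrightarrow> d x y = ereal g)"
  by (simp add: distance_algebra_def Let_def)

lemma mult_apply: "(a \<otimes>\<^bsub>\<Lambda>\<^esub> b) (x, z) = (\<Oplus>\<^bsub>K\<^esub>y\<in>{y \<in> X. between d x y z}. a (x, y) \<otimes>\<^bsub>K\<^esub> b (y, z))"
  by (simp add: distance_algebra_def Let_def)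

lemma coeff_closed [simp]: "a \<in> carrier \<Lambda> \<Longrightarrow> a p \<in> carrier K"
  unfolding carrier_iff by blast

lemma coeff_zero: "a \<in> carrier \<Lambda> \<Longrightarrow> p \<notin> FP \<Longrightarrow> a p = \<zero>\<^bsub>K\<^esub>"
  unfolding carrier_iff by blast

lemma carrierI:
  "\<lbrakk>\<And>p. a p \<in> carrier K; \<And>p. p \<notin> FP \<Longrightarrow> a p = \<zero>\<^bsub>K\<^esub>\<rbrakk> \<Longrightarrow> a \<in> carrier \<Lambda>"
  unfolding carrier_iff by blast

lemma abelian: "abelian_group \<Lambda>"
proof (rule abelian_groupI)
  fix a assume a: "a \<in> carrier \<Lambda>"
  have "(\<lambda>p. \<ominus>\<^bsub>K\<^esub> a p) \<in> carrier \<Lambda>"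
    by (rule carrierI) (use a coeff_zero[OF a] in simp_all)
  then show "\<exists>b\<in>carrier \<Lambda>. b \<oplus>\<^bsub>\<Lambda>\<^esub> a = \<zero>\<^bsub>\<Lambda>\<^esub>"
    by (rule bexI[rotated]) (use a in \<open>simp add: K.l_neg\<close>)
next
  show "a \<oplus>\<^bsub>\<Lambda>\<^esub> b \<in> carrier \<Lambda>" if "a \<in> carrier \<Lambda>" "b \<in> carrier \<Lambda>" for a b
    by (rule carrierI) (use that coeff_zero[OF that(1)] coeff_zero[OF that(2)] in simp_all)
  show "\<zero>\<^bsub>\<Lambda>\<^esub> \<in> carrier \<Lambda>" by (rule carrierI) simp_all
qed (auto simp: K.a_ac)

definition el :: "'k \<Rightarrow> 'x \<Rightarrow> 'x \<Rightarrow> 'x \<times> 'x \<Rightarrow> 'k" where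
  "el k x y = (\<lambda>p. if p = (x, y) then k else \<zero>\<^bsub>K\<^esub>)"

lemma el_apply: "el k x y p = (if p = (x, y) then k else \<zero>\<^bsub>K\<^esub>)"
  by (simp add: el_def)

lemma el_closed: "\<lbrakk>k \<in> carrier K; (x, y) \<in> FP\<rbrakk> \<Longrightarrow> el k x y \<in> carrier \<Lambda>"
  by (rule carrierI) (auto simp: el_def)

lemma el_mult_apply:
  assumes "k \<in> carrier K" "y \<in> X" "a \<in> carrier \<Lambda>"
  shows "(el k x y \<otimes>\<^bsub>\<Lambda>\<^esub> a) (u, z) = (if u = x \<and> between d x y z then k \<otimes>\<^bsub>K\<^esub> a (y, z) else \<zero>\<^bsub>K\<^esub>)"
proof -
  let ?A = "{y' \<in> X. between d u y' z}"
  have "(el k x y \<otimes>\<^bsub>\<Lambda>\<^esub> a) (u, z) = (\<Oplus>\<^bsub>K\<^esub>y'\<in>?A. if u = x \<and> y = y' then k \<otimes>\<^bsub>K\<^esub> a (y', z) else \<zero>\<^bsub>K\<^esub>)"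
    unfolding mult_apply by (rule K.finsum_cong') (use assms in \<open>auto simp: el_def\<close>)
  also have "\<dots> = (if u = x \<and> between d x y z then k \<otimes>\<^bsub>K\<^esub> a (y, z) else \<zero>\<^bsub>K\<^esub>)"
  proof (cases "u = x \<and> between d x y z")
    case True
    then show ?thesis
      using K.finsum_singleton[of y ?A "\<lambda>y'. k \<otimes>\<^bsub>K\<^esub> a (y', z)"] assms finite_X by auto
  next
    case False
    then show ?thesis by (auto intro!: K.add.finprod_one_eqI)
  qed
  finally show ?thesis .
qed

lemma mult_closed:
  assumes "a \<in> carrier \<Lambda>" "b \<in> carrier \<Lambda>"
  shows "a \<otimes>\<^bsub>\<Lambda>\<^esub> b \<in> carrier \<Lambda>"
proof -
  have "(a \<otimes>\<^bsub>\<Lambda>\<^esub> b) (x, z) \<in> carrier K" for x z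
    unfolding mult_apply using assms by (intro K.finsum_closed) auto
  moreover have "(a \<otimes>\<^bsub>\<Lambda>\<^esub> b) (x, z) = \<zero>\<^bsub>K\<^esub>" if "(x, z) \<notin> FP" for x z
    unfolding mult_apply
  proof (rule K.add.finprod_one_eqI)
    fix y
    have "(x, y) \<notin> FP \<or> (y, z) \<notin> FP" using FP_trans(1) that by blast
    then show "a (x, y) \<otimes>\<^bsub>K\<^esub> b (y, z) = \<zero>\<^bsub>K\<^esub>" using assms by (auto simp: coeff_zero)
  qed
  ultimately show ?thesis by (intro carrierI) (metis surj_pair)+
qed

lemma l_distr:
  assumes "a \<in> carrier \<Lambda>" "a' \<in> carrier \<Lambda>" "b \<in> carrier \<Lambda>"
  shows "(a \<oplus>\<^bsub>\<Lambda>\<^esub> a') \<otimes>\<^bsub>\<Lambda>\<^esub> b = (a \<otimes>\<^bsub>\<Lambda>\<^esub> b) \<oplus>\<^bsub>\<Lambda>\<^esub> (a' \<otimes>\<^bsub>\<Lambda>\<^esub> b)"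
proof
  fix p :: "'x \<times> 'x"
  obtain x z where p: "p = (x, z)" by fastforce
  have "((a \<oplus>\<^bsub>\<Lambda>\<^esub> a') \<otimes>\<^bsub>\<Lambda>\<^esub> b) (x, z) =
      (\<Oplus>\<^bsub>K\<^esub>y\<in>{y \<in> X. between d x y z}. a (x, y) \<otimes>\<^bsub>K\<^esub> b (y, z) \<oplus>\<^bsub>K\<^esub> a' (x, y) \<otimes>\<^bsub>K\<^esub> b (y, z))"
    unfolding mult_apply using assms by (intro K.finsum_cong') (auto simp: K.l_distr)
  also have "\<dots> = (a \<otimes>\<^bsub>\<Lambda>\<^esub> b) (x, z) \<oplus>\<^bsub>K\<^esub> (a' \<otimes>\<^bsub>\<Lambda>\<^esub> b) (x, z)"
    unfolding mult_apply using assms finite_X by (intro K.finsum_addf) auto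
  finally show "((a \<oplus>\<^bsub>\<Lambda>\<^esub> a') \<otimes>\<^bsub>\<Lambda>\<^esub> b) p = ((a \<otimes>\<^bsub>\<Lambda>\<^esub> b) \<oplus>\<^bsub>\<Lambda>\<^esub> (a' \<otimes>\<^bsub>\<Lambda>\<^esub> b)) p" by (simp add: p)
qed

lemma r_distr:
  assumes "a \<in> carrier \<Lambda>" "b \<in> carrier \<Lambda>" "b' \<in> carrier \<Lambda>"
  shows "a \<otimes>\<^bsub>\<Lambda>\<^esub> (b \<oplus>\<^bsub>\<Lambda>\<^esub> b') = (a \<otimes>\<^bsub>\<Lambda>\<^esub> b) \<oplus>\<^bsub>\<Lambda>\<^esub> (a \<otimes>\<^bsub>\<Lambda>\<^esub> b')"
proof
  fix p :: "'x \<times> 'x"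
  obtain x z where p: "p = (x, z)" by fastforce
  have "(a \<otimes>\<^bsub>\<Lambda>\<^esub> (b \<oplus>\<^bsub>\<Lambda>\<^esub> b')) (x, z) =
      (\<Oplus>\<^bsub>K\<^esub>y\<in>{y \<in> X. between d x y z}. a (x, y) \<otimes>\<^bsub>K\<^esub> b (y, z) \<oplus>\<^bsub>K\<^esub> a (x, y) \<otimes>\<^bsub>K\<^esub> b' (y, z))"
    unfolding mult_apply using assms by (intro K.finsum_cong') (auto simp: K.r_distr)
  also have "\<dots> = (a \<otimes>\<^bsub>\<Lambda>\<^esub> b) (x, z) \<oplus>\<^bsub>K\<^esub> (a \<otimes>\<^bsub>\<Lambda>\<^esub> b') (x, z)"
    unfolding mult_apply using assms finite_X by (intro K.finsum_addf) auto
  finally show "(a \<otimes>\<^bsub>\<Lambda>\<^esub> (b \<oplus>\<^bsub>\<Lambda>\<^esub> b')) p = ((a \<otimes>\<^bsub>\<Lambda>\<^esub> b) \<oplus>\<^bsub>\<Lambda>\<^esub> (a \<otimes>\<^bsub>\<Lambda>\<^esub> b')) p" by (simp add: p)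
qed

lemma algebra_eqI:
  assumes "\<And>a b. \<lbrakk>a \<in> carrier \<Lambda>; b \<in> carrier \<Lambda>\<rbrakk> \<Longrightarrow> f (a \<oplus>\<^bsub>\<Lambda>\<^esub> b) = f a \<oplus>\<^bsub>N\<^esub> f b"
    and "\<And>a b. \<lbrakk>a \<in> carrier \<Lambda>; b \<in> carrier \<Lambda>\<rbrakk> \<Longrightarrow> g (a \<oplus>\<^bsub>\<Lambda>\<^esub> b) = g a \<oplus>\<^bsub>N\<^esub> g b"
    and "f \<zero>\<^bsub>\<Lambda>\<^esub> = g \<zero>\<^bsub>\<Lambda>\<^esub>"
    and eq: "\<And>k x y. \<lbrakk>k \<in> carrier K; (x, y) \<in> FP\<rbrakk> \<Longrightarrow> f (el k x y) = g (el k x y)"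
    and a: "a \<in> carrier \<Lambda>"
  shows "f a = g a"
proof (rule additive_eqI[where M = \<Lambda> and N = N and f = f and g = g
      and supp = "\<lambda>a. {p. a p \<noteq> \<zero>\<^bsub>K\<^esub>}" and B = "{el k x y | k x y. k \<in> carrier K \<and> (x, y) \<in> FP}",
      OF assms(1-3)])
  fix a p assume a: "a \<in> carrier \<Lambda>" and p: "p \<in> {p. a p \<noteq> \<zero>\<^bsub>K\<^esub>}"
  obtain x y where xy: "p = (x, y)" by fastforce
  then have FP: "(x, y) \<in> FP" using a p coeff_zero by blast
  show "\<exists>u\<in>{el k x y | k x y. k \<in> carrier K \<and> (x, y) \<in> FP}. \<exists>v\<in>carrier \<Lambda>. a = u \<oplus>\<^bsub>\<Lambda>\<^esub> v \<and>
      {p. v p \<noteq> \<zero>\<^bsub>K\<^esub>} \<subset> {p. a p \<noteq> \<zero>\<^bsub>K\<^esub>}"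
  proof (rule bexI, rule bexI, rule conjI)
    show "a = el (a p) x y \<oplus>\<^bsub>\<Lambda>\<^esub> (a(p := \<zero>\<^bsub>K\<^esub>))" using a by (auto simp: el_def xy)
    show "{q. (a(p := \<zero>\<^bsub>K\<^esub>)) q \<noteq> \<zero>\<^bsub>K\<^esub>} \<subset> {q. a q \<noteq> \<zero>\<^bsub>K\<^esub>}" using p by auto
    show "a(p := \<zero>\<^bsub>K\<^esub>) \<in> carrier \<Lambda>" by (rule carrierI) (use a coeff_zero[OF a] in auto)
    show "el (a p) x y \<in> {el k x y | k x y. k \<in> carrier K \<and> (x, y) \<in> FP}"
      using coeff_closed[OF a] FP by blast
  qed
next
  show "finite {p. a p \<noteq> \<zero>\<^bsub>K\<^esub>}" if "a \<in> carrier \<Lambda>" for a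
    by (rule finite_subset[OF _ finite_FP]) (use coeff_zero[OF that] in blast)
qed (use eq a in \<open>auto simp: el_closed\<close>)

text \<open>Associativity is additive in the first factor, hence may be checked for
  \<open>el k x y\<close> there. Then each side has a coefficient that is a single sum over a middle
  point \<open>z\<close>, and the conditions on \<open>z\<close> agree by
  \<open>between_assoc\<close>.\<close>

lemma distance_algebra_ring: "ring \<Lambda>"
proof (rule ringI)
  show "abelian_group \<Lambda>" by (rule abelian)
  have one: "\<one>\<^bsub>\<Lambda>\<^esub> \<in> carrier \<Lambda>" by (rule carrierI) (auto simp: FP_refl)
  have l1: "\<one>\<^bsub>\<Lambda>\<^esub> \<otimes>\<^bsub>\<Lambda>\<^esub> a = a" and r1: "a \<otimes>\<^bsub>\<Lambda>\<^esub> \<one>\<^bsub>\<Lambda>\<^esub> = a" if a: "a \<in> carrier \<Lambda>" for a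
  proof (safe intro!: ext)
    fix x z
    let ?A = "{y \<in> X. between d x y z}"
    have "(\<one>\<^bsub>\<Lambda>\<^esub> \<otimes>\<^bsub>\<Lambda>\<^esub> a) (x, z) = (\<Oplus>\<^bsub>K\<^esub>y\<in>?A. if x = y then a (y, z) else \<zero>\<^bsub>K\<^esub>)"
      unfolding mult_apply by (rule K.finsum_cong') (use a in auto)
    also have "\<dots> = a (x, z)"
    proof (cases "(x, z) \<in> FP")
      case True
      then have "x \<in> ?A" using FP_D between_refl by auto
      then show ?thesis using K.finsum_singleton[of x ?A "\<lambda>y. a (y, z)"] a finite_X by auto
    next
      case False
      then have "(\<Oplus>\<^bsub>K\<^esub>y\<in>?A. if x = y then a (y, z) else \<zero>\<^bsub>K\<^esub>) = \<zero>\<^bsub>K\<^esub>"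
        using a by (intro K.add.finprod_one_eqI) (auto simp: coeff_zero)
      then show ?thesis using False a by (simp add: coeff_zero)
    qed
    finally show "(\<one>\<^bsub>\<Lambda>\<^esub> \<otimes>\<^bsub>\<Lambda>\<^esub> a) (x, z) = a (x, z)" .
    have "(a \<otimes>\<^bsub>\<Lambda>\<^esub> \<one>\<^bsub>\<Lambda>\<^esub>) (x, z) = (\<Oplus>\<^bsub>K\<^esub>y\<in>?A. if z = y then a (x, y) else \<zero>\<^bsub>K\<^esub>)"
      unfolding mult_apply by (rule K.finsum_cong') (use a in auto)
    also have "\<dots> = a (x, z)"
    proof (cases "(x, z) \<in> FP")
      case True
      then have "z \<in> ?A" using FP_D between_refl by auto
      then show ?thesis using K.finsum_singleton[of z ?A "\<lambda>y. a (x, y)"] a finite_X by auto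
    next
      case False
      then have "(\<Oplus>\<^bsub>K\<^esub>y\<in>?A. if z = y then a (x, y) else \<zero>\<^bsub>K\<^esub>) = \<zero>\<^bsub>K\<^esub>"
        using a by (intro K.add.finprod_one_eqI) (auto simp: coeff_zero)
      then show ?thesis using False a by (simp add: coeff_zero)
    qed
    finally show "(a \<otimes>\<^bsub>\<Lambda>\<^esub> \<one>\<^bsub>\<Lambda>\<^esub>) (x, z) = a (x, z)" .
  qed
  have assoc: "(a \<otimes>\<^bsub>\<Lambda>\<^esub> b) \<otimes>\<^bsub>\<Lambda>\<^esub> c = a \<otimes>\<^bsub>\<Lambda>\<^esub> (b \<otimes>\<^bsub>\<Lambda>\<^esub> c)"
    if a: "a \<in> carrier \<Lambda>" and b: "b \<in> carrier \<Lambda>" and c: "c \<in> carrier \<Lambda>" for a b c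
  proof (rule algebra_eqI[OF _ _ _ _ a, of "\<lambda>a. (a \<otimes>\<^bsub>\<Lambda>\<^esub> b) \<otimes>\<^bsub>\<Lambda>\<^esub> c" \<Lambda> "\<lambda>a. a \<otimes>\<^bsub>\<Lambda>\<^esub> (b \<otimes>\<^bsub>\<Lambda>\<^esub> c)"])
    show "((a \<oplus>\<^bsub>\<Lambda>\<^esub> a') \<otimes>\<^bsub>\<Lambda>\<^esub> b) \<otimes>\<^bsub>\<Lambda>\<^esub> c = (a \<otimes>\<^bsub>\<Lambda>\<^esub> b) \<otimes>\<^bsub>\<Lambda>\<^esub> c \<oplus>\<^bsub>\<Lambda>\<^esub> (a' \<otimes>\<^bsub>\<Lambda>\<^esub> b) \<otimes>\<^bsub>\<Lambda>\<^esub> c"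
      if "a \<in> carrier \<Lambda>" "a' \<in> carrier \<Lambda>" for a a'
      using l_distr[OF that b] l_distr[OF mult_closed mult_closed c] that b by metis
    show "(a \<oplus>\<^bsub>\<Lambda>\<^esub> a') \<otimes>\<^bsub>\<Lambda>\<^esub> (b \<otimes>\<^bsub>\<Lambda>\<^esub> c) = a \<otimes>\<^bsub>\<Lambda>\<^esub> (b \<otimes>\<^bsub>\<Lambda>\<^esub> c) \<oplus>\<^bsub>\<Lambda>\<^esub> a' \<otimes>\<^bsub>\<Lambda>\<^esub> (b \<otimes>\<^bsub>\<Lambda>\<^esub> c)"
      if "a \<in> carrier \<Lambda>" "a' \<in> carrier \<Lambda>" for a a'
      by (rule l_distr[OF that mult_closed[OF b c]])
    have z: "\<zero>\<^bsub>\<Lambda>\<^esub> \<otimes>\<^bsub>\<Lambda>\<^esub> e = \<zero>\<^bsub>\<Lambda>\<^esub>" if "e \<in> carrier \<Lambda>" for e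
    proof
      fix p :: "'x \<times> 'x"
      obtain x z where p: "p = (x, z)" by fastforce
      show "(\<zero>\<^bsub>\<Lambda>\<^esub> \<otimes>\<^bsub>\<Lambda>\<^esub> e) p = \<zero>\<^bsub>\<Lambda>\<^esub> p"
        unfolding p mult_apply using that by (auto intro!: K.add.finprod_one_eqI)
    qed
    show "(\<zero>\<^bsub>\<Lambda>\<^esub> \<otimes>\<^bsub>\<Lambda>\<^esub> b) \<otimes>\<^bsub>\<Lambda>\<^esub> c = \<zero>\<^bsub>\<Lambda>\<^esub> \<otimes>\<^bsub>\<Lambda>\<^esub> (b \<otimes>\<^bsub>\<Lambda>\<^esub> c)"
      using z b c mult_closed by metis
  next
    fix k x y assume k: "k \<in> carrier K" and xy: "(x, y) \<in> FP"
    note y = FP_D(2)[OF xy]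
    have kb: "el k x y \<otimes>\<^bsub>\<Lambda>\<^esub> b \<in> carrier \<Lambda>" by (rule mult_closed[OF el_closed[OF k xy] b])
    show "(el k x y \<otimes>\<^bsub>\<Lambda>\<^esub> b) \<otimes>\<^bsub>\<Lambda>\<^esub> c = el k x y \<otimes>\<^bsub>\<Lambda>\<^esub> (b \<otimes>\<^bsub>\<Lambda>\<^esub> c)"
    proof (safe intro!: ext)
      fix u w
      let ?t = "\<lambda>z. k \<otimes>\<^bsub>K\<^esub> (b (y, z) \<otimes>\<^bsub>K\<^esub> c (z, w))"
      have t: "?t z \<in> carrier K" for z using k b c by simp
      have "((el k x y \<otimes>\<^bsub>\<Lambda>\<^esub> b) \<otimes>\<^bsub>\<Lambda>\<^esub> c) (u, w) =
          (\<Oplus>\<^bsub>K\<^esub>z\<in>{z \<in> X. between d u z w}. if u = x \<and> between d x y z then ?t z else \<zero>\<^bsub>K\<^esub>)"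
        unfolding mult_apply[of _ c]
        by (rule K.finsum_cong') (use k b c t in \<open>auto simp: el_mult_apply[OF k y b] K.m_assoc\<close>)
      \<comment> \<open>The sum is extended to all of \<open>X\<close> and the betweenness
        conditions become conditions on the summands, so that they can be exchanged one summand at a
        time.\<close>
      also have "\<dots> = (\<Oplus>\<^bsub>K\<^esub>z\<in>X. if u = x \<and> between d x y z \<and> between d u z w then ?t z else \<zero>\<^bsub>K\<^esub>)"
        by (rule K.add.finprod_mono_neutral_cong_left) (use finite_X t in auto)
      also have "\<dots> = (\<Oplus>\<^bsub>K\<^esub>z\<in>X. if u = x \<and> between d x y w \<and> between d y z w then ?t z else \<zero>\<^bsub>K\<^esub>)"
      proof (rule K.finsum_cong')
        fix z assume z: "z \<in> X"
        show "(if u = x \<and> between d x y z \<and> between d u z w then ?t z else \<zero>\<^bsub>K\<^esub>) =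
          (if u = x \<and> between d x y w \<and> between d y z w then ?t z else \<zero>\<^bsub>K\<^esub>)"
        proof (cases "(y, z) \<in> FP \<and> (z, w) \<in> FP")
          case True
          then show ?thesis using between_assoc[OF xy, of z w] by auto
        next
          \<comment> \<open>The triangle argument needs finite distances; where one is infinite, a
            coefficient of \<open>b\<close> or \<open>c\<close> vanishes.\<close>
          case False
          then have "?t z = \<zero>\<^bsub>K\<^esub>" using k b c by (auto simp: coeff_zero)
          then show ?thesis by simp
        qed
      qed (use t in auto)
      also have "\<dots> = (if u = x \<and> between d x y w then (\<Oplus>\<^bsub>K\<^esub>z\<in>{z \<in> X. between d y z w}. ?t z) else \<zero>\<^bsub>K\<^esub>)"
      proof (cases "u = x \<and> between d x y w")
        case True
        then have "(\<Oplus>\<^bsub>K\<^esub>z\<in>X. if u = x \<and> between d x y w \<and> between d y z w then ?t z else \<zero>\<^bsub>K\<^esub>) =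
            (\<Oplus>\<^bsub>K\<^esub>z\<in>{z \<in> X. between d y z w}. ?t z)"
          by (intro K.add.finprod_mono_neutral_cong_right) (use finite_X t in auto)
        then show ?thesis using True by simp
      next
        case False
        then show ?thesis by (auto intro!: K.add.finprod_one_eqI)
      qed
      also have "(\<Oplus>\<^bsub>K\<^esub>z\<in>{z \<in> X. between d y z w}. ?t z) = k \<otimes>\<^bsub>K\<^esub> (b \<otimes>\<^bsub>\<Lambda>\<^esub> c) (y, w)"
        unfolding mult_apply by (rule K.finsum_rdistr[symmetric]) (use finite_X k b c in auto)
      finally show "((el k x y \<otimes>\<^bsub>\<Lambda>\<^esub> b) \<otimes>\<^bsub>\<Lambda>\<^esub> c) (u, w) = (el k x y \<otimes>\<^bsub>\<Lambda>\<^esub> (b \<otimes>\<^bsub>\<Lambda>\<^esub> c)) (u, w)"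
        using el_mult_apply[OF k y mult_closed[OF b c]] by simp
    qed
  qed
  show "monoid \<Lambda>"
    by (rule monoidI) (use one l1 r1 assoc mult_closed in auto)
qed (use l_distr r_distr in auto)

lemma one_closed: "\<one>\<^bsub>\<Lambda>\<^esub> \<in> carrier \<Lambda>"
  using distance_algebra_ring by (rule ring.ring_simprules(6))

lemma gpart_rdist: "a \<in> gpart \<Lambda> g \<longleftrightarrow> a \<in> carrier \<Lambda> \<and> (\<forall>p. a p \<noteq> \<zero>\<^bsub>K\<^esub> \<longrightarrow> rdist (fst p) (snd p) = g)"
proof -
  have "d x y = ereal g \<longleftrightarrow> rdist x y = g" if "a \<in> carrier \<Lambda>" "a (x, y) \<noteq> \<zero>\<^bsub>K\<^esub>" for x y
    using FP_D(3)[of x y] coeff_zero[OF that(1), of "(x, y)"] that(2) by (cases "(x, y) \<in> FP") simp_all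
  then show ?thesis unfolding gpart_iff by auto
qed

lemma truncate:
  assumes "a \<in> carrier \<Lambda>"
  shows "(\<lambda>p. if P p then a p else \<zero>\<^bsub>K\<^esub>) \<in> carrier \<Lambda>"
  by (rule carrierI) (use assms coeff_zero[OF assms] in auto)

lemma distance_algebra_graded: "graded_ring G \<Lambda>"
proof (intro graded_ring.intro graded_ring_axioms.intro distance_algebra_ring zero_in_G)
  show "is_grading G \<Lambda>"
  proof (rule is_gradingI_support[OF abelian K.abelian_group_axioms, where ev = "\<lambda>p a. a p"
        and w = "\<lambda>p. rdist (fst p) (snd p)"])
    show "gpart \<Lambda> g = {m \<in> carrier \<Lambda>. \<forall>p. m p \<noteq> \<zero>\<^bsub>K\<^esub> \<longrightarrow> rdist (fst p) (snd p) = g}" for g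
      using gpart_rdist by blast
    show "\<exists>m'\<in>carrier \<Lambda>. \<forall>p. m' p = (if rdist (fst p) (snd p) = g then m p else \<zero>\<^bsub>K\<^esub>)"
      if "m \<in> carrier \<Lambda>" for m g
      using truncate[OF that] by (intro bexI[of _ "\<lambda>p. if rdist (fst p) (snd p) = g then m p else \<zero>\<^bsub>K\<^esub>"]) auto
    show "\<exists>W. finite W \<and> W \<subseteq> G \<and> (\<forall>p. m p \<noteq> \<zero>\<^bsub>K\<^esub> \<longrightarrow> rdist (fst p) (snd p) \<in> W)"
      if m: "m \<in> carrier \<Lambda>" for m
    proof (intro exI conjI allI impI)
      show "finite ((\<lambda>p. rdist (fst p) (snd p)) ` FP)" using finite_FP by simp
      show "(\<lambda>p. rdist (fst p) (snd p)) ` FP \<subseteq> G" using FP_D(4) by fastforce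
      show "rdist (fst p) (snd p) \<in> (\<lambda>p. rdist (fst p) (snd p)) ` FP" if "m p \<noteq> \<zero>\<^bsub>K\<^esub>" for p
        using coeff_zero[OF m] that by blast
    qed
  qed auto
next
  fix g h a b assume g: "g \<in> G" "h \<in> G" and a: "a \<in> gpart \<Lambda> g" and b: "b \<in> gpart \<Lambda> h"
  note a' = a[unfolded gpart_iff] and b' = b[unfolded gpart_iff]
  have "d x z = ereal (g + h)" if nz: "(a \<otimes>\<^bsub>\<Lambda>\<^esub> b) (x, z) \<noteq> \<zero>\<^bsub>K\<^esub>" for x z
  proof (rule ccontr)
    assume ne: "d x z \<noteq> ereal (g + h)"
    have "(a \<otimes>\<^bsub>\<Lambda>\<^esub> b) (x, z) = \<zero>\<^bsub>K\<^esub>"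
      unfolding mult_apply
    proof (rule K.add.finprod_one_eqI)
      fix y assume "y \<in> {y \<in> X. between d x y z}"
      then have "a (x, y) = \<zero>\<^bsub>K\<^esub> \<or> b (y, z) = \<zero>\<^bsub>K\<^esub>"
        using ne a' b' by (metis (mono_tags, lifting) between_def mem_Collect_eq plus_ereal.simps(1))
      then show "a (x, y) \<otimes>\<^bsub>K\<^esub> b (y, z) = \<zero>\<^bsub>K\<^esub>" using a' b' by auto
    qed
    then show False using nz by simp
  qed
  then show "a \<otimes>\<^bsub>\<Lambda>\<^esub> b \<in> gpart \<Lambda> (g + h)" using mult_closed a' b' unfolding gpart_iff by blast
next
  show "\<one>\<^bsub>\<Lambda>\<^esub> \<in> gpart \<Lambda> 0"
    unfolding gpart_iff using one_closed zero_iff by (auto simp: zero_ereal_def[symmetric])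
qed (use diff_in_G in auto)

lemma scalar_apply: "k \<in> carrier K \<Longrightarrow> k \<odot>\<^bsub>\<Lambda>\<^esub> \<one>\<^bsub>\<Lambda>\<^esub> = (\<lambda>(x, y). if x \<in> X \<and> x = y then k else \<zero>\<^bsub>K\<^esub>)"
  by (auto intro!: ext)

text \<open>Scalars act on coefficients from either side, by commutativity of \<open>\<K>\<close>.
  This provides the centrality required of the base ring.\<close>

lemma scalar_mult:
  assumes k: "k \<in> carrier K" and a: "a \<in> carrier \<Lambda>"
  shows "(k \<odot>\<^bsub>\<Lambda>\<^esub> \<one>\<^bsub>\<Lambda>\<^esub>) \<otimes>\<^bsub>\<Lambda>\<^esub> a = (\<lambda>p. k \<otimes>\<^bsub>K\<^esub> a p)" "a \<otimes>\<^bsub>\<Lambda>\<^esub> (k \<odot>\<^bsub>\<Lambda>\<^esub> \<one>\<^bsub>\<Lambda>\<^esub>) = (\<lambda>p. k \<otimes>\<^bsub>K\<^esub> a p)"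
proof -
  interpret \<Lambda>: ring \<Lambda> by (rule distance_algebra_ring)
  note one = one_closed
  have "((k \<odot>\<^bsub>\<Lambda>\<^esub> \<one>\<^bsub>\<Lambda>\<^esub>) \<otimes>\<^bsub>\<Lambda>\<^esub> a) (x, z) = k \<otimes>\<^bsub>K\<^esub> (\<one>\<^bsub>\<Lambda>\<^esub> \<otimes>\<^bsub>\<Lambda>\<^esub> a) (x, z)" for x z
  proof -
    have "k \<otimes>\<^bsub>K\<^esub> (\<one>\<^bsub>\<Lambda>\<^esub> \<otimes>\<^bsub>\<Lambda>\<^esub> a) (x, z) =
        (\<Oplus>\<^bsub>K\<^esub>y\<in>{y \<in> X. between d x y z}. k \<otimes>\<^bsub>K\<^esub> (\<one>\<^bsub>\<Lambda>\<^esub> (x, y) \<otimes>\<^bsub>K\<^esub> a (y, z)))"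
      unfolding mult_apply
      by (rule K.finsum_rdistr) (use finite_X k coeff_closed[OF a] coeff_closed[OF one] in \<open>auto simp del: distance_algebra_simps\<close>)
    also have "\<dots> = ((k \<odot>\<^bsub>\<Lambda>\<^esub> \<one>\<^bsub>\<Lambda>\<^esub>) \<otimes>\<^bsub>\<Lambda>\<^esub> a) (x, z)"
      unfolding mult_apply
      by (rule K.finsum_cong') (use k a in \<open>auto simp: K.m_assoc\<close>)
    finally show ?thesis by simp
  qed
  then show "(k \<odot>\<^bsub>\<Lambda>\<^esub> \<one>\<^bsub>\<Lambda>\<^esub>) \<otimes>\<^bsub>\<Lambda>\<^esub> a = (\<lambda>p. k \<otimes>\<^bsub>K\<^esub> a p)"
    using \<Lambda>.l_one[OF a] by (metis (no_types, lifting) ext surj_pair)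
  have "(a \<otimes>\<^bsub>\<Lambda>\<^esub> (k \<odot>\<^bsub>\<Lambda>\<^esub> \<one>\<^bsub>\<Lambda>\<^esub>)) (x, z) = k \<otimes>\<^bsub>K\<^esub> (a \<otimes>\<^bsub>\<Lambda>\<^esub> \<one>\<^bsub>\<Lambda>\<^esub>) (x, z)" for x z
  proof -
    have "k \<otimes>\<^bsub>K\<^esub> (a \<otimes>\<^bsub>\<Lambda>\<^esub> \<one>\<^bsub>\<Lambda>\<^esub>) (x, z) =
        (\<Oplus>\<^bsub>K\<^esub>y\<in>{y \<in> X. between d x y z}. k \<otimes>\<^bsub>K\<^esub> (a (x, y) \<otimes>\<^bsub>K\<^esub> \<one>\<^bsub>\<Lambda>\<^esub> (y, z)))"
      unfolding mult_apply
      by (rule K.finsum_rdistr) (use finite_X k coeff_closed[OF a] coeff_closed[OF one] in \<open>auto simp del: distance_algebra_simps\<close>)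
    also have "\<dots> = (a \<otimes>\<^bsub>\<Lambda>\<^esub> (k \<odot>\<^bsub>\<Lambda>\<^esub> \<one>\<^bsub>\<Lambda>\<^esub>)) (x, z)"
      unfolding mult_apply
      by (rule K.finsum_cong') (use k a in \<open>auto simp: K.m_ac\<close>)
    finally show ?thesis by simp
  qed
  then show "a \<otimes>\<^bsub>\<Lambda>\<^esub> (k \<odot>\<^bsub>\<Lambda>\<^esub> \<one>\<^bsub>\<Lambda>\<^esub>) = (\<lambda>p. k \<otimes>\<^bsub>K\<^esub> a p)"
    using \<Lambda>.r_one[OF a] by (metis (no_types, lifting) ext surj_pair)
qed

end

sublocale finite_quasimetric \<subseteq> L: graded_algebra K G \<Lambda>
proof -
  have "(\<lambda>p. k \<otimes>\<^bsub>K\<^esub> a p) \<in> carrier \<Lambda>" if "k \<in> carrier K" "a \<in> carrier \<Lambda>" for k a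
    by (rule carrierI) (use that coeff_zero[OF that(2)] in auto)
  then have cl: "k \<odot>\<^bsub>\<Lambda>\<^esub> \<one>\<^bsub>\<Lambda>\<^esub> \<in> carrier \<Lambda>" if "k \<in> carrier K" for k
    using that one_closed unfolding distance_algebra_simps(3) by blast
  have "(\<lambda>k. k \<odot>\<^bsub>\<Lambda>\<^esub> \<one>\<^bsub>\<Lambda>\<^esub>) \<in> ring_hom K \<Lambda>"
  proof (rule ring_hom_memI)
    fix k k' assume k: "k \<in> carrier K" "k' \<in> carrier K"
    show "(k \<otimes>\<^bsub>K\<^esub> k') \<odot>\<^bsub>\<Lambda>\<^esub> \<one>\<^bsub>\<Lambda>\<^esub> = (k \<odot>\<^bsub>\<Lambda>\<^esub> \<one>\<^bsub>\<Lambda>\<^esub>) \<otimes>\<^bsub>\<Lambda>\<^esub> (k' \<odot>\<^bsub>\<Lambda>\<^esub> \<one>\<^bsub>\<Lambda>\<^esub>)"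
      unfolding scalar_mult(1)[OF k(1) cl[OF k(2)]]
      using k by (auto simp: K.m_assoc)
    show "(k \<oplus>\<^bsub>K\<^esub> k') \<odot>\<^bsub>\<Lambda>\<^esub> \<one>\<^bsub>\<Lambda>\<^esub> = k \<odot>\<^bsub>\<Lambda>\<^esub> \<one>\<^bsub>\<Lambda>\<^esub> \<oplus>\<^bsub>\<Lambda>\<^esub> k' \<odot>\<^bsub>\<Lambda>\<^esub> \<one>\<^bsub>\<Lambda>\<^esub>"
      using k by (auto simp: K.l_distr)
  qed (use cl in auto)
  moreover have "k \<odot>\<^bsub>\<Lambda>\<^esub> \<one>\<^bsub>\<Lambda>\<^esub> \<in> gpart \<Lambda> 0" if k: "k \<in> carrier K" for k
    unfolding gpart_iff using cl[OF k] zero_iff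
    by (auto simp: scalar_apply[OF k] zero_ereal_def[symmetric] simp del: distance_algebra_simps split: if_splits)
  ultimately show "graded_algebra K G \<Lambda>"
    using scalar_mult
    by (intro graded_algebra.intro graded_algebra_axioms.intro K.cring_axioms distance_algebra_graded) auto
qed

section \<open>The ideal J and the quotient S\<close>

context finite_quasimetric
begin

text \<open>By \<open>between_same\<close> only the middle point \<open>x\<close> itself
  contributes. Thus taking diagonal coefficients is multiplicative, with kernel \<open>JX\<close>,
  and \<open>S\<close> becomes a subring of a product of copies of \<open>\<K>\<close>.\<close>

lemma diag_mult:
  assumes "a \<in> carrier \<Lambda>" "b \<in> carrier \<Lambda>"
  shows "(a \<otimes>\<^bsub>\<Lambda>\<^esub> b) (x, x) = a (x, x) \<otimes>\<^bsub>K\<^esub> b (x, x)"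
proof (cases "x \<in> X")
  case True
  let ?A = "{y \<in> X. between d x y x}"
  have "(a \<otimes>\<^bsub>\<Lambda>\<^esub> b) (x, x) = (\<Oplus>\<^bsub>K\<^esub>y\<in>?A. if x = y then a (x, y) \<otimes>\<^bsub>K\<^esub> b (y, x) else \<zero>\<^bsub>K\<^esub>)"
    unfolding mult_apply
  proof (rule K.finsum_cong')
    fix y assume "y \<in> ?A"
    then have "x = y \<or> (x, y) \<notin> FP \<or> (y, x) \<notin> FP" using between_same[of x y] by blast
    then show "a (x, y) \<otimes>\<^bsub>K\<^esub> b (y, x) = (if x = y then a (x, y) \<otimes>\<^bsub>K\<^esub> b (y, x) else \<zero>\<^bsub>K\<^esub>)"
    proof (elim disjE)
      assume "(x, y) \<notin> FP"
      then show ?thesis using coeff_zero[OF assms(1)] assms(2) by (cases "x = y") simp_all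
    next
      assume "(y, x) \<notin> FP"
      then show ?thesis using coeff_zero[OF assms(2)] assms(1) by (cases "x = y") simp_all
    qed simp
  qed (use assms in auto)
  also have "\<dots> = a (x, x) \<otimes>\<^bsub>K\<^esub> b (x, x)"
    by (rule K.finsum_singleton) (use True between_refl[OF True True] assms finite_X in auto)
  finally show ?thesis .
next
  case False
  then have "(x, x) \<notin> FP" using FP_D by blast
  then show ?thesis using assms mult_closed[OF assms] by (simp add: coeff_zero)
qed

definition JX :: "('x \<times> 'x \<Rightarrow> 'k) set" where "JX = {a \<in> carrier \<Lambda>. \<forall>x. a (x, x) = \<zero>\<^bsub>K\<^esub>}"

lemma JX_ideal: "ideal JX \<Lambda>"
proof (rule idealI[OF distance_algebra_ring])
  have inv: "(\<ominus>\<^bsub>\<Lambda>\<^esub> a) p = \<ominus>\<^bsub>K\<^esub> a p" if "a \<in> carrier \<Lambda>" for a p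
  proof -
    have "(\<ominus>\<^bsub>\<Lambda>\<^esub> a \<oplus>\<^bsub>\<Lambda>\<^esub> a) p = \<zero>\<^bsub>K\<^esub>" using L.l_neg[OF that] by simp
    then show ?thesis using that L.a_inv_closed[OF that] by (simp add: K.minus_equality)
  qed
  show "subgroup JX (add_monoid \<Lambda>)"
  proof (rule subgroup.intro)
    fix a assume "a \<in> JX"
    then have "\<ominus>\<^bsub>\<Lambda>\<^esub> a \<in> JX" using L.a_inv_closed[of a] by (simp add: JX_def inv)
    then show "inv\<^bsub>add_monoid \<Lambda>\<^esub> a \<in> JX" by (simp add: a_inv_def)
  next
    show "a \<otimes>\<^bsub>add_monoid \<Lambda>\<^esub> b \<in> JX" if "a \<in> JX" "b \<in> JX" for a b
      using that L.a_closed[of a b] by (auto simp: JX_def)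
    show "\<one>\<^bsub>add_monoid \<Lambda>\<^esub> \<in> JX" using L.zero_closed by (simp add: JX_def)
  qed (auto simp: JX_def)
  show "x \<otimes>\<^bsub>\<Lambda>\<^esub> a \<in> JX" "a \<otimes>\<^bsub>\<Lambda>\<^esub> x \<in> JX" if "a \<in> JX" "x \<in> carrier \<Lambda>" for a x
    using that by (auto simp: JX_def diag_mult mult_closed)
qed

text \<open>The explicit ideal \<open>JX\<close> contains the generating pairs, which gives one
  inclusion by minimality. For the other, an element without diagonal coefficients is a finite sum
  of multiples of such pairs.\<close>

lemma distance_ideal_eq: "distance_ideal K X d = JX"
proof
  let ?B = "{basis_vec K (x, y) | x y. (x, y) \<in> FP \<and> 0 < d x y}"
  have bv: "basis_vec K (x, y) = el \<one>\<^bsub>K\<^esub> x y" for x y by (auto simp: basis_vec_def el_def)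
  have pos: "x \<noteq> y" if "(x, y) \<in> FP" "0 < d x y" for x y
    using that FP_D(1)[OF that(1)] zero_iff[of x y] by auto
  have B: "?B \<subseteq> JX" by (auto simp: bv JX_def el_closed) (auto simp: el_def dest: pos)
  show "distance_ideal K X d \<subseteq> JX"
    unfolding distance_ideal_def by (rule L.genideal_minimal[OF JX_ideal B])
  have "?B \<subseteq> carrier \<Lambda>" using B by (auto simp: JX_def)
  then have I: "ideal (distance_ideal K X d) \<Lambda>" "?B \<subseteq> distance_ideal K X d"
    unfolding distance_ideal_def by (auto intro: L.genideal_ideal dest: L.genideal_self)
  interpret I: ideal "distance_ideal K X d" \<Lambda> by (rule I(1))
  have gen: "el k x y \<in> distance_ideal K X d" if "k \<in> carrier K" "(x, y) \<in> FP" "x \<noteq> y" for k x y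
  proof -
    have "0 < d x y" using FP_D(3,5,6)[OF that(2)] that(3) by (simp add: zero_ereal_def)
    then have "el \<one>\<^bsub>K\<^esub> x y \<in> distance_ideal K X d" using I(2) that(2) by (auto simp: bv)
    \<comment> \<open>An ideal is closed under multiplication by elements of
      \<open>\<Lambda>\<close>; multiples by \<open>k\<close> are obtained by multiplying with the
      ring element \<open>k 1\<close>.\<close>
    then have "(k \<odot>\<^bsub>\<Lambda>\<^esub> \<one>\<^bsub>\<Lambda>\<^esub>) \<otimes>\<^bsub>\<Lambda>\<^esub> el \<one>\<^bsub>K\<^esub> x y \<in> distance_ideal K X d"
      using L.scalar_closed[OF that(1)] I.I_l_closed by (simp only: L.scalar_def)
    also have "(k \<odot>\<^bsub>\<Lambda>\<^esub> \<one>\<^bsub>\<Lambda>\<^esub>) \<otimes>\<^bsub>\<Lambda>\<^esub> el \<one>\<^bsub>K\<^esub> x y = el k x y"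
      using that by (simp only: scalar_mult(1) el_closed K.one_closed) (auto simp: el_def)
    finally show ?thesis .
  qed
  show "JX \<subseteq> distance_ideal K X d"
  proof
    fix a assume "a \<in> JX"
    then have a: "a \<in> carrier \<Lambda>" "\<And>x. a (x, x) = \<zero>\<^bsub>K\<^esub>" by (auto simp: JX_def)
    \<comment> \<open>Induction over a finite set that contains the support, clearing one
      coefficient at each step.\<close>
    have "finite S \<Longrightarrow> b \<in> carrier \<Lambda> \<Longrightarrow> (\<And>x. b (x, x) = \<zero>\<^bsub>K\<^esub>) \<Longrightarrow> (\<And>p. p \<notin> S \<Longrightarrow> b p = \<zero>\<^bsub>K\<^esub>)
        \<Longrightarrow> b \<in> distance_ideal K X d" for S b
    proof (induction S arbitrary: b rule: finite_induct)
      case empty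
      then have "b = \<zero>\<^bsub>\<Lambda>\<^esub>" by auto
      then show ?case using I.zero_closed by simp
    next
      case (insert p S)
      obtain x y where p: "p = (x, y)" by fastforce
      have 1: "b(p := \<zero>\<^bsub>K\<^esub>) \<in> carrier \<Lambda>"
        by (rule carrierI) (use insert.prems(1) coeff_zero[OF insert.prems(1)] in auto)
      have 2: "b(p := \<zero>\<^bsub>K\<^esub>) \<in> distance_ideal K X d"
        by (rule insert.IH[OF 1]) (use insert.prems in auto)
      show ?case
      proof (cases "b p = \<zero>\<^bsub>K\<^esub>")
        case True
        then have "b(p := \<zero>\<^bsub>K\<^esub>) = b" by auto
        then show ?thesis using 2 by simp
      next
        case False
        then have "(x, y) \<in> FP" "x \<noteq> y" using insert.prems coeff_zero[OF insert.prems(1), of p] p by auto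
        then have "el (b p) x y \<in> distance_ideal K X d" using gen insert.prems(1) by simp
        then have "el (b p) x y \<oplus>\<^bsub>\<Lambda>\<^esub> (b(p := \<zero>\<^bsub>K\<^esub>)) \<in> distance_ideal K X d" using 2 by (rule I.a_closed)
        also have "el (b p) x y \<oplus>\<^bsub>\<Lambda>\<^esub> (b(p := \<zero>\<^bsub>K\<^esub>)) = b"
          using insert.prems(1) by (auto simp: el_def p)
        finally show ?thesis .
      qed
    qed
    from this[OF finite_FP a] show "a \<in> distance_ideal K X d" using coeff_zero[OF a(1)] by blast
  qed
qed

abbreviation "SX \<equiv> distance_quotient K X d"

definition q :: "('x \<times> 'x \<Rightarrow> 'k) \<Rightarrow> ('x \<times> 'x \<Rightarrow> 'k) set" where "q a = JX +>\<^bsub>\<Lambda>\<^esub> a"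

text \<open>The coordinate at \<open>x\<close> under the identification of \<open>S\<close> with
  \<open>K^X\<close>. The representative is immaterial by \<open>q_eq_iff\<close>, and at points
  outside \<open>X\<close> the coordinate is 0.\<close>

definition diag :: "('x \<times> 'x \<Rightarrow> 'k) set \<Rightarrow> 'x \<Rightarrow> 'k"
  where "diag A x = (SOME a. a \<in> carrier \<Lambda> \<and> q a = A) (x, x)"

lemma SX_simps:
  "carrier SX = q ` carrier \<Lambda>" "zero SX = q \<zero>\<^bsub>\<Lambda>\<^esub>" "gpart SX g = q ` gpart \<Lambda> g"
  "\<lbrakk>a \<in> carrier \<Lambda>; b \<in> carrier \<Lambda>\<rbrakk> \<Longrightarrow> q a \<oplus>\<^bsub>SX\<^esub> q b = q (a \<oplus>\<^bsub>\<Lambda>\<^esub> b)"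
  "\<lbrakk>a \<in> carrier \<Lambda>; b \<in> carrier \<Lambda>\<rbrakk> \<Longrightarrow> a \<odot>\<^bsub>SX\<^esub> q b = q (a \<otimes>\<^bsub>\<Lambda>\<^esub> b)"
proof -
  interpret J: ideal JX \<Lambda> by (rule JX_ideal)
  show "carrier SX = q ` carrier \<Lambda>"
    by (auto simp: distance_quotient_def quotient_left_module_def Let_def distance_ideal_eq FactRing_def
        A_RCOSETS_def' q_def)
  have "q \<zero>\<^bsub>\<Lambda>\<^esub> = JX" unfolding q_def using J.a_subset by (intro L.a_coset_add_zero)
  then show "zero SX = q \<zero>\<^bsub>\<Lambda>\<^esub>"
    by (simp add: distance_quotient_def quotient_left_module_def Let_def distance_ideal_eq FactRing_def)
  show "gpart SX g = q ` gpart \<Lambda> g"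
    by (simp add: distance_quotient_def quotient_left_module_def Let_def distance_ideal_eq q_def)
  show "\<lbrakk>a \<in> carrier \<Lambda>; b \<in> carrier \<Lambda>\<rbrakk> \<Longrightarrow> q a \<oplus>\<^bsub>SX\<^esub> q b = q (a \<oplus>\<^bsub>\<Lambda>\<^esub> b)"
    using J.a_rcos_sum[of a b]
    by (simp add: distance_quotient_def quotient_left_module_def Let_def distance_ideal_eq FactRing_def q_def)
  show "\<lbrakk>a \<in> carrier \<Lambda>; b \<in> carrier \<Lambda>\<rbrakk> \<Longrightarrow> a \<odot>\<^bsub>SX\<^esub> q b = q (a \<otimes>\<^bsub>\<Lambda>\<^esub> b)"
    using J.rcoset_mult_add[of a b]
    by (simp add: distance_quotient_def quotient_left_module_def Let_def distance_ideal_eq FactRing_def q_def)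
qed

lemma q_eq_iff:
  assumes "a \<in> carrier \<Lambda>" "b \<in> carrier \<Lambda>"
  shows "q a = q b \<longleftrightarrow> (\<forall>x. a (x, x) = b (x, x))"
proof -
  have "(a \<ominus>\<^bsub>\<Lambda>\<^esub> b \<oplus>\<^bsub>\<Lambda>\<^esub> b) p = a p" for p
    using L.minus_add_cancel_both(1)[OF assms] by simp
  then have m: "(a \<ominus>\<^bsub>\<Lambda>\<^esub> b) p \<oplus>\<^bsub>K\<^esub> b p = a p" for p by simp
  have c: "a \<ominus>\<^bsub>\<Lambda>\<^esub> b \<in> carrier \<Lambda>" using assms by (rule L.minus_closed)
  have "(a \<ominus>\<^bsub>\<Lambda>\<^esub> b) p = \<zero>\<^bsub>K\<^esub> \<longleftrightarrow> a p = b p" for p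
    using m[of p] coeff_closed[OF c, of p] coeff_closed[OF assms(2), of p]
    by (metis K.l_zero K.add.right_cancel K.zero_closed)
  then show ?thesis
    unfolding q_def using L.quotient_eq_iff_same_a_r_cos[OF JX_ideal assms] c by (auto simp: JX_def)
qed

lemma diag_q: "a \<in> carrier \<Lambda> \<Longrightarrow> diag (q a) x = a (x, x)"
proof -
  assume a: "a \<in> carrier \<Lambda>"
  have "(SOME b. b \<in> carrier \<Lambda> \<and> q b = q a) \<in> carrier \<Lambda> \<and> q (SOME b. b \<in> carrier \<Lambda> \<and> q b = q a) = q a"
    by (rule someI[of _ a]) (simp add: a)
  then show ?thesis unfolding diag_def using q_eq_iff[OF _ a] by blast
qed

lemma SX_eqI: "\<lbrakk>A \<in> carrier SX; B \<in> carrier SX; \<And>x. diag A x = diag B x\<rbrakk> \<Longrightarrow> A = B"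
proof -
  assume "A \<in> carrier SX" "B \<in> carrier SX" and eq: "\<And>x. diag A x = diag B x"
  then obtain a b where "a \<in> carrier \<Lambda>" "A = q a" "b \<in> carrier \<Lambda>" "B = q b"
    unfolding SX_simps(1) by (auto simp del: split_paired_All)
  then show ?thesis using eq q_eq_iff[of a b] by (simp add: diag_q)
qed

lemma diag_simps:
  "A \<in> carrier SX \<Longrightarrow> diag A x \<in> carrier K"
  "\<lbrakk>A \<in> carrier SX; B \<in> carrier SX\<rbrakk> \<Longrightarrow> diag (A \<oplus>\<^bsub>SX\<^esub> B) x = diag A x \<oplus>\<^bsub>K\<^esub> diag B x"
  "\<lbrakk>a \<in> carrier \<Lambda>; A \<in> carrier SX\<rbrakk> \<Longrightarrow> diag (a \<odot>\<^bsub>SX\<^esub> A) x = a (x, x) \<otimes>\<^bsub>K\<^esub> diag A x"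
  "diag \<zero>\<^bsub>SX\<^esub> x = \<zero>\<^bsub>K\<^esub>"
proof -
  show "A \<in> carrier SX \<Longrightarrow> diag A x \<in> carrier K" by (auto simp: SX_simps(1) diag_q)
  show "\<lbrakk>A \<in> carrier SX; B \<in> carrier SX\<rbrakk> \<Longrightarrow> diag (A \<oplus>\<^bsub>SX\<^esub> B) x = diag A x \<oplus>\<^bsub>K\<^esub> diag B x"
    using L.a_closed by (auto simp: SX_simps(1,4) diag_q simp del: distance_algebra_simps) (simp add: diag_q)
  show "\<lbrakk>a \<in> carrier \<Lambda>; A \<in> carrier SX\<rbrakk> \<Longrightarrow> diag (a \<odot>\<^bsub>SX\<^esub> A) x = a (x, x) \<otimes>\<^bsub>K\<^esub> diag A x"
    by (auto simp: SX_simps(1,5) diag_q mult_closed diag_mult)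
  show "diag \<zero>\<^bsub>SX\<^esub> x = \<zero>\<^bsub>K\<^esub>"
    unfolding SX_simps(2) using diag_q[OF L.zero_closed] by simp
qed

text \<open>\<open>S\<close> is concentrated in degree 0: what survives in it is the diagonal, and
  the pairs \<open>(x, x)\<close> have degree 0. This is why the grading criterion is applied with
  all coordinates in degree 0.\<close>

lemma SX_graded: "graded_left_module G \<Lambda> SX"
proof -
  have ab: "abelian_group SX"
  proof (rule abelian_groupI)
    fix A assume "A \<in> carrier SX"
    then obtain a where a: "a \<in> carrier \<Lambda>" "A = q a" by (auto simp: SX_simps(1))
    have "q (\<ominus>\<^bsub>\<Lambda>\<^esub> a) \<oplus>\<^bsub>SX\<^esub> A = \<zero>\<^bsub>SX\<^esub>"
      using a L.a_inv_closed L.l_neg[of a] by (simp add: SX_simps del: distance_algebra_simps)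
    then show "\<exists>B\<in>carrier SX. B \<oplus>\<^bsub>SX\<^esub> A = \<zero>\<^bsub>SX\<^esub>"
      using a L.a_inv_closed by (auto simp: SX_simps(1))
  qed (use L.a_closed L.zero_closed L.a_assoc L.a_comm L.l_zero in \<open>auto simp: SX_simps simp del: distance_algebra_simps\<close>)
  have lm: "left_module \<Lambda> SX"
    by (intro left_module.intro left_module_axioms.intro distance_algebra_ring ab)
      (use L.m_closed L.l_distr L.r_distr L.m_assoc L.l_one L.a_closed in \<open>auto simp: SX_simps simp del: distance_algebra_simps\<close>)
  have z0: "\<zero>\<^bsub>SX\<^esub> \<in> carrier SX" by (rule abelian_monoid.zero_closed[OF abelian_group.axioms(1)[OF ab]])
  have g0: "gpart SX 0 = carrier SX"
  proof
    show "gpart SX 0 \<subseteq> carrier SX" by (auto simp: SX_simps gpart_iff)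
    show "carrier SX \<subseteq> gpart SX 0"
    proof
      fix A assume "A \<in> carrier SX"
      then obtain a where a: "a \<in> carrier \<Lambda>" "A = q a" by (auto simp: SX_simps(1))
      \<comment> \<open>Discarding the off-diagonal coefficients does not change the class and
        leaves a representative that is homogeneous of degree 0.\<close>
      let ?b = "\<lambda>p. if fst p = snd p then a p else \<zero>\<^bsub>K\<^esub>"
      have b: "?b \<in> carrier \<Lambda>" by (rule truncate[OF a(1)])
      have "?b \<in> gpart \<Lambda> 0"
        unfolding gpart_rdist using b FP_D(6) coeff_zero[OF a(1)] by (auto split: if_splits)
      moreover have "A = q ?b" unfolding a(2) by (subst q_eq_iff[OF a(1) b]) simp
      ultimately show "A \<in> gpart SX 0" by (auto simp: SX_simps)
    qed
  qed
  have gne: "gpart SX g = {\<zero>\<^bsub>SX\<^esub>}" if "g \<noteq> 0" for g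
  proof -
    have "q a = q \<zero>\<^bsub>\<Lambda>\<^esub>" if "a \<in> gpart \<Lambda> g" for a
    proof -
      have "a (x, x) = \<zero>\<^bsub>K\<^esub>" for x
      proof (rule ccontr)
        assume nz: "a (x, x) \<noteq> \<zero>\<^bsub>K\<^esub>"
        then have "d x x = ereal g" "(x, x) \<in> FP" using that coeff_zero by (auto simp: gpart_iff)
        then show False using FP_D(3,6)[of x x] \<open>g \<noteq> 0\<close> by auto
      qed
      then show ?thesis using that L.zero_closed by (subst q_eq_iff) (auto simp: gpart_iff)
    qed
    moreover have "\<zero>\<^bsub>\<Lambda>\<^esub> \<in> gpart \<Lambda> g" using L.zero_closed by (simp add: gpart_iff)
    ultimately show ?thesis unfolding SX_simps by blast
  qed
  have "is_grading G SX"
  proof (rule is_gradingI_support[OF ab K.abelian_group_axioms, where ev = "\<lambda>x A. diag A x" and w = "\<lambda>x. 0"])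
    show "gpart SX g = {m \<in> carrier SX. \<forall>x. diag m x \<noteq> \<zero>\<^bsub>K\<^esub> \<longrightarrow> 0 = g}" if "g \<in> G" for g
    proof (cases "g = 0")
      case False
      have "m \<in> carrier SX \<and> (\<forall>x. diag m x = \<zero>\<^bsub>K\<^esub>) \<longleftrightarrow> m = \<zero>\<^bsub>SX\<^esub>" for m
        using SX_eqI[OF _ z0, of m] z0 by (auto simp: diag_simps(4))
      then show ?thesis unfolding gne[OF False] using False by auto
    qed (simp add: g0)
    show "\<exists>m'\<in>carrier SX. \<forall>x. diag m' x = (if 0 = g then diag m x else \<zero>\<^bsub>K\<^esub>)"
      if "m \<in> carrier SX" for m and g :: real
    proof (cases "g = 0")
      case False
      then show ?thesis by (intro bexI[OF _ z0]) (simp add: diag_simps(4))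
    qed (use that in auto)
    show "\<exists>W. finite W \<and> W \<subseteq> G \<and> (\<forall>x. diag m x \<noteq> \<zero>\<^bsub>K\<^esub> \<longrightarrow> 0 \<in> W)" for m
      using zero_in_G by (intro exI[of _ "{0}"]) simp
  qed (simp_all only: diag_simps, rule SX_eqI)
  moreover have "a \<odot>\<^bsub>SX\<^esub> A \<in> gpart SX (g + h)"
    if "g \<in> G" "h \<in> G" and a: "a \<in> gpart \<Lambda> g" and A: "A \<in> gpart SX h" for g h a A
  proof -
    obtain b where b: "b \<in> gpart \<Lambda> h" "A = q b" using A unfolding SX_simps(3) by (rule imageE)
    have "a \<odot>\<^bsub>SX\<^esub> A = q (a \<otimes>\<^bsub>\<Lambda>\<^esub> b)"
      using a b(1) unfolding b(2) gpart_iff by (intro SX_simps(5)) auto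
    then show ?thesis using L.mult_gpart[OF that(1,2) a b(1)] unfolding SX_simps(3) by simp
  qed
  ultimately show ?thesis
    by (intro graded_left_module.intro graded_left_module_axioms.intro lm)
qed

lemma SX_zero_gpart: "g \<noteq> 0 \<Longrightarrow> A \<in> gpart SX g \<Longrightarrow> diag A x = \<zero>\<^bsub>K\<^esub>"
proof (rule ccontr)
  assume g: "g \<noteq> 0" and A: "A \<in> gpart SX g" and nz: "diag A x \<noteq> \<zero>\<^bsub>K\<^esub>"
  obtain a where a: "a \<in> gpart \<Lambda> g" "A = q a" using A by (auto simp: SX_simps)
  have ac: "a \<in> carrier \<Lambda>" using a(1) by (simp add: gpart_iff)
  have "d x x = ereal g" "(x, x) \<in> FP" using a nz coeff_zero[OF ac, of "(x, x)"] by (auto simp: gpart_iff diag_q)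
  then show False using FP_D(3,6)[of x x] g by auto
qed

end

section \<open>The bar resolution\<close>

context finite_quasimetric
begin

text \<open>A recursion along the tuple, for all lengths at once, suited to inserting and deleting
  points at the left end. The relation to the tuples of the magnitude complex is
  \<open>mag_tuples_eq\<close>.\<close>

fun valid :: "'x list \<Rightarrow> bool" where
  "valid [] = False"
| "valid [x] = (x \<in> X)"
| "valid (x # y # ys) = (x \<noteq> y \<and> (x, y) \<in> FP \<and> valid (y # ys))"

fun wt :: "'x list \<Rightarrow> real" where
  "wt [] = 0"
| "wt [x] = 0"
| "wt (x # y # ys) = rdist x y + wt (y # ys)"

definition T :: "int \<Rightarrow> 'x list set" where "T n = {xs. valid xs \<and> int (length xs) = n + 1}"

lemma valid_set: "valid xs \<Longrightarrow> set xs \<subseteq> X"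
  by (induction xs rule: valid.induct) (auto dest: FP_D(1))

lemma valid_hd: "valid xs \<Longrightarrow> hd xs \<in> X"
  by (cases xs rule: valid.cases) (auto dest: FP_D(1))

lemma valid_not_Nil: "valid xs \<Longrightarrow> xs \<noteq> []"
  by auto

lemma valid_wt: "valid xs \<Longrightarrow> wt xs \<in> G"
  by (induction xs rule: valid.induct) (auto simp: zero_in_G intro: add_in_G FP_D(4))

lemma valid_Cons: "xs \<noteq> [] \<Longrightarrow> valid (x # xs) \<longleftrightarrow> x \<noteq> hd xs \<and> (x, hd xs) \<in> FP \<and> valid xs"
  by (cases xs) auto

lemma wt_Cons: "xs \<noteq> [] \<Longrightarrow> wt (x # xs) = rdist x (hd xs) + wt xs"
  by (cases xs) auto

lemma T_valid: "xs \<in> T n \<Longrightarrow> valid xs"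
  by (simp add: T_def)

lemma finite_T: "finite (T n)"
proof (rule finite_subset)
  show "T n \<subseteq> {xs. set xs \<subseteq> X \<and> length xs = nat (n + 1)}" using valid_set by (auto simp: T_def)
  show "finite {xs. set xs \<subseteq> X \<and> length xs = nat (n + 1)}" by (rule finite_lists_length_eq[OF finite_X])
qed

lemma T_neg: "n < 0 \<Longrightarrow> T n = {}"
proof -
  have "0 \<le> n" if "xs \<in> T n" for xs
    using that by (cases xs) (auto simp: T_def)
  then show "n < 0 \<Longrightarrow> T n = {}" by fastforce
qed

lemma T_Cons: "xs \<noteq> [] \<Longrightarrow> x # xs \<in> T (n + 1) \<longleftrightarrow> xs \<in> T n \<and> x \<noteq> hd xs \<and> (x, hd xs) \<in> FP"
  by (auto simp: T_def valid_Cons)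

text \<open>The submodule of the free \<open>\<Lambda>\<close>-module on \<open>T n\<close> that is spanned by the left ideals
  \<open>\<Lambda> \<cdot> (x\<^sub>0, x\<^sub>0)\<close>; the element \<open>(x, x\<^sub>0)\<close> in the component of \<open>(x\<^sub>0, \<dots>, x\<^sub>n)\<close> stands for
  the tuple \<open>(x, x\<^sub>0, \<dots>, x\<^sub>n)\<close> of the bar resolution.\<close>

definition bar :: "int \<Rightarrow> ('x \<times> 'x \<Rightarrow> 'k, 'x list \<Rightarrow> 'x \<times> 'x \<Rightarrow> 'k) gmodule" where
  "bar n =
    (let C = {c. (\<forall>t p. c t p \<in> carrier K) \<and> (\<forall>t p. c t p \<noteq> \<zero>\<^bsub>K\<^esub> \<longrightarrow> t \<in> T n \<and> p \<in> FP \<and> snd p = hd t)} in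
     \<lparr>carrier = C, mult = undefined, one = undefined,
      zero = (\<lambda>t p. \<zero>\<^bsub>K\<^esub>), add = (\<lambda>c c' t p. c t p \<oplus>\<^bsub>K\<^esub> c' t p), smult = (\<lambda>r c t. r \<otimes>\<^bsub>\<Lambda>\<^esub> c t),
      gpart = (\<lambda>g. {c \<in> C. \<forall>t p. c t p \<noteq> \<zero>\<^bsub>K\<^esub> \<longrightarrow> rdist (fst p) (snd p) + wt t = g})\<rparr>)"

lemma bar_simps [simp]:
  "\<zero>\<^bsub>bar n\<^esub> = (\<lambda>t p. \<zero>\<^bsub>K\<^esub>)" "c \<oplus>\<^bsub>bar n\<^esub> c' = (\<lambda>t p. c t p \<oplus>\<^bsub>K\<^esub> c' t p)"
  "r \<odot>\<^bsub>bar n\<^esub> c = (\<lambda>t. r \<otimes>\<^bsub>\<Lambda>\<^esub> c t)"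
  by (simp_all add: bar_def Let_def)

lemma barI:
  assumes "\<And>t p. c t p \<in> carrier K"
    and "\<And>t p. c t p \<noteq> \<zero>\<^bsub>K\<^esub> \<Longrightarrow> t \<in> T n \<and> p \<in> FP \<and> snd p = hd t"
  shows "c \<in> carrier (bar n)"
  unfolding bar_def Let_def using assms by (simp del: split_paired_All)

lemma barD:
  assumes "c \<in> carrier (bar n)"
  shows "c t p \<in> carrier K" "c t p \<noteq> \<zero>\<^bsub>K\<^esub> \<Longrightarrow> t \<in> T n \<and> p \<in> FP \<and> snd p = hd t"
  using assms unfolding bar_def Let_def by (simp_all del: split_paired_All)

lemma bar_gpart: "c \<in> gpart (bar n) g \<longleftrightarrow>
    c \<in> carrier (bar n) \<and> (\<forall>t p. c t p \<noteq> \<zero>\<^bsub>K\<^esub> \<longrightarrow> rdist (fst p) (snd p) + wt t = g)"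
  by (simp add: bar_def Let_def)

lemma bar_component: "c \<in> carrier (bar n) \<Longrightarrow> c t \<in> carrier \<Lambda>"
  by (rule carrierI) (use barD in blast)+

lemma bar_free: "c \<in> carrier (bar n) \<Longrightarrow> c \<in> carrier (free_module \<Lambda> (T n))"
proof -
  assume c: "c \<in> carrier (bar n)"
  have z: "c t = \<zero>\<^bsub>\<Lambda>\<^esub>" if "t \<notin> T n" for t using barD(2)[OF c] that by fastforce
  moreover have "finite {t. c t \<noteq> \<zero>\<^bsub>\<Lambda>\<^esub>}" by (rule finite_subset[OF _ finite_T[of n]]) (use z in blast)
  ultimately show ?thesis using bar_component[OF c] unfolding free_module_carrier by blast
qed

lemma bar_left_module: "left_module \<Lambda> (bar n)"
proof -
  interpret F: left_module \<Lambda> "free_module \<Lambda> (T n)" by (rule free_left_module[OF distance_algebra_ring])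
  show ?thesis
  proof (rule F.submodule)
    show "additive_subgroup (carrier (bar n)) (free_module \<Lambda> (T n))"
    proof (intro additive_subgroup.intro subgroup.intro)
      show "carrier (bar n) \<subseteq> carrier (add_monoid (free_module \<Lambda> (T n)))" using bar_free by auto
      show "\<one>\<^bsub>add_monoid (free_module \<Lambda> (T n))\<^esub> \<in> carrier (bar n)" by (rule barI) auto
      fix c assume c: "c \<in> carrier (bar n)"
      show "c \<otimes>\<^bsub>add_monoid (free_module \<Lambda> (T n))\<^esub> c' \<in> carrier (bar n)" if c': "c' \<in> carrier (bar n)" for c'
      proof (rule barI)
        fix t p
        show "(c \<otimes>\<^bsub>add_monoid (free_module \<Lambda> (T n))\<^esub> c') t p \<in> carrier K"
          using barD(1)[OF c] barD(1)[OF c'] by simp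
        assume "(c \<otimes>\<^bsub>add_monoid (free_module \<Lambda> (T n))\<^esub> c') t p \<noteq> \<zero>\<^bsub>K\<^esub>"
        then have "c t p \<noteq> \<zero>\<^bsub>K\<^esub> \<or> c' t p \<noteq> \<zero>\<^bsub>K\<^esub>" by auto
        then show "t \<in> T n \<and> p \<in> FP \<and> snd p = hd t" using barD(2)[OF c] barD(2)[OF c'] by blast
      qed
      let ?i = "\<ominus>\<^bsub>free_module \<Lambda> (T n)\<^esub> c"
      have i: "?i \<in> carrier (free_module \<Lambda> (T n))" by (rule F.M.a_inv_closed[OF bar_free[OF c]])
      have "?i \<oplus>\<^bsub>free_module \<Lambda> (T n)\<^esub> c = \<zero>\<^bsub>free_module \<Lambda> (T n)\<^esub>" by (rule F.M.l_neg[OF bar_free[OF c]])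
      from fun_cong[OF fun_cong[OF this]] have s: "?i t p \<oplus>\<^bsub>K\<^esub> c t p = \<zero>\<^bsub>K\<^esub>" for t p by simp
      have ik: "?i t p \<in> carrier K" for t p using i coeff_closed unfolding free_module_carrier by blast
      have "?i \<in> carrier (bar n)"
      proof (rule barI)
        fix t p assume nz: "?i t p \<noteq> \<zero>\<^bsub>K\<^esub>"
        have "c t p \<noteq> \<zero>\<^bsub>K\<^esub>" using s[of t p] ik[of t p] nz by auto
        then show "t \<in> T n \<and> p \<in> FP \<and> snd p = hd t" by (rule barD(2)[OF c])
      qed (rule ik)
      then show "inv\<^bsub>add_monoid (free_module \<Lambda> (T n))\<^esub> c \<in> carrier (bar n)" by (simp add: a_inv_def)
    qed
    fix r c assume r: "r \<in> carrier \<Lambda>" and c: "c \<in> carrier (bar n)"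
    note rc = mult_closed[OF r bar_component[OF c]]
    show "r \<odot>\<^bsub>free_module \<Lambda> (T n)\<^esub> c \<in> carrier (bar n)"
      unfolding free_module_simps
    proof (rule barI)
      fix t p show "(r \<otimes>\<^bsub>\<Lambda>\<^esub> c t) p \<in> carrier K" using rc by simp
      assume nz: "(r \<otimes>\<^bsub>\<Lambda>\<^esub> c t) p \<noteq> \<zero>\<^bsub>K\<^esub>"
      obtain x z where p: "p = (x, z)" by fastforce
      have "p \<in> FP" using coeff_zero[OF rc] nz by blast
      \<comment> \<open>Multiplication from the left keeps the second point of every pair, so the
        condition that it be the first point of the tuple is preserved.\<close>
      moreover have "t \<in> T n \<and> z = hd t"
      proof (rule ccontr)
        assume n: "\<not> (t \<in> T n \<and> z = hd t)"
        have "c t (y, z) = \<zero>\<^bsub>K\<^esub>" for y using barD(2)[OF c, of t "(y, z)"] n by auto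
        then have "(r \<otimes>\<^bsub>\<Lambda>\<^esub> c t) (x, z) = \<zero>\<^bsub>K\<^esub>"
          unfolding mult_apply using r by (intro K.add.finprod_one_eqI) simp
        then show False using nz p by simp
      qed
      ultimately show "t \<in> T n \<and> p \<in> FP \<and> snd p = hd t" by (simp add: p)
    qed
  qed (auto simp: fun_eq_iff bar_def Let_def free_module_def)
qed

lemma bar_ab: "abelian_group (bar n)"
  using bar_left_module by (simp add: left_module_def)

lemma bar_minus:
  assumes "c \<in> carrier (bar n)" "c' \<in> carrier (bar n)"
  shows "c \<ominus>\<^bsub>bar n\<^esub> c' = (\<lambda>t p. c t p \<ominus>\<^bsub>K\<^esub> c' t p)"
proof (intro ext)
  interpret B: left_module \<Lambda> "bar n" by (rule bar_left_module)
  fix t p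
  have "(c \<ominus>\<^bsub>bar n\<^esub> c') \<oplus>\<^bsub>bar n\<^esub> c' = c" by (rule B.M.minus_add_cancel_both(1)[OF assms])
  from fun_cong[OF fun_cong[OF this]] have "(c \<ominus>\<^bsub>bar n\<^esub> c') t p \<oplus>\<^bsub>K\<^esub> c' t p = c t p" by simp
  then show "(c \<ominus>\<^bsub>bar n\<^esub> c') t p = c t p \<ominus>\<^bsub>K\<^esub> c' t p"
    using barD(1)[OF assms(2)] barD(1)[OF B.M.minus_closed[OF assms]] K.minus_add_cancel_both(2) by metis
qed

text \<open>The degree of the basis element \<open>(x, x_0)\<close> in the component of a tuple is
  the length of the whole path: the distance from \<open>x\<close> to \<open>x_0\<close> plus the
  length of the tuple.\<close>

lemma bar_graded: "graded_left_module G \<Lambda> (bar n)"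
proof (intro graded_left_module.intro graded_left_module_axioms.intro bar_left_module)
  show "is_grading G (bar n)"
  proof (rule is_gradingI_support[OF bar_ab K.abelian_group_axioms, where ev = "\<lambda>i c. c (fst i) (snd i)"
        and w = "\<lambda>i. rdist (fst (snd i)) (snd (snd i)) + wt (fst i)"])
    show "m = m'" if "\<And>i. m (fst i) (snd i) = m' (fst i) (snd i)" for m m' :: "'x list \<Rightarrow> 'x \<times> 'x \<Rightarrow> 'k"
      using that[of "(_, _)"] by (intro ext) simp
    show "gpart (bar n) g = {m \<in> carrier (bar n). \<forall>i. m (fst i) (snd i) \<noteq> \<zero>\<^bsub>K\<^esub> \<longrightarrow>
        rdist (fst (snd i)) (snd (snd i)) + wt (fst i) = g}" for g
      using bar_gpart by fastforce
    show "\<exists>m'\<in>carrier (bar n). \<forall>i. m' (fst i) (snd i) =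
        (if rdist (fst (snd i)) (snd (snd i)) + wt (fst i) = g then m (fst i) (snd i) else \<zero>\<^bsub>K\<^esub>)"
      if m: "m \<in> carrier (bar n)" for m g
    proof (rule bexI)
      show "(\<lambda>t p. if rdist (fst p) (snd p) + wt t = g then m t p else \<zero>\<^bsub>K\<^esub>) \<in> carrier (bar n)"
        by (rule barI) (use barD[OF m] in \<open>auto split: if_splits\<close>)
    qed simp
    show "\<exists>W. finite W \<and> W \<subseteq> G \<and> (\<forall>i. m (fst i) (snd i) \<noteq> \<zero>\<^bsub>K\<^esub> \<longrightarrow>
        rdist (fst (snd i)) (snd (snd i)) + wt (fst i) \<in> W)"
      if m: "m \<in> carrier (bar n)" for m
    proof (intro exI conjI allI impI)
      let ?W = "(\<lambda>i. rdist (fst (snd i)) (snd (snd i)) + wt (fst i)) ` (T n \<times> FP)"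
      show "finite ?W" using finite_T finite_FP by simp
      show "?W \<subseteq> G" using valid_wt T_valid FP_D(4) add_in_G by fastforce
      fix i assume "m (fst i) (snd i) \<noteq> \<zero>\<^bsub>K\<^esub>"
      then have "i \<in> T n \<times> FP" using barD(2)[OF m] by (metis mem_Times_iff)
      then show "rdist (fst (snd i)) (snd (snd i)) + wt (fst i) \<in> ?W" by blast
    qed
  qed (use barD in auto)
next
  fix g h a c assume g: "g \<in> G" "h \<in> G" and a: "a \<in> gpart \<Lambda> g" and c: "c \<in> gpart (bar n) h"
  have cc: "c \<in> carrier (bar n)" and ac: "a \<in> carrier \<Lambda>" using a c by (auto simp: bar_gpart gpart_iff)
  have "a \<otimes>\<^bsub>\<Lambda>\<^esub> c t \<in> gpart \<Lambda> (g + (h - wt t))" if t: "t \<in> T n" for t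
  proof (rule L.mult_gpart[OF g(1) _ a])
    show "h - wt t \<in> G" using diff_in_G[OF g(2) valid_wt[OF T_valid[OF t]]] .
    show "c t \<in> gpart \<Lambda> (h - wt t)"
      using c bar_component[OF cc] unfolding gpart_rdist bar_gpart by fastforce
  qed
  moreover have rc: "a \<odot>\<^bsub>bar n\<^esub> c \<in> carrier (bar n)"
    by (rule left_module.smult_closed[OF bar_left_module ac cc])
  ultimately show "a \<odot>\<^bsub>bar n\<^esub> c \<in> gpart (bar n) (g + h)"
    unfolding bar_gpart gpart_rdist using barD(2)[OF rc] by fastforce
qed

section \<open>Generators, extension of maps and projectivity\<close>

definition bvec :: "'k \<Rightarrow> 'x \<Rightarrow> 'x list \<Rightarrow> 'x list \<Rightarrow> 'x \<times> 'x \<Rightarrow> 'k" where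
  "bvec k x xs = (\<lambda>t p. if t = xs \<and> p = (x, hd xs) then k else \<zero>\<^bsub>K\<^esub>)"

abbreviation "gen xs \<equiv> bvec \<one>\<^bsub>K\<^esub> (hd xs) xs"

lemma bvec_closed:
  assumes "k \<in> carrier K" "xs \<in> T n" "(x, hd xs) \<in> FP"
  shows "bvec k x xs \<in> carrier (bar n)" "bvec k x xs \<in> gpart (bar n) (rdist x (hd xs) + wt xs)"
proof -
  show 1: "bvec k x xs \<in> carrier (bar n)"
    by (rule barI) (use assms in \<open>auto simp: bvec_def split: if_splits\<close>)
  show "bvec k x xs \<in> gpart (bar n) (rdist x (hd xs) + wt xs)"
    unfolding bar_gpart using 1 by (auto simp: bvec_def)
qed

lemma bvec_component: "bvec k x xs t = (if t = xs then el k x (hd xs) else \<zero>\<^bsub>\<Lambda>\<^esub>)"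
  by (auto simp: bvec_def el_def)

lemma gen_closed:
  assumes "xs \<in> T n"
  shows "gen xs \<in> carrier (bar n)" "gen xs \<in> gpart (bar n) (wt xs)"
  using bvec_closed[OF K.one_closed assms FP_refl[OF valid_hd[OF T_valid[OF assms]]]]
    FP_D(6)[OF FP_refl[OF valid_hd[OF T_valid[OF assms]]]] by simp_all

lemma el_mult_el:
  assumes "k \<in> carrier K" "k' \<in> carrier K" "(x, y) \<in> FP" "(y, z) \<in> FP"
  shows "el k x y \<otimes>\<^bsub>\<Lambda>\<^esub> el k' y z = (if between d x y z then el (k \<otimes>\<^bsub>K\<^esub> k') x z else \<zero>\<^bsub>\<Lambda>\<^esub>)"
proof (safe intro!: ext)
  fix u w
  show "(el k x y \<otimes>\<^bsub>\<Lambda>\<^esub> el k' y z) (u, w) = (if between d x y z then el (k \<otimes>\<^bsub>K\<^esub> k') x z else \<zero>\<^bsub>\<Lambda>\<^esub>) (u, w)"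
    using assms by (auto simp: el_mult_apply[OF assms(1) FP_D(2)[OF assms(3)] el_closed[OF assms(2,4)]] el_apply)
qed

lemma smult_bvec:
  assumes "k \<in> carrier K" "k' \<in> carrier K" "(x, y) \<in> FP" "xs \<in> T n" "(y, hd xs) \<in> FP"
  shows "el k x y \<odot>\<^bsub>bar n\<^esub> bvec k' y xs =
    (if between d x y (hd xs) then bvec (k \<otimes>\<^bsub>K\<^esub> k') x xs else \<zero>\<^bsub>bar n\<^esub>)"
proof
  fix t
  show "(el k x y \<odot>\<^bsub>bar n\<^esub> bvec k' y xs) t =
      (if between d x y (hd xs) then bvec (k \<otimes>\<^bsub>K\<^esub> k') x xs else \<zero>\<^bsub>bar n\<^esub>) t"
    using el_mult_el[OF assms(1,2,3,5)] L.r_null[OF el_closed[OF assms(1,3)]]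
    by (auto simp: bvec_component)
qed

lemma bvec_gen:
  assumes "k \<in> carrier K" "xs \<in> T n" "(x, hd xs) \<in> FP"
  shows "el k x (hd xs) \<odot>\<^bsub>bar n\<^esub> gen xs = bvec k x xs"
  using smult_bvec[OF assms(1) K.one_closed assms(3,2) FP_refl[OF FP_D(2)[OF assms(3)]]]
    between_refl(2)[OF FP_D(1,2)[OF assms(3)]] assms(1) by simp

text \<open>For identities that involve \<open>con\<close> only additivity is available, so all
  multiples of basis elements are tested. For \<open>\<Lambda>\<close>-linear maps the generators
  suffice, as in \<open>bar_maps_eqI\<close>.\<close>

lemma bar_eqI:
  assumes "\<And>c c'. \<lbrakk>c \<in> carrier (bar n); c' \<in> carrier (bar n)\<rbrakk> \<Longrightarrow> f (c \<oplus>\<^bsub>bar n\<^esub> c') = f c \<oplus>\<^bsub>N\<^esub> f c'"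
    and "\<And>c c'. \<lbrakk>c \<in> carrier (bar n); c' \<in> carrier (bar n)\<rbrakk> \<Longrightarrow> g (c \<oplus>\<^bsub>bar n\<^esub> c') = g c \<oplus>\<^bsub>N\<^esub> g c'"
    and "f \<zero>\<^bsub>bar n\<^esub> = g \<zero>\<^bsub>bar n\<^esub>"
    and eq: "\<And>k x xs. \<lbrakk>k \<in> carrier K; xs \<in> T n; (x, hd xs) \<in> FP\<rbrakk> \<Longrightarrow> f (bvec k x xs) = g (bvec k x xs)"
    and c: "c \<in> carrier (bar n)"
  shows "f c = g c"
proof (rule additive_eqI[where M = "bar n" and N = N and f = f and g = g
      and supp = "\<lambda>c. {(t, p). c t p \<noteq> \<zero>\<^bsub>K\<^esub>}"
      and B = "{bvec k x xs | k x xs. k \<in> carrier K \<and> xs \<in> T n \<and> (x, hd xs) \<in> FP}", OF assms(1-3)])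
  fix c i assume c: "c \<in> carrier (bar n)" and i: "i \<in> {(t, p). c t p \<noteq> \<zero>\<^bsub>K\<^esub>}"
  obtain t x z where t: "i = (t, (x, z))" by (metis surj_pair)
  have nz: "c t (x, z) \<noteq> \<zero>\<^bsub>K\<^esub>" using i t by simp
  have tT: "t \<in> T n" "(x, hd t) \<in> FP" "z = hd t" using barD(2)[OF c nz] by auto
  let ?v = "\<lambda>t' p. if t' = t \<and> p = (x, z) then \<zero>\<^bsub>K\<^esub> else c t' p"
  show "\<exists>u\<in>{bvec k x xs | k x xs. k \<in> carrier K \<and> xs \<in> T n \<and> (x, hd xs) \<in> FP}. \<exists>v\<in>carrier (bar n).
      c = u \<oplus>\<^bsub>bar n\<^esub> v \<and> {(t, p). v t p \<noteq> \<zero>\<^bsub>K\<^esub>} \<subset> {(t, p). c t p \<noteq> \<zero>\<^bsub>K\<^esub>}"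
  proof (rule bexI, rule bexI, rule conjI)
    show "c = bvec (c t (x, z)) x t \<oplus>\<^bsub>bar n\<^esub> ?v"
      using barD(1)[OF c] tT(3) by (auto simp: bvec_def intro!: ext)
    have "(t, x, z) \<notin> {(t, p). ?v t p \<noteq> \<zero>\<^bsub>K\<^esub>}" "(t, x, z) \<in> {(t, p). c t p \<noteq> \<zero>\<^bsub>K\<^esub>}"
      using nz by auto
    moreover have "{(t, p). ?v t p \<noteq> \<zero>\<^bsub>K\<^esub>} \<subseteq> {(t, p). c t p \<noteq> \<zero>\<^bsub>K\<^esub>}" by auto
    ultimately show "{(t, p). ?v t p \<noteq> \<zero>\<^bsub>K\<^esub>} \<subset> {(t, p). c t p \<noteq> \<zero>\<^bsub>K\<^esub>}" by blast
    show "?v \<in> carrier (bar n)" by (rule barI) (use barD[OF c] in \<open>auto split: if_splits\<close>)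
    show "bvec (c t (x, z)) x t \<in> {bvec k x xs | k x xs. k \<in> carrier K \<and> xs \<in> T n \<and> (x, hd xs) \<in> FP}"
      using barD(1)[OF c] tT by blast
  qed
next
  show "finite {(t, p). c t p \<noteq> \<zero>\<^bsub>K\<^esub>}" if c: "c \<in> carrier (bar n)" for c
    by (rule finite_subset[of _ "T n \<times> FP"]) (use barD(2)[OF c] finite_T finite_FP in auto)
  show "c = \<zero>\<^bsub>bar n\<^esub>" if "{(t, p). c t p \<noteq> \<zero>\<^bsub>K\<^esub>} = {}" for c
    using that by (auto intro!: ext)
qed (use eq c bvec_closed(1) in auto)

lemma bar_maps_eqI:
  assumes N: "left_module \<Lambda> N" and f: "f \<in> linear_maps \<Lambda> (bar n) N" and g: "g \<in> linear_maps \<Lambda> (bar n) N"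
    and eq: "\<And>xs. xs \<in> T n \<Longrightarrow> f (gen xs) = g (gen xs)" and c: "c \<in> carrier (bar n)"
  shows "f c = g c"
proof (rule bar_eqI[OF linear_mapsD(2)[OF f] linear_mapsD(2)[OF g] _ _ c])
  have "abelian_group N" using N by (simp add: left_module_def)
  then show "f \<zero>\<^bsub>bar n\<^esub> = g \<zero>\<^bsub>bar n\<^esub>"
    using linear_maps_zero[OF bar_ab _ f] linear_maps_zero[OF bar_ab _ g] by simp
  fix k x xs assume a: "k \<in> carrier K" "xs \<in> T n" "(x, hd xs) \<in> FP"
  show "f (bvec k x xs) = g (bvec k x xs)"
    using eq[OF a(2)] linear_mapsD(3)[OF f el_closed[OF a(1,3)] gen_closed(1)[OF a(2)]]
      linear_mapsD(3)[OF g el_closed[OF a(1,3)] gen_closed(1)[OF a(2)]] bvec_gen[OF a]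
    by simp
qed auto

text \<open>\<open>bar n\<close> lies in the free module on \<open>T n\<close> but is not free on
  its own generators: the extension takes the value \<open>(x_0, x_0) \<nu> xs\<close> at
  \<open>gen xs\<close>, which equals \<open>\<nu> xs\<close> only if the idempotent fixes
  \<open>\<nu> xs\<close>.\<close>

definition extb :: "('x \<times> 'x \<Rightarrow> 'k, 'n) gmodule \<Rightarrow> int \<Rightarrow> ('x list \<Rightarrow> 'n) \<Rightarrow> ('x list \<Rightarrow> 'x \<times> 'x \<Rightarrow> 'k) \<Rightarrow> 'n"
  where "extb N n \<nu> = (\<lambda>c\<in>carrier (bar n). lin_ext \<Lambda> N \<nu> c)"

lemma extb_bvec:
  assumes "left_module \<Lambda> N" "\<nu> xs \<in> carrier N" "k \<in> carrier K" "xs \<in> T n" "(x, hd xs) \<in> FP"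
  shows "extb N n \<nu> (bvec k x xs) = el k x (hd xs) \<odot>\<^bsub>N\<^esub> \<nu> xs"
proof -
  interpret N: left_module \<Lambda> N by fact
  have m: "bvec k x xs \<in> carrier (free_module \<Lambda> {xs})"
    using el_closed[OF assms(3,5)] L.zero_closed unfolding free_module_carrier
    by (auto simp: bvec_component simp del: distance_algebra_simps intro: finite_subset[of _ "{xs}"])
  have "lin_ext \<Lambda> N \<nu> (bvec k x xs) = (\<Oplus>\<^bsub>N\<^esub>t\<in>{xs}. bvec k x xs t \<odot>\<^bsub>N\<^esub> \<nu> t)"
    by (rule lin_ext_superset[OF assms(1) m]) (use assms(2) in \<open>auto simp: bvec_component simp del: distance_algebra_simps\<close>)
  then show ?thesis
    using bvec_closed(1)[OF assms(3-5)] el_closed[OF assms(3,5)] assms(2) by (simp add: extb_def bvec_component)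
qed

lemma extb_gen:
  assumes "left_module \<Lambda> N" "\<nu> xs \<in> carrier N" "xs \<in> T n"
  shows "extb N n \<nu> (gen xs) = el \<one>\<^bsub>K\<^esub> (hd xs) (hd xs) \<odot>\<^bsub>N\<^esub> \<nu> xs"
  by (rule extb_bvec[where \<nu> = \<nu> and xs = xs,
        OF assms(1,2) K.one_closed assms(3) FP_refl[OF valid_hd[OF T_valid[OF assms(3)]]]])

lemma extb_graded:
  assumes N: "graded_left_module G \<Lambda> N" and \<nu>: "\<And>xs. xs \<in> T n \<Longrightarrow> \<nu> xs \<in> gpart N (wt xs)"
  shows "extb N n \<nu> \<in> graded_maps G \<Lambda> (bar n) N"
proof -
  interpret N: graded_left_module G \<Lambda> N by fact
  interpret B: graded_left_module G \<Lambda> "bar n" by (rule bar_graded)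
  have \<nu>c: "\<nu> \<in> T n \<rightarrow> carrier N" using \<nu> N.gpart_carrier valid_wt T_valid by blast
  note lin = lin_ext_linear[OF N.left_module_axioms \<nu>c]
  have e: "extb N n \<nu> c = (\<lambda>c\<in>carrier (free_module \<Lambda> (T n)). lin_ext \<Lambda> N \<nu> c) c" if "c \<in> carrier (bar n)" for c
    using that bar_free by (simp add: extb_def)
  show ?thesis
  proof (rule graded_mapsI)
    show "extb N n \<nu> \<in> carrier (bar n) \<rightarrow>\<^sub>E carrier N"
      using linear_mapsD(1)[OF lin bar_free] e by (auto simp: extb_def)
    show "extb N n \<nu> (c \<oplus>\<^bsub>bar n\<^esub> c') = extb N n \<nu> c \<oplus>\<^bsub>N\<^esub> extb N n \<nu> c'"
      if "c \<in> carrier (bar n)" "c' \<in> carrier (bar n)" for c c'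
      using linear_mapsD(2)[OF lin bar_free[OF that(1)] bar_free[OF that(2)]] B.M.a_closed[OF that] that
      by (simp add: e)
    show "extb N n \<nu> (r \<odot>\<^bsub>bar n\<^esub> c) = r \<odot>\<^bsub>N\<^esub> extb N n \<nu> c" if "r \<in> carrier \<Lambda>" "c \<in> carrier (bar n)" for r c
      using linear_mapsD(3)[OF lin that(1) bar_free[OF that(2)]] B.smult_closed[OF that] that
      by (simp add: e)
    fix g c assume g: "g \<in> G" and c: "c \<in> gpart (bar n) g"
    then have cc: "c \<in> carrier (bar n)" by (simp add: bar_gpart)
    have "lin_ext \<Lambda> N \<nu> c \<in> gpart N g"
      unfolding lin_ext_def
    proof (rule N.gpart_finsum[OF g])
      show "finite {t. c t \<noteq> \<zero>\<^bsub>\<Lambda>\<^esub>}" using bar_free[OF cc] unfolding free_module_carrier by blast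
      fix t assume "t \<in> {t. c t \<noteq> \<zero>\<^bsub>\<Lambda>\<^esub>}"
      then have t: "t \<in> T n" using bar_free[OF cc] unfolding free_module_carrier by blast
      note w = valid_wt[OF T_valid[OF t]]
      have "c t \<in> gpart \<Lambda> (g - wt t)"
        using c bar_component[OF cc] unfolding gpart_rdist bar_gpart by fastforce
      then show "c t \<odot>\<^bsub>N\<^esub> \<nu> t \<in> gpart N g"
        using N.smult_gpart[OF diff_in_G[OF g w] w _ \<nu>[OF t]] by simp
    qed
    then show "extb N n \<nu> c \<in> gpart N g" using cc by (simp add: extb_def)
  qed
qed

lemma idem_gen: "xs \<in> T n \<Longrightarrow> el \<one>\<^bsub>K\<^esub> (hd xs) (hd xs) \<odot>\<^bsub>bar n\<^esub> gen xs = gen xs"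
  by (rule bvec_gen[OF K.one_closed _ FP_refl[OF valid_hd[OF T_valid]]])

lemma el_gpart: "\<lbrakk>k \<in> carrier K; (x, y) \<in> FP\<rbrakk> \<Longrightarrow> el k x y \<in> gpart \<Lambda> (rdist x y)"
  unfolding gpart_rdist by (simp add: el_closed el_apply)

text \<open>Homogeneous preimages \<open>p xs\<close> of the values on generators need not be fixed
  by the idempotents \<open>(x_0, x_0)\<close>. The extension multiplies them by the idempotents,
  and this does no harm because the values \<open>f (gen xs)\<close> are fixed.\<close>

lemma bar_projective: "graded_projective G \<Lambda> (bar n)"
  unfolding graded_projective_def
proof (intro conjI allI impI bar_graded)
  fix N :: "('x \<times> 'x \<Rightarrow> 'k, real \<times> ('x list \<Rightarrow> 'x \<times> 'x \<Rightarrow> 'k) \<Rightarrow> 'x \<times> 'x \<Rightarrow> 'k) gmodule"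
    and N' :: "('x \<times> 'x \<Rightarrow> 'k, 'x list \<Rightarrow> 'x \<times> 'x \<Rightarrow> 'k) gmodule" and u f
  assume N: "graded_left_module G \<Lambda> N" and N': "graded_left_module G \<Lambda> N'"
    and u: "u \<in> graded_maps G \<Lambda> N N'" "u ` carrier N = carrier N'" and f: "f \<in> graded_maps G \<Lambda> (bar n) N'"
  interpret N: graded_left_module G \<Lambda> N by (rule N)
  interpret N': graded_left_module G \<Lambda> N' by (rule N')
  have "\<exists>p\<in>gpart N (wt xs). u p = f (gen xs)" if "xs \<in> T n" for xs
    by (rule graded_surj_gpart[OF N N' u valid_wt[OF T_valid[OF that]]])
      (rule graded_mapsD(2)[OF f valid_wt[OF T_valid[OF that]] gen_closed(2)[OF that]])
  then obtain p where p: "\<And>xs. xs \<in> T n \<Longrightarrow> p xs \<in> gpart N (wt xs)" "\<And>xs. xs \<in> T n \<Longrightarrow> u (p xs) = f (gen xs)"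
    by metis
  have h: "extb N n p \<in> graded_maps G \<Lambda> (bar n) N" by (rule extb_graded[OF N p(1)])
  have "compose (carrier (bar n)) u (extb N n p) c = f c" if c: "c \<in> carrier (bar n)" for c
  proof (rule bar_maps_eqI[OF N'.left_module_axioms graded_mapsD(1)[OF compose_graded_maps[OF h u(1) bar_graded]]
        graded_mapsD(1)[OF f] _ c])
    fix xs assume xs: "xs \<in> T n"
    have e: "el \<one>\<^bsub>K\<^esub> (hd xs) (hd xs) \<in> carrier \<Lambda>"
      by (rule el_closed[OF K.one_closed FP_refl[OF valid_hd[OF T_valid[OF xs]]]])
    have pc: "p xs \<in> carrier N" by (rule N.gpart_carrier[OF valid_wt[OF T_valid[OF xs]] p(1)[OF xs]])
    have "u (extb N n p (gen xs)) = el \<one>\<^bsub>K\<^esub> (hd xs) (hd xs) \<odot>\<^bsub>N'\<^esub> f (gen xs)"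
      using extb_gen[where \<nu> = p and xs = xs, OF N.left_module_axioms pc xs] linear_mapsD(3)[OF graded_mapsD(1)[OF u(1)] e pc] p(2)[OF xs]
      by simp
    also have "\<dots> = f (gen xs)"
      using linear_mapsD(3)[OF graded_mapsD(1)[OF f] e gen_closed(1)[OF xs]] idem_gen[OF xs] by simp
    finally show "compose (carrier (bar n)) u (extb N n p) (gen xs) = f (gen xs)"
      using gen_closed(1)[OF xs] by (simp add: compose_eq)
  qed
  then show "\<exists>h\<in>graded_maps G \<Lambda> (bar n) N. \<forall>x\<in>carrier (bar n). u (h x) = f x"
    using h by (intro bexI[OF _ h]) (simp add: compose_eq)
qed

lemma bar_gpart_minus:
  assumes "g \<in> G" "c \<in> gpart (bar n) g" "c' \<in> gpart (bar n) g"
  shows "(\<lambda>t p. c t p \<ominus>\<^bsub>K\<^esub> c' t p) \<in> gpart (bar n) g"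
proof -
  interpret B: graded_left_module G \<Lambda> "bar n" by (rule bar_graded)
  interpret A: additive_subgroup "gpart (bar n) g" "bar n" by (rule B.gpart_subgroup[OF assms(1)])
  have "c \<ominus>\<^bsub>bar n\<^esub> c' \<in> gpart (bar n) g"
    unfolding B.M.minus_eq by (rule A.a_closed[OF assms(2) A.a_inv_closed[OF assms(3)]])
  moreover have "c \<in> carrier (bar n)" "c' \<in> carrier (bar n)"
    using assms(2,3) unfolding bar_gpart by blast+
  ultimately show ?thesis by (simp only: bar_minus)
qed

text \<open>The extra degeneracy \<open>s\<close> of the bar resolution, which sends \<open>(x, x\<^sub>0, \<dots>, x\<^sub>n)\<close> to
  \<open>(x, x, x\<^sub>0, \<dots>, x\<^sub>n)\<close> if \<open>x \<noteq> x\<^sub>0\<close> and to \<open>0\<close> otherwise.\<close>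

definition con :: "('x list \<Rightarrow> 'x \<times> 'x \<Rightarrow> 'k) \<Rightarrow> 'x list \<Rightarrow> 'x \<times> 'x \<Rightarrow> 'k" where
  "con c = (\<lambda>t p. if valid t \<and> tl t \<noteq> [] \<and> p = (hd t, hd t) then c (tl t) (hd t, hd (tl t)) else \<zero>\<^bsub>K\<^esub>)"

text \<open>The length of the pair \<open>(x, x_0)\<close> passes from the coefficient to the tuple,
  and the new coefficient \<open>(x, x)\<close> has length 0; the total degree is unchanged.\<close>

lemma con_gpart:
  assumes "c \<in> gpart (bar n) g"
  shows "con c \<in> gpart (bar (n + 1)) g"
proof -
  have c: "c \<in> carrier (bar n)" using assms by (simp add: bar_gpart)
  have nz: "valid t \<and> tl t \<noteq> [] \<and> p = (hd t, hd t) \<and> c (tl t) (hd t, hd (tl t)) \<noteq> \<zero>\<^bsub>K\<^esub>" if "con c t p \<noteq> \<zero>\<^bsub>K\<^esub>" for t p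
    using that by (auto simp: con_def split: if_splits)
  have "t \<in> T (n + 1) \<and> p \<in> FP \<and> snd p = hd t" "rdist (fst p) (snd p) + wt t = g"
    if "con c t p \<noteq> \<zero>\<^bsub>K\<^esub>" for t p
  proof -
    note z = nz[OF that]
    have b: "tl t \<in> T n" "(hd t, hd (tl t)) \<in> FP" using barD(2)[OF c] z by blast+
    have t: "t = hd t # tl t" using z valid_not_Nil by simp
    have "t \<in> T (n + 1)" using b(1) z by (cases t) (simp_all add: T_def)
    then show "t \<in> T (n + 1) \<and> p \<in> FP \<and> snd p = hd t"
      using z FP_refl[OF valid_hd[of t]] by simp
    have "rdist (hd t) (hd (tl t)) + wt (tl t) = g" using assms z unfolding bar_gpart by fastforce
    moreover have "rdist (hd t) (hd t) = 0" using FP_D(6)[OF FP_refl[OF valid_hd]] z by simp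
    ultimately show "rdist (fst p) (snd p) + wt t = g"
      using z wt_Cons[of "tl t" "hd t"] t by simp
  qed
  moreover have "con c t p \<in> carrier K" for t p using barD(1)[OF c] by (simp add: con_def)
  ultimately show ?thesis unfolding bar_gpart by (blast intro: barI)
qed

lemma con_closed: "c \<in> carrier (bar n) \<Longrightarrow> con c \<in> carrier (bar (n + 1))"
proof -
  assume c: "c \<in> carrier (bar n)"
  show ?thesis
  proof (rule barI)
    fix t p show "con c t p \<in> carrier K" using barD(1)[OF c] by (simp add: con_def)
    assume "con c t p \<noteq> \<zero>\<^bsub>K\<^esub>"
    then have z: "valid t" "tl t \<noteq> []" "p = (hd t, hd t)" "c (tl t) (hd t, hd (tl t)) \<noteq> \<zero>\<^bsub>K\<^esub>"
      by (auto simp: con_def split: if_splits)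
    have "tl t \<in> T n" using barD(2)[OF c z(4)] by blast
    then have "t \<in> T (n + 1)" using z by (cases t) (simp_all add: T_def)
    then show "t \<in> T (n + 1) \<and> p \<in> FP \<and> snd p = hd t"
      using z FP_refl[OF valid_hd[of t]] by simp
  qed
qed

lemma con_add:
  assumes "c \<in> carrier (bar n)" "c' \<in> carrier (bar n)"
  shows "con (c \<oplus>\<^bsub>bar n\<^esub> c') = con c \<oplus>\<^bsub>bar m\<^esub> con c'"
  using barD(1)[OF assms(1)] by (auto simp: con_def intro!: ext)

lemma con_zero [simp]: "con (\<lambda>t p. \<zero>\<^bsub>K\<^esub>) = (\<lambda>t p. \<zero>\<^bsub>K\<^esub>)"
  by (auto simp: con_def intro!: ext)

lemma con_minus: "con (\<lambda>t p. c t p \<ominus>\<^bsub>K\<^esub> c' t p) = (\<lambda>t p. con c t p \<ominus>\<^bsub>K\<^esub> con c' t p)"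
  by (auto simp: con_def K.minus_eq intro!: ext)

text \<open>The image of \<open>con\<close> consists of terms whose coefficient is
  \<open>(x, x)\<close> for the first point \<open>x\<close> of the tuple, and these are exactly the
  degenerate ones that \<open>con\<close> kills.\<close>

lemma con_con: "con (con c) = (\<lambda>t p. \<zero>\<^bsub>K\<^esub>)"
proof (intro ext)
  fix t p
  show "con (con c) t p = \<zero>\<^bsub>K\<^esub>"
  proof (cases "valid t \<and> tl t \<noteq> []")
    case True
    then have "hd t \<noteq> hd (tl t)" using valid_Cons[of "tl t" "hd t"] valid_not_Nil by auto
    then show ?thesis by (simp add: con_def)
  qed (simp add: con_def)
qed

lemma con_bvec:
  assumes "xs \<in> T n" "(x, hd xs) \<in> FP"
  shows "con (bvec k x xs) = (if x = hd xs then (\<lambda>t p. \<zero>\<^bsub>K\<^esub>) else bvec k x (x # xs))"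
proof -
  have ne: "xs \<noteq> []" using T_valid[OF assms(1)] valid_not_Nil by blast
  have v: "valid (x # xs) \<longleftrightarrow> x \<noteq> hd xs" using valid_Cons[OF ne] T_valid[OF assms(1)] assms(2) by simp
  have "valid t \<and> tl t \<noteq> [] \<and> p = (hd t, hd t) \<and> tl t = xs \<and> (hd t, hd (tl t)) = (x, hd xs)
      \<longleftrightarrow> x \<noteq> hd xs \<and> t = x # xs \<and> p = (x, x)" for t p
    using v ne valid_not_Nil[of t] by (cases t) auto
  then show ?thesis by (auto simp: con_def bvec_def fun_eq_iff)
qed

text \<open>\<open>con\<close> is not \<open>\<Lambda>\<close>-linear. On terms that start at
  \<open>x\<close>, however, multiplication by \<open>k (x, x)\<close> is just multiplication by the
  scalar \<open>k\<close>, and this passes through \<open>con\<close>.\<close>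

lemma el_con:
  assumes k: "k \<in> carrier K" and xy: "(x, y) \<in> FP" and c: "c \<in> carrier (bar n)"
  shows "el k x x \<odot>\<^bsub>bar m\<^esub> con (el \<one>\<^bsub>K\<^esub> x y \<odot>\<^bsub>bar n\<^esub> c) = con (el k x y \<odot>\<^bsub>bar n\<^esub> c)"
proof (safe intro!: ext)
  interpret B: left_module \<Lambda> "bar n" by (rule bar_left_module)
  fix t u v
  have e: "el \<one>\<^bsub>K\<^esub> x y \<in> carrier \<Lambda>" using xy by (simp add: el_closed)
  have cc: "con (el \<one>\<^bsub>K\<^esub> x y \<odot>\<^bsub>bar n\<^esub> c) t \<in> carrier \<Lambda>"
    by (rule bar_component[OF con_closed[OF B.smult_closed[OF e c]]])
  note x = FP_D(1,2)[OF xy]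
  have ct: "c (tl t) p \<in> carrier K" for p by (rule barD(1)[OF c])
  have X: "valid t \<Longrightarrow> hd t \<in> X" by (rule valid_hd)
  show "(el k x x \<odot>\<^bsub>bar m\<^esub> con (el \<one>\<^bsub>K\<^esub> x y \<odot>\<^bsub>bar n\<^esub> c)) t (u, v) = con (el k x y \<odot>\<^bsub>bar n\<^esub> c) t (u, v)"
    using el_mult_apply[OF k x(1) cc, of x u v] k ct X between_refl(1)[OF x(1) x(1)]
    by (auto simp: con_def el_mult_apply[OF K.one_closed x(2) bar_component[OF c]]
        el_mult_apply[OF k x(2) bar_component[OF c]])
qed

text \<open>Writing the generator \<open>(x\<^sub>0, \<dots>, x\<^sub>n)\<close> as the contraction of
  \<open>(x\<^sub>0, x\<^sub>1) \<cdot> (x\<^sub>1, \<dots>, x\<^sub>n)\<close>, the identity \<open>\<partial>s + s\<partial> = 1\<close> dictates its boundary.\<close>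

fun bnd :: "'x list \<Rightarrow> 'x list \<Rightarrow> 'x \<times> 'x \<Rightarrow> 'k" where
  "bnd (x # y # ys) = (\<lambda>t p. bvec \<one>\<^bsub>K\<^esub> x (y # ys) t p \<ominus>\<^bsub>K\<^esub> con (\<lambda>t. el \<one>\<^bsub>K\<^esub> x y \<otimes>\<^bsub>\<Lambda>\<^esub> bnd (y # ys) t) t p)"
| "bnd xs = (\<lambda>t p. \<zero>\<^bsub>K\<^esub>)"

lemma bnd_gpart: "xs \<in> T n \<Longrightarrow> bnd xs \<in> gpart (bar (n - 1)) (wt xs)"
proof (induction xs arbitrary: n rule: bnd.induct)
  case (1 x y ys)
  have xy: "(x, y) \<in> FP" "x \<noteq> y" and ys: "y # ys \<in> T (n - 1)"
    using "1.prems" T_Cons[of "y # ys" x "n - 1"] by auto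
  interpret B: graded_left_module G \<Lambda> "bar (n - 2)" by (rule bar_graded)
  have w: "rdist x y \<in> G" "wt (y # ys) \<in> G" using FP_D(4)[OF xy(1)] valid_wt[OF T_valid[OF ys]] by auto
  have "bnd (y # ys) \<in> gpart (bar (n - 2)) (wt (y # ys))" using "1.IH"[OF ys] by simp
  then have "el \<one>\<^bsub>K\<^esub> x y \<odot>\<^bsub>bar (n - 2)\<^esub> bnd (y # ys) \<in> gpart (bar (n - 2)) (rdist x y + wt (y # ys))"
    by (rule B.smult_gpart[OF w el_gpart[OF K.one_closed xy(1)]])
  from con_gpart[OF this]
  have c: "con (\<lambda>t. el \<one>\<^bsub>K\<^esub> x y \<otimes>\<^bsub>\<Lambda>\<^esub> bnd (y # ys) t) \<in> gpart (bar (n - 1)) (wt (x # y # ys))" by simp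
  have b: "bvec \<one>\<^bsub>K\<^esub> x (y # ys) \<in> gpart (bar (n - 1)) (wt (x # y # ys))"
    using bvec_closed(2)[OF K.one_closed ys, of x] xy(1) by simp
  show ?case
    using bar_gpart_minus[OF valid_wt[OF T_valid[OF "1.prems"]] b c] by simp
qed (auto simp: bar_gpart intro!: barI)

lemma bnd_closed: "xs \<in> T n \<Longrightarrow> bnd xs \<in> carrier (bar (n - 1))"
  using bnd_gpart[of xs n] by (simp add: bar_gpart)

definition bard :: "int \<Rightarrow> ('x list \<Rightarrow> 'x \<times> 'x \<Rightarrow> 'k) \<Rightarrow> 'x list \<Rightarrow> 'x \<times> 'x \<Rightarrow> 'k" where
  "bard n = extb (bar (n - 1)) n bnd"

lemma bard_maps: "bard n \<in> graded_maps G \<Lambda> (bar n) (bar (n - 1))"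
  unfolding bard_def by (rule extb_graded[OF bar_graded bnd_gpart])

lemma bard_closed: "c \<in> carrier (bar n) \<Longrightarrow> bard n c \<in> carrier (bar (n - 1))"
  by (rule graded_maps_closed[OF bard_maps])

lemma bard_closed': "c \<in> carrier (bar (n + 1)) \<Longrightarrow> bard (n + 1) c \<in> carrier (bar n)"
  using bard_closed[of c "n + 1"] by simp

lemma bard_add:
  "\<lbrakk>c \<in> carrier (bar n); c' \<in> carrier (bar n)\<rbrakk> \<Longrightarrow> bard n (c \<oplus>\<^bsub>bar n\<^esub> c') = bard n c \<oplus>\<^bsub>bar (n - 1)\<^esub> bard n c'"
  by (rule linear_mapsD(2)[OF graded_mapsD(1)[OF bard_maps]])

lemma bard_zero: "bard n (\<lambda>t p. \<zero>\<^bsub>K\<^esub>) = (\<lambda>t p. \<zero>\<^bsub>K\<^esub>)"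
  using linear_maps_zero[OF bar_ab bar_ab graded_mapsD(1)[OF bard_maps[of n]]] by simp

lemma bard_minus:
  "\<lbrakk>c \<in> carrier (bar n); c' \<in> carrier (bar n)\<rbrakk> \<Longrightarrow>
    bard n (\<lambda>t p. c t p \<ominus>\<^bsub>K\<^esub> c' t p) = (\<lambda>t p. bard n c t p \<ominus>\<^bsub>K\<^esub> bard n c' t p)"
  using linear_maps_minus[OF bar_ab bar_ab graded_mapsD(1)[OF bard_maps[of n]], of c c']
    bar_minus[of c n c'] bar_minus[of "bard n c" "n - 1" "bard n c'"] bard_closed by simp

lemma bard_bvec:
  assumes "k \<in> carrier K" "xs \<in> T n" "(x, hd xs) \<in> FP"
  shows "bard n (bvec k x xs) = el k x (hd xs) \<odot>\<^bsub>bar (n - 1)\<^esub> bnd xs"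
  unfolding bard_def by (rule extb_bvec[where \<nu> = bnd and xs = xs, OF bar_left_module bnd_closed[OF assms(2)] assms])

lemma smult_minus:
  assumes "r \<in> carrier \<Lambda>" "c \<in> carrier (bar n)" "c' \<in> carrier (bar n)"
  shows "r \<odot>\<^bsub>bar n\<^esub> (\<lambda>t p. c t p \<ominus>\<^bsub>K\<^esub> c' t p) =
    (\<lambda>t p. (r \<odot>\<^bsub>bar n\<^esub> c) t p \<ominus>\<^bsub>K\<^esub> (r \<odot>\<^bsub>bar n\<^esub> c') t p)"
proof -
  interpret B: left_module \<Lambda> "bar n" by (rule bar_left_module)
  have "r \<odot>\<^bsub>bar n\<^esub> (c \<ominus>\<^bsub>bar n\<^esub> c') = (r \<odot>\<^bsub>bar n\<^esub> c) \<ominus>\<^bsub>bar n\<^esub> (r \<odot>\<^bsub>bar n\<^esub> c')"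
    using assms by (simp only: B.M.minus_eq B.smult_r_distr B.smult_r_inv B.M.a_inv_closed)
  then show ?thesis
    using bar_minus[OF assms(2,3)] bar_minus[OF B.smult_closed[OF assms(1,2)] B.smult_closed[OF assms(1,3)]]
    by simp
qed

text \<open>The recursion of \<open>bnd\<close> multiplied by \<open>k (x, x)\<close>. This is
  needed because \<open>bard\<close> evaluates \<open>bvec k x xs\<close> as such a multiple of
  \<open>bnd xs\<close>, and \<open>el_con\<close> is what moves the factor inside the
  contraction.\<close>

lemma el_bnd:
  assumes k: "k \<in> carrier K" and xs: "x # y # ys \<in> T n"
  shows "el k x x \<odot>\<^bsub>bar (n - 1)\<^esub> bnd (x # y # ys) =
    (\<lambda>t p. bvec k x (y # ys) t p \<ominus>\<^bsub>K\<^esub> con (el k x y \<odot>\<^bsub>bar (n - 2)\<^esub> bnd (y # ys)) t p)"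
proof -
  have xy: "(x, y) \<in> FP" and ys: "y # ys \<in> T (n - 1)"
    using xs T_Cons[of "y # ys" x "n - 1"] by auto
  interpret B: left_module \<Lambda> "bar (n - 2)" by (rule bar_left_module)
  have xx: "(x, x) \<in> FP" by (rule FP_refl[OF FP_D(1)[OF xy]])
  have b: "bnd (y # ys) \<in> carrier (bar (n - 2))" using bnd_closed[OF ys] by simp
  have c: "con (el \<one>\<^bsub>K\<^esub> x y \<odot>\<^bsub>bar (n - 2)\<^esub> bnd (y # ys)) \<in> carrier (bar (n - 1))"
    using con_closed[OF B.smult_closed[OF el_closed[OF K.one_closed xy] b]] by simp
  have v: "bvec \<one>\<^bsub>K\<^esub> x (y # ys) \<in> carrier (bar (n - 1))"
    using bvec_closed(1)[OF K.one_closed ys, of x] xy by simp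
  have "el k x x \<odot>\<^bsub>bar (n - 1)\<^esub> bvec \<one>\<^bsub>K\<^esub> x (y # ys) = bvec k x (y # ys)"
    using smult_bvec[OF k K.one_closed xx ys] xy between_refl(1)[OF FP_D(1,2)[OF xy]] k by simp
  moreover have "el k x x \<odot>\<^bsub>bar (n - 1)\<^esub> con (el \<one>\<^bsub>K\<^esub> x y \<odot>\<^bsub>bar (n - 2)\<^esub> bnd (y # ys)) =
      con (el k x y \<odot>\<^bsub>bar (n - 2)\<^esub> bnd (y # ys))"
    by (rule el_con[OF k xy b])
  ultimately show ?thesis
    using smult_minus[OF el_closed[OF k xx] v c] by simp
qed

text \<open>If \<open>x\<close> differs from \<open>x_0\<close>, then contracting gives a multiple
  of the generator of the lengthened tuple, so the recursion of \<open>bnd\<close> is literally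
  \<open>\<partial>s = 1 - s\<partial>\<close> here. The degree is arbitrary: degree 0 is included
  because the augmentation does not see \<open>(x, x_0)\<close> with distinct points.\<close>

lemma bnd_bvec_con:
  assumes k: "k \<in> carrier K" and xs: "xs \<in> T n" and x: "(x, hd xs) \<in> FP" "x \<noteq> hd xs"
  shows "bard (n + 1) (con (bvec k x xs)) = (\<lambda>t p. bvec k x xs t p \<ominus>\<^bsub>K\<^esub> con (bard n (bvec k x xs)) t p)"
proof -
  obtain y ys where y: "xs = y # ys" using T_valid[OF xs] by (cases xs) auto
  have xxs: "x # y # ys \<in> T (n + 1)" using T_Cons[of xs x n] xs x y by simp
  have xx: "(x, x) \<in> FP" by (rule FP_refl[OF FP_D(1)[OF x(1)]])
  have "bard (n + 1) (con (bvec k x xs)) = el k x x \<odot>\<^bsub>bar n\<^esub> bnd (x # y # ys)"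
    using con_bvec[OF xs x(1), of k] x(2) bard_bvec[OF k xxs, of x] xx y by simp
  also have "\<dots> = (\<lambda>t p. bvec k x xs t p \<ominus>\<^bsub>K\<^esub> con (bard n (bvec k x xs)) t p)"
    using el_bnd[OF k xxs] bard_bvec[OF k xs x(1)] y by simp
  finally show ?thesis .
qed

section \<open>The contraction identity, the augmentation and exactness\<close>

lemma minus_add_K: "\<lbrakk>a \<in> carrier K; b \<in> carrier K\<rbrakk> \<Longrightarrow> (a \<ominus>\<^bsub>K\<^esub> b) \<oplus>\<^bsub>K\<^esub> b = a"
  by (rule K.minus_add_cancel_both(1))

text \<open>If \<open>x\<close> differs from \<open>x_0\<close>, this is
  \<open>bnd_bvec_con\<close>. If \<open>x = x_0\<close>, the element is a multiple of a generator
  and \<open>s\<close> kills it; its boundary is the face without \<open>x_0\<close> minus something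
  of the form \<open>s c\<close>, and contracting again restores the generator while
  \<open>con_con\<close> removes the rest. The second case needs a second point, hence
  \<open>n \<ge> 1\<close>.\<close>

lemma contraction:
  assumes n: "n \<ge> 1" and c: "c \<in> carrier (bar n)"
  shows "bard (n + 1) (con c) \<oplus>\<^bsub>bar n\<^esub> con (bard n c) = c"
proof (rule bar_eqI[where N = "bar n" and f = "\<lambda>c. bard (n + 1) (con c) \<oplus>\<^bsub>bar n\<^esub> con (bard n c)" and g = "\<lambda>c. c",
      OF _ _ _ _ c])
  interpret B: left_module \<Lambda> "bar n" by (rule bar_left_module)
  have cl: "bard (n + 1) (con c) \<in> carrier (bar n)" "con (bard n c) \<in> carrier (bar n)"
    if "c \<in> carrier (bar n)" for c
    using bard_closed'[OF con_closed[OF that]] con_closed[OF bard_closed[OF that]] by simp_all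
  fix c c' assume c: "c \<in> carrier (bar n)" "c' \<in> carrier (bar n)"
  have "con (c \<oplus>\<^bsub>bar n\<^esub> c') = con c \<oplus>\<^bsub>bar (n + 1)\<^esub> con c'" by (rule con_add[OF c])
  then have 1: "bard (n + 1) (con (c \<oplus>\<^bsub>bar n\<^esub> c')) = bard (n + 1) (con c) \<oplus>\<^bsub>bar n\<^esub> bard (n + 1) (con c')"
    using bard_add[OF con_closed[OF c(1)] con_closed[OF c(2)]] by simp
  have 2: "con (bard n (c \<oplus>\<^bsub>bar n\<^esub> c')) = con (bard n c) \<oplus>\<^bsub>bar n\<^esub> con (bard n c')"
    unfolding bard_add[OF c] by (rule con_add[OF bard_closed[OF c(1)] bard_closed[OF c(2)]])
  show "bard (n + 1) (con (c \<oplus>\<^bsub>bar n\<^esub> c')) \<oplus>\<^bsub>bar n\<^esub> con (bard n (c \<oplus>\<^bsub>bar n\<^esub> c')) =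
      (bard (n + 1) (con c) \<oplus>\<^bsub>bar n\<^esub> con (bard n c)) \<oplus>\<^bsub>bar n\<^esub> (bard (n + 1) (con c') \<oplus>\<^bsub>bar n\<^esub> con (bard n c'))"
    unfolding 1 2 using barD(1)[OF cl(1)[OF c(1)]] barD(1)[OF cl(2)[OF c(1)]]
      barD(1)[OF cl(1)[OF c(2)]] barD(1)[OF cl(2)[OF c(2)]]
    by (auto simp: K.a_ac intro!: ext)
next
  fix k x xs assume k: "k \<in> carrier K" and xs: "xs \<in> T n" and x: "(x, hd xs) \<in> FP"
  have m: "bvec k x xs \<in> carrier (bar n)" by (rule bvec_closed(1)[OF k xs x])
  show "bard (n + 1) (con (bvec k x xs)) \<oplus>\<^bsub>bar n\<^esub> con (bard n (bvec k x xs)) = bvec k x xs"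
  proof (cases "x = hd xs")
    case False
    have "con (bard n (bvec k x xs)) \<in> carrier (bar n)" using con_closed[OF bard_closed[OF m]] by simp
    then show ?thesis
      using bnd_bvec_con[OF k xs x False] barD(1)[OF m] minus_add_K barD(1) by simp
  next
    case True
    obtain y ys where xsy: "xs = x # y # ys"
      using xs True n by (cases xs; cases "tl xs") (auto simp: T_def)
    have ys: "y # ys \<in> T (n - 1)" "(x, y) \<in> FP" "x \<noteq> y"
      using xs T_Cons[of "y # ys" x "n - 1"] xsy by auto
    have "bard n (bvec k x xs) = (\<lambda>t p. bvec k x (y # ys) t p \<ominus>\<^bsub>K\<^esub> con (el k x y \<odot>\<^bsub>bar (n - 2)\<^esub> bnd (y # ys)) t p)"
      using bard_bvec[OF k xs x] el_bnd[OF k xs[unfolded xsy]] xsy by simp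
    then have "con (bard n (bvec k x xs)) = (\<lambda>t p. bvec k x xs t p \<ominus>\<^bsub>K\<^esub> \<zero>\<^bsub>K\<^esub>)"
      using con_minus con_con con_bvec[OF ys(1), of x k] ys xsy by simp
    then have "con (bard n (bvec k x xs)) = bvec k x xs"
      using barD(1)[OF m] by (simp add: K.minus_eq)
    moreover have "bard (n + 1) (con (bvec k x xs)) = (\<lambda>t p. \<zero>\<^bsub>K\<^esub>)"
      using con_bvec[OF xs x, of k] True bard_zero by simp
    ultimately show ?thesis using barD(1)[OF m] by simp
  qed
qed (auto simp: bard_zero)

text \<open>In degree 0 the augmentation \<open>\<epsilon>\<close> enters the contraction identity
  through \<open>\<eta>\<epsilon>\<close>, where \<open>\<eta>\<close> is the
  \<open>\<K>\<close>-linear section of \<open>\<epsilon>\<close> sending the class of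
  \<open>(x, x)\<close> to the generator \<open>(x)\<close>. This is the projection
  \<open>\<eta>\<epsilon>\<close>.\<close>

definition diagonal :: "('x list \<Rightarrow> 'x \<times> 'x \<Rightarrow> 'k) \<Rightarrow> 'x list \<Rightarrow> 'x \<times> 'x \<Rightarrow> 'k" where
  "diagonal c = (\<lambda>t p. if fst p = snd p then c t p else \<zero>\<^bsub>K\<^esub>)"

lemma contraction_0:
  assumes c: "c \<in> carrier (bar 0)"
  shows "bard 1 (con c) \<oplus>\<^bsub>bar 0\<^esub> diagonal c = c"
proof (rule bar_eqI[where N = "bar 0" and f = "\<lambda>c. bard 1 (con c) \<oplus>\<^bsub>bar 0\<^esub> diagonal c" and g = "\<lambda>c. c", OF _ _ _ _ c])
  interpret B: left_module \<Lambda> "bar 0" by (rule bar_left_module)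
  fix c c' assume c: "c \<in> carrier (bar 0)" "c' \<in> carrier (bar 0)"
  have "con (c \<oplus>\<^bsub>bar 0\<^esub> c') = con c \<oplus>\<^bsub>bar 1\<^esub> con c'" by (rule con_add[OF c])
  then have 1: "bard 1 (con (c \<oplus>\<^bsub>bar 0\<^esub> c')) = bard 1 (con c) \<oplus>\<^bsub>bar 0\<^esub> bard 1 (con c')"
    using bard_add[OF con_closed[OF c(1)] con_closed[OF c(2)]] by simp
  have cl: "bard 1 (con c) \<in> carrier (bar 0)" if "c \<in> carrier (bar 0)" for c
    using bard_closed'[of "con c" 0] con_closed[OF that] by simp
  show "bard 1 (con (c \<oplus>\<^bsub>bar 0\<^esub> c')) \<oplus>\<^bsub>bar 0\<^esub> diagonal (c \<oplus>\<^bsub>bar 0\<^esub> c') =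
      (bard 1 (con c) \<oplus>\<^bsub>bar 0\<^esub> diagonal c) \<oplus>\<^bsub>bar 0\<^esub> (bard 1 (con c') \<oplus>\<^bsub>bar 0\<^esub> diagonal c')"
    unfolding 1 using barD(1)[OF cl[OF c(1)]] barD(1)[OF cl[OF c(2)]] barD(1)[OF c(1)] barD(1)[OF c(2)]
    by (auto simp: diagonal_def K.a_ac intro!: ext)
next
  fix k x xs assume k: "k \<in> carrier K" and xs: "xs \<in> T 0" and x: "(x, hd xs) \<in> FP"
  have m: "bvec k x xs \<in> carrier (bar 0)" by (rule bvec_closed(1)[OF k xs x])
  obtain y where y: "xs = [y]" using xs by (cases xs) (auto simp: T_def)
  show "bard 1 (con (bvec k x xs)) \<oplus>\<^bsub>bar 0\<^esub> diagonal (bvec k x xs) = bvec k x xs"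
  proof (cases "x = hd xs")
    case False
    have "el k x y \<in> carrier \<Lambda>" using el_closed[OF k] x y by simp
    then have "bard 0 (bvec k x xs) = (\<lambda>t p. \<zero>\<^bsub>K\<^esub>)"
      using bard_bvec[OF k xs x] left_module.smult_r_null[OF bar_left_module[of "- 1"], of "el k x y"] y by simp
    moreover have "diagonal (bvec k x xs) = (\<lambda>t p. \<zero>\<^bsub>K\<^esub>)"
      using False by (auto simp: diagonal_def bvec_def intro!: ext)
    ultimately show ?thesis
      using bnd_bvec_con[OF k xs x False] barD(1)[OF m] by (simp add: K.minus_eq)
  next
    case True
    have "diagonal (bvec k x xs) = bvec k x xs" using True by (auto simp: diagonal_def bvec_def intro!: ext)
    then show ?thesis
      using con_bvec[OF xs x, of k] True bard_zero[of 1] barD(1)[OF m] by simp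
  qed
qed (auto simp: bard_zero diagonal_def)

definition bar_aug :: "('x list \<Rightarrow> 'x \<times> 'x \<Rightarrow> 'k) \<Rightarrow> ('x \<times> 'x \<Rightarrow> 'k) set" where
  "bar_aug = extb SX 0 (\<lambda>xs. q (el \<one>\<^bsub>K\<^esub> (hd xs) (hd xs)))"

lemma q_el_gpart: "\<lbrakk>k \<in> carrier K; x \<in> X\<rbrakk> \<Longrightarrow> q (el k x x) \<in> gpart SX 0"
  using el_gpart[OF _ FP_refl, of k x] FP_D(6)[OF FP_refl, of x] by (simp add: SX_simps(3))

lemma bar_aug_maps: "bar_aug \<in> graded_maps G \<Lambda> (bar 0) SX"
  unfolding bar_aug_def
proof (rule extb_graded[OF SX_graded])
  fix xs assume "xs \<in> T 0"
  moreover from this obtain y where "xs = [y]" by (cases xs) (auto simp: T_def)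
  ultimately show "q (el \<one>\<^bsub>K\<^esub> (hd xs) (hd xs)) \<in> gpart SX (wt xs)"
    using q_el_gpart[OF K.one_closed] by (simp add: T_def)
qed

lemma diag_bar_aug:
  assumes c: "c \<in> carrier (bar 0)"
  shows "diag (bar_aug c) u = c [u] (u, u)"
proof (rule bar_eqI[where N = K and n = 0 and f = "\<lambda>c. diag (bar_aug c) u" and g = "\<lambda>c. c [u] (u, u)", OF _ _ _ _ c])
  interpret S: graded_left_module G \<Lambda> SX by (rule SX_graded)
  note l = linear_mapsD[OF graded_mapsD(1)[OF bar_aug_maps]]
  show "diag (bar_aug (c \<oplus>\<^bsub>bar 0\<^esub> c')) u = diag (bar_aug c) u \<oplus>\<^bsub>K\<^esub> diag (bar_aug c') u"
    if "c \<in> carrier (bar 0)" "c' \<in> carrier (bar 0)" for c c'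
    using l(1)[OF that(1)] l(1)[OF that(2)] l(2)[OF that] by (simp add: diag_simps(2) del: bar_simps)
  show "diag (bar_aug \<zero>\<^bsub>bar 0\<^esub>) u = \<zero>\<^bsub>bar 0\<^esub> [u] (u, u)"
    using linear_maps_zero[OF bar_ab S.M.abelian_group_axioms graded_mapsD(1)[OF bar_aug_maps]]
    by (simp add: diag_simps(4))
  fix k x xs assume k: "k \<in> carrier K" and xs: "xs \<in> T 0" and x: "(x, hd xs) \<in> FP"
  obtain y where y: "xs = [y]" using xs by (cases xs) (auto simp: T_def)
  have yX: "y \<in> X" using xs y by (simp add: T_def)
  have e: "el \<one>\<^bsub>K\<^esub> y y \<in> carrier \<Lambda>" "el k x y \<in> carrier \<Lambda>" using el_closed FP_refl[OF yX] k x y by auto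
  have "bar_aug (bvec k x xs) = el k x y \<odot>\<^bsub>SX\<^esub> q (el \<one>\<^bsub>K\<^esub> y y)"
    unfolding bar_aug_def
    using extb_bvec[where \<nu> = "\<lambda>xs. q (el \<one>\<^bsub>K\<^esub> (hd xs) (hd xs))", OF S.left_module_axioms _ k xs x] e y
    by (simp add: SX_simps(1))
  then have "diag (bar_aug (bvec k x xs)) u = el k x y (u, u) \<otimes>\<^bsub>K\<^esub> el \<one>\<^bsub>K\<^esub> y y (u, u)"
    using e by (simp add: diag_simps(3) diag_q SX_simps(1))
  then show "diag (bar_aug (bvec k x xs)) u = bvec k x xs [u] (u, u)"
    using k y by (auto simp: el_apply bvec_def)
qed auto

text \<open>The coordinates of \<open>bar_aug c\<close> are precisely the coefficients that
  \<open>diagonal\<close> retains. With \<open>contraction_0\<close> this gives exactness at degree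
  0.\<close>

lemma diagonal_zero:
  assumes c: "c \<in> carrier (bar 0)" and z: "bar_aug c = \<zero>\<^bsub>SX\<^esub>"
  shows "diagonal c = (\<lambda>t p. \<zero>\<^bsub>K\<^esub>)"
proof (intro ext)
  fix t p
  show "diagonal c t p = \<zero>\<^bsub>K\<^esub>"
  proof (rule ccontr)
    assume nz: "diagonal c t p \<noteq> \<zero>\<^bsub>K\<^esub>"
    then have e: "fst p = snd p" "c t p \<noteq> \<zero>\<^bsub>K\<^esub>" by (auto simp: diagonal_def split: if_splits)
    then have t: "t \<in> T 0" "snd p = hd t" using barD(2)[OF c] by auto
    obtain y where y: "t = [y]" using t(1) by (cases t) (auto simp: T_def)
    have "p = (y, y)" using e t(2) y by (metis list.sel(1) prod.collapse)
    then show False using diag_bar_aug[OF c, of y] z e(2) y by (simp add: diag_simps(4))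
  qed
qed

text \<open>The boundary of the generator \<open>(x, y)\<close> is the pair \<open>(x, y)\<close> in
  the component of \<open>(y)\<close>, which has no diagonal coefficient because \<open>x\<close>
  and \<open>y\<close> differ.\<close>

lemma bar_aug_bard:
  assumes c: "c \<in> carrier (bar 1)"
  shows "bar_aug (bard 1 c) = \<zero>\<^bsub>SX\<^esub>"
proof -
  interpret S: graded_left_module G \<Lambda> SX by (rule SX_graded)
  have d: "bard 1 \<in> graded_maps G \<Lambda> (bar 1) (bar 0)" using bard_maps[of 1] by simp
  have z: "(\<lambda>x\<in>carrier (bar 1). \<zero>\<^bsub>SX\<^esub>) \<in> graded_maps G \<Lambda> (bar 1) SX"
    by (rule L.graded_maps_zero[OF bar_graded SX_graded])
  have "compose (carrier (bar 1)) bar_aug (bard 1) c = (\<lambda>x\<in>carrier (bar 1). \<zero>\<^bsub>SX\<^esub>) c"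
  proof (rule bar_maps_eqI[OF S.left_module_axioms graded_mapsD(1)[OF compose_graded_maps[OF d bar_aug_maps bar_graded]]
        graded_mapsD(1)[OF z] _ c])
    fix xs assume xs: "xs \<in> T 1"
    obtain x y where xy: "xs = [x, y]" using xs by (cases xs; cases "tl xs") (auto simp: T_def)
    have FP: "(x, y) \<in> FP" "x \<noteq> y" "y \<in> X" using xs by (auto simp: T_def xy)
    have g: "gen xs \<in> carrier (bar 1)" by (rule gen_closed(1)[OF xs])
    have b: "bard 1 (gen xs) \<in> carrier (bar 0)" by (rule graded_maps_closed[OF d g])
    have y0: "[y] \<in> T 0" using FP by (simp add: T_def)
    have xx: "(x, hd xs) \<in> FP" using FP_refl[OF FP_D(1)[OF FP(1)]] xy by simp
    have "el \<one>\<^bsub>K\<^esub> x y \<odot>\<^bsub>bar (- 1)\<^esub> bnd [y] = \<zero>\<^bsub>bar (- 1)\<^esub>"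
      using left_module.smult_r_null[OF bar_left_module[of "- 1"] el_closed[OF K.one_closed FP(1)]] by simp
    then have "bard 1 (gen xs) = (\<lambda>t p. bvec \<one>\<^bsub>K\<^esub> x [y] t p \<ominus>\<^bsub>K\<^esub> \<zero>\<^bsub>K\<^esub>)"
      using bard_bvec[OF K.one_closed xs xx] el_bnd[OF K.one_closed xs[unfolded xy]] xy by simp
    then have "bard 1 (gen xs) [u] (u, u) = \<zero>\<^bsub>K\<^esub>" for u
      using FP(2) by (auto simp: bvec_def K.minus_eq)
    then have "bar_aug (bard 1 (gen xs)) = \<zero>\<^bsub>SX\<^esub>"
      by (intro SX_eqI[OF graded_maps_closed[OF bar_aug_maps b] S.M.zero_closed])
        (simp add: diag_bar_aug[OF b] diag_simps(4))
    then show "compose (carrier (bar 1)) bar_aug (bard 1) (gen xs) = (\<lambda>x\<in>carrier (bar 1). \<zero>\<^bsub>SX\<^esub>) (gen xs)"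
      using g by (simp add: compose_eq)
  qed
  then show ?thesis using c by (simp add: compose_eq)
qed

text \<open>On generators, which are contractions, \<open>\<partial>\<partial> = 0\<close> follows from \<open>\<partial>s + s\<partial> = 1\<close> and
  \<open>\<partial>\<partial> = 0\<close> in lower degree.\<close>

lemma bard_bard_step:
  assumes n: "n \<ge> 1" and key: "\<And>m. m \<in> carrier (bar n) \<Longrightarrow> bard n (con (bard n m)) = bard n m"
    and c: "c \<in> carrier (bar (n + 1))"
  shows "bard n (bard (n + 1) c) = (\<lambda>t p. \<zero>\<^bsub>K\<^esub>)"
proof -
  have d: "bard (n + 1) \<in> graded_maps G \<Lambda> (bar (n + 1)) (bar n)" using bard_maps[of "n + 1"] by simp
  have z: "(\<lambda>x\<in>carrier (bar (n + 1)). \<zero>\<^bsub>bar (n - 1)\<^esub>) \<in> graded_maps G \<Lambda> (bar (n + 1)) (bar (n - 1))"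
    by (rule L.graded_maps_zero[OF bar_graded bar_graded])
  have "compose (carrier (bar (n + 1))) (bard n) (bard (n + 1)) c = (\<lambda>x\<in>carrier (bar (n + 1)). \<zero>\<^bsub>bar (n - 1)\<^esub>) c"
  proof (rule bar_maps_eqI[OF bar_left_module graded_mapsD(1)[OF compose_graded_maps[OF d bard_maps bar_graded]]
        graded_mapsD(1)[OF z] _ c])
    fix xs assume xs: "xs \<in> T (n + 1)"
    obtain x y zs where xy: "xs = x # y # zs" using xs n by (cases xs; cases "tl xs") (auto simp: T_def)
    have ys: "y # zs \<in> T n" "(x, hd (y # zs)) \<in> FP" "x \<noteq> hd (y # zs)"
      using xs T_Cons[of "y # zs" x n] xy by auto
    let ?m = "bvec \<one>\<^bsub>K\<^esub> x (y # zs)"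
    have m: "?m \<in> carrier (bar n)" by (rule bvec_closed(1)[OF K.one_closed ys(1,2)])
    have b: "bard n ?m \<in> carrier (bar (n - 1))" by (rule bard_closed[OF m])
    have cb: "con (bard n ?m) \<in> carrier (bar n)" using con_closed[OF b] by simp
    have "gen xs = con ?m" using con_bvec[OF ys(1,2), of "\<one>\<^bsub>K\<^esub>"] ys(3) xy by simp
    then have "bard n (bard (n + 1) (gen xs)) = (\<lambda>t p. bard n ?m t p \<ominus>\<^bsub>K\<^esub> bard n ?m t p)"
      using bnd_bvec_con[OF K.one_closed ys] bard_minus[OF m cb] key[OF m] by simp
    then show "compose (carrier (bar (n + 1))) (bard n) (bard (n + 1)) (gen xs) =
        (\<lambda>x\<in>carrier (bar (n + 1)). \<zero>\<^bsub>bar (n - 1)\<^esub>) (gen xs)"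
      using gen_closed(1)[OF xs] barD(1)[OF b] by (simp add: compose_eq K.minus_eq K.r_neg)
  qed
  then show ?thesis using c by (simp add: compose_eq)
qed

text \<open>The required identity \<open>\<partial>s\<partial> = \<partial>\<close> is the
  contraction identity applied to a boundary, where the other summand vanishes: by the induction
  hypothesis in general, and by \<open>\<epsilon>\<partial> = 0\<close> at the bottom.\<close>

lemma bard_bard:
  assumes "n \<ge> 1" "c \<in> carrier (bar (n + 1))"
  shows "bard n (bard (n + 1) c) = (\<lambda>t p. \<zero>\<^bsub>K\<^esub>)"
  using assms
proof (induction n arbitrary: c rule: int_ge_induct)
  case base
  show ?case
  proof (rule bard_bard_step[OF _ _ base])
    fix m assume m: "m \<in> carrier (bar 1)"
    have b: "bard 1 m \<in> carrier (bar 0)" using bard_closed[OF m] by simp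
    show "bard 1 (con (bard 1 m)) = bard 1 m"
      using contraction_0[OF b] diagonal_zero[OF b bar_aug_bard[OF m]]
        barD(1)[OF bard_closed'[of "con (bard 1 m)" 0]] con_closed[OF b] by simp
  qed simp
next
  case (step i)
  show ?case
  proof (rule bard_bard_step[OF _ _ step.prems])
    fix m assume m: "m \<in> carrier (bar (i + 1))"
    have b: "bard (i + 1) m \<in> carrier (bar i)" by (rule bard_closed'[OF m])
    show "bard (i + 1) (con (bard (i + 1) m)) = bard (i + 1) m"
      using contraction[OF step.hyps b] step.IH[OF m] barD(1)[OF bard_closed'[OF con_closed[OF b]]] by simp
  qed (use step.hyps in simp)
qed

lemma bar_resolution: "projective_resolution G \<Lambda> SX bar bard bar_aug"
  unfolding projective_resolution_def
proof (intro conjI allI impI)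
  show "carrier (bar n) = {\<zero>\<^bsub>bar n\<^esub>}" if "n < 0" for n
  proof -
    have "c = \<zero>\<^bsub>bar n\<^esub>" if "c \<in> carrier (bar n)" for c
      using barD(2)[OF that] T_neg[OF \<open>n < 0\<close>] by (intro ext) fastforce
    moreover have "\<zero>\<^bsub>bar n\<^esub> \<in> carrier (bar n)"
      by (rule abelian_monoid.zero_closed[OF abelian_group.axioms(1)[OF bar_ab]])
    ultimately show ?thesis by blast
  qed
  show "bard (n + 1) ` carrier (bar (n + 1)) = {x \<in> carrier (bar n). bard n x = \<zero>\<^bsub>bar (n - 1)\<^esub>}"
    if n: "n \<ge> 1" for n
  proof (intro subset_antisym subsetI)
    fix b assume "b \<in> bard (n + 1) ` carrier (bar (n + 1))"
    then show "b \<in> {x \<in> carrier (bar n). bard n x = \<zero>\<^bsub>bar (n - 1)\<^esub>}"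
      using bard_closed' bard_bard[OF n] by auto
  next
    fix c assume "c \<in> {x \<in> carrier (bar n). bard n x = \<zero>\<^bsub>bar (n - 1)\<^esub>}"
    then have c: "c \<in> carrier (bar n)" "bard n c = (\<lambda>t p. \<zero>\<^bsub>K\<^esub>)" by auto
    have cc: "con c \<in> carrier (bar (n + 1))" by (rule con_closed[OF c(1)])
    have "bard (n + 1) (con c) = c"
      using contraction[OF n c(1)] c(2) barD(1)[OF bard_closed'[OF cc]] by simp
    then show "c \<in> bard (n + 1) ` carrier (bar (n + 1))" using cc by (metis imageI)
  qed
  show "bard 1 ` carrier (bar 1) = {x \<in> carrier (bar 0). bar_aug x = \<zero>\<^bsub>SX\<^esub>}"
  proof (intro subset_antisym subsetI)
    fix b assume "b \<in> bard 1 ` carrier (bar 1)"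
    then show "b \<in> {x \<in> carrier (bar 0). bar_aug x = \<zero>\<^bsub>SX\<^esub>}"
      using bard_closed'[of _ 0] bar_aug_bard by auto
  next
    fix c assume "c \<in> {x \<in> carrier (bar 0). bar_aug x = \<zero>\<^bsub>SX\<^esub>}"
    then have c: "c \<in> carrier (bar 0)" "bar_aug c = \<zero>\<^bsub>SX\<^esub>" by auto
    have cc: "con c \<in> carrier (bar 1)" using con_closed[OF c(1)] by simp
    have "bard 1 (con c) = c"
      using contraction_0[OF c(1)] diagonal_zero[OF c] barD(1)[OF bard_closed'[of "con c" 0]] cc by simp
    then show "c \<in> bard 1 ` carrier (bar 1)" using cc by (metis imageI)
  qed
  show "bar_aug ` carrier (bar 0) = carrier SX"
  proof (intro subset_antisym subsetI)
    fix A assume "A \<in> bar_aug ` carrier (bar 0)"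
    then show "A \<in> carrier SX" using graded_maps_closed[OF bar_aug_maps] by auto
  next
    fix A assume A: "A \<in> carrier SX"
    \<comment> \<open>The section of the augmentation: the coordinate of \<open>A\<close> at
      \<open>x\<close> is placed on the generator \<open>(x)\<close>.\<close>
    let ?c = "\<lambda>t p. if \<exists>x\<in>X. t = [x] \<and> p = (x, x) then diag A (hd t) else \<zero>\<^bsub>K\<^esub>"
    have c: "?c \<in> carrier (bar 0)"
      by (rule barI) (use diag_simps(1)[OF A] FP_refl in \<open>auto simp: T_def split: if_splits\<close>)
    have "A = bar_aug ?c"
    proof (rule SX_eqI[OF A graded_maps_closed[OF bar_aug_maps c]])
      fix x
      obtain a where a: "a \<in> carrier \<Lambda>" "A = q a" using A unfolding SX_simps(1) by (rule imageE)
      \<comment> \<open>Coordinates are indexed by all elements of the type, so those outside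
        \<open>X\<close> have to be seen to vanish.\<close>
      have "diag A x = \<zero>\<^bsub>K\<^esub>" if "x \<notin> X"
        using that coeff_zero[OF a(1), of "(x, x)"] FP_D(1)[of x x] diag_q[OF a(1)] a(2) by auto
      then show "diag A x = diag (bar_aug ?c) x" unfolding diag_bar_aug[OF c] by auto
    qed
    then show "A \<in> bar_aug ` carrier (bar 0)" using c by blast
  qed
qed (auto intro: bar_projective bard_maps bar_aug_maps)

lemma bar_is_resolution: "resolution K G \<Lambda> SX bar bard bar_aug"
  by (intro resolution.intro resolution_axioms.intro L.graded_algebra_axioms SX_graded bar_resolution)

end

section \<open>Magnitude cochains as morphisms from the bar resolution\<close>

lemma regular_left_module: "ring R \<Longrightarrow> left_module R (regular_module R)"
proof -
  assume "ring R"
  then interpret ring R .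
  have "abelian_group (regular_module R)"
    by (rule abelian_groupI) (auto simp: regular_module_def a_ac intro: l_neg)
  then show ?thesis
    by (intro left_module.intro left_module_axioms.intro ring_axioms)
      (auto simp: regular_module_def l_distr r_distr m_assoc)
qed

lemma regular_simps [simp]:
  "carrier (regular_module R) = carrier R" "zero (regular_module R) = zero R"
  "add (regular_module R) = add R" "smult (regular_module R) = mult R"
  by (simp_all add: regular_module_def)

lemma free_module_eqI:
  assumes R: "ring R" and N: "abelian_group N"
    and f: "f \<in> linear_maps R (free_module R S) N" and g: "g \<in> linear_maps R (free_module R S) N"
    and eq: "\<And>t. t \<in> S \<Longrightarrow> f (basis_vec R t) = g (basis_vec R t)"
    and c: "c \<in> carrier (free_module R S)"
  shows "f c = g c"
proof -
  interpret R: ring R by fact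
  interpret F: left_module R "free_module R S" by (rule free_left_module[OF R])
  show ?thesis
  proof (rule additive_eqI[where M = "free_module R S" and N = N and f = f and g = g
        and supp = "\<lambda>c. {t. c t \<noteq> \<zero>\<^bsub>R\<^esub>}" and B = "{r \<odot>\<^bsub>free_module R S\<^esub> basis_vec R t | r t. r \<in> carrier R \<and> t \<in> S}",
        OF linear_mapsD(2)[OF f] linear_mapsD(2)[OF g]])
    show "f \<zero>\<^bsub>free_module R S\<^esub> = g \<zero>\<^bsub>free_module R S\<^esub>"
      using linear_maps_zero[OF F.M.abelian_group_axioms N f] linear_maps_zero[OF F.M.abelian_group_axioms N g] by simp
    fix u assume "u \<in> {r \<odot>\<^bsub>free_module R S\<^esub> basis_vec R t | r t. r \<in> carrier R \<and> t \<in> S}"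
    then obtain r t where u: "u = r \<odot>\<^bsub>free_module R S\<^esub> basis_vec R t" "r \<in> carrier R" "t \<in> S" by blast
    note b = basis_vec_in_free_module[OF R u(3)]
    show "u \<in> carrier (free_module R S)" unfolding u(1) by (rule F.smult_closed[OF u(2) b])
    show "f u = g u" unfolding u(1) linear_mapsD(3)[OF f u(2) b] linear_mapsD(3)[OF g u(2) b] eq[OF u(3)] ..
  next
    fix c t assume c: "c \<in> carrier (free_module R S)" and t: "t \<in> {t. c t \<noteq> \<zero>\<^bsub>R\<^esub>}"
    then have tS: "t \<in> S" and ct: "c t \<in> carrier R" by (auto simp: free_module_carrier)
    have f: "finite {t'. (c(t := \<zero>\<^bsub>R\<^esub>)) t' \<noteq> \<zero>\<^bsub>R\<^esub>}"
      by (rule finite_subset[of _ "{t. c t \<noteq> \<zero>\<^bsub>R\<^esub>}"]) (use c in \<open>auto simp: free_module_carrier\<close>)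
    show "\<exists>u\<in>{r \<odot>\<^bsub>free_module R S\<^esub> basis_vec R t | r t. r \<in> carrier R \<and> t \<in> S}.
        \<exists>v\<in>carrier (free_module R S). c = u \<oplus>\<^bsub>free_module R S\<^esub> v \<and> {t. v t \<noteq> \<zero>\<^bsub>R\<^esub>} \<subset> {t. c t \<noteq> \<zero>\<^bsub>R\<^esub>}"
    proof (rule bexI, rule bexI, rule conjI)
      show "c = c t \<odot>\<^bsub>free_module R S\<^esub> basis_vec R t \<oplus>\<^bsub>free_module R S\<^esub> (c(t := \<zero>\<^bsub>R\<^esub>))"
        using c by (auto simp: free_module_carrier basis_vec_def intro!: ext)
      show "{t'. (c(t := \<zero>\<^bsub>R\<^esub>)) t' \<noteq> \<zero>\<^bsub>R\<^esub>} \<subset> {t. c t \<noteq> \<zero>\<^bsub>R\<^esub>}" using t by auto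
      show "c(t := \<zero>\<^bsub>R\<^esub>) \<in> carrier (free_module R S)" using c f by (simp add: free_module_carrier)
      show "c t \<odot>\<^bsub>free_module R S\<^esub> basis_vec R t \<in> {r \<odot>\<^bsub>free_module R S\<^esub> basis_vec R t | r t. r \<in> carrier R \<and> t \<in> S}"
        using ct tS by blast
    qed
  qed (use c in \<open>auto simp: free_module_carrier intro!: ext\<close>)
qed

lemma dual_simps [simp]:
  "carrier (dual_module R M) = linear_maps R M (regular_module R)"
  "zero (dual_module R M) = (\<lambda>x\<in>carrier M. \<zero>\<^bsub>R\<^esub>)"
  "f \<oplus>\<^bsub>dual_module R M\<^esub> f' = (\<lambda>x\<in>carrier M. f x \<oplus>\<^bsub>R\<^esub> f' x)"
  "k \<odot>\<^bsub>dual_module R M\<^esub> f = (\<lambda>x\<in>carrier M. k \<otimes>\<^bsub>R\<^esub> f x)"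
  by (simp_all add: dual_module_def)

lemma dual_left_module:
  assumes "cring R" "left_module R M"
  shows "left_module R (dual_module R M)"
proof -
  interpret R: cring R by fact
  interpret M: left_module R M by fact
  note reg = regular_left_module[OF R.ring_axioms]
  have ab: "abelian_group (regular_module R)" using reg by (simp add: left_module_def)
  have D: "f x \<in> carrier R" "f (x \<oplus>\<^bsub>M\<^esub> y) = f x \<oplus>\<^bsub>R\<^esub> f y" "r \<in> carrier R \<Longrightarrow> f (r \<odot>\<^bsub>M\<^esub> x) = r \<otimes>\<^bsub>R\<^esub> f x"
    if "f \<in> linear_maps R M (regular_module R)" "x \<in> carrier M" "y \<in> carrier M" for f x y r
    using linear_mapsD[OF that(1)] that(2,3) by auto
  have e: "(\<lambda>x\<in>carrier M. f x) = f" if "f \<in> linear_maps R M (regular_module R)" for f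
    using linear_maps_extensional[OF that] by (simp add: extensional_restrict)
  have grp: "abelian_group (dual_module R M)"
  proof (rule abelian_groupI)
    fix f assume "f \<in> carrier (dual_module R M)"
    then have f: "f \<in> linear_maps R M (regular_module R)" by simp
    have "(\<lambda>x\<in>carrier M. \<ominus>\<^bsub>R\<^esub> f x) \<in> linear_maps R M (regular_module R)"
      by (rule linear_mapsI) (use D[OF f] in \<open>auto simp: R.minus_add R.r_minus\<close>)
    then show "\<exists>f'\<in>carrier (dual_module R M). f' \<oplus>\<^bsub>dual_module R M\<^esub> f = \<zero>\<^bsub>dual_module R M\<^esub>"
      using D(1)[OF f] by (intro bexI[of _ "\<lambda>x\<in>carrier M. \<ominus>\<^bsub>R\<^esub> f x"]) (auto simp: R.l_neg intro!: restrict_ext)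
    show "\<zero>\<^bsub>dual_module R M\<^esub> \<oplus>\<^bsub>dual_module R M\<^esub> f = f"
      using D(1)[OF f] by (subst (2) e[OF f, symmetric]) (auto intro!: restrict_ext)
  next
    fix f g assume "f \<in> carrier (dual_module R M)" "g \<in> carrier (dual_module R M)"
    then have f: "f \<in> linear_maps R M (regular_module R)" and g: "g \<in> linear_maps R M (regular_module R)" by auto
    have "(\<lambda>x\<in>carrier M. f x \<oplus>\<^bsub>R\<^esub> g x) \<in> linear_maps R M (regular_module R)"
      by (rule linear_mapsI) (use D[OF f] D[OF g] in \<open>auto simp: R.a_ac R.r_distr\<close>)
    then show "f \<oplus>\<^bsub>dual_module R M\<^esub> g \<in> carrier (dual_module R M)" by simp
  next
    show "\<zero>\<^bsub>dual_module R M\<^esub> \<in> carrier (dual_module R M)" by (auto intro!: linear_mapsI)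
  qed (use D(1) in \<open>auto simp: R.a_ac intro!: restrict_ext\<close>)
  show ?thesis
  proof (intro left_module.intro left_module_axioms.intro grp R.ring_axioms)
    fix r f assume r: "r \<in> carrier R" and "f \<in> carrier (dual_module R M)"
    then have f: "f \<in> linear_maps R M (regular_module R)" by simp
    have "(\<lambda>x\<in>carrier M. r \<otimes>\<^bsub>R\<^esub> f x) \<in> linear_maps R M (regular_module R)"
      by (rule linear_mapsI) (use r D[OF f] in \<open>auto simp: R.r_distr R.m_lcomm\<close>)
    then show "r \<odot>\<^bsub>dual_module R M\<^esub> f \<in> carrier (dual_module R M)" by simp
  next
    fix f assume "f \<in> carrier (dual_module R M)"
    then have f: "f \<in> linear_maps R M (regular_module R)" by simp
    show "\<one>\<^bsub>R\<^esub> \<odot>\<^bsub>dual_module R M\<^esub> f = f"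
      using D(1)[OF f] by (subst (2) e[OF f, symmetric]) (auto intro!: restrict_ext)
  qed (use D(1) in \<open>auto simp: R.l_distr R.r_distr R.m_assoc intro!: restrict_ext\<close>)
qed

context finite_quasimetric
begin

section \<open>Magnitude tuples, and cochains as morphisms\<close>

lemma path_length_Cons: "path_length d (x # y # ys) = d x y + path_length d (y # ys)"
  by (simp add: path_length_def sum.lessThan_Suc_shift del: sum.lessThan_Suc)

lemma valid_path_length: "valid xs \<Longrightarrow> path_length d xs = ereal (wt xs)"
proof (induction xs rule: valid.induct)
  case (2 x)
  then show ?case by (simp add: path_length_def zero_ereal_def)
next
  case (3 x y ys)
  then show ?case using FP_D(3)[of x y] by (simp add: path_length_Cons)
qed simp

lemma valid_nth: "valid xs \<Longrightarrow> Suc i < length xs \<Longrightarrow> xs ! i \<noteq> xs ! Suc i"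
proof (induction xs arbitrary: i rule: valid.induct)
  case (3 x y ys)
  then show ?case by (cases i) auto
qed auto

text \<open>Distances are non-negative, so a finite total length forces every single distance to be
  finite.\<close>

lemma validI:
  "\<lbrakk>xs \<noteq> []; set xs \<subseteq> X; \<And>i. Suc i < length xs \<Longrightarrow> xs ! i \<noteq> xs ! Suc i; path_length d xs < \<infinity>\<rbrakk> \<Longrightarrow> valid xs"
proof (induction xs rule: valid.induct)
  case (3 x y ys)
  have X: "x \<in> X" "y \<in> X" "set (y # ys) \<subseteq> X" using "3.prems"(2) by auto
  have nn: "0 \<le> path_length d (y # ys)"
    unfolding path_length_def
  proof (rule sum_nonneg)
    have "zs ! j \<in> X" if "set zs \<subseteq> X" "j < length zs" for zs j using that nth_mem by blast
    then show "0 \<le> d ((y # ys) ! i) ((y # ys) ! Suc i)" if "i \<in> {..<length (y # ys) - 1}" for i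
      using that X(3) by (intro nonneg) auto
  qed
  have "d x y < \<infinity> \<and> path_length d (y # ys) < \<infinity>"
    using "3.prems"(4) nonneg[OF X(1,2)] nn unfolding path_length_Cons
    by (cases "d x y"; cases "path_length d (y # ys)") auto
  then show ?case
    using "3.IH" "3.prems"(3)[of 0] "3.prems"(3)[of "Suc _"] X by (auto simp: finite_pairs_def)
qed auto

lemma mag_tuples_eq: "mag_tuples X d n l = {xs \<in> T n. wt xs = l}"
proof (intro subset_antisym subsetI)
  fix xs assume xs: "xs \<in> mag_tuples X d n l"
  then have "valid xs" by (intro validI) (auto simp: mag_tuples_def)
  then show "xs \<in> {xs \<in> T n. wt xs = l}"
    using xs valid_path_length by (auto simp: mag_tuples_def T_def)
next
  fix xs assume xs: "xs \<in> {xs \<in> T n. wt xs = l}"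
  then have "0 \<le> n" using T_neg[of n] by (cases "n < 0") auto
  then show "xs \<in> mag_tuples X d n l"
    using xs valid_path_length valid_set valid_nth by (auto simp: mag_tuples_def T_def)
qed

abbreviation "MC \<equiv> mag_cochains K X d"
abbreviation "dM \<equiv> mag_coboundary K X d"
abbreviation "MCh \<equiv> mag_chains K X d"

definition val :: "(('x list \<Rightarrow> 'k) \<Rightarrow> 'k) \<Rightarrow> 'x list \<Rightarrow> 'k" where "val \<psi> xs = \<psi> (basis_vec K xs)"

lemma K_reg: "left_module K (regular_module K)"
  by (rule regular_left_module[OF K.ring_axioms])

lemma MCh_module: "left_module K (MCh l n)"
  unfolding mag_chains_def by (rule free_left_module[OF K.ring_axioms])

lemma MC_module: "left_module K (MC l n)"
  unfolding mag_cochains_def by (rule dual_left_module[OF K.cring_axioms MCh_module])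

lemma basis_closed: "\<lbrakk>xs \<in> T n; wt xs = l\<rbrakk> \<Longrightarrow> basis_vec K xs \<in> carrier (MCh l n)"
  unfolding mag_chains_def by (rule basis_vec_in_free_module[OF K.ring_axioms]) (simp add: mag_tuples_eq)

lemma val_closed: "\<lbrakk>\<psi> \<in> carrier (MC l n); xs \<in> T n; wt xs = l\<rbrakk> \<Longrightarrow> val \<psi> xs \<in> carrier K"
  using linear_mapsD(1)[of \<psi> K "MCh l n" "regular_module K" "basis_vec K xs"] basis_closed[of xs n l]
  by (simp add: val_def mag_cochains_def)

lemma MC_eqI:
  assumes a: "\<psi> \<in> carrier (MC l n)" and b: "\<psi>' \<in> carrier (MC l n)"
    and eq: "\<And>xs. \<lbrakk>xs \<in> T n; wt xs = l\<rbrakk> \<Longrightarrow> val \<psi> xs = val \<psi>' xs"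
  shows "\<psi> = \<psi>'"
proof (rule extensionalityI[of _ "carrier (MCh l n)"])
  have l: "\<psi> \<in> linear_maps K (MCh l n) (regular_module K)" "\<psi>' \<in> linear_maps K (MCh l n) (regular_module K)"
    using a b by (simp_all add: mag_cochains_def)
  show "\<psi> \<in> extensional (carrier (MCh l n))" "\<psi>' \<in> extensional (carrier (MCh l n))"
    using linear_maps_extensional l by auto
  show "\<psi> c = \<psi>' c" if "c \<in> carrier (MCh l n)" for c
    by (rule free_module_eqI[OF K.ring_axioms left_module.axioms(2)[OF K_reg], of \<psi> "mag_tuples X d n l" \<psi>'])
      (use l that eq in \<open>auto simp: mag_chains_def mag_tuples_eq val_def\<close>)
qed

lemma cochain_of_closed:
  assumes "\<And>xs. \<lbrakk>xs \<in> T n; wt xs = l\<rbrakk> \<Longrightarrow> v xs \<in> carrier K"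
  shows "mag_cochain_of K X d l n v \<in> carrier (MC l n)"
  using lin_ext_linear[OF K_reg, of v "mag_tuples X d n l"] assms
  by (auto simp: mag_cochain_of_def mag_cochains_def mag_chains_def mag_tuples_eq)

lemma val_cochain_of:
  assumes "xs \<in> T n" "wt xs = l" "v xs \<in> carrier K"
  shows "val (mag_cochain_of K X d l n v) xs = v xs"
  using lin_ext_basis_vec[OF K_reg, of v xs] basis_closed[OF assms(1,2)] assms(3)
  by (simp add: val_def mag_cochain_of_def)

text \<open>\<open>S[l]\<close> is concentrated in degree \<open>l\<close>, so a generator of
  another length must go to 0. The case distinction also discards the meaningless values of
  \<open>\<psi>\<close> at tuples that do not belong to the chain module of length
  \<open>l\<close>.\<close>

definition toHom :: "int \<Rightarrow> real \<Rightarrow> (('x list \<Rightarrow> 'k) \<Rightarrow> 'k) \<Rightarrow> ('x list \<Rightarrow> 'x \<times> 'x \<Rightarrow> 'k) \<Rightarrow> ('x \<times> 'x \<Rightarrow> 'k) set"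
  where "toHom n l \<psi> =
    extb (shift l SX) n (\<lambda>xs. q (el (if wt xs = l then val \<psi> xs else \<zero>\<^bsub>K\<^esub>) (hd xs) (hd xs)))"

lemma toHom_val:
  assumes "\<psi> \<in> carrier (MC l n)" "xs \<in> T n"
  shows "el (if wt xs = l then val \<psi> xs else \<zero>\<^bsub>K\<^esub>) (hd xs) (hd xs) \<in> carrier \<Lambda>"
  using val_closed[OF assms] by (intro el_closed FP_refl[OF valid_hd[OF T_valid[OF assms(2)]]]) auto

lemma toHom_maps:
  assumes l: "l \<in> G" and \<psi>: "\<psi> \<in> carrier (MC l n)"
  shows "toHom n l \<psi> \<in> graded_maps G \<Lambda> (bar n) (shift l SX)"
  unfolding toHom_def
proof (rule extb_graded[OF L.shift_graded[OF SX_graded l]])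
  interpret S: graded_left_module G \<Lambda> SX by (rule SX_graded)
  fix xs assume xs: "xs \<in> T n"
  show "q (el (if wt xs = l then val \<psi> xs else \<zero>\<^bsub>K\<^esub>) (hd xs) (hd xs)) \<in> gpart (shift l SX) (wt xs)"
  proof (cases "wt xs = l")
    case True
    then show ?thesis using q_el_gpart[OF val_closed[OF \<psi> xs True] valid_hd[OF T_valid[OF xs]]] by simp
  next
    case False
    have "el \<zero>\<^bsub>K\<^esub> (hd xs) (hd xs) = \<zero>\<^bsub>\<Lambda>\<^esub>" by (auto simp: el_def)
    then show ?thesis
      using False S.gpart_zero[OF diff_in_G[OF valid_wt[OF T_valid[OF xs]] l]] SX_simps(2) by simp
  qed
qed

lemma diag_toHom_gen:
  assumes l: "l \<in> G" and \<psi>: "\<psi> \<in> carrier (MC l n)" and xs: "xs \<in> T n"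
  shows "diag (toHom n l \<psi> (gen xs)) u = (if u = hd xs \<and> wt xs = l then val \<psi> xs else \<zero>\<^bsub>K\<^esub>)"
proof -
  interpret S: graded_left_module G \<Lambda> "shift l SX" by (rule L.shift_graded[OF SX_graded l])
  let ?e = "el (if wt xs = l then val \<psi> xs else \<zero>\<^bsub>K\<^esub>) (hd xs) (hd xs)"
  note e = toHom_val[OF \<psi> xs]
  have i: "el \<one>\<^bsub>K\<^esub> (hd xs) (hd xs) \<in> carrier \<Lambda>"
    by (intro el_closed K.one_closed FP_refl[OF valid_hd[OF T_valid[OF xs]]])
  have "toHom n l \<psi> (gen xs) = el \<one>\<^bsub>K\<^esub> (hd xs) (hd xs) \<odot>\<^bsub>SX\<^esub> q ?e"
    unfolding toHom_def
    using extb_gen[where \<nu> = "\<lambda>xs. q (el (if wt xs = l then val \<psi> xs else \<zero>\<^bsub>K\<^esub>) (hd xs) (hd xs))" and xs = xs,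
        OF S.left_module_axioms _ xs] e by (simp add: SX_simps(1))
  then have "diag (toHom n l \<psi> (gen xs)) u = el \<one>\<^bsub>K\<^esub> (hd xs) (hd xs) (u, u) \<otimes>\<^bsub>K\<^esub> ?e (u, u)"
    using diag_simps(3)[OF i, of "q ?e" u] diag_q[OF e, of u] e by (simp add: SX_simps(1))
  then show ?thesis using val_closed[OF \<psi> xs] by (auto simp: el_apply)
qed

text \<open>Two constraints on an arbitrary morphism: degrees force 0 unless the tuple has length
  \<open>l\<close>, and the idempotent \<open>(x_0, x_0)\<close> fixing the generator allows only
  the coordinate at \<open>x_0\<close>. One scalar per tuple of length \<open>l\<close> remains,
  which makes \<open>toHom\<close> bijective.\<close>

lemma gen_support:
  assumes l: "l \<in> G" and \<alpha>: "\<alpha> \<in> graded_maps G \<Lambda> (bar n) (shift l SX)" and xs: "xs \<in> T n"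
    and u: "u \<noteq> hd xs \<or> wt xs \<noteq> l"
  shows "diag (\<alpha> (gen xs)) u = \<zero>\<^bsub>K\<^esub>"
proof (cases "wt xs = l")
  case True
  note g = gen_closed(1)[OF xs]
  have i: "el \<one>\<^bsub>K\<^esub> (hd xs) (hd xs) \<in> carrier \<Lambda>"
    by (intro el_closed K.one_closed FP_refl[OF valid_hd[OF T_valid[OF xs]]])
  have c: "\<alpha> (gen xs) \<in> carrier SX" using graded_maps_closed[OF \<alpha> g] by simp
  have "\<alpha> (gen xs) = el \<one>\<^bsub>K\<^esub> (hd xs) (hd xs) \<odot>\<^bsub>SX\<^esub> \<alpha> (gen xs)"
    using linear_mapsD(3)[OF graded_mapsD(1)[OF \<alpha>] i g] idem_gen[OF xs] by simp
  then have "diag (\<alpha> (gen xs)) u = el \<one>\<^bsub>K\<^esub> (hd xs) (hd xs) (u, u) \<otimes>\<^bsub>K\<^esub> diag (\<alpha> (gen xs)) u"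
    using diag_simps(3)[OF i c, of u] by simp
  then show ?thesis using u True diag_simps(1)[OF c] by (simp add: el_apply)
next
  case False
  have "\<alpha> (gen xs) \<in> gpart SX (wt xs - l)"
    using graded_mapsD(2)[OF \<alpha> valid_wt[OF T_valid[OF xs]] gen_closed(2)[OF xs]] by simp
  then show ?thesis by (rule SX_zero_gpart[rotated]) (use False in simp)
qed

lemma hom_eqI:
  assumes l: "l \<in> G" and \<alpha>: "\<alpha> \<in> graded_maps G \<Lambda> (bar n) (shift l SX)" and \<beta>: "\<beta> \<in> graded_maps G \<Lambda> (bar n) (shift l SX)"
    and eq: "\<And>xs. \<lbrakk>xs \<in> T n; wt xs = l\<rbrakk> \<Longrightarrow> diag (\<alpha> (gen xs)) (hd xs) = diag (\<beta> (gen xs)) (hd xs)"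
  shows "\<alpha> = \<beta>"
proof (rule extensionalityI[of _ "carrier (bar n)"])
  interpret S: graded_left_module G \<Lambda> "shift l SX" by (rule L.shift_graded[OF SX_graded l])
  note lin = graded_mapsD(1)[OF \<alpha>] graded_mapsD(1)[OF \<beta>]
  show "\<alpha> \<in> extensional (carrier (bar n))" "\<beta> \<in> extensional (carrier (bar n))"
    using linear_maps_extensional lin by auto
  show "\<alpha> c = \<beta> c" if "c \<in> carrier (bar n)" for c
  proof (rule bar_maps_eqI[OF S.left_module_axioms lin _ that])
    fix xs assume xs: "xs \<in> T n"
    show "\<alpha> (gen xs) = \<beta> (gen xs)"
    proof (rule SX_eqI)
      show "\<alpha> (gen xs) \<in> carrier SX" "\<beta> (gen xs) \<in> carrier SX"
        using graded_maps_closed[OF \<alpha> gen_closed(1)[OF xs]] graded_maps_closed[OF \<beta> gen_closed(1)[OF xs]] by simp_all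
      show "diag (\<alpha> (gen xs)) u = diag (\<beta> (gen xs)) u" for u
        using gen_support[OF l \<alpha> xs, of u] gen_support[OF l \<beta> xs, of u] eq[OF xs] by (cases "u = hd xs \<and> wt xs = l") auto
    qed
  qed
qed

lemma toHom_inj:
  assumes l: "l \<in> G" and a: "\<psi> \<in> carrier (MC l n)" and b: "\<psi>' \<in> carrier (MC l n)" and eq: "toHom n l \<psi> = toHom n l \<psi>'"
  shows "\<psi> = \<psi>'"
proof (rule MC_eqI[OF a b])
  fix xs assume xs: "xs \<in> T n" "wt xs = l"
  show "val \<psi> xs = val \<psi>' xs"
    using diag_toHom_gen[OF l a xs(1), of "hd xs"] diag_toHom_gen[OF l b xs(1), of "hd xs"] xs(2) eq by simp
qed

lemma toHom_surj:
  assumes l: "l \<in> G" and \<alpha>: "\<alpha> \<in> graded_maps G \<Lambda> (bar n) (shift l SX)"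
  shows "\<exists>\<psi>\<in>carrier (MC l n). toHom n l \<psi> = \<alpha>"
proof -
  let ?v = "\<lambda>xs. diag (\<alpha> (gen xs)) (hd xs)"
  have v: "?v xs \<in> carrier K" if "xs \<in> T n" for xs
    using graded_maps_closed[OF \<alpha> gen_closed(1)[OF that]] by (simp add: diag_simps(1))
  have c: "mag_cochain_of K X d l n ?v \<in> carrier (MC l n)" by (rule cochain_of_closed) (rule v)
  have "toHom n l (mag_cochain_of K X d l n ?v) = \<alpha>"
  proof (rule hom_eqI[OF l toHom_maps[OF l c] \<alpha>])
    fix xs assume xs: "xs \<in> T n" "wt xs = l"
    show "diag (toHom n l (mag_cochain_of K X d l n ?v) (gen xs)) (hd xs) = ?v xs"
      using diag_toHom_gen[OF l c xs(1), of "hd xs"] val_cochain_of[where v = ?v, OF xs v[OF xs(1)]] xs(2) by simp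
  qed
  then show ?thesis using c by blast
qed

lemma toHom_add:
  assumes l: "l \<in> G" and a: "\<psi> \<in> carrier (MC l n)" and b: "\<psi>' \<in> carrier (MC l n)"
  shows "toHom n l (\<psi> \<oplus>\<^bsub>MC l n\<^esub> \<psi>') = (\<lambda>c\<in>carrier (bar n). toHom n l \<psi> c \<oplus>\<^bsub>SX\<^esub> toHom n l \<psi>' c)"
proof -
  interpret C: left_module K "MC l n" by (rule MC_module)
  note sS = L.shift_graded[OF SX_graded l]
  note m = toHom_maps[OF l a] toHom_maps[OF l b]
  have s: "(\<lambda>c\<in>carrier (bar n). toHom n l \<psi> c \<oplus>\<^bsub>SX\<^esub> toHom n l \<psi>' c) \<in> graded_maps G \<Lambda> (bar n) (shift l SX)"
    using L.graded_maps_add[OF bar_graded sS m] by simp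
  show ?thesis
  proof (rule hom_eqI[OF l toHom_maps[OF l C.M.a_closed[OF a b]] s])
    fix xs assume xs: "xs \<in> T n" "wt xs = l"
    note g = gen_closed(1)[OF xs(1)]
    have "val (\<psi> \<oplus>\<^bsub>MC l n\<^esub> \<psi>') xs = val \<psi> xs \<oplus>\<^bsub>K\<^esub> val \<psi>' xs"
      using basis_closed[OF xs] by (simp add: val_def mag_cochains_def)
    then show "diag (toHom n l (\<psi> \<oplus>\<^bsub>MC l n\<^esub> \<psi>') (gen xs)) (hd xs) =
        diag ((\<lambda>c\<in>carrier (bar n). toHom n l \<psi> c \<oplus>\<^bsub>SX\<^esub> toHom n l \<psi>' c) (gen xs)) (hd xs)"
      using diag_toHom_gen[OF l C.M.a_closed[OF a b] xs(1), of "hd xs"] diag_toHom_gen[OF l a xs(1), of "hd xs"]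
        diag_toHom_gen[OF l b xs(1), of "hd xs"] xs(2) g
        graded_maps_closed[OF m(1) g] graded_maps_closed[OF m(2) g] by (simp add: diag_simps(2))
  qed
qed

lemma toHom_smult:
  assumes l: "l \<in> G" and k: "k \<in> carrier K" and a: "\<psi> \<in> carrier (MC l n)"
  shows "toHom n l (k \<odot>\<^bsub>MC l n\<^esub> \<psi>) = (\<lambda>c\<in>carrier (bar n). L.scalar k \<odot>\<^bsub>SX\<^esub> toHom n l \<psi> c)"
proof -
  interpret C: left_module K "MC l n" by (rule MC_module)
  note sS = L.shift_graded[OF SX_graded l]
  note m = toHom_maps[OF l a]
  have s: "(\<lambda>c\<in>carrier (bar n). L.scalar k \<odot>\<^bsub>SX\<^esub> toHom n l \<psi> c) \<in> graded_maps G \<Lambda> (bar n) (shift l SX)"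
    using left_module.smult_closed[OF L.graded_hom_left_module[OF bar_graded sS] k, of "toHom n l \<psi>"] m by simp
  show ?thesis
  proof (rule hom_eqI[OF l toHom_maps[OF l C.smult_closed[OF k a]] s])
    fix xs assume xs: "xs \<in> T n" "wt xs = l"
    note g = gen_closed(1)[OF xs(1)]
    have "val (k \<odot>\<^bsub>MC l n\<^esub> \<psi>) xs = k \<otimes>\<^bsub>K\<^esub> val \<psi> xs"
      using basis_closed[OF xs] by (simp add: val_def mag_cochains_def)
    moreover have "L.scalar k (hd xs, hd xs) = k"
      unfolding L.scalar_def using valid_hd[OF T_valid[OF xs(1)]] k by simp
    ultimately show "diag (toHom n l (k \<odot>\<^bsub>MC l n\<^esub> \<psi>) (gen xs)) (hd xs) =
        diag ((\<lambda>c\<in>carrier (bar n). L.scalar k \<odot>\<^bsub>SX\<^esub> toHom n l \<psi> c) (gen xs)) (hd xs)"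
      using diag_toHom_gen[OF l C.smult_closed[OF k a] xs(1), of "hd xs"] diag_toHom_gen[OF l a xs(1), of "hd xs"]
        xs(2) g graded_maps_closed[OF m g] L.scalar_closed[OF k] by (simp add: diag_simps(3))
  qed
qed

section \<open>The coboundary as an alternating sum of faces\<close>

abbreviation "sgn_pow i \<equiv> (\<ominus>\<^bsub>K\<^esub> \<one>\<^bsub>K\<^esub>) [^]\<^bsub>K\<^esub> (i :: nat)"
abbreviation "del i xs \<equiv> take i xs @ drop (Suc i) xs"

text \<open>The terms obtained by unrolling the recursion of \<open>bnd\<close>. The term for
  \<open>i = 0\<close> keeps the pair \<open>(x_0, x_1)\<close> as its coefficient; the terms for
  interior \<open>i\<close> are generators or 0. The recursion produces no term for the last point,
  which would act on \<open>S\<close> by a pair of positive degree.\<close>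

fun face :: "nat \<Rightarrow> 'x list \<Rightarrow> 'x list \<Rightarrow> 'x \<times> 'x \<Rightarrow> 'k" where
  "face 0 (x # ys) = bvec \<one>\<^bsub>K\<^esub> x ys"
| "face (Suc i) (x # y # ys) = con (\<lambda>t. el \<one>\<^bsub>K\<^esub> x y \<otimes>\<^bsub>\<Lambda>\<^esub> face i (y # ys) t)"
| "face i xs = (\<lambda>t p. \<zero>\<^bsub>K\<^esub>)"

lemma T_ConsD:
  assumes "x # y # ys \<in> T n"
  shows "y # ys \<in> T (n - 1)" "(x, y) \<in> FP" "x \<noteq> y"
  using assms T_Cons[of "y # ys" x "n - 1"] by auto

lemma face_closed: "\<lbrakk>xs \<in> T n; Suc i < length xs\<rbrakk> \<Longrightarrow> face i xs \<in> carrier (bar (n - 1))"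
proof (induction i xs arbitrary: n rule: face.induct)
  case (1 x ys)
  then obtain y zs where y: "ys = y # zs" by (cases ys) auto
  show ?case using bvec_closed(1)[OF K.one_closed T_ConsD(1)[OF "1.prems"(1)[unfolded y]], of x]
      T_ConsD(2)[OF "1.prems"(1)[unfolded y]] y by simp
next
  case (2 i x y ys)
  note t = T_ConsD[OF "2.prems"(1)]
  have "face i (y # ys) \<in> carrier (bar (n - 2))" using "2.IH"[OF t(1)] "2.prems"(2) by simp
  then have "el \<one>\<^bsub>K\<^esub> x y \<odot>\<^bsub>bar (n - 2)\<^esub> face i (y # ys) \<in> carrier (bar (n - 2))"
    by (rule left_module.smult_closed[OF bar_left_module el_closed[OF K.one_closed t(2)]])
  from con_closed[OF this] show ?case by simp
qed (auto intro: barI)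

lemma finsum_lessThan_Suc:
  assumes "\<And>i. g i \<in> carrier K"
  shows "(\<Oplus>\<^bsub>K\<^esub>i\<in>{..<Suc m}. g i) = g 0 \<oplus>\<^bsub>K\<^esub> (\<Oplus>\<^bsub>K\<^esub>i\<in>{..<m}. g (Suc i))"
proof -
  have "(\<Oplus>\<^bsub>K\<^esub>i\<in>{..<Suc m}. g i) = (\<Oplus>\<^bsub>K\<^esub>i\<in>insert 0 (Suc ` {..<m}). g i)"
    by (simp only: lessThan_Suc_eq_insert_0)
  also have "\<dots> = g 0 \<oplus>\<^bsub>K\<^esub> (\<Oplus>\<^bsub>K\<^esub>i\<in>Suc ` {..<m}. g i)"
    by (rule K.finsum_insert) (use assms in auto)
  also have "(\<Oplus>\<^bsub>K\<^esub>i\<in>Suc ` {..<m}. g i) = (\<Oplus>\<^bsub>K\<^esub>i\<in>{..<m}. g (Suc i))"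
    by (rule K.finsum_reindex) (use assms in auto)
  finally show ?thesis .
qed

text \<open>The expansion into faces is tested against additive functionals, so that all sums live
  in \<open>\<K>\<close>. In the induction step the functional \<open>f\<close> is replaced by its
  composite with multiplication by \<open>(x, y)\<close> and \<open>con\<close>, which is how each
  layer of the recursion acts on the faces of the shorter tuple.\<close>

lemma functional_bnd:
  assumes "xs \<in> T n"
    and "\<And>c. c \<in> carrier (bar (n - 1)) \<Longrightarrow> f c \<in> carrier K"
    and "\<And>c c'. \<lbrakk>c \<in> carrier (bar (n - 1)); c' \<in> carrier (bar (n - 1))\<rbrakk> \<Longrightarrow> f (c \<oplus>\<^bsub>bar (n - 1)\<^esub> c') = f c \<oplus>\<^bsub>K\<^esub> f c'"
  shows "f (bnd xs) = (\<Oplus>\<^bsub>K\<^esub>i\<in>{..<length xs - 1}. sgn_pow i \<otimes>\<^bsub>K\<^esub> f (face i xs))"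
  using assms
proof (induction xs arbitrary: n f rule: bnd.induct)
  case (1 x y ys)
  note t = T_ConsD[OF "1.prems"(1)] and fc = "1.prems"(2) and fa = "1.prems"(3)
  let ?m = "length ys"
  let ?f = "\<lambda>c. f (con (el \<one>\<^bsub>K\<^esub> x y \<odot>\<^bsub>bar (n - 2)\<^esub> c))"
  interpret B: left_module \<Lambda> "bar (n - 2)" by (rule bar_left_module)
  interpret B1: left_module \<Lambda> "bar (n - 1)" by (rule bar_left_module)
  note e = el_closed[OF K.one_closed t(2)]
  have cc: "con (el \<one>\<^bsub>K\<^esub> x y \<odot>\<^bsub>bar (n - 2)\<^esub> c) \<in> carrier (bar (n - 1))" if "c \<in> carrier (bar (n - 2))" for c
    using con_closed[OF B.smult_closed[OF e that]] by simp
  have IH: "?f (bnd (y # ys)) = (\<Oplus>\<^bsub>K\<^esub>i\<in>{..<length (y # ys) - 1}. sgn_pow i \<otimes>\<^bsub>K\<^esub> ?f (face i (y # ys)))"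
  proof (rule "1.IH"[OF t(1), of ?f])
    show "?f c \<in> carrier K" if "c \<in> carrier (bar (n - 1 - 1))" for c using fc cc that by simp
    show "?f (c \<oplus>\<^bsub>bar (n - 1 - 1)\<^esub> c') = ?f c \<oplus>\<^bsub>K\<^esub> ?f c'"
      if "c \<in> carrier (bar (n - 1 - 1))" "c' \<in> carrier (bar (n - 1 - 1))" for c c'
    proof -
      have c: "c \<in> carrier (bar (n - 2))" "c' \<in> carrier (bar (n - 2))" using that by simp_all
      have "con (el \<one>\<^bsub>K\<^esub> x y \<odot>\<^bsub>bar (n - 2)\<^esub> (c \<oplus>\<^bsub>bar (n - 2)\<^esub> c')) =
          con (el \<one>\<^bsub>K\<^esub> x y \<odot>\<^bsub>bar (n - 2)\<^esub> c) \<oplus>\<^bsub>bar (n - 1)\<^esub> con (el \<one>\<^bsub>K\<^esub> x y \<odot>\<^bsub>bar (n - 2)\<^esub> c')"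
        unfolding B.smult_r_distr[OF e c] by (rule con_add[OF B.smult_closed[OF e c(1)] B.smult_closed[OF e c(2)]])
      then show ?thesis using fa[OF cc[OF c(1)] cc[OF c(2)]] by simp
    qed
  qed
  have b: "bnd (y # ys) \<in> carrier (bar (n - 2))" using bnd_closed[OF t(1)] by simp
  have v: "bvec \<one>\<^bsub>K\<^esub> x (y # ys) \<in> carrier (bar (n - 1))" using bvec_closed(1)[OF K.one_closed t(1), of x] t(2) by simp
  have bx: "bnd (x # y # ys) \<in> carrier (bar (n - 1))" by (rule bnd_closed[OF "1.prems"(1)])
  have "bnd (x # y # ys) = bvec \<one>\<^bsub>K\<^esub> x (y # ys) \<ominus>\<^bsub>bar (n - 1)\<^esub> con (el \<one>\<^bsub>K\<^esub> x y \<odot>\<^bsub>bar (n - 2)\<^esub> bnd (y # ys))"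
    using bar_minus[OF v cc[OF b]] by simp
  then have "bnd (x # y # ys) \<oplus>\<^bsub>bar (n - 1)\<^esub> con (el \<one>\<^bsub>K\<^esub> x y \<odot>\<^bsub>bar (n - 2)\<^esub> bnd (y # ys)) = bvec \<one>\<^bsub>K\<^esub> x (y # ys)"
    using B1.M.minus_add_cancel_both(1)[OF v cc[OF b]] by (simp only:)
  then have "f (bnd (x # y # ys)) \<oplus>\<^bsub>K\<^esub> ?f (bnd (y # ys)) = f (bvec \<one>\<^bsub>K\<^esub> x (y # ys))"
    using fa[OF bx cc[OF b]] by (simp only:)
  then have f1: "f (bnd (x # y # ys)) = f (bvec \<one>\<^bsub>K\<^esub> x (y # ys)) \<oplus>\<^bsub>K\<^esub> (\<ominus>\<^bsub>K\<^esub> \<one>\<^bsub>K\<^esub>) \<otimes>\<^bsub>K\<^esub> ?f (bnd (y # ys))"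
    using fc[OF bx] fc[OF cc[OF b]] K.minus_add_cancel_both(2)[of "f (bnd (x # y # ys))" "?f (bnd (y # ys))"]
    by (metis K.l_minus K.l_one K.minus_eq K.one_closed)
  \<comment> \<open>Cut off at the number of faces: splitting off the first summand requires all
    summands to lie in \<open>\<K>\<close>, and this is known for actual faces only.\<close>
  let ?g = "\<lambda>i. if i < Suc ?m then sgn_pow i \<otimes>\<^bsub>K\<^esub> f (face i (x # y # ys)) else \<zero>\<^bsub>K\<^esub>"
  have fi: "f (face i (x # y # ys)) \<in> carrier K" if "i < Suc ?m" for i
    using fc[OF face_closed[OF "1.prems"(1), of i]] that by simp
  have "(\<Oplus>\<^bsub>K\<^esub>i\<in>{..<Suc ?m}. sgn_pow i \<otimes>\<^bsub>K\<^esub> f (face i (x # y # ys))) = (\<Oplus>\<^bsub>K\<^esub>i\<in>{..<Suc ?m}. ?g i)"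
    by (rule K.finsum_cong') (use fi in auto)
  also have "\<dots> = ?g 0 \<oplus>\<^bsub>K\<^esub> (\<Oplus>\<^bsub>K\<^esub>i\<in>{..<?m}. ?g (Suc i))"
    by (rule finsum_lessThan_Suc) (use fi in auto)
  also have "?g 0 = f (bvec \<one>\<^bsub>K\<^esub> x (y # ys))" using fi[of 0] by simp
  also have "(\<Oplus>\<^bsub>K\<^esub>i\<in>{..<?m}. ?g (Suc i)) =
      (\<Oplus>\<^bsub>K\<^esub>i\<in>{..<?m}. (\<ominus>\<^bsub>K\<^esub> \<one>\<^bsub>K\<^esub>) \<otimes>\<^bsub>K\<^esub> (sgn_pow i \<otimes>\<^bsub>K\<^esub> ?f (face i (y # ys))))"
  proof (rule K.finsum_cong')
    fix i assume "i \<in> {..<?m}"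
    then show "?g (Suc i) = (\<ominus>\<^bsub>K\<^esub> \<one>\<^bsub>K\<^esub>) \<otimes>\<^bsub>K\<^esub> (sgn_pow i \<otimes>\<^bsub>K\<^esub> ?f (face i (y # ys)))"
      using fi[of "Suc i"] by (simp add: K.m_ac)
  qed (use fi[of "Suc _"] in auto)
  also have "\<dots> = (\<ominus>\<^bsub>K\<^esub> \<one>\<^bsub>K\<^esub>) \<otimes>\<^bsub>K\<^esub> (\<Oplus>\<^bsub>K\<^esub>i\<in>{..<?m}. sgn_pow i \<otimes>\<^bsub>K\<^esub> ?f (face i (y # ys)))"
    by (rule K.finsum_rdistr[symmetric]) (use fi[of "Suc _"] in auto)
  also have "(\<Oplus>\<^bsub>K\<^esub>i\<in>{..<?m}. sgn_pow i \<otimes>\<^bsub>K\<^esub> ?f (face i (y # ys))) = ?f (bnd (y # ys))"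
    using IH by simp
  finally show ?case using f1 by simp
next
  case ("2_2" x)
  have "f \<zero>\<^bsub>bar (n - 1)\<^esub> = \<zero>\<^bsub>K\<^esub>"
    by (rule additive_zero[OF bar_ab K.abelian_group_axioms]) (use "2_2.prems" in auto)
  then show ?case by simp
qed (simp add: T_def)

text \<open>Deleting the second point \<open>y\<close> comes from the product
  \<open>(x, y)(y, z)\<close>, which is \<open>(x, z)\<close> if \<open>y\<close> lies between and 0
  otherwise; \<open>con\<close> then turns \<open>(x, z)\<close> into the start of a generator.
  Deletion of a later point happens in the shorter tuple, and the outer layers merely put points in
  front.\<close>

lemma face_interior:
  "\<lbrakk>xs \<in> T n; Suc (Suc i) < length xs\<rbrakk> \<Longrightarrow> face (Suc i) xs =
    (if valid (del (Suc i) xs) \<and> wt (del (Suc i) xs) = wt xs then gen (del (Suc i) xs) else (\<lambda>t p. \<zero>\<^bsub>K\<^esub>))"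
proof (induction i arbitrary: xs n)
  case 0
  obtain x y z ws where xs: "xs = x # y # z # ws"
    using "0.prems"(2) by (cases xs; cases "tl xs"; cases "tl (tl xs)") auto
  note t = T_ConsD[OF "0.prems"(1)[unfolded xs]]
  note t' = T_ConsD[OF t(1)]
  have FP: "(x, z) \<in> FP" by (rule FP_trans(1)[OF t(2) t'(2)])
  have v: "valid (z # ws)" by (rule T_valid[OF t'(1)])
  \<comment> \<open>A deletion that preserves the length never produces a degenerate tuple, so both
    reasons for a face to vanish are covered by betweenness alone.\<close>
  have ne: "x \<noteq> z" if "between d x y z"
    using that between_same[OF t(2)] t'(2) t(3) by blast
  have cond: "valid (x # z # ws) \<and> wt (x # z # ws) = wt xs \<longleftrightarrow> between d x y z"
    using between_iff[OF t(2) t'(2)] ne FP v by (auto simp: xs)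
  have "el \<one>\<^bsub>K\<^esub> x y \<odot>\<^bsub>bar (n - 2)\<^esub> bvec \<one>\<^bsub>K\<^esub> y (z # ws) =
      (if between d x y z then bvec \<one>\<^bsub>K\<^esub> x (z # ws) else (\<lambda>t p. \<zero>\<^bsub>K\<^esub>))"
    using smult_bvec[OF K.one_closed K.one_closed t(2) t'(1), of ] t'(2) by simp
  then have "face (Suc 0) xs = con (if between d x y z then bvec \<one>\<^bsub>K\<^esub> x (z # ws) else (\<lambda>t p. \<zero>\<^bsub>K\<^esub>))"
    by (simp add: xs)
  also have "\<dots> = (if between d x y z then gen (x # z # ws) else (\<lambda>t p. \<zero>\<^bsub>K\<^esub>))"
    using con_bvec[OF t'(1), of x "\<one>\<^bsub>K\<^esub>"] FP ne by auto
  finally show ?case using cond by (simp add: xs)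
next
  case (Suc i)
  obtain x y zs where xs: "xs = x # y # zs"
    using Suc.prems(2) by (cases xs; cases "tl xs") auto
  note t = T_ConsD[OF Suc.prems(1)[unfolded xs]]
  let ?w = "del (Suc i) (y # zs)"
  have w: "?w \<noteq> []" "hd ?w = y" by auto
  have dx: "del (Suc (Suc i)) xs = x # ?w" by (simp add: xs)
  have IH: "face (Suc i) (y # zs) =
    (if valid ?w \<and> wt ?w = wt (y # zs) then gen ?w else (\<lambda>t p. \<zero>\<^bsub>K\<^esub>))"
    using Suc.IH[OF t(1)] Suc.prems(2) by (simp add: xs)
  have cond: "valid (x # ?w) \<and> wt (x # ?w) = wt xs \<longleftrightarrow> valid ?w \<and> wt ?w = wt (y # zs)"
    using valid_Cons[OF w(1), of x] wt_Cons[OF w(1), of x] w(2) t by (auto simp: xs)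
  show ?case
  proof (cases "valid ?w \<and> wt ?w = wt (y # zs)")
    case True
    then have wT: "?w \<in> T (n - 2)"
      using t(1) Suc.prems(2) by (auto simp: T_def xs min_def)
    have FPy: "(y, hd ?w) \<in> FP" using FP_refl[OF FP_D(2)[OF t(2)]] by simp
    have "el \<one>\<^bsub>K\<^esub> x y \<odot>\<^bsub>bar (n - 2)\<^esub> bvec \<one>\<^bsub>K\<^esub> y ?w = bvec \<one>\<^bsub>K\<^esub> x ?w"
      using smult_bvec[OF K.one_closed K.one_closed t(2) wT FPy] between_refl(2)[OF FP_D(1,2)[OF t(2)]] by simp
    moreover have "con (bvec \<one>\<^bsub>K\<^esub> x ?w) = bvec \<one>\<^bsub>K\<^esub> x (x # ?w)"
      using con_bvec[OF wT, of x "\<one>\<^bsub>K\<^esub>"] t by simp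
    ultimately have "face (Suc (Suc i)) xs = gen (x # ?w)"
      using IH True by (simp add: xs)
    then show ?thesis using cond True dx by simp
  next
    case False
    have "el \<one>\<^bsub>K\<^esub> x y \<odot>\<^bsub>bar (n - 2)\<^esub> \<zero>\<^bsub>bar (n - 2)\<^esub> = \<zero>\<^bsub>bar (n - 2)\<^esub>"
      by (rule left_module.smult_r_null[OF bar_left_module el_closed[OF K.one_closed t(2)]])
    moreover have "face (Suc i) (y # zs) = (\<lambda>t p. \<zero>\<^bsub>K\<^esub>)" using IH False by (simp only: if_False)
    ultimately have "face (Suc (Suc i)) xs = (\<lambda>t p. \<zero>\<^bsub>K\<^esub>)" by (simp add: xs)
    moreover have "\<not> (valid (x # ?w) \<and> wt (x # ?w) = wt xs)" using cond False by blast
    ultimately show ?thesis unfolding dx by (simp only: if_False)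
  qed
qed

lemma wt_butlast: "\<lbrakk>valid xs; tl xs \<noteq> []\<rbrakk> \<Longrightarrow> wt (butlast xs) < wt xs"
proof (induction xs rule: valid.induct)
  case (3 x y ys)
  have pos: "0 < rdist x y" using "3.prems"(1) FP_D(5,6)[of x y] by auto
  show ?case
  proof (cases ys)
    case (Cons z zs)
    then have "wt (butlast (y # ys)) < wt (y # ys)" using "3.IH" "3.prems" by simp
    then show ?thesis using Cons by simp
  qed (use pos in simp)
qed auto

text \<open>Consecutive points are distinct, so the first and the last step have positive length.
  Hence the two outer faces are 0 in the magnitude complex.\<close>

lemma del_0_last:
  assumes "xs \<in> T (n + 1)" "tl xs \<noteq> []"
  shows "wt (del 0 xs) < wt xs" "wt (del (length xs - 1) xs) < wt xs"
proof -
  obtain x y ys where xs: "xs = x # y # ys" using assms(2) by (cases xs; cases "tl xs") auto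
  have "0 < rdist x y" using FP_D(5,6)[of x y] assms(1) by (auto simp: T_def xs)
  then show "wt (del 0 xs) < wt xs" by (simp add: xs)
  have "del (length xs - 1) xs = butlast xs" by (simp add: butlast_conv_take)
  then show "wt (del (length xs - 1) xs) < wt xs" using wt_butlast[OF T_valid[OF assms(1)] assms(2)] by simp
qed

definition face_val :: "(('x list \<Rightarrow> 'k) \<Rightarrow> 'k) \<Rightarrow> int \<Rightarrow> real \<Rightarrow> 'x list \<Rightarrow> 'k" where
  "face_val \<psi> n l ys = (if ys \<in> T n \<and> wt ys = l then val \<psi> ys else \<zero>\<^bsub>K\<^esub>)"

lemma face_val_closed: "\<psi> \<in> carrier (MC l n) \<Longrightarrow> face_val \<psi> n l ys \<in> carrier K"
  using val_closed by (simp add: face_val_def)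

lemma boundary_terms:
  fixes l :: real and n :: int
  shows "mag_face K X d l (n + 1) i xs \<in> carrier (MCh l n)"
    and "(\<Oplus>\<^bsub>MCh l n\<^esub>i\<in>{..<length xs}. sgn_pow i \<odot>\<^bsub>MCh l n\<^esub> mag_face K X d l (n + 1) i xs) \<in> carrier (MCh l n)"
proof -
  interpret C: left_module K "MCh l n" by (rule MCh_module)
  show 1: "mag_face K X d l (n + 1) i xs \<in> carrier (MCh l n)" for i
    unfolding mag_face_def Let_def using basis_closed[of _ n l] C.M.zero_closed by (simp add: mag_tuples_eq)
  show "(\<Oplus>\<^bsub>MCh l n\<^esub>i\<in>{..<length xs}. sgn_pow i \<odot>\<^bsub>MCh l n\<^esub> mag_face K X d l (n + 1) i xs) \<in> carrier (MCh l n)"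
    by (rule C.M.finsum_closed) (use C.smult_closed[OF _ 1] in auto)
qed

lemma coboundary_closed:
  assumes "\<psi> \<in> carrier (MC l n)"
  shows "dM l n \<psi> \<in> carrier (MC l (n + 1))"
proof -
  let ?\<phi> = "\<lambda>xs. \<Oplus>\<^bsub>MCh l n\<^esub>i\<in>{..<length xs}. sgn_pow i \<odot>\<^bsub>MCh l n\<^esub> mag_face K X d l (n + 1) i xs"
  have b: "restrict (mag_boundary K X d l (n + 1)) (carrier (MCh l (n + 1))) \<in> linear_maps K (MCh l (n + 1)) (MCh l n)"
    using lin_ext_linear[OF MCh_module[of l n], of ?\<phi> "mag_tuples X d (n + 1) l"] boundary_terms(2)[of l n]
    by (simp add: mag_boundary_def Let_def mag_chains_def)
  have p: "\<psi> \<in> linear_maps K (MCh l n) (regular_module K)" using assms by (simp add: mag_cochains_def)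
  interpret C: left_module K "MCh l (n + 1)" by (rule MCh_module)
  note b' = linear_mapsD[OF b] and p' = linear_mapsD[OF p]
  have "compose (carrier (MCh l (n + 1))) \<psi> (mag_boundary K X d l (n + 1)) \<in> linear_maps K (MCh l (n + 1)) (regular_module K)"
  proof (rule linear_mapsI)
    fix c c' assume c: "c \<in> carrier (MCh l (n + 1))" "c' \<in> carrier (MCh l (n + 1))"
    show "compose (carrier (MCh l (n + 1))) \<psi> (mag_boundary K X d l (n + 1)) (c \<oplus>\<^bsub>MCh l (n + 1)\<^esub> c') =
        compose (carrier (MCh l (n + 1))) \<psi> (mag_boundary K X d l (n + 1)) c \<oplus>\<^bsub>regular_module K\<^esub>
        compose (carrier (MCh l (n + 1))) \<psi> (mag_boundary K X d l (n + 1)) c'"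
      using b'(1)[OF c(1)] b'(1)[OF c(2)] b'(2)[OF c] p'(2) c C.M.a_closed[OF c] by (simp add: compose_eq)
  next
    fix k c assume c: "k \<in> carrier K" "c \<in> carrier (MCh l (n + 1))"
    show "compose (carrier (MCh l (n + 1))) \<psi> (mag_boundary K X d l (n + 1)) (k \<odot>\<^bsub>MCh l (n + 1)\<^esub> c) =
        k \<odot>\<^bsub>regular_module K\<^esub> compose (carrier (MCh l (n + 1))) \<psi> (mag_boundary K X d l (n + 1)) c"
      using b'(1)[OF c(2)] b'(3)[OF c] p'(3) c C.smult_closed[OF c] by (simp add: compose_eq)
  qed (use b'(1) p'(1) in \<open>auto simp: compose_def\<close>)
  then show ?thesis by (simp add: mag_coboundary_def mag_cochains_def)
qed

lemma val_coboundary: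
  assumes \<psi>: "\<psi> \<in> carrier (MC l n)" and xs: "xs \<in> T (n + 1)" "wt xs = l"
  shows "val (dM l n \<psi>) xs = (\<Oplus>\<^bsub>K\<^esub>i\<in>{..<length xs}. sgn_pow i \<otimes>\<^bsub>K\<^esub> face_val \<psi> n l (del i xs))"
proof -
  interpret C: left_module K "MCh l n" by (rule MCh_module)
  have rab: "abelian_group (regular_module K)" by (rule left_module.axioms(2)[OF K_reg])
  have p: "\<psi> \<in> linear_maps K (MCh l n) (regular_module K)" using \<psi> by (simp add: mag_cochains_def)
  let ?\<phi> = "\<lambda>xs. \<Oplus>\<^bsub>MCh l n\<^esub>i\<in>{..<length xs}. sgn_pow i \<odot>\<^bsub>MCh l n\<^esub> mag_face K X d l (n + 1) i xs"
  have pf: "\<psi> (mag_face K X d l (n + 1) i xs) = face_val \<psi> n l (del i xs)" for i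
    using linear_maps_zero[OF C.M.abelian_group_axioms rab p]
    by (simp add: mag_face_def Let_def mag_tuples_eq face_val_def val_def)
  have "val (dM l n \<psi>) xs = \<psi> (?\<phi> xs)"
    using basis_closed[OF xs] lin_ext_basis_vec[OF MCh_module[of l n], of ?\<phi> xs] boundary_terms(2)[of l n xs]
    by (simp add: val_def mag_coboundary_def compose_eq mag_boundary_def Let_def)
  also have "\<dots> = (\<Oplus>\<^bsub>regular_module K\<^esub>i\<in>{..<length xs}. \<psi> (sgn_pow i \<odot>\<^bsub>MCh l n\<^esub> mag_face K X d l (n + 1) i xs))"
    by (rule linear_maps_finsum[OF C.M.abelian_group_axioms rab p])
      (use C.smult_closed[OF _ boundary_terms(1)] in auto)
  also have "\<dots> = (\<Oplus>\<^bsub>K\<^esub>i\<in>{..<length xs}. \<psi> (sgn_pow i \<odot>\<^bsub>MCh l n\<^esub> mag_face K X d l (n + 1) i xs))"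
    by (rule finsum_cong_subset[OF K.abelian_group_axioms rab])
      (use linear_mapsD(1)[OF p C.smult_closed[OF _ boundary_terms(1)]] in auto)
  also have "\<dots> = (\<Oplus>\<^bsub>K\<^esub>i\<in>{..<length xs}. sgn_pow i \<otimes>\<^bsub>K\<^esub> face_val \<psi> n l (del i xs))"
    by (rule K.finsum_cong') (use linear_mapsD(3)[OF p _ boundary_terms(1)] pf face_val_closed[OF \<psi>] in auto)
  finally show ?thesis .
qed

text \<open>It suffices to compare the coordinate at \<open>x_0\<close> on generators of length
  \<open>l\<close>, where both sides are alternating sums over faces. The interior faces match by
  \<open>face_interior\<close>, and the outer ones contribute 0 on either side.\<close>

lemma toHom_coboundary:
  assumes l: "l \<in> G" and \<psi>: "\<psi> \<in> carrier (MC l n)"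
  shows "toHom (n + 1) l (dM l n \<psi>) = hom_diff bar bard n (toHom n l \<psi>)"
proof -
  interpret S: graded_left_module G \<Lambda> SX by (rule SX_graded)
  let ?\<theta> = "toHom n l \<psi>"
  note \<theta> = toHom_maps[OF l \<psi>]
  note \<theta>l = linear_mapsD[OF graded_mapsD(1)[OF \<theta>], simplified]
  have bd: "bard (n + 1) \<in> graded_maps G \<Lambda> (bar (n + 1)) (bar n)" using bard_maps[of "n + 1"] by simp
  have hd: "hom_diff bar bard n ?\<theta> \<in> graded_maps G \<Lambda> (bar (n + 1)) (shift l SX)"
    unfolding hom_diff_def by (rule compose_graded_maps[OF bd \<theta> bar_graded])
  show ?thesis
  proof (rule hom_eqI[OF l toHom_maps[OF l coboundary_closed[OF \<psi>]] hd])
    fix xs assume xs: "xs \<in> T (n + 1)" "wt xs = l"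
    let ?x = "hd xs"
    have X: "?x \<in> X" by (rule valid_hd[OF T_valid[OF xs(1)]])
    have e: "el \<one>\<^bsub>K\<^esub> ?x ?x \<in> carrier \<Lambda>" by (intro el_closed K.one_closed FP_refl[OF X])
    have b: "bnd xs \<in> carrier (bar n)" using bnd_closed[OF xs(1)] by simp
    let ?f = "\<lambda>c. diag (?\<theta> c) ?x"
    have "bard (n + 1) (gen xs) = el \<one>\<^bsub>K\<^esub> ?x ?x \<odot>\<^bsub>bar n\<^esub> bnd xs"
      using bard_bvec[OF K.one_closed xs(1) FP_refl[OF X]] by simp
    then have "?f (bard (n + 1) (gen xs)) = ?f (bnd xs)"
      using \<theta>l(3)[OF e b] diag_simps(3)[OF e \<theta>l(1)[OF b], of ?x] diag_simps(1)[OF \<theta>l(1)[OF b]]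
      by (simp add: el_apply)
    also have "\<dots> = (\<Oplus>\<^bsub>K\<^esub>i\<in>{..<length xs - 1}. sgn_pow i \<otimes>\<^bsub>K\<^esub> ?f (face i xs))"
      by (rule functional_bnd[OF xs(1)])
        (use \<theta>l(1,2) diag_simps(1,2) in simp_all)
    also have "\<dots> = (\<Oplus>\<^bsub>K\<^esub>i\<in>{..<length xs}. sgn_pow i \<otimes>\<^bsub>K\<^esub> face_val \<psi> n l (del i xs))"
    proof (rule K.add.finprod_mono_neutral_cong)
      \<comment> \<open>The face deleting the last point has no counterpart in \<open>bnd\<close>;
        the magnitude side has to be 0 there.\<close>
      fix i assume "i \<in> {..<length xs} - {..<length xs - 1}"
      then have i: "i = length xs - 1" "xs \<noteq> []" by auto
      have "face_val \<psi> n l (del i xs) = \<zero>\<^bsub>K\<^esub>"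
      \<comment> \<open>A tuple with one point occurs for \<open>n = -1\<close>. Deleting its point
        gives the empty list, which is not a tuple, so the comparison of lengths is not what settles
        this case.\<close>
      proof (cases "tl xs = []")
        case True
        then have "del i xs = []" using i by (cases xs) auto
        then have "face_val \<psi> n l (del i xs) = face_val \<psi> n l []" by (rule arg_cong)
        then show ?thesis by (simp add: face_val_def T_def)
      next
        case False
        then show ?thesis using del_0_last(2)[OF xs(1)] xs(2) i by (simp add: face_val_def)
      qed
      then show "sgn_pow i \<otimes>\<^bsub>K\<^esub> face_val \<psi> n l (del i xs) = \<zero>\<^bsub>K\<^esub>" by simp
    next
      fix i assume "i \<in> {..<length xs - 1} \<inter> {..<length xs}"
      then have i: "Suc i < length xs" by auto
      have "?f (face i xs) = face_val \<psi> n l (del i xs)"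
      proof (cases i)
        case 0
        obtain x y ys where xy: "xs = x # y # ys" using i by (cases xs; cases "tl xs") auto
        note t = T_ConsD[OF xs(1)[unfolded xy]]
        have t1: "y # ys \<in> T n" using t(1) by simp
        \<comment> \<open>The first face is a multiple by the off-diagonal pair
          \<open>(x, y)\<close>, which acts on \<open>S\<close> by 0.\<close>
        have "face 0 xs = el \<one>\<^bsub>K\<^esub> x y \<odot>\<^bsub>bar n\<^esub> gen (y # ys)"
          using bvec_gen[OF K.one_closed t1, of x] t(2) xy by simp
        then have "?f (face 0 xs) = el \<one>\<^bsub>K\<^esub> x y (x, x) \<otimes>\<^bsub>K\<^esub> ?f (gen (y # ys))"
          using \<theta>l(3)[OF el_closed[OF K.one_closed t(2)] gen_closed(1)[OF t1]]
            diag_simps(3)[OF el_closed[OF K.one_closed t(2)] \<theta>l(1)[OF gen_closed(1)[OF t1]], of x] xy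
          by simp
        moreover have "face_val \<psi> n l (del 0 xs) = \<zero>\<^bsub>K\<^esub>"
          using del_0_last(1)[OF xs(1)] xs(2) xy by (simp add: face_val_def)
        ultimately show ?thesis
          using 0 t(3) diag_simps(1)[OF \<theta>l(1)[OF gen_closed(1)[OF t1]]] by (simp add: el_apply)
      next
        case (Suc j)
        have len: "int (length (del i xs)) = n + 1" using xs(1) i by (simp add: T_def min_def)
        have hd: "hd (del i xs) = ?x" using Suc i by (cases xs) auto
        have "?f (\<lambda>t p. \<zero>\<^bsub>K\<^esub>) = \<zero>\<^bsub>K\<^esub>"
          using linear_maps_zero[OF bar_ab _ graded_mapsD(1)[OF \<theta>]]
            graded_left_module_ab[OF L.shift_graded[OF SX_graded l]] diag_simps(4) by simp
        then show ?thesis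
          using face_interior[OF xs(1), of j] i Suc diag_toHom_gen[OF l \<psi>, of "del i xs" ?x] len hd xs(2)
          by (auto simp: face_val_def T_def)
      qed
      then show "sgn_pow i \<otimes>\<^bsub>K\<^esub> ?f (face i xs) = sgn_pow i \<otimes>\<^bsub>K\<^esub> face_val \<psi> n l (del i xs)" by simp
    qed (use face_val_closed[OF \<psi>] face_closed[OF xs(1)] \<theta>l(1) diag_simps(1) in auto)
    finally show "diag (toHom (n + 1) l (dM l n \<psi>) (gen xs)) ?x = diag (hom_diff bar bard n ?\<theta> (gen xs)) ?x"
      using val_coboundary[OF \<psi> xs] diag_toHom_gen[OF l coboundary_closed[OF \<psi>] xs(1), of ?x] xs(2)
        gen_closed(1)[OF xs(1)] by (simp add: hom_diff_def compose_eq)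
  qed
qed

end

section \<open>Comparison of the products\<close>

context finite_quasimetric
begin

text \<open>The two pieces share the point at position \<open>j\<close>, so every step of the tuple
  belongs to exactly one of them.\<close>

lemma valid_take_drop:
  "\<lbrakk>valid xs; j < length xs\<rbrakk> \<Longrightarrow> valid (take (Suc j) xs) \<and> wt xs = wt (take (Suc j) xs) + wt (drop j xs)"
proof (induction j arbitrary: xs)
  case 0
  then show ?case using valid_hd[of xs] by (cases xs) auto
next
  case (Suc j)
  obtain x y ys where xs: "xs = x # y # ys"
    using Suc.prems(2) by (cases xs; cases "tl xs") auto
  have p: "valid (y # ys)" "j < length (y # ys)" and x: "x \<noteq> y" "(x, y) \<in> FP"
    using Suc.prems xs by auto
  define t where "t = take (Suc j) (y # ys)"
  define u where "u = drop j (y # ys)"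
  have t: "t \<noteq> []" "hd t = y" by (simp_all add: t_def)
  have IH: "valid t" "wt (y # ys) = wt t + wt u" using Suc.IH[OF p] by (simp_all only: t_def u_def)
  have "take (Suc (Suc j)) xs = x # t" "drop (Suc j) xs = u" by (simp_all add: xs t_def u_def)
  moreover have "valid (x # t)" using valid_Cons[OF t(1)] t(2) x IH(1) by simp
  moreover have "wt (x # t) = rdist x y + wt t" using wt_Cons[OF t(1)] t(2) by simp
  moreover have "wt xs = rdist x y + wt (y # ys)" by (simp add: xs)
  ultimately show ?case using IH(2) by (simp only: add.assoc)
qed

lemma T_split:
  assumes "xs \<in> T (n + k)" "0 \<le> k" "drop (nat k) xs \<in> T n"
  shows "take (Suc (nat k)) xs \<in> T k" "hd (take (Suc (nat k)) xs) = hd xs"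
    "wt xs = wt (take (Suc (nat k)) xs) + wt (drop (nat k) xs)"
proof -
  have len: "nat k < length xs" using valid_not_Nil[OF T_valid[OF assms(3)]] by simp
  show "take (Suc (nat k)) xs \<in> T k" "wt xs = wt (take (Suc (nat k)) xs) + wt (drop (nat k) xs)"
    using valid_take_drop[OF T_valid[OF assms(1)] len] len assms(2) by (auto simp: T_def)
  show "hd (take (Suc (nat k)) xs) = hd xs" by (cases xs) auto
qed

text \<open>The end of the tuple is evaluated by \<open>\<phi>\<close> and the beginning is kept as
  a generator. Membership of the end in \<open>T n\<close> also makes the lift vanish for negative
  \<open>n\<close>.\<close>

definition lift_val :: "(('x list \<Rightarrow> 'k) \<Rightarrow> 'k) \<Rightarrow> int \<Rightarrow> real \<Rightarrow> int \<Rightarrow> 'x list \<Rightarrow> 'x list \<Rightarrow> 'x \<times> 'x \<Rightarrow> 'k" where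
  "lift_val \<phi> n l k xs =
    (if 0 \<le> k \<and> drop (nat k) xs \<in> T n \<and> wt (drop (nat k) xs) = l
     then bvec (val \<phi> (drop (nat k) xs)) (hd xs) (take (Suc (nat k)) xs) else (\<lambda>t p. \<zero>\<^bsub>K\<^esub>))"

text \<open>The lift of the cocycle of \<open>\<phi>\<close> that sends \<open>(x\<^sub>0, \<dots>, x\<^sub>n\<^sub>+\<^sub>k)\<close> to
  \<open>\<phi>(x\<^sub>k, \<dots>, x\<^sub>n\<^sub>+\<^sub>k) \<cdot> (x\<^sub>0, \<dots>, x\<^sub>k)\<close>.  It commutes with the contraction.\<close>

definition mlift :: "(('x list \<Rightarrow> 'k) \<Rightarrow> 'k) \<Rightarrow> int \<Rightarrow> real \<Rightarrow> int \<Rightarrow> ('x list \<Rightarrow> 'x \<times> 'x \<Rightarrow> 'k) \<Rightarrow> 'x list \<Rightarrow> 'x \<times> 'x \<Rightarrow> 'k"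
  where "mlift \<phi> n l k = extb (shift l (bar k)) (n + k) (lift_val \<phi> n l k)"

lemma zero_bar_gpart: "(\<lambda>t p. \<zero>\<^bsub>K\<^esub>) \<in> gpart (bar n) g"
  unfolding bar_gpart by (auto intro: barI)

context
  fixes \<phi> :: "('x list \<Rightarrow> 'k) \<Rightarrow> 'k" and n :: int and l :: real
  assumes l: "l \<in> G" and \<phi>: "\<phi> \<in> carrier (MC l n)"
begin

lemma lift_val_gpart:
  assumes xs: "xs \<in> T (n + k)"
  shows "lift_val \<phi> n l k xs \<in> gpart (bar k) (wt xs - l)"
proof (cases "0 \<le> k \<and> drop (nat k) xs \<in> T n \<and> wt (drop (nat k) xs) = l")
  case True
  have t: "take (Suc (nat k)) xs \<in> T k" "hd (take (Suc (nat k)) xs) = hd xs" "wt xs = wt (take (Suc (nat k)) xs) + l"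
    using T_split[OF xs] True by auto
  have h: "(hd xs, hd xs) \<in> FP" by (rule FP_refl[OF valid_hd[OF T_valid[OF xs]]])
  have "bvec (val \<phi> (drop (nat k) xs)) (hd xs) (take (Suc (nat k)) xs)
      \<in> gpart (bar k) (rdist (hd xs) (hd xs) + wt (take (Suc (nat k)) xs))"
    using bvec_closed(2)[OF val_closed[OF \<phi>] t(1), of "drop (nat k) xs" "hd xs"] t(2) h True by simp
  then show ?thesis using True t(3) FP_D(6)[OF h] by (simp add: lift_val_def)
next
  case False
  then have "lift_val \<phi> n l k xs = (\<lambda>t p. \<zero>\<^bsub>K\<^esub>)" by (simp only: lift_val_def if_False)
  then show ?thesis using zero_bar_gpart by simp
qed

lemma mlift_maps: "mlift \<phi> n l k \<in> graded_maps G \<Lambda> (bar (n + k)) (shift l (bar k))"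
  unfolding mlift_def
  by (rule extb_graded[OF L.shift_graded[OF bar_graded l]]) (use lift_val_gpart in simp)

lemma mlift_closed: "c \<in> carrier (bar (n + k)) \<Longrightarrow> mlift \<phi> n l k c \<in> carrier (bar k)"
  using graded_maps_closed[OF mlift_maps] by simp

lemma mlift_add: "\<lbrakk>c \<in> carrier (bar (n + k)); c' \<in> carrier (bar (n + k))\<rbrakk> \<Longrightarrow>
    mlift \<phi> n l k (c \<oplus>\<^bsub>bar (n + k)\<^esub> c') = mlift \<phi> n l k c \<oplus>\<^bsub>bar k\<^esub> mlift \<phi> n l k c'"
  using linear_mapsD(2)[OF graded_mapsD(1)[OF mlift_maps]] by simp

lemma mlift_zero: "mlift \<phi> n l k (\<lambda>t p. \<zero>\<^bsub>K\<^esub>) = (\<lambda>t p. \<zero>\<^bsub>K\<^esub>)"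
  using graded_maps_ab(1)[OF mlift_maps bar_graded L.shift_graded[OF bar_graded l]] by simp

lemma mlift_minus: "\<lbrakk>c \<in> carrier (bar (n + k)); c' \<in> carrier (bar (n + k))\<rbrakk> \<Longrightarrow>
    mlift \<phi> n l k (\<lambda>t p. c t p \<ominus>\<^bsub>K\<^esub> c' t p) = (\<lambda>t p. mlift \<phi> n l k c t p \<ominus>\<^bsub>K\<^esub> mlift \<phi> n l k c' t p)"
  using graded_maps_ab(3)[OF mlift_maps bar_graded L.shift_graded[OF bar_graded l], of c k c']
    bar_minus[of c "n + k" c'] bar_minus[OF mlift_closed mlift_closed, of c k c'] by simp

lemma mlift_bvec:
  assumes j: "j \<in> carrier K" and xs: "xs \<in> T (n + k)" and x: "(x, hd xs) \<in> FP"
  shows "mlift \<phi> n l k (bvec j x xs) =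
    (if 0 \<le> k \<and> drop (nat k) xs \<in> T n \<and> wt (drop (nat k) xs) = l
     then bvec (j \<otimes>\<^bsub>K\<^esub> val \<phi> (drop (nat k) xs)) x (take (Suc (nat k)) xs) else (\<lambda>t p. \<zero>\<^bsub>K\<^esub>))"
proof -
  interpret S: graded_left_module G \<Lambda> "shift l (bar k)" by (rule L.shift_graded[OF bar_graded l])
  have lc: "lift_val \<phi> n l k xs \<in> carrier (bar k)" using lift_val_gpart[OF xs] by (simp add: bar_gpart)
  have 1: "mlift \<phi> n l k (bvec j x xs) = el j x (hd xs) \<odot>\<^bsub>bar k\<^esub> lift_val \<phi> n l k xs"
    unfolding mlift_def
    using extb_bvec[where \<nu> = "lift_val \<phi> n l k" and xs = xs, OF S.left_module_axioms _ j xs x] lc by simp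
  show ?thesis
  proof (cases "0 \<le> k \<and> drop (nat k) xs \<in> T n \<and> wt (drop (nat k) xs) = l")
    case True
    have t: "take (Suc (nat k)) xs \<in> T k" "hd (take (Suc (nat k)) xs) = hd xs"
      using T_split[OF xs] True by auto
    have "el j x (hd xs) \<odot>\<^bsub>bar k\<^esub> bvec (val \<phi> (drop (nat k) xs)) (hd xs) (take (Suc (nat k)) xs) =
        bvec (j \<otimes>\<^bsub>K\<^esub> val \<phi> (drop (nat k) xs)) x (take (Suc (nat k)) xs)"
      using smult_bvec[OF j val_closed[OF \<phi>] x t(1), of "drop (nat k) xs"] t(2) True
        FP_refl[OF FP_D(2)[OF x]] between_refl(2)[OF FP_D(1,2)[OF x]] by simp
    then show ?thesis using 1 True by (simp add: lift_val_def)
  next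
    case False
    then have "lift_val \<phi> n l k xs = (\<lambda>t p. \<zero>\<^bsub>K\<^esub>)" by (simp only: lift_val_def if_False)
    then have "mlift \<phi> n l k (bvec j x xs) = (\<lambda>t p. \<zero>\<^bsub>K\<^esub>)"
      using 1 left_module.smult_r_null[OF bar_left_module[of k] el_closed[OF j x]] by simp
    then show ?thesis using False by (simp only: if_False)
  qed
qed

text \<open>\<open>con\<close> works at the left end of a tuple and the lift cuts at the right end.
  Inserting a point on the left only moves the position of the cut from \<open>k - 1\<close> to
  \<open>k\<close>, leaving the evaluated end unchanged.\<close>

lemma mlift_con:
  assumes k: "k \<ge> 1" and c: "c \<in> carrier (bar (n + (k - 1)))"
  shows "mlift \<phi> n l k (con c) = con (mlift \<phi> n l (k - 1) c)"
proof (rule bar_eqI[where N = "bar k" and f = "\<lambda>c. mlift \<phi> n l k (con c)" and g = "\<lambda>c. con (mlift \<phi> n l (k - 1) c)",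
      OF _ _ _ _ c])
  have cc: "con c \<in> carrier (bar (n + k))" if "c \<in> carrier (bar (n + (k - 1)))" for c
    using con_closed[OF that] by (simp add: algebra_simps)
  show "mlift \<phi> n l k (con (c \<oplus>\<^bsub>bar (n + (k - 1))\<^esub> c')) = mlift \<phi> n l k (con c) \<oplus>\<^bsub>bar k\<^esub> mlift \<phi> n l k (con c')"
    if "c \<in> carrier (bar (n + (k - 1)))" "c' \<in> carrier (bar (n + (k - 1)))" for c c'
    using mlift_add[OF cc[OF that(1)] cc[OF that(2)]] con_add[OF that, of "n + k"] by simp
  show "con (mlift \<phi> n l (k - 1) (c \<oplus>\<^bsub>bar (n + (k - 1))\<^esub> c')) =
      con (mlift \<phi> n l (k - 1) c) \<oplus>\<^bsub>bar k\<^esub> con (mlift \<phi> n l (k - 1) c')"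
    if "c \<in> carrier (bar (n + (k - 1)))" "c' \<in> carrier (bar (n + (k - 1)))" for c c'
    unfolding mlift_add[OF that] by (rule con_add[OF mlift_closed[OF that(1)] mlift_closed[OF that(2)]])
  show "mlift \<phi> n l k (con \<zero>\<^bsub>bar (n + (k - 1))\<^esub>) = con (mlift \<phi> n l (k - 1) \<zero>\<^bsub>bar (n + (k - 1))\<^esub>)"
    by (simp add: mlift_zero)
  fix j x ys assume j: "j \<in> carrier K" and ys: "ys \<in> T (n + (k - 1))" and x: "(x, hd ys) \<in> FP"
  have nk: "nat k = Suc (nat (k - 1))" using k by simp
  have dr: "drop (nat k) (x # ys) = drop (nat (k - 1)) ys" "take (Suc (nat k)) (x # ys) = x # take (Suc (nat (k - 1))) ys"
    by (simp_all add: nk)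
  let ?C = "drop (nat (k - 1)) ys \<in> T n \<and> wt (drop (nat (k - 1)) ys) = l"
  let ?v = "val \<phi> (drop (nat (k - 1)) ys)" and ?w = "take (Suc (nat (k - 1))) ys"
  have R: "mlift \<phi> n l (k - 1) (bvec j x ys) = (if ?C then bvec (j \<otimes>\<^bsub>K\<^esub> ?v) x ?w else (\<lambda>t p. \<zero>\<^bsub>K\<^esub>))"
    using mlift_bvec[OF j ys x] k by simp
  have w: "?w \<in> T (k - 1)" "hd ?w = hd ys" if ?C using T_split[OF ys] that k by auto
  have con_R: "con (mlift \<phi> n l (k - 1) (bvec j x ys)) =
      (if ?C then if x = hd ys then (\<lambda>t p. \<zero>\<^bsub>K\<^esub>) else bvec (j \<otimes>\<^bsub>K\<^esub> ?v) x (x # ?w) else (\<lambda>t p. \<zero>\<^bsub>K\<^esub>))"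
  proof (cases ?C)
    case True
    then show ?thesis using R con_bvec[OF w(1)[OF True], of x "j \<otimes>\<^bsub>K\<^esub> ?v"] w(2)[OF True] x by simp
  next
    case False
    then show ?thesis using R by (simp only: if_False con_zero)
  qed
  have yne: "ys \<noteq> []" by (rule valid_not_Nil[OF T_valid[OF ys]])
  show "mlift \<phi> n l k (con (bvec j x ys)) = con (mlift \<phi> n l (k - 1) (bvec j x ys))"
  proof (cases "x = hd ys")
    case True
    then have "con (mlift \<phi> n l (k - 1) (bvec j x ys)) = (\<lambda>t p. \<zero>\<^bsub>K\<^esub>)"
      unfolding con_R by auto
    then show ?thesis using con_bvec[OF ys x, of j] True mlift_zero by simp
  next
    case False
    have xys: "x # ys \<in> T (n + k)" using T_Cons[OF yne, of x "n + (k - 1)"] ys x False by (simp add: algebra_simps)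
    have xx: "(x, hd (x # ys)) \<in> FP" using FP_refl[OF FP_D(1)[OF x]] by simp
    have "mlift \<phi> n l k (bvec j x (x # ys)) = (if ?C then bvec (j \<otimes>\<^bsub>K\<^esub> ?v) x (x # ?w) else (\<lambda>t p. \<zero>\<^bsub>K\<^esub>))"
      using mlift_bvec[OF j xys xx] k unfolding dr by simp
    also have "\<dots> = con (mlift \<phi> n l (k - 1) (bvec j x ys))"
      unfolding con_R using False by (simp only: if_False)
    finally show ?thesis using con_bvec[OF ys x, of j] False by simp
  qed
qed

text \<open>At the bottom there is no contraction on the target side to commute with. Its substitute
  is that contracted elements are mapped to diagonal ones, on which the augmentation is
  injective.\<close>

lemma mlift_con_diagonal:
  assumes c: "c \<in> carrier (bar (n - 1))"
  shows "diagonal (mlift \<phi> n l 0 (con c)) = mlift \<phi> n l 0 (con c)"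
proof (rule bar_eqI[where N = "bar 0" and f = "\<lambda>c. diagonal (mlift \<phi> n l 0 (con c))" and g = "\<lambda>c. mlift \<phi> n l 0 (con c)",
      OF _ _ _ _ c])
  have cc: "con c \<in> carrier (bar (n + 0))" if "c \<in> carrier (bar (n - 1))" for c
    using con_closed[OF that] by simp
  show 1: "mlift \<phi> n l 0 (con (c \<oplus>\<^bsub>bar (n - 1)\<^esub> c')) = mlift \<phi> n l 0 (con c) \<oplus>\<^bsub>bar 0\<^esub> mlift \<phi> n l 0 (con c')"
    if "c \<in> carrier (bar (n - 1))" "c' \<in> carrier (bar (n - 1))" for c c'
    using mlift_add[OF cc[OF that(1)] cc[OF that(2)]] con_add[OF that, of n] by simp
  show "diagonal (mlift \<phi> n l 0 (con (c \<oplus>\<^bsub>bar (n - 1)\<^esub> c'))) =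
      diagonal (mlift \<phi> n l 0 (con c)) \<oplus>\<^bsub>bar 0\<^esub> diagonal (mlift \<phi> n l 0 (con c'))"
    if "c \<in> carrier (bar (n - 1))" "c' \<in> carrier (bar (n - 1))" for c c'
    unfolding 1[OF that] by (auto simp: diagonal_def intro!: ext)
  show "diagonal (mlift \<phi> n l 0 (con \<zero>\<^bsub>bar (n - 1)\<^esub>)) = mlift \<phi> n l 0 (con \<zero>\<^bsub>bar (n - 1)\<^esub>)"
    by (simp add: mlift_zero diagonal_def)
  fix j x ys assume j: "j \<in> carrier K" and ys: "ys \<in> T (n - 1)" and x: "(x, hd ys) \<in> FP"
  have yne: "ys \<noteq> []" by (rule valid_not_Nil[OF T_valid[OF ys]])
  show "diagonal (mlift \<phi> n l 0 (con (bvec j x ys))) = mlift \<phi> n l 0 (con (bvec j x ys))"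
  proof (cases "x = hd ys")
    case True
    then show ?thesis using con_bvec[OF ys x, of j] mlift_zero by (simp add: diagonal_def)
  next
    case False
    have xys: "x # ys \<in> T (n + 0)" using T_Cons[OF yne, of x "n - 1"] ys x False by simp
    have xx: "(x, hd (x # ys)) \<in> FP" using FP_refl[OF FP_D(1)[OF x]] by simp
    have "mlift \<phi> n l 0 (con (bvec j x ys)) =
        (if x # ys \<in> T n \<and> wt (x # ys) = l then bvec (j \<otimes>\<^bsub>K\<^esub> val \<phi> (x # ys)) x [x] else (\<lambda>t p. \<zero>\<^bsub>K\<^esub>))"
      using mlift_bvec[OF j xys xx] con_bvec[OF ys x, of j] False by simp
    then show ?thesis by (auto simp: diagonal_def bvec_def intro!: ext)
  qed
qed

lemma mlift_aug:
  assumes c: "c \<in> carrier (bar n)"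
  shows "bar_aug (mlift \<phi> n l 0 c) = toHom n l \<phi> c"
proof -
  have m: "mlift \<phi> n l 0 \<in> graded_maps G \<Lambda> (bar n) (shift l (bar 0))" using mlift_maps[of 0] by simp
  have b: "bar_aug \<in> graded_maps G \<Lambda> (shift l (bar 0)) (shift l SX)" by (rule L.graded_maps_shift[OF bar_aug_maps l])
  have "compose (carrier (bar n)) bar_aug (mlift \<phi> n l 0) = toHom n l \<phi>"
  proof (rule hom_eqI[OF l compose_graded_maps[OF m b bar_graded] toHom_maps[OF l \<phi>]])
    fix xs assume xs: "xs \<in> T n" "wt xs = l"
    have xs0: "xs \<in> T (n + 0)" using xs by simp
    have h: "(hd xs, hd xs) \<in> FP" by (rule FP_refl[OF valid_hd[OF T_valid[OF xs(1)]]])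
    have "take (Suc 0) xs = [hd xs]" using valid_not_Nil[OF T_valid[OF xs(1)]] by (cases xs) auto
    then have "mlift \<phi> n l 0 (gen xs) = bvec (val \<phi> xs) (hd xs) [hd xs]"
      using mlift_bvec[OF K.one_closed xs0 h] xs val_closed[OF \<phi> xs] by simp
    moreover have "bvec (val \<phi> xs) (hd xs) [hd xs] \<in> carrier (bar 0)"
      using bvec_closed(1)[OF val_closed[OF \<phi> xs], of "[hd xs]" 0 "hd xs"] h valid_hd[OF T_valid[OF xs(1)]]
      by (simp add: T_def)
    ultimately show "diag (compose (carrier (bar n)) bar_aug (mlift \<phi> n l 0) (gen xs)) (hd xs) =
        diag (toHom n l \<phi> (gen xs)) (hd xs)"
      using diag_bar_aug diag_toHom_gen[OF l \<phi> xs(1), of "hd xs"] xs(2) gen_closed(1)[OF xs(1)]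
      by (simp add: compose_eq bvec_def)
  qed
  from fun_cong[OF this, of c] show ?thesis using c by (simp add: compose_eq)
qed

text \<open>A generator is a contraction \<open>s m\<close>. Commuting the lift with
  \<open>s\<close> on one side and replacing \<open>\<partial>s m\<close> by
  \<open>m - s\<partial>m\<close> on the other reduces the claim to the identity \<open>key\<close>,
  which involves only the lift one degree below.\<close>

lemma mlift_chain_step:
  assumes k: "k \<ge> 1" and n: "n \<ge> 0"
    and key: "\<And>x ys. \<lbrakk>ys \<in> T (n + (k - 1)); (x, hd ys) \<in> FP; x \<noteq> hd ys\<rbrakk> \<Longrightarrow>
      bard k (con (mlift \<phi> n l (k - 1) (bvec \<one>\<^bsub>K\<^esub> x ys))) =
      (\<lambda>t p. mlift \<phi> n l (k - 1) (bvec \<one>\<^bsub>K\<^esub> x ys) t p \<ominus>\<^bsub>K\<^esub>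
        mlift \<phi> n l (k - 1) (con (bard (n + (k - 1)) (bvec \<one>\<^bsub>K\<^esub> x ys))) t p)"
    and c: "c \<in> carrier (bar (n + k))"
  shows "bard k (mlift \<phi> n l k c) = mlift \<phi> n l (k - 1) (bard (n + k) c)"
proof -
  interpret S: graded_left_module G \<Lambda> "shift l (bar (k - 1))" by (rule L.shift_graded[OF bar_graded l])
  have nk: "n + k - 1 = n + (k - 1)" by simp
  have b: "bard k \<in> graded_maps G \<Lambda> (shift l (bar k)) (shift l (bar (k - 1)))"
    by (rule L.graded_maps_shift[OF bard_maps l])
  have d: "bard (n + k) \<in> graded_maps G \<Lambda> (bar (n + k)) (bar (n + (k - 1)))" using bard_maps[of "n + k"] nk by simp
  have "compose (carrier (bar (n + k))) (bard k) (mlift \<phi> n l k) c =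
      compose (carrier (bar (n + k))) (mlift \<phi> n l (k - 1)) (bard (n + k)) c"
  proof (rule bar_maps_eqI[OF S.left_module_axioms graded_mapsD(1)[OF compose_graded_maps[OF mlift_maps b bar_graded]]
        graded_mapsD(1)[OF compose_graded_maps[OF d mlift_maps bar_graded]] _ c])
    fix xs assume xs: "xs \<in> T (n + k)"
    \<comment> \<open>The bounds on \<open>n\<close> and \<open>k\<close> guarantee at least two
      points.\<close>
    obtain x y zs where xy: "xs = x # y # zs" using xs k n by (cases xs; cases "tl xs") (auto simp: T_def)
    have ys: "y # zs \<in> T (n + (k - 1))" "(x, hd (y # zs)) \<in> FP" "x \<noteq> hd (y # zs)"
      using T_ConsD[OF xs[unfolded xy]] nk by simp_all
    let ?m = "bvec \<one>\<^bsub>K\<^esub> x (y # zs)"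
    have m: "?m \<in> carrier (bar (n + (k - 1)))" by (rule bvec_closed(1)[OF K.one_closed ys(1,2)])
    have cb: "con (bard (n + (k - 1)) ?m) \<in> carrier (bar (n + (k - 1)))"
      using con_closed[OF bard_closed[OF m]] by (simp add: add_diff_eq)
    have g: "gen xs = con ?m" using con_bvec[OF ys(1,2), of "\<one>\<^bsub>K\<^esub>"] ys(3) xy by simp
    have nk1: "n + (k - 1) + 1 = n + k" by simp
    have "bard (n + k) (con ?m) = (\<lambda>t p. ?m t p \<ominus>\<^bsub>K\<^esub> con (bard (n + (k - 1)) ?m) t p)"
      using bnd_bvec_con[OF K.one_closed ys] unfolding nk1 .
    then have "mlift \<phi> n l (k - 1) (bard (n + k) (gen xs)) =
        (\<lambda>t p. mlift \<phi> n l (k - 1) ?m t p \<ominus>\<^bsub>K\<^esub> mlift \<phi> n l (k - 1) (con (bard (n + (k - 1)) ?m)) t p)"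
      using mlift_minus[OF m cb] g by simp
    then have "bard k (mlift \<phi> n l k (gen xs)) = mlift \<phi> n l (k - 1) (bard (n + k) (gen xs))"
      using key[OF ys] mlift_con[OF k m] g by simp
    then show "compose (carrier (bar (n + k))) (bard k) (mlift \<phi> n l k) (gen xs) =
        compose (carrier (bar (n + k))) (mlift \<phi> n l (k - 1)) (bard (n + k)) (gen xs)"
      using gen_closed(1)[OF xs] by (simp add: compose_eq)
  qed
  then show ?thesis using c by (simp add: compose_eq)
qed

lemma mlift_neg:
  assumes n: "n < 0" and c: "c \<in> carrier (bar (n + k))"
  shows "mlift \<phi> n l k c = (\<lambda>t p. \<zero>\<^bsub>K\<^esub>)"
proof (rule bar_eqI[where N = "bar k" and f = "mlift \<phi> n l k" and g = "\<lambda>c t p. \<zero>\<^bsub>K\<^esub>", OF mlift_add _ _ _ c])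
  show "mlift \<phi> n l k (bvec j x xs) = (\<lambda>t p. \<zero>\<^bsub>K\<^esub>)" if "j \<in> carrier K" "xs \<in> T (n + k)" "(x, hd xs) \<in> FP" for j x xs
    unfolding mlift_bvec[OF that] T_neg[OF n] by simp
qed (simp_all add: mlift_zero)

text \<open>The cocycle condition is used at \<open>k = 1\<close> alone; from there on the
  contraction identity propagates the chain property. For negative \<open>n\<close> all lifts are
  0.\<close>

lemma mlift_chain:
  assumes cocycle: "\<And>c. c \<in> carrier (bar (n + 1)) \<Longrightarrow> toHom n l \<phi> (bard (n + 1) c) = \<zero>\<^bsub>SX\<^esub>"
    and "k \<ge> 1" "c \<in> carrier (bar (n + k))"
  shows "bard k (mlift \<phi> n l k c) = mlift \<phi> n l (k - 1) (bard (n + k) c)"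
proof (cases "n < 0")
  case True
  have "bard (n + k) c \<in> carrier (bar (n + (k - 1)))" using bard_closed[OF assms(3)] by (simp add: algebra_simps)
  then show ?thesis using mlift_neg[OF True] assms(3) bard_zero by simp
next
  case False
  then have n: "n \<ge> 0" by simp
  show ?thesis using assms(2,3)
  proof (induction k arbitrary: c rule: int_ge_induct)
    case base
    show ?case
    proof (rule mlift_chain_step[OF _ n _ base])
      fix x ys assume "ys \<in> T (n + (1 - 1))" "(x, hd ys) \<in> FP" and ne: "x \<noteq> hd ys"
      then have ys: "ys \<in> T n" "ys \<in> T (n + 0)" "(x, hd ys) \<in> FP" by simp_all
      let ?m = "bvec \<one>\<^bsub>K\<^esub> x ys"
      let ?z = "con (bard n ?m)"
      have m: "?m \<in> carrier (bar n)" by (rule bvec_closed(1)[OF K.one_closed ys(1,3)])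
      have z: "?z \<in> carrier (bar n)" using con_closed[OF bard_closed[OF m]] by simp
      have am: "mlift \<phi> n l 0 ?m \<in> carrier (bar 0)" using mlift_closed[of ?m 0] m by simp
      have az: "mlift \<phi> n l 0 ?z \<in> carrier (bar 0)" using mlift_closed[of ?z 0] z by simp
      note \<theta> = toHom_maps[OF l \<phi>]
      note sS = L.shift_graded[OF SX_graded l]
      interpret S: graded_left_module G \<Lambda> SX by (rule SX_graded)
      have el: "el \<one>\<^bsub>K\<^esub> x (hd ys) \<in> carrier \<Lambda>" by (rule el_closed[OF K.one_closed ys(3)])
      have tg: "toHom n l \<phi> (gen ys) \<in> carrier SX" using graded_maps_closed[OF \<theta> gen_closed(1)[OF ys(1)]] by simp
      \<comment> \<open>The coefficient \<open>(x, x_0)\<close> has distinct points and therefore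
        acts on \<open>S\<close> by 0.\<close>
      have tm: "toHom n l \<phi> ?m = \<zero>\<^bsub>SX\<^esub>"
      proof (rule SX_eqI)
        show "toHom n l \<phi> ?m \<in> carrier SX" using graded_maps_closed[OF \<theta> m] by simp
        have "toHom n l \<phi> ?m = el \<one>\<^bsub>K\<^esub> x (hd ys) \<odot>\<^bsub>SX\<^esub> toHom n l \<phi> (gen ys)"
          using linear_mapsD(3)[OF graded_mapsD(1)[OF \<theta>] el gen_closed(1)[OF ys(1)]]
            bvec_gen[OF K.one_closed ys(1,3)] by simp
        then show "diag (toHom n l \<phi> ?m) u = diag \<zero>\<^bsub>SX\<^esub> u" for u
          using diag_simps(3)[OF el tg, of u] diag_simps(1)[OF tg] ne by (auto simp: el_apply diag_simps(4))
      qed simp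
      have "con ?m \<in> carrier (bar (n + 1))" by (rule con_closed[OF m])
      from cocycle[OF this] have "\<zero>\<^bsub>SX\<^esub> = toHom n l \<phi> (\<lambda>t p. ?m t p \<ominus>\<^bsub>K\<^esub> ?z t p)"
        unfolding bnd_bvec_con[OF K.one_closed ys(1,3) ne] by (rule sym)
      also have "\<dots> = toHom n l \<phi> ?m \<ominus>\<^bsub>SX\<^esub> toHom n l \<phi> ?z"
        using graded_maps_ab(3)[OF \<theta> bar_graded sS m z] bar_minus[OF m z] by simp
      \<comment> \<open>The cocycle condition at \<open>s m\<close> says that the morphism vanishes
        on \<open>\<partial>s m = m - s\<partial>m\<close>; as it vanishes on \<open>m\<close>, it
        vanishes on \<open>s\<partial>m\<close>. The lift of \<open>s\<partial>m\<close> is then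
        both diagonal and in the kernel of the augmentation, hence 0.\<close>
      finally have tz: "toHom n l \<phi> ?z = \<zero>\<^bsub>SX\<^esub>"
        using tm graded_maps_closed[OF \<theta> z] S.M.minus_add_cancel_both(1)[of "\<zero>\<^bsub>SX\<^esub>" "toHom n l \<phi> ?z"] by simp
      have "mlift \<phi> n l 0 ?z = diagonal (mlift \<phi> n l 0 ?z)"
        using mlift_con_diagonal[OF bard_closed[OF m]] by simp
      also have "\<dots> = (\<lambda>t p. \<zero>\<^bsub>K\<^esub>)"
        by (rule diagonal_zero[OF az]) (use mlift_aug[OF z] tz in simp)
      finally have z0: "mlift \<phi> n l 0 ?z = (\<lambda>t p. \<zero>\<^bsub>K\<^esub>)" .
      have "diagonal (mlift \<phi> n l 0 ?m) = (\<lambda>t p. \<zero>\<^bsub>K\<^esub>)"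
        by (rule diagonal_zero[OF am]) (use mlift_aug[OF m] tm in simp)
      then have "bard 1 (con (mlift \<phi> n l 0 ?m)) = mlift \<phi> n l 0 ?m"
        using contraction_0[OF am] barD(1)[OF bard_closed'[of "con (mlift \<phi> n l 0 ?m)" 0]] con_closed[OF am] by simp
      then show "bard 1 (con (mlift \<phi> n l (1 - 1) ?m)) =
          (\<lambda>t p. mlift \<phi> n l (1 - 1) ?m t p \<ominus>\<^bsub>K\<^esub> mlift \<phi> n l (1 - 1) (con (bard (n + (1 - 1)) ?m)) t p)"
        using z0 barD(1)[OF am] by (simp add: K.minus_eq)
    qed simp
  next
    case (step i)
    show ?case
    proof (rule mlift_chain_step[OF _ n _ step.prems])
      fix x ys assume "ys \<in> T (n + (i + 1 - 1))" "(x, hd ys) \<in> FP" and ne: "x \<noteq> hd ys"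
      then have ys: "ys \<in> T (n + i)" "(x, hd ys) \<in> FP" by simp_all
      let ?m = "bvec \<one>\<^bsub>K\<^esub> x ys"
      have m: "?m \<in> carrier (bar (n + i))" by (rule bvec_closed(1)[OF K.one_closed ys])
      have am: "mlift \<phi> n l i ?m \<in> carrier (bar i)" by (rule mlift_closed[OF m])
      have bm: "bard (n + i) ?m \<in> carrier (bar (n + (i - 1)))" using bard_closed[OF m] by (simp add: algebra_simps)
      have r: "con (mlift \<phi> n l (i - 1) (bard (n + i) ?m)) = mlift \<phi> n l i (con (bard (n + i) ?m))"
        using mlift_con[OF step.hyps bm] by simp
      have c1: "bard (i + 1) (con (mlift \<phi> n l i ?m)) \<in> carrier (bar i)" by (rule bard_closed'[OF con_closed[OF am]])
      have c2: "mlift \<phi> n l i (con (bard (n + i) ?m)) \<in> carrier (bar i)"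
        using mlift_closed[of "con (bard (n + i) ?m)" i] con_closed[OF bm] by (simp add: algebra_simps)
      \<comment> \<open>The contraction identity at the lift of \<open>m\<close>: by the induction
        hypothesis and \<open>mlift_con\<close>, its summand \<open>s\<partial>\<close> applied to
        that lift is the lift of \<open>s\<partial>m\<close>.\<close>
      have "bard (i + 1) (con (mlift \<phi> n l i ?m)) \<oplus>\<^bsub>bar i\<^esub> mlift \<phi> n l i (con (bard (n + i) ?m)) = mlift \<phi> n l i ?m"
        using contraction[OF step.hyps am] step.IH[OF m] r by simp
      then have "mlift \<phi> n l i ?m = (\<lambda>t p. bard (i + 1) (con (mlift \<phi> n l i ?m)) t p \<oplus>\<^bsub>K\<^esub>
          mlift \<phi> n l i (con (bard (n + i) ?m)) t p)" by simp
      then have "(\<lambda>t p. mlift \<phi> n l i ?m t p \<ominus>\<^bsub>K\<^esub> mlift \<phi> n l i (con (bard (n + i) ?m)) t p) =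
          bard (i + 1) (con (mlift \<phi> n l i ?m))"
        using K.minus_add_cancel_both(2)[OF barD(1)[OF c1] barD(1)[OF c2]] by (simp add: fun_eq_iff)
      then show "bard (i + 1) (con (mlift \<phi> n l (i + 1 - 1) ?m)) =
          (\<lambda>t p. mlift \<phi> n l (i + 1 - 1) ?m t p \<ominus>\<^bsub>K\<^esub> mlift \<phi> n l (i + 1 - 1) (con (bard (n + (i + 1 - 1)) ?m)) t p)"
        by simp
    qed (use step.hyps in simp)
  qed
qed

lemma mlift_yoneda:
  assumes "\<And>c. c \<in> carrier (bar (n + 1)) \<Longrightarrow> toHom n l \<phi> (bard (n + 1) c) = \<zero>\<^bsub>SX\<^esub>"
  shows "mlift \<phi> n l \<in> yoneda_lifts G \<Lambda> bar bard bar_aug n l (toHom n l \<phi>)"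
  unfolding yoneda_lifts_def using mlift_maps mlift_chain[OF assms] mlift_aug by blast

text \<open>The lift evaluates the end of a tuple by \<open>\<phi>\<close> and leaves the generator
  of its beginning, on which the morphism of \<open>\<psi>\<close> is then evaluated. This is the
  magnitude product on the nose, before passing to cohomology and without signs.\<close>

lemma toHom_mult:
  assumes s: "s \<in> G" and \<psi>: "\<psi> \<in> carrier (MC s m)"
  shows "mag_cochain_mult K X d m s n l \<psi> \<phi> \<in> carrier (MC (s + l) (m + n))"
    and "toHom (m + n) (s + l) (mag_cochain_mult K X d m s n l \<psi> \<phi>) =
      compose (carrier (bar (m + n))) (toHom m s \<psi>) (mlift \<phi> n l m)"
proof -
  note sl = add_in_G[OF s l]
  let ?v = "\<lambda>xs. (let ys = take (nat m + 1) xs; zs = drop (nat m) xs in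
       if ys \<in> mag_tuples X d m s \<and> zs \<in> mag_tuples X d n l
       then \<psi> (basis_vec K ys) \<otimes>\<^bsub>K\<^esub> \<phi> (basis_vec K zs) else \<zero>\<^bsub>K\<^esub>)"
  have v: "?v xs = (if take (Suc (nat m)) xs \<in> T m \<and> wt (take (Suc (nat m)) xs) = s \<and>
      drop (nat m) xs \<in> T n \<and> wt (drop (nat m) xs) = l
      then val \<psi> (take (Suc (nat m)) xs) \<otimes>\<^bsub>K\<^esub> val \<phi> (drop (nat m) xs) else \<zero>\<^bsub>K\<^esub>)" for xs
    by (auto simp: Let_def mag_tuples_eq val_def)
  have vc: "?v xs \<in> carrier K" for xs
    unfolding v using val_closed[OF \<psi>] val_closed[OF \<phi>] by auto
  show c: "mag_cochain_mult K X d m s n l \<psi> \<phi> \<in> carrier (MC (s + l) (m + n))"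
    unfolding mag_cochain_mult_def by (rule cochain_of_closed) (rule vc)
  have mm: "mlift \<phi> n l m \<in> graded_maps G \<Lambda> (bar (m + n)) (shift l (bar m))" using mlift_maps[of m] by (simp add: add.commute)
  have tt: "toHom m s \<psi> \<in> graded_maps G \<Lambda> (shift l (bar m)) (shift (s + l) SX)"
    using L.graded_maps_shift[OF toHom_maps[OF s \<psi>] l] by (simp add: add.commute)
  show "toHom (m + n) (s + l) (mag_cochain_mult K X d m s n l \<psi> \<phi>) =
      compose (carrier (bar (m + n))) (toHom m s \<psi>) (mlift \<phi> n l m)"
  proof (rule hom_eqI[OF sl toHom_maps[OF sl c] compose_graded_maps[OF mm tt bar_graded]])
    fix xs assume xs: "xs \<in> T (m + n)" "wt xs = s + l"
    have xs': "xs \<in> T (n + m)" using xs(1) by (simp add: add.commute)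
    note \<theta> = toHom_maps[OF s \<psi>]
    interpret S: graded_left_module G \<Lambda> SX by (rule SX_graded)
    let ?h = "hd xs" and ?y = "take (Suc (nat m)) xs" and ?z = "drop (nat m) xs"
    have hh: "(?h, ?h) \<in> FP" by (rule FP_refl[OF valid_hd[OF T_valid[OF xs(1)]]])
    have L: "diag (toHom (m + n) (s + l) (mag_cochain_mult K X d m s n l \<psi> \<phi>) (gen xs)) ?h = ?v xs"
      using diag_toHom_gen[OF sl c xs(1), of ?h] val_cochain_of[where v = ?v, OF xs vc] xs(2)
      by (simp add: mag_cochain_mult_def)
    have "diag (toHom m s \<psi> (mlift \<phi> n l m (gen xs))) ?h = ?v xs"
    proof (cases "0 \<le> m \<and> ?z \<in> T n \<and> wt ?z = l")
      case True
      have y: "?y \<in> T m" "hd ?y = ?h" using T_split[OF xs'] True by auto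
      have vz: "val \<phi> ?z \<in> carrier K" using val_closed[OF \<phi>] True by blast
      have e: "el (val \<phi> ?z) ?h (hd ?y) \<in> carrier \<Lambda>" using el_closed[OF vz] hh y(2) by simp
      have tg: "toHom m s \<psi> (gen ?y) \<in> carrier SX" using graded_maps_closed[OF \<theta> gen_closed(1)[OF y(1)]] by simp
      have "mlift \<phi> n l m (gen xs) = bvec (val \<phi> ?z) ?h ?y"
        using mlift_bvec[OF K.one_closed xs' hh] True vz by simp
      also have "\<dots> = el (val \<phi> ?z) ?h (hd ?y) \<odot>\<^bsub>bar m\<^esub> gen ?y"
        using bvec_gen[OF vz y(1), of ?h] y(2) hh by simp
      finally have "toHom m s \<psi> (mlift \<phi> n l m (gen xs)) = el (val \<phi> ?z) ?h (hd ?y) \<odot>\<^bsub>SX\<^esub> toHom m s \<psi> (gen ?y)"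
        using linear_mapsD(3)[OF graded_mapsD(1)[OF \<theta>] e gen_closed(1)[OF y(1)]] by simp
      then have "diag (toHom m s \<psi> (mlift \<phi> n l m (gen xs))) ?h =
          val \<phi> ?z \<otimes>\<^bsub>K\<^esub> (if wt ?y = s then val \<psi> ?y else \<zero>\<^bsub>K\<^esub>)"
        using diag_simps(3)[OF e tg, of ?h] diag_toHom_gen[OF s \<psi> y(1), of ?h] y(2) by (simp add: el_apply)
      also have "\<dots> = ?v xs"
        \<comment> \<open>The composite yields the value of \<open>\<phi>\<close> to the left of
          that of \<open>\<psi>\<close>; commutativity of \<open>\<K>\<close> puts them in the order
          of the magnitude product.\<close>
        unfolding v using True y(1) vz val_closed[OF \<psi> y(1)] by (auto simp: K.m_comm)
      finally show ?thesis .
    next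
      case False
      \<comment> \<open>For negative \<open>m\<close> the magnitude product vanishes because there
        are no tuples in degree \<open>m\<close>.\<close>
      have "?v xs = \<zero>\<^bsub>K\<^esub>"
        unfolding v using False T_neg[of m] by (cases "0 \<le> m") auto
      moreover have "mlift \<phi> n l m (gen xs) = (\<lambda>t p. \<zero>\<^bsub>K\<^esub>)"
        using mlift_bvec[OF K.one_closed xs' hh] False by (simp only: if_False)
      moreover have "toHom m s \<psi> (\<lambda>t p. \<zero>\<^bsub>K\<^esub>) = \<zero>\<^bsub>SX\<^esub>"
        using graded_maps_ab(1)[OF \<theta> bar_graded L.shift_graded[OF SX_graded s]] by simp
      ultimately show ?thesis by (simp only: diag_simps(4))
    qed
    then show "diag (toHom (m + n) (s + l) (mag_cochain_mult K X d m s n l \<psi> \<phi>) (gen xs)) ?h =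
        diag (compose (carrier (bar (m + n))) (toHom m s \<psi>) (mlift \<phi> n l m) (gen xs)) ?h"
      using L gen_closed(1)[OF xs(1)] by (simp add: compose_eq)
  qed
qed

end

interpretation R: resolution K G \<Lambda> SX bar bard bar_aug
  by (rule bar_is_resolution)

section \<open>Passage to cohomology\<close>

lemma toHom_linear:
  assumes l: "l \<in> G"
  shows "restrict (toHom n l) (carrier (MC l n)) \<in> linear_maps K (MC l n) (R.HC l n)"
proof (rule linear_mapsI)
  interpret C: left_module K "MC l n" by (rule MC_module)
  show "restrict (toHom n l) (carrier (MC l n)) \<in> carrier (MC l n) \<rightarrow>\<^sub>E carrier (R.HC l n)"
    using toHom_maps[OF l] by (auto simp: R.hom_complex_simps)
  show "restrict (toHom n l) (carrier (MC l n)) (\<psi> \<oplus>\<^bsub>MC l n\<^esub> \<psi>') =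
      restrict (toHom n l) (carrier (MC l n)) \<psi> \<oplus>\<^bsub>R.HC l n\<^esub> restrict (toHom n l) (carrier (MC l n)) \<psi>'"
    if "\<psi> \<in> carrier (MC l n)" "\<psi>' \<in> carrier (MC l n)" for \<psi> \<psi>'
    using that C.M.a_closed[OF that] toHom_add[OF l that] by (simp add: R.hom_complex_simps)
  show "restrict (toHom n l) (carrier (MC l n)) (k \<odot>\<^bsub>MC l n\<^esub> \<psi>) =
      k \<odot>\<^bsub>R.HC l n\<^esub> restrict (toHom n l) (carrier (MC l n)) \<psi>"
    if "k \<in> carrier K" "\<psi> \<in> carrier (MC l n)" for k \<psi>
    using that C.smult_closed[OF that] toHom_smult[OF l that] by (simp add: R.hom_complex_simps)
qed

lemma toHom_zero:
  assumes l: "l \<in> G"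
  shows "toHom n l \<zero>\<^bsub>MC l n\<^esub> = \<zero>\<^bsub>R.HC l n\<^esub>"
proof -
  interpret C: left_module K "MC l n" by (rule MC_module)
  interpret H: cochain_complex K "R.HC l" R.dH by (rule R.cochain[OF l])
  show ?thesis
    using linear_maps_zero[OF C.M.abelian_group_axioms H.ab toHom_linear[OF l, of n]] by simp
qed

text \<open>All properties of the magnitude coboundary, including
  \<open>\<delta>\<delta> = 0\<close>, are pulled back along the injective maps \<open>toHom\<close>
  from the complex of morphisms out of the bar resolution.\<close>

lemma mag_cochain_complex:
  assumes l: "l \<in> G"
  shows "cochain_complex K (MC l) (dM l)"
proof (intro cochain_complex.intro cochain_complex_axioms.intro K.ring_axioms MC_module)
  interpret H: cochain_complex K "R.HC l" R.dH by (rule R.cochain[OF l])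
  note tl = linear_mapsD[OF toHom_linear[OF l]]
  show "restrict (dM l n) (carrier (MC l n)) \<in> linear_maps K (MC l n) (MC l (n + 1))" for n
  proof (rule linear_mapsI)
    interpret C: left_module K "MC l n" by (rule MC_module)
    interpret C1: left_module K "MC l (n + 1)" by (rule MC_module)
    show "restrict (dM l n) (carrier (MC l n)) \<in> carrier (MC l n) \<rightarrow>\<^sub>E carrier (MC l (n + 1))"
      using coboundary_closed by auto
    have th: "toHom n l \<psi> \<in> carrier (R.HC l n)" if "\<psi> \<in> carrier (MC l n)" for \<psi> and n
      using toHom_maps[OF l that] by (simp add: R.hom_complex_simps)
    show "restrict (dM l n) (carrier (MC l n)) (\<psi> \<oplus>\<^bsub>MC l n\<^esub> \<psi>') =
        restrict (dM l n) (carrier (MC l n)) \<psi> \<oplus>\<^bsub>MC l (n + 1)\<^esub> restrict (dM l n) (carrier (MC l n)) \<psi>'"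
      if \<psi>: "\<psi> \<in> carrier (MC l n)" "\<psi>' \<in> carrier (MC l n)" for \<psi> \<psi>'
    proof -
      note c = coboundary_closed[OF \<psi>(1)] coboundary_closed[OF \<psi>(2)]
      have "toHom (n + 1) l (dM l n (\<psi> \<oplus>\<^bsub>MC l n\<^esub> \<psi>')) = R.dH n (toHom n l \<psi> \<oplus>\<^bsub>R.HC l n\<^esub> toHom n l \<psi>')"
        using toHom_coboundary[OF l C.M.a_closed[OF \<psi>]] tl(2)[OF \<psi>] \<psi> C.M.a_closed[OF \<psi>] by simp
      also have "\<dots> = toHom (n + 1) l (dM l n \<psi>) \<oplus>\<^bsub>R.HC l (n + 1)\<^esub> toHom (n + 1) l (dM l n \<psi>')"
        using H.diff_props(2)[OF th[OF \<psi>(1)] th[OF \<psi>(2)]] toHom_coboundary[OF l] \<psi> by simp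
      also have "\<dots> = toHom (n + 1) l (dM l n \<psi> \<oplus>\<^bsub>MC l (n + 1)\<^esub> dM l n \<psi>')"
        using tl(2)[OF c] c C1.M.a_closed[OF c] by simp
      finally show ?thesis
        using toHom_inj[OF l coboundary_closed[OF C.M.a_closed[OF \<psi>]] C1.M.a_closed[OF c]] \<psi> C.M.a_closed[OF \<psi>] by simp
    qed
    show "restrict (dM l n) (carrier (MC l n)) (k \<odot>\<^bsub>MC l n\<^esub> \<psi>) =
        k \<odot>\<^bsub>MC l (n + 1)\<^esub> restrict (dM l n) (carrier (MC l n)) \<psi>"
      if k: "k \<in> carrier K" and \<psi>: "\<psi> \<in> carrier (MC l n)" for k \<psi>
    proof -
      note c = coboundary_closed[OF \<psi>]
      have "toHom (n + 1) l (dM l n (k \<odot>\<^bsub>MC l n\<^esub> \<psi>)) = R.dH n (k \<odot>\<^bsub>R.HC l n\<^esub> toHom n l \<psi>)"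
        using toHom_coboundary[OF l C.smult_closed[OF k \<psi>]] tl(3)[OF k \<psi>] \<psi> C.smult_closed[OF k \<psi>] by simp
      also have "\<dots> = k \<odot>\<^bsub>R.HC l (n + 1)\<^esub> toHom (n + 1) l (dM l n \<psi>)"
        using H.diff_props(3)[OF k th[OF \<psi>]] toHom_coboundary[OF l \<psi>] by simp
      also have "\<dots> = toHom (n + 1) l (k \<odot>\<^bsub>MC l (n + 1)\<^esub> dM l n \<psi>)"
        using tl(3)[OF k c] c C1.smult_closed[OF k c] by simp
      finally show ?thesis
        using toHom_inj[OF l coboundary_closed[OF C.smult_closed[OF k \<psi>]] C1.smult_closed[OF k c]] \<psi> C.smult_closed[OF k \<psi>] by simp
    qed
  qed
  show "dM l n (dM l (n - 1) \<psi>) = \<zero>\<^bsub>MC l (n + 1)\<^esub>" if \<psi>: "\<psi> \<in> carrier (MC l (n - 1))" for n \<psi>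
  proof (rule toHom_inj[OF l])
    interpret C1: left_module K "MC l (n + 1)" by (rule MC_module)
    have c: "dM l (n - 1) \<psi> \<in> carrier (MC l n)" using coboundary_closed[OF \<psi>] by simp
    show "dM l n (dM l (n - 1) \<psi>) \<in> carrier (MC l (n + 1))" by (rule coboundary_closed[OF c])
    have "toHom (n - 1) l \<psi> \<in> carrier (R.HC l (n - 1))" using toHom_maps[OF l \<psi>] by (simp add: R.hom_complex_simps)
    then show "toHom (n + 1) l (dM l n (dM l (n - 1) \<psi>)) = toHom (n + 1) l \<zero>\<^bsub>MC l (n + 1)\<^esub>"
      using toHom_coboundary[OF l c] toHom_coboundary[OF l \<psi>] toHom_zero[OF l] H.diff_diff by simp
  qed (rule abelian_monoid.zero_closed[OF abelian_group.axioms(1)[OF left_module.axioms(2)[OF MC_module]]])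
qed

lemma toHom_cocycle_iff:
  assumes l: "l \<in> G" and \<psi>: "\<psi> \<in> carrier (MC l n)"
  shows "toHom n l \<psi> \<in> cocycles (R.HC l) R.dH n \<longleftrightarrow> \<psi> \<in> cocycles (MC l) (dM l) n"
proof -
  interpret C1: left_module K "MC l (n + 1)" by (rule MC_module)
  have "toHom n l \<psi> \<in> carrier (R.HC l n)" using toHom_maps[OF l \<psi>] by (simp add: R.hom_complex_simps)
  then show ?thesis
    using toHom_coboundary[OF l \<psi>] toHom_zero[OF l, of "n + 1"]
      toHom_inj[OF l coboundary_closed[OF \<psi>] C1.M.zero_closed] \<psi>
    by (auto simp: cocycles_def)
qed

text \<open>\<open>toHom\<close> is already bijective on cochains and compatible with the
  differentials, so preimages of cocycles and of primitives exist exactly; the correcting coboundary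
  is 0.\<close>

lemma mag_cohomology_iso:
  assumes l: "l \<in> G"
  shows "\<exists>\<Phi>. \<forall>n. \<Phi> n \<in> linear_maps K (cohomology (MC l) (dM l) n) (yoneda_comp G \<Lambda> SX bar bard n l) \<and>
      bij_betw (\<Phi> n) (carrier (cohomology (MC l) (dM l) n)) (carrier (yoneda_comp G \<Lambda> SX bar bard n l)) \<and>
      (\<forall>z\<in>cocycles (MC l) (dM l) n. \<Phi> n (mag_class K X d n l z) = R.ycls n l (toHom n l z))"
proof -
  interpret C: cochain_complex K "MC l" "dM l" by (rule mag_cochain_complex[OF l])
  interpret H: cochain_complex K "R.HC l" R.dH by (rule R.cochain[OF l])
  let ?F = "\<lambda>n. restrict (toHom n l) (carrier (MC l n))"
  have "\<exists>\<Phi>. \<forall>n. \<Phi> n \<in> linear_maps K (cohomology (MC l) (dM l) n) (cohomology (R.HC l) R.dH n) \<and>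
      bij_betw (\<Phi> n) (carrier (cohomology (MC l) (dM l) n)) (carrier (cohomology (R.HC l) R.dH n)) \<and>
      (\<forall>z\<in>cocycles (MC l) (dM l) n. \<Phi> n (cohomology_class (MC l) (dM l) n z) = cohomology_class (R.HC l) R.dH n (?F n z))"
  proof (rule cohomology_iso[OF C.cochain_complex_axioms H.cochain_complex_axioms toHom_linear[OF l]])
    show "?F (n + 1) (dM l n \<psi>) = R.dH n (?F n \<psi>)" if "\<psi> \<in> carrier (MC l n)" for n \<psi>
      using that coboundary_closed[OF that] toHom_coboundary[OF l that] by simp
  next
    fix n z assume z: "z \<in> cocycles (MC l) (dM l) n" and "?F n z \<in> coboundaries (R.HC l) R.dH n"
    then have zc: "z \<in> carrier (MC l n)" and "toHom n l z \<in> coboundaries (R.HC l) R.dH n"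
      using C.cocycles_carrier[OF z] by simp_all
    then obtain \<gamma> where \<gamma>: "\<gamma> \<in> graded_maps G \<Lambda> (bar (n - 1)) (shift l SX)" "toHom n l z = R.dH (n - 1) \<gamma>"
      by (auto simp: coboundaries_def R.hom_complex_simps)
    obtain \<eta> where \<eta>: "\<eta> \<in> carrier (MC l (n - 1))" "toHom (n - 1) l \<eta> = \<gamma>" using toHom_surj[OF l \<gamma>(1)] by blast
    have "dM l (n - 1) \<eta> \<in> carrier (MC l n)" using coboundary_closed[OF \<eta>(1)] by simp
    then have "z = dM l (n - 1) \<eta>"
      using toHom_inj[OF l zc] toHom_coboundary[OF l \<eta>(1)] \<gamma>(2) \<eta>(2) by simp
    then show "z \<in> coboundaries (MC l) (dM l) n" using \<eta>(1) by (auto simp: coboundaries_def)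
  next
    fix n z' assume z': "z' \<in> cocycles (R.HC l) R.dH n"
    then have "z' \<in> graded_maps G \<Lambda> (bar n) (shift l SX)" by (simp add: R.cocycles_iff)
    then obtain z where z: "z \<in> carrier (MC l n)" "toHom n l z = z'" using toHom_surj[OF l] by blast
    interpret Hn: left_module K "R.HC l n" by (rule H.comp)
    have "?F n z = \<zero>\<^bsub>R.HC l n\<^esub> \<oplus>\<^bsub>R.HC l n\<^esub> z'" using z H.cocycles_carrier[OF z'] by simp
    then show "\<exists>z\<in>cocycles (MC l) (dM l) n. \<exists>b\<in>coboundaries (R.HC l) R.dH n. ?F n z = b \<oplus>\<^bsub>R.HC l n\<^esub> z'"
      using toHom_cocycle_iff[OF l z(1)] z z' H.zero_coboundary by blast
  qed
  then show ?thesis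
    using C.cocycles_carrier by (simp add: yoneda_comp_def yoneda_class_def mag_class_def)
qed

text \<open>The explicit lift \<open>mlift\<close> identifies the product of cochains with a
  representative of the Yoneda product. That it is again a cocycle is then inherited from the Yoneda
  side.\<close>

lemma mult_cocycle:
  assumes l: "l \<in> G" and s: "s \<in> G"
    and \<psi>: "\<psi> \<in> cocycles (MC s) (dM s) m" and \<phi>: "\<phi> \<in> cocycles (MC l) (dM l) n"
  shows "mag_cochain_mult K X d m s n l \<psi> \<phi> \<in> cocycles (MC (s + l)) (dM (s + l)) (m + n)"
    and "R.ycls (m + n) (s + l) (toHom (m + n) (s + l) (mag_cochain_mult K X d m s n l \<psi> \<phi>)) =
      yoneda_mult G \<Lambda> SX bar bard bar_aug m s n l (R.ycls m s (toHom m s \<psi>)) (R.ycls n l (toHom n l \<phi>))"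
proof -
  have \<psi>c: "\<psi> \<in> carrier (MC s m)" and \<phi>c: "\<phi> \<in> carrier (MC l n)"
    using cochain_complex.cocycles_carrier[OF mag_cochain_complex[OF s] \<psi>]
      cochain_complex.cocycles_carrier[OF mag_cochain_complex[OF l] \<phi>] by auto
  have h\<psi>: "toHom m s \<psi> \<in> cocycles (R.HC s) R.dH m" using toHom_cocycle_iff[OF s \<psi>c] \<psi> by simp
  have h\<phi>: "toHom n l \<phi> \<in> cocycles (R.HC l) R.dH n" using toHom_cocycle_iff[OF l \<phi>c] \<phi> by simp
  have lift: "mlift \<phi> n l \<in> yoneda_lifts G \<Lambda> bar bard bar_aug n l (toHom n l \<phi>)"
    by (rule mlift_yoneda[OF l \<phi>c]) (use h\<phi> in \<open>auto simp: R.cocycles_iff\<close>)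
  note m = toHom_mult[OF l \<phi>c s \<psi>c]
  show "mag_cochain_mult K X d m s n l \<psi> \<phi> \<in> cocycles (MC (s + l)) (dM (s + l)) (m + n)"
    using R.yoneda_mult_class(1)[OF l s h\<psi> h\<phi> lift] m(2) toHom_cocycle_iff[OF add_in_G[OF s l] m(1)] by simp
  show "R.ycls (m + n) (s + l) (toHom (m + n) (s + l) (mag_cochain_mult K X d m s n l \<psi> \<phi>)) =
      yoneda_mult G \<Lambda> SX bar bard bar_aug m s n l (R.ycls m s (toHom m s \<psi>)) (R.ycls n l (toHom n l \<phi>))"
    using R.yoneda_mult_class(2)[OF l s h\<psi> h\<phi> lift] m(2) by simp
qed

text \<open>The constant cochain 1 on points corresponds to the augmentation, which represents the
  unit of the Yoneda algebra.\<close>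

lemma mag_unit:
  "mag_cochain_of K X d 0 0 (\<lambda>xs. \<one>\<^bsub>K\<^esub>) \<in> cocycles (MC 0) (dM 0) 0"
  "toHom 0 0 (mag_cochain_of K X d 0 0 (\<lambda>xs. \<one>\<^bsub>K\<^esub>)) = bar_aug"
proof -
  let ?u = "mag_cochain_of K X d 0 0 (\<lambda>xs. \<one>\<^bsub>K\<^esub>)"
  have u: "?u \<in> carrier (MC 0 0)" by (rule cochain_of_closed) simp
  have a: "bar_aug \<in> graded_maps G \<Lambda> (bar 0) (shift 0 SX)" using bar_aug_maps by simp
  show t: "toHom 0 0 ?u = bar_aug"
  proof (rule hom_eqI[OF zero_in_G toHom_maps[OF zero_in_G u] a])
    fix xs assume xs: "xs \<in> T 0" "wt xs = 0"
    obtain y where y: "xs = [y]" using xs(1) by (cases xs) (auto simp: T_def)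
    show "diag (toHom 0 0 ?u (gen xs)) (hd xs) = diag (bar_aug (gen xs)) (hd xs)"
      using diag_toHom_gen[OF zero_in_G u xs(1), of "hd xs"] val_cochain_of[OF xs, of "\<lambda>xs. \<one>\<^bsub>K\<^esub>"]
        diag_bar_aug[OF gen_closed(1)[OF xs(1)], of "hd xs"] xs(2) y by (simp add: bvec_def)
  qed
  show "?u \<in> cocycles (MC 0) (dM 0) 0"
    using toHom_cocycle_iff[OF zero_in_G u] t R.eps_cocycle by simp
qed

text \<open>The product of classes is a union over representatives. Different representatives give
  the same Yoneda classes, hence the same Yoneda product, and injectivity of the comparison on
  cohomology brings the equality back.\<close>

lemma mag_mult_class:
  assumes l: "l \<in> G" and s: "s \<in> G"
    and \<psi>: "\<psi> \<in> cocycles (MC s) (dM s) m" and \<phi>: "\<phi> \<in> cocycles (MC l) (dM l) n"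
  shows "bmult (magnitude_cohomology_algebra K X d) m s n l (mag_class K X d m s \<psi>) (mag_class K X d n l \<phi>) =
    mag_class K X d (m + n) (s + l) (mag_cochain_mult K X d m s n l \<psi> \<phi>)"
proof -
  note sl = add_in_G[OF s l]
  interpret Cs: cochain_complex K "MC s" "dM s" by (rule mag_cochain_complex[OF s])
  interpret Cl: cochain_complex K "MC l" "dM l" by (rule mag_cochain_complex[OF l])
  interpret C: cochain_complex K "MC (s + l)" "dM (s + l)" by (rule mag_cochain_complex[OF sl])
  have t: "\<exists>\<Phi>. \<forall>z\<in>cocycles (MC g) (dM g) j. \<Phi> (mag_class K X d j g z) = R.ycls j g (toHom j g z)"
    if "g \<in> G" for g j using mag_cohomology_iso[OF that] by blast
  obtain \<Phi> where inj: "inj_on \<Phi> (carrier (cohomology (MC (s + l)) (dM (s + l)) (m + n)))"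
    and \<Phi>: "\<And>z. z \<in> cocycles (MC (s + l)) (dM (s + l)) (m + n) \<Longrightarrow>
      \<Phi> (mag_class K X d (m + n) (s + l) z) = R.ycls (m + n) (s + l) (toHom (m + n) (s + l) z)"
    using mag_cohomology_iso[OF sl] unfolding bij_betw_def by metis
  have key: "mag_class K X d (m + n) (s + l) (mag_cochain_mult K X d m s n l \<psi>' \<phi>') =
      mag_class K X d (m + n) (s + l) (mag_cochain_mult K X d m s n l \<psi> \<phi>)"
    if a: "\<psi>' \<in> mag_class K X d m s \<psi>" and b: "\<phi>' \<in> mag_class K X d n l \<phi>" for \<psi>' \<phi>'
  proof (rule inj_onD[OF inj])
    have \<psi>': "\<psi>' \<in> cocycles (MC s) (dM s) m" and ea: "mag_class K X d m s \<psi>' = mag_class K X d m s \<psi>"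
      using Cs.class_subset[OF \<psi>] Cs.class_eq_of_mem[OF \<psi>] a unfolding mag_class_def by blast+
    have \<phi>': "\<phi>' \<in> cocycles (MC l) (dM l) n" and eb: "mag_class K X d n l \<phi>' = mag_class K X d n l \<phi>"
      using Cl.class_subset[OF \<phi>] Cl.class_eq_of_mem[OF \<phi>] b unfolding mag_class_def by blast+
    note c = mult_cocycle[OF l s \<psi> \<phi>] and c' = mult_cocycle[OF l s \<psi>' \<phi>']
    have ya: "R.ycls m s (toHom m s \<psi>') = R.ycls m s (toHom m s \<psi>)" using t[OF s, of m] \<psi> \<psi>' ea by metis
    have yb: "R.ycls n l (toHom n l \<phi>') = R.ycls n l (toHom n l \<phi>)" using t[OF l, of n] \<phi> \<phi>' eb by metis
    show "\<Phi> (mag_class K X d (m + n) (s + l) (mag_cochain_mult K X d m s n l \<psi>' \<phi>')) =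
        \<Phi> (mag_class K X d (m + n) (s + l) (mag_cochain_mult K X d m s n l \<psi> \<phi>))"
      using \<Phi>[OF c(1)] \<Phi>[OF c'(1)] c(2) c'(2) ya yb by simp
    show "mag_class K X d (m + n) (s + l) (mag_cochain_mult K X d m s n l \<psi>' \<phi>')
        \<in> carrier (cohomology (MC (s + l)) (dM (s + l)) (m + n))"
      "mag_class K X d (m + n) (s + l) (mag_cochain_mult K X d m s n l \<psi> \<phi>)
        \<in> carrier (cohomology (MC (s + l)) (dM (s + l)) (m + n))"
      unfolding mag_class_def C.cohomology_carrier using c(1) c'(1) by simp_all
  qed
  have "\<psi> \<in> mag_class K X d m s \<psi>" "\<phi> \<in> mag_class K X d n l \<phi>"
    using Cs.class_self[OF \<psi>] Cl.class_self[OF \<phi>] by (simp_all add: mag_class_def)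
  then show ?thesis
    unfolding magnitude_cohomology_algebra_def bigraded_algebra.simps using key by blast
qed

theorem magnitude_yoneda_iso:
  assumes res: "projective_resolution G \<Lambda> SX P D \<epsilon>"
  shows "bigraded_algebra_isomorphic K G (magnitude_cohomology_algebra K X d) (yoneda_algebra G \<Lambda> SX P D \<epsilon>)"
    (is "bigraded_algebra_isomorphic K G ?A ?C")
proof -
  let ?B = "yoneda_algebra G \<Lambda> SX bar bard bar_aug"
  have "resolution K G \<Lambda> SX P D \<epsilon>"
    by (intro resolution.intro resolution_axioms.intro L.graded_algebra_axioms SX_graded res)
  from yoneda_algebra_invariance[OF bar_is_resolution this] obtain \<Psi> where \<Psi>: "\<Psi> \<in> bigraded_algebra_iso K G ?B ?C"
    unfolding bigraded_algebra_isomorphic_def by blast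
  have \<Psi>l: "\<Psi> n l \<in> linear_maps K (bcomp ?B n l) (bcomp ?C n l)"
    and \<Psi>b: "bij_betw (\<Psi> n l) (carrier (bcomp ?B n l)) (carrier (bcomp ?C n l))" if "l \<in> G" for n l
    using \<Psi> that unfolding bigraded_algebra_iso_def by blast+
  have \<Psi>m: "\<Psi> (m + n) (s + l) (bmult ?B m s n l a b) = bmult ?C m s n l (\<Psi> m s a) (\<Psi> n l b)"
    if "s \<in> G" "l \<in> G" "a \<in> carrier (bcomp ?B m s)" "b \<in> carrier (bcomp ?B n l)" for m s n l a b
    using \<Psi> that unfolding bigraded_algebra_iso_def by blast
  have \<Psi>1: "\<Psi> 0 0 (bone ?B) = bone ?C" using \<Psi> unfolding bigraded_algebra_iso_def by blast
  obtain \<Phi> where \<Phi>l: "\<And>l n. l \<in> G \<Longrightarrow> \<Phi> l n \<in> linear_maps K (bcomp ?A n l) (bcomp ?B n l)"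
    and \<Phi>b: "\<And>l n. l \<in> G \<Longrightarrow> bij_betw (\<Phi> l n) (carrier (bcomp ?A n l)) (carrier (bcomp ?B n l))"
    and \<Phi>c: "\<And>l n z. l \<in> G \<Longrightarrow> z \<in> cocycles (MC l) (dM l) n \<Longrightarrow>
      \<Phi> l n (mag_class K X d n l z) = R.ycls n l (toHom n l z)"
    using mag_cohomology_iso
    unfolding magnitude_cohomology_algebra_def yoneda_algebra_def bigraded_algebra.simps by metis
  have class_in: "mag_class K X d n l z \<in> carrier (bcomp ?A n l)"
    if "l \<in> G" "z \<in> cocycles (MC l) (dM l) n" for n l z
    using cochain_complex.cohomology_carrier[OF mag_cochain_complex[OF that(1)]] that(2)
    by (simp add: magnitude_cohomology_algebra_def mag_class_def)
  have in_class: "\<exists>z\<in>cocycles (MC l) (dM l) n. a = mag_class K X d n l z"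
    if "l \<in> G" "a \<in> carrier (bcomp ?A n l)" for n l a
    using cochain_complex.cohomology_carrier[OF mag_cochain_complex[OF that(1)]] that(2)
    by (auto simp: magnitude_cohomology_algebra_def mag_class_def)
  let ?\<Theta> = "\<lambda>n l. compose (carrier (bcomp ?A n l)) (\<Psi> n l) (\<Phi> l n)"
  have "?\<Theta> \<in> bigraded_algebra_iso K G ?A ?C"
    unfolding bigraded_algebra_iso_def mem_Collect_eq
  proof (intro conjI allI ballI)
    fix n l assume l: "l \<in> G"
    interpret C: cochain_complex K "MC l" "dM l" by (rule mag_cochain_complex[OF l])
    interpret Z: left_module K "C.Z n" by (rule C.cocycles_module)
    note pl = linear_mapsD[OF \<Phi>l[OF l]] and ql = linear_mapsD[OF \<Psi>l[OF l]]
    have coh: "bcomp ?A n l = cohomology (MC l) (dM l) n" by (simp add: magnitude_cohomology_algebra_def)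
    \<comment> \<open>The composite below is defined by restriction to the carrier, so its linearity
      requires that sums and multiples of classes stay in the carrier.\<close>
    have add_in: "a \<oplus>\<^bsub>bcomp ?A n l\<^esub> b \<in> carrier (bcomp ?A n l)"
      if "a \<in> carrier (bcomp ?A n l)" "b \<in> carrier (bcomp ?A n l)" for a b
      using that Z.M.a_closed unfolding coh C.cohomology_carrier by (auto simp: C.cohomology_add)
    have smult_in: "k \<odot>\<^bsub>bcomp ?A n l\<^esub> a \<in> carrier (bcomp ?A n l)"
      if "k \<in> carrier K" "a \<in> carrier (bcomp ?A n l)" for k a
      using that Z.smult_closed unfolding coh C.cohomology_carrier by (auto simp: C.cohomology_smult)
    show "?\<Theta> n l \<in> linear_maps K (bcomp ?A n l) (bcomp ?C n l)"
      by (rule linear_mapsI) (use pl ql add_in smult_in in \<open>auto simp: compose_eq compose_def\<close>)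
    show "bij_betw (?\<Theta> n l) (carrier (bcomp ?A n l)) (carrier (bcomp ?C n l))"
      using bij_betw_trans[OF \<Phi>b[OF l] \<Psi>b[OF l]] by (rule bij_betw_cong[THEN iffD1, rotated]) (simp add: compose_eq)
  next
    fix m n s l a b assume s: "s \<in> G" and l: "l \<in> G"
      and a: "a \<in> carrier (bcomp ?A m s)" and b: "b \<in> carrier (bcomp ?A n l)"
    obtain \<psi> where \<psi>: "\<psi> \<in> cocycles (MC s) (dM s) m" "a = mag_class K X d m s \<psi>" using in_class[OF s a] by blast
    obtain \<phi> where \<phi>: "\<phi> \<in> cocycles (MC l) (dM l) n" "b = mag_class K X d n l \<phi>" using in_class[OF l b] by blast
    note mc = mult_cocycle[OF l s \<psi>(1) \<phi>(1)] and sl = add_in_G[OF s l]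
    have ab: "bmult ?A m s n l a b = mag_class K X d (m + n) (s + l) (mag_cochain_mult K X d m s n l \<psi> \<phi>)"
      using mag_mult_class[OF l s \<psi>(1) \<phi>(1)] \<psi>(2) \<phi>(2) by simp
    have "\<Phi> (s + l) (m + n) (bmult ?A m s n l a b) = bmult ?B m s n l (\<Phi> s m a) (\<Phi> l n b)"
      using \<Phi>c[OF sl mc(1)] mc(2) \<Phi>c[OF s \<psi>(1)] \<Phi>c[OF l \<phi>(1)] ab \<psi>(2) \<phi>(2) by (simp add: yoneda_algebra_def)
    then show "?\<Theta> (m + n) (s + l) (bmult ?A m s n l a b) = bmult ?C m s n l (?\<Theta> m s a) (?\<Theta> n l b)"
      using \<Psi>m[OF s l linear_mapsD(1)[OF \<Phi>l[OF s] a] linear_mapsD(1)[OF \<Phi>l[OF l] b]]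
        class_in[OF sl mc(1)] ab a b by (simp add: compose_eq)
  next
    have "bone ?A = mag_class K X d 0 0 (mag_cochain_of K X d 0 0 (\<lambda>xs. \<one>\<^bsub>K\<^esub>))"
      by (simp add: magnitude_cohomology_algebra_def)
    moreover have "\<Phi> 0 0 (bone ?A) = bone ?B"
      using \<Phi>c[OF zero_in_G mag_unit(1)] mag_unit(2) calculation by (simp add: yoneda_algebra_def)
    ultimately show "?\<Theta> 0 0 (bone ?A) = bone ?C"
      using \<Psi>1 class_in[OF zero_in_G mag_unit(1)] by (simp add: compose_eq)
  qed
  then show ?thesis unfolding bigraded_algebra_isomorphic_def by blast
qed

end

theorem theorem5p6:
  fixes K :: "('k, 'c) ring_scheme"
    and G :: "real set"
    and X :: "'x set"
    and d :: "'x \<Rightarrow> 'x \<Rightarrow> ereal"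
    and P :: "int \<Rightarrow> ('x \<times> 'x \<Rightarrow> 'k, 'p) gmodule"
    and D :: "int \<Rightarrow> 'p \<Rightarrow> 'p"
    and \<epsilon> :: "'p \<Rightarrow> ('x \<times> 'x \<Rightarrow> 'k) set"
  assumes "cring K"
    and "0 \<in> G" and "\<And>a b. a \<in> G \<Longrightarrow> b \<in> G \<Longrightarrow> a - b \<in> G"
    and "finite X" and "quasimetric_space X d"
    and "\<And>x y. x \<in> X \<Longrightarrow> y \<in> X \<Longrightarrow> d x y \<in> insert \<infinity> (ereal ` G)"
    and "projective_resolution G (distance_algebra K X d) (distance_quotient K X d) P D \<epsilon>"
  shows "bigraded_algebra_isomorphic K G
    (magnitude_cohomology_algebra K X d)
    (yoneda_algebra G (distance_algebra K X d) (distance_quotient K X d) P D \<epsilon>)"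
proof -
  interpret finite_quasimetric K G X d
    by (intro finite_quasimetric.intro finite_quasimetric_axioms.intro assms(1-6))
  show ?thesis by (rule magnitude_yoneda_iso[OF assms(7)])
qed

end
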